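(* Let $k$ be a positive integer. For every canvas $(\mathcal G,z)\in\mathcal{G}_k$, at least one of the following holds: (SMALL) $|V(\mathcal G)|=3$; (EXPA) $\mathcal G_k$ contains a canvas $(\mathcal G',z)\prec(\mathcal G,z)$ such that $(\mathcal G,z)$ is a $\mathcal G_k$-expansion of $(\mathcal G',z)$ or a $\mathcal G_k$-expansion of a 2-alteration of $(\mathcal G',z)$; (EXPB) $\mathcal G_k$ contains a canvas $(\mathcal G',z)\prec(\mathcal G,z)$ such that $(\mathcal G,z)$ is a $\mathcal G_k$-expansion of a 1-alteration of $(\mathcal G',z)$; (ADD) $(\mathcal G,z)$ is a tip-alteration of a canvas $(\mathcal G',z)\prec(\mathcal G,z)$ belonging to $\mathcal G_k$; (REM) $(\mathcal G,z)$ is a tip-reduction of a canvas $(\mathcal G',z)\prec(\mathcal G,z)$ belonging to $\mathcal G_k$. Moreover, if $\mathcal G$ has minimum degree at most four, then (SMALL) or (EXPA) holds.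
   Context: Graphs are finite, loopless, may have parallel edges. A $\mathbb{Z}_3$-boundary of $G$ is $\beta:V(G)\to\mathbb{Z}_3$ summing to $0$ over every component; $\mathcal G=(G,\beta)$ is a $\mathbb{Z}_3$-bordered graph. A nowhere-zero flow is an orientation with $\deg^+(v)-\deg^-(v)\equiv\beta(v)\pmod 3$ for all $v$. For $A\subseteq V(G)$, $\deg(A)$ is the number of edges with exactly one end in $A$, $\beta(A)=\sum_{v\in A}\beta(v)$; $\tau(A)$ is $\{0\}$ (even degree, $\beta(A)=0$), $\{-2\}$ (even, $\beta(A)=1$), $\{2\}$ (even, $\beta(A)=-1$), $\{-3,3\}$ (odd, $\beta(A)=0$), $\{1\}$ (odd, $\beta(A)=1$), $\{-1\}$ (odd, $\beta(A)=-1$), where "even/odd" refers to $\deg(A)$, and $|\tau(A)|$ is the absolute value of its elements; $\tau(v)=\tau(\{v\})$. For a partition $\mathcal P$ of $V(G)$, $\mathcal G/\mathcal P$ identifies each part into one vertex, deletes loops, and sums $\beta$ over parts; $\mathcal P$ is non-trivial if some part has $\ge 2$ vertices. A canvas $(\mathcal G,z)$ is a $\mathbb{Z}_3$-bordered graph with a tip $z$. A tip preflow is an orientation $\psi$ of the edges at $z$ with (in $\psi$) $\deg^+(z)-\deg^-(z)\equiv\beta(z)\pmod 3$; it extends if some nowhere-zero flow agrees with it at $z$. $\mathcal P$ is tip-respecting if $\{z\}$ is a part. The canvas is flow-critical if for every non-trivial tip-respecting $\mathcal P$ some tip preflow extends to a nowhere-zero flow in $\mathcal G/\mathcal P$ but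 not in $\mathcal G$; tame if $\deg(v)\ge4+|\tau(v)|$ for all $v\ne z$. For $A\subseteq V(\mathcal G)\setminus\{z\}$, the restriction $(\mathcal G,z)\restriction A$ is the canvas obtained by contracting $V(\mathcal G)\setminus A$ into a single vertex $b$ (deleting loops, summing boundary) with tip $b$. A tip preflow $\psi$ of a canvas with $\deg(z)\le k+1$ is $k$-tallness-witnessing if it does not extend to a nowhere-zero flow and, in case $\deg(z)=k+1$, it does not direct all edges at $z$ the same way (all towards or all away from $z$). $\mathcal G_k$ is the class of flow-critical tame canvases with $\deg(z)\le k+1$ admitting a $k$-tallness-witnessing preflow (membership is up to isomorphism preserving tip and boundary). A vertex $v$ is in-friendly if $\tau(v)$ contains a non-positive value and out-friendly if it contains a non-negative value; an edge $uv$ with $u\ne z\ne v$ is mixed if one end is in-friendly and the other out-friendly; the canvas is $z$-homogeneous if it has no mixed edge. Let $o(\mathcal G,z)=|V(\mathcal G)|+|E(\mathcal G-z)|$. Write $(\mathcal G_1,z_1)\prec(\mathcal G_2,z_2)$ if $o(\mathcal G_1,z_1)<o(\mathcal G_2,z_2)$; or $o$ values are equal, $(\mathcal G_1,z_1)$ is not $z_1$-homogeneous and $(\mathcal G_2,z_2)$ is $z_2$-homogeneous; or $o$ values are equal, both are homogeneous, and $\deg(z_1)<\deg(z_2)$. Operations: adding an edge between distinct vertices $u,v$, increasing the boundary at $u$ by 1 and decreasing it at $v$ by 1, is a 1-alteration at $u,v$ if $u\neq z\neq v$, and a tip-alteration at the vertex of $\{u,v\}\setminus\{z\}$ otherwise.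 If some vertex $v\ne z$ is joined to $z$ by at least two edges, deleting one of them (boundary unchanged) is a tip-reduction at $v$. For a non-empty set $X$ of at most two elements, each an edge or a vertex of $\mathcal G'$, the 2-alteration on $X$ deletes the edges in $X$, adds a new vertex $y$ with boundary $0$, adds edges $uy$, $yv$ for each edge $uv\in X$, and two parallel edges $yw$ for each vertex $w\in X$. For a class $\mathcal C$ of canvases, a $\mathcal C$-partition of $(\mathcal G,z)$ is a tip-respecting partition $\mathcal P$ such that $(\mathcal G,z)\restriction P$ is isomorphic to a member of $\mathcal C$ for every part $P$ of size $\ge 2$; $(\mathcal G,z)$ is a $\mathcal C$-expansion of $(\mathcal G',z)$ if it has a $\mathcal C$-partition $\mathcal P$ with $\mathcal G/\mathcal P=\mathcal G'$ (tip corresponding to tip). *)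

theory Defs
  imports "HOL-Library.Numeral_Type" "HOL-Library.Disjoint_Sets"
begin

section \<open>Bordered multigraphs\<close>

text \<open>Parallel edges are distinct edge names with equal end sets. The type \<open>3\<close> is the ring
  \<open>\<int>/3\<int>\<close>. Values of \<open>ends\<close> and \<open>bdry\<close> outside the edge set and the vertex set are irrelevant.\<close>

record ('v, 'e) bgraph =
  verts :: "'v set"
  edges :: "'e set"
  ends :: "'e \<Rightarrow> 'v set"
  bdry :: "'v \<Rightarrow> 3"

type_synonym ('v, 'e) canvas = "('v, 'e) bgraph \<times> 'v"

definition multigraph :: "('v, 'e) bgraph \<Rightarrow> bool" where
  "multigraph G \<longleftrightarrow> finite (verts G) \<and> finite (edges G) \<and>
     (\<forall>e\<in>edges G. ends G e \<subseteq> verts G \<and> card (ends G e) = 2)"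

definition adj :: "('v, 'e) bgraph \<Rightarrow> ('v \<times> 'v) set" where
  "adj G = {(u, v). \<exists>e\<in>edges G. ends G e = {u, v}}"

definition component :: "('v, 'e) bgraph \<Rightarrow> 'v \<Rightarrow> 'v set" where
  "component G v = (adj G)\<^sup>* `` {v}"

definition bordered_graph :: "('v, 'e) bgraph \<Rightarrow> bool" where
  "bordered_graph G \<longleftrightarrow> multigraph G \<and> (\<forall>v\<in>verts G. sum (bdry G) (component G v) = 0)"

definition is_canvas :: "('v, 'e) bgraph \<Rightarrow> 'v \<Rightarrow> bool" where
  "is_canvas G z \<longleftrightarrow> bordered_graph G \<and> z \<in> verts G"

definition canvas_iso :: "('v, 'e) bgraph \<Rightarrow> 'v \<Rightarrow> ('w, 'f) bgraph \<Rightarrow> 'w \<Rightarrow> bool" where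
  "canvas_iso G z H y \<longleftrightarrow>
     (\<exists>f g. bij_betw f (verts G) (verts H) \<and> bij_betw g (edges G) (edges H) \<and>
        (\<forall>e\<in>edges G. ends H (g e) = f ` ends G e) \<and>
        (\<forall>v\<in>verts G. bdry H (f v) = bdry G v) \<and> f z = y)"

definition cut :: "('v, 'e) bgraph \<Rightarrow> 'v set \<Rightarrow> 'e set" where
  "cut G A = {e \<in> edges G. card (ends G e \<inter> A) = 1}"

definition deg :: "('v, 'e) bgraph \<Rightarrow> 'v set \<Rightarrow> nat" where
  "deg G A = card (cut G A)"

definition min_degree :: "('v, 'e) bgraph \<Rightarrow> nat" where
  "min_degree G = Min ((\<lambda>v. deg G {v}) ` verts G)"

text \<open>In both parities, the final alternative is the remaining value \<open>-1\<close> of the boundary.\<close>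

definition tau :: "('v, 'e) bgraph \<Rightarrow> 'v set \<Rightarrow> int set" where
  "tau G A =
     (let b = sum (bdry G) A in
      if even (deg G A) then (if b = 0 then {0} else if b = 1 then {-2} else {2})
      else (if b = 0 then {-3, 3} else if b = 1 then {1} else {-1}))"

definition abs_tau :: "('v, 'e) bgraph \<Rightarrow> 'v set \<Rightarrow> int" where
  "abs_tau G A = the_elem (abs ` tau G A)"

section \<open>Contraction and restriction\<close>

text \<open>Contraction keeps edge names, so the edges at a tip that forms a part of its own are the
  same before and after contraction.\<close>

definition contract :: "('v, 'e) bgraph \<Rightarrow> 'v set set \<Rightarrow> ('v set, 'e) bgraph" where
  "contract G P =
     \<lparr>verts = P,
      edges = {e \<in> edges G. \<not> (\<exists>p\<in>P. ends G e \<subseteq> p)},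
      ends = (\<lambda>e. {p \<in> P. p \<inter> ends G e \<noteq> {}}),
      bdry = (\<lambda>p. sum (bdry G) p)\<rparr>"

definition tip_respecting :: "('v, 'e) bgraph \<Rightarrow> 'v \<Rightarrow> 'v set set \<Rightarrow> bool" where
  "tip_respecting G z P \<longleftrightarrow> partition_on (verts G) P \<and> {z} \<in> P"

definition nontrivial :: "'v set set \<Rightarrow> bool" where
  "nontrivial P \<longleftrightarrow> (\<exists>p\<in>P. card p \<ge> 2)"

text \<open>The set of all vertices outside \<open>A\<close> is identified into the new tip; it contains the old
  tip whenever \<open>A\<close> avoids it.\<close>

definition restriction :: "('v, 'e) bgraph \<Rightarrow> 'v set \<Rightarrow> ('v set, 'e) canvas" where
  "restriction G A =
     (contract G (insert (verts G - A) ((\<lambda>a. {a}) ` A)), verts G - A)"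

section \<open>Flows and preflows\<close>

text \<open>As there are no loops, an orientation is given by the tail of each edge. An orientation of
  the edges at the tip is given by the set \<open>S\<close> of those edges that are directed away from
  the tip; the edges at the tip not in \<open>S\<close> are directed towards it.\<close>

definition orientation :: "('v, 'e) bgraph \<Rightarrow> ('e \<Rightarrow> 'v) \<Rightarrow> bool" where
  "orientation G t \<longleftrightarrow> (\<forall>e\<in>edges G. t e \<in> ends G e)"

definition outdeg :: "('v, 'e) bgraph \<Rightarrow> ('e \<Rightarrow> 'v) \<Rightarrow> 'v \<Rightarrow> nat" where
  "outdeg G t v = card {e \<in> cut G {v}. t e = v}"

definition indeg :: "('v, 'e) bgraph \<Rightarrow> ('e \<Rightarrow> 'v) \<Rightarrow> 'v \<Rightarrow> nat" where
  "indeg G t v = card {e \<in> cut G {v}. t e \<noteq> v}"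

definition nowhere_zero_flow :: "('v, 'e) bgraph \<Rightarrow> ('e \<Rightarrow> 'v) \<Rightarrow> bool" where
  "nowhere_zero_flow G t \<longleftrightarrow> orientation G t \<and>
     (\<forall>v\<in>verts G. of_nat (outdeg G t v) - of_nat (indeg G t v) = bdry G v)"

definition tip_preflow :: "('v, 'e) bgraph \<Rightarrow> 'v \<Rightarrow> 'e set \<Rightarrow> bool" where
  "tip_preflow G z S \<longleftrightarrow> S \<subseteq> cut G {z} \<and>
     of_nat (card S) - of_nat (card (cut G {z} - S)) = bdry G z"

definition extends :: "('v, 'e) bgraph \<Rightarrow> 'v \<Rightarrow> 'e set \<Rightarrow> bool" where
  "extends G z S \<longleftrightarrow>
     (\<exists>t. nowhere_zero_flow G t \<and> {e \<in> cut G {z}. t e = z} = S)"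

definition flow_critical :: "('v, 'e) bgraph \<Rightarrow> 'v \<Rightarrow> bool" where
  "flow_critical G z \<longleftrightarrow>
     (\<forall>P. tip_respecting G z P \<and> nontrivial P \<longrightarrow>
        (\<exists>S. tip_preflow G z S \<and> extends (contract G P) {z} S \<and> \<not> extends G z S))"

definition tame :: "('v, 'e) bgraph \<Rightarrow> 'v \<Rightarrow> bool" where
  "tame G z \<longleftrightarrow> (\<forall>v\<in>verts G - {z}. int (deg G {v}) \<ge> 4 + abs_tau G {v})"

definition tallness_witnessing :: "nat \<Rightarrow> ('v, 'e) bgraph \<Rightarrow> 'v \<Rightarrow> 'e set \<Rightarrow> bool" where
  "tallness_witnessing k G z S \<longleftrightarrow>
     deg G {z} \<le> k + 1 \<and> tip_preflow G z S \<and> \<not> extends G z S \<and>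
     (deg G {z} = k + 1 \<longrightarrow> S \<noteq> {} \<and> S \<noteq> cut G {z})"

text \<open>The class is polymorphic in the types of vertices and edges. Every finite canvas is isomorphic
  to one over the natural numbers, so quantification over the members of the class
  is quantification over its instance at \<open>nat\<close>, up to isomorphism.\<close>

definition tall_class :: "nat \<Rightarrow> ('v, 'e) canvas set" where
  "tall_class k = {(G, z). is_canvas G z \<and> flow_critical G z \<and> tame G z \<and>
     deg G {z} \<le> k + 1 \<and> (\<exists>S. tallness_witnessing k G z S)}"

section \<open>The order on canvases\<close>

definition in_friendly :: "('v, 'e) bgraph \<Rightarrow> 'v \<Rightarrow> bool" where
  "in_friendly G v \<longleftrightarrow> (\<exists>x\<in>tau G {v}. x \<le> 0)"

definition out_friendly :: "('v, 'e) bgraph \<Rightarrow> 'v \<Rightarrow> bool" where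
  "out_friendly G v \<longleftrightarrow> (\<exists>x\<in>tau G {v}. x \<ge> 0)"

definition mixed :: "('v, 'e) bgraph \<Rightarrow> 'v \<Rightarrow> 'e \<Rightarrow> bool" where
  "mixed G z e \<longleftrightarrow>
     (\<exists>u v. ends G e = {u, v} \<and> u \<noteq> z \<and> v \<noteq> z \<and> u \<noteq> v \<and> in_friendly G u \<and> out_friendly G v)"

definition homogeneous :: "('v, 'e) bgraph \<Rightarrow> 'v \<Rightarrow> bool" where
  "homogeneous G z \<longleftrightarrow> \<not> (\<exists>e\<in>edges G. mixed G z e)"

definition canvas_size :: "('v, 'e) bgraph \<Rightarrow> 'v \<Rightarrow> nat" where
  "canvas_size G z = card (verts G) + card {e \<in> edges G. z \<notin> ends G e}"

definition prec :: "('v, 'e) bgraph \<Rightarrow> 'v \<Rightarrow> ('w, 'f) bgraph \<Rightarrow> 'w \<Rightarrow> bool" where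
  "prec G1 z1 G2 z2 \<longleftrightarrow>
     canvas_size G1 z1 < canvas_size G2 z2 \<or>
     (canvas_size G1 z1 = canvas_size G2 z2 \<and> \<not> homogeneous G1 z1 \<and> homogeneous G2 z2) \<or>
     (canvas_size G1 z1 = canvas_size G2 z2 \<and> homogeneous G1 z1 \<and> homogeneous G2 z2 \<and>
        deg G1 {z1} < deg G2 {z2})"

section \<open>Operations\<close>

text \<open>The new edge is \<open>None\<close>.\<close>

definition add_edge :: "('v, 'e) bgraph \<Rightarrow> 'v \<Rightarrow> 'v \<Rightarrow> ('v, 'e option) bgraph" where
  "add_edge G u v =
     \<lparr>verts = verts G,
      edges = insert None (Some ` edges G),
      ends = case_option {u, v} (ends G),
      bdry = (bdry G)(u := bdry G u + 1, v := bdry G v - 1)\<rparr>"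

definition one_alteration_at :: "('v, 'e) bgraph \<Rightarrow> 'v \<Rightarrow> 'v \<Rightarrow> 'v \<Rightarrow> bool" where
  "one_alteration_at G z u v \<longleftrightarrow> u \<in> verts G \<and> v \<in> verts G \<and> u \<noteq> v \<and> u \<noteq> z \<and> v \<noteq> z"

definition tip_alteration_at :: "('v, 'e) bgraph \<Rightarrow> 'v \<Rightarrow> 'v \<Rightarrow> 'v \<Rightarrow> bool" where
  "tip_alteration_at G z u v \<longleftrightarrow> u \<in> verts G \<and> v \<in> verts G \<and> u \<noteq> v \<and> (u = z \<or> v = z)"

definition delete_edge :: "('v, 'e) bgraph \<Rightarrow> 'e \<Rightarrow> ('v, 'e) bgraph" where
  "delete_edge G e = G\<lparr>edges := edges G - {e}\<rparr>"

definition tip_reduction_at :: "('v, 'e) bgraph \<Rightarrow> 'v \<Rightarrow> 'v \<Rightarrow> 'e \<Rightarrow> bool" where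
  "tip_reduction_at G z v e \<longleftrightarrow> v \<in> verts G \<and> v \<noteq> z \<and>
     card {f \<in> edges G. ends G f = {v, z}} \<ge> 2 \<and> e \<in> edges G \<and> ends G e = {v, z}"

text \<open>In a 2-alteration on \<open>X\<close>, vertices in \<open>X\<close> are tagged \<open>Inl\<close> and edges \<open>Inr\<close>. The new vertex is
  \<open>None\<close>; \<open>Half e u\<close> joins it to the end \<open>u\<close> of the deleted edge \<open>e\<close>, and \<open>Double w False\<close>,
  \<open>Double w True\<close> are the two parallel edges joining it to \<open>w\<close>.\<close>

datatype ('v, 'e) alt_edge = Old 'e | Half 'e 'v | Double 'v bool

definition two_alteration ::
  "('v, 'e) bgraph \<Rightarrow> ('v + 'e) set \<Rightarrow> ('v option, ('v, 'e) alt_edge) bgraph" where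
  "two_alteration G X =
     \<lparr>verts = insert None (Some ` verts G),
      edges = {Old e | e. e \<in> edges G \<and> Inr e \<notin> X} \<union>
              {Half e u | e u. Inr e \<in> X \<and> u \<in> ends G e} \<union>
              {Double w b | w b. Inl w \<in> X},
      ends = (\<lambda>a. case a of Old e \<Rightarrow> Some ` ends G e
                          | Half e u \<Rightarrow> {None, Some u}
                          | Double w b \<Rightarrow> {None, Some w}),
      bdry = case_option 0 (bdry G)\<rparr>"

definition two_alteration_on :: "('v, 'e) bgraph \<Rightarrow> ('v + 'e) set \<Rightarrow> bool" where
  "two_alteration_on G X \<longleftrightarrow> X \<subseteq> verts G <+> edges G \<and> X \<noteq> {} \<and> card X \<le> 2"

definition class_partition ::
  "(nat, nat) canvas set \<Rightarrow> ('v, 'e) bgraph \<Rightarrow> 'v \<Rightarrow> 'v set set \<Rightarrow> bool" where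
  "class_partition K G z P \<longleftrightarrow> tip_respecting G z P \<and>
     (\<forall>p\<in>P. card p \<ge> 2 \<longrightarrow>
        (\<exists>(H, y)\<in>K. canvas_iso (fst (restriction G p)) (snd (restriction G p)) H y))"

definition expansion ::
  "(nat, nat) canvas set \<Rightarrow> ('v, 'e) bgraph \<Rightarrow> 'v \<Rightarrow> ('w, 'f) bgraph \<Rightarrow> 'w \<Rightarrow> bool" where
  "expansion K G z G' z' \<longleftrightarrow>
     (\<exists>P. class_partition K G z P \<and> canvas_iso (contract G P) {z} G' z')"

section \<open>The outcomes\<close>

definition SMALL :: "('v, 'e) bgraph \<Rightarrow> bool" where
  "SMALL G \<longleftrightarrow> card (verts G) = 3"

definition EXPA :: "nat \<Rightarrow> ('v, 'e) bgraph \<Rightarrow> 'v \<Rightarrow> bool" where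
  "EXPA k G z \<longleftrightarrow>
     (\<exists>(G' :: (nat, nat) bgraph, z') \<in> tall_class k. prec G' z' G z \<and>
        (expansion (tall_class k) G z G' z' \<or>
         (\<exists>X. two_alteration_on G' X \<and>
              expansion (tall_class k) G z (two_alteration G' X) (Some z'))))"

definition EXPB :: "nat \<Rightarrow> ('v, 'e) bgraph \<Rightarrow> 'v \<Rightarrow> bool" where
  "EXPB k G z \<longleftrightarrow>
     (\<exists>(G' :: (nat, nat) bgraph, z') \<in> tall_class k. prec G' z' G z \<and>
        (\<exists>u v. one_alteration_at G' z' u v \<and>
               expansion (tall_class k) G z (add_edge G' u v) z'))"

definition ADD :: "nat \<Rightarrow> ('v, 'e) bgraph \<Rightarrow> 'v \<Rightarrow> bool" where
  "ADD k G z \<longleftrightarrow>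
     (\<exists>(G' :: (nat, nat) bgraph, z') \<in> tall_class k. prec G' z' G z \<and>
        (\<exists>u v. tip_alteration_at G' z' u v \<and> canvas_iso G z (add_edge G' u v) z'))"

definition REM :: "nat \<Rightarrow> ('v, 'e) bgraph \<Rightarrow> 'v \<Rightarrow> bool" where
  "REM k G z \<longleftrightarrow>
     (\<exists>(G' :: (nat, nat) bgraph, z') \<in> tall_class k. prec G' z' G z \<and>
        (\<exists>v e. tip_reduction_at G' z' v e \<and> canvas_iso G z (delete_edge G' e) z'))"

end

(* If deg(A) >= 4 + |tau(A)| for all proper sets A of vertices avoiding the tip, and the degree of
   the tip is less than 6 + |tau(z)|, then every tip preflow extends. In a minimal counterexample
   all sets of at least two vertices have larger degree, since others could be contracted and
   filled in afterwards; lifting pairs of edges at vertices of degree four and deleting edges then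
   gives a smaller counterexample. Hence in a tame flow-critical canvas every set A of at least two
   vertices with at least two vertices outside has degree at least 6 + |tau(A)|.

   Fix a witnessing preflow S. Among the tip-respecting partitions to whose quotient S does not
   extend, a coarsest one has a flow-critical quotient. If it is non-trivial, this quotient is
   the smaller canvas of (EXPA). Otherwise S extends to every proper quotient, and splitting a
   vertex of degree four, deleting a mixed edge, or deleting or doubling an edge at the tip yields
   a smaller canvas to which S still does not extend; its coarsest non-extending quotient is the
   required smaller canvas. The restriction to a part P of degree k + 1 is tall because some flow
   of the quotient is not uniform around P. *)
theory Submission imports Defs
begin

text \<open>A prescribed orientation at the tip acts on the rest only through the net outflow that
  it leaves to each vertex. Hence the extension theorem is stated with the tip removed, on integer
  multiplicities: a flow depends only on the demands \<open>c\<close>, and the tip arcs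
  \<open>x\<close>, \<open>y\<close> enter only through degrees and boundaries, so they may be
  deleted or exchanged as long as \<open>c\<close> is kept. The theorem also admits one exceptional
  vertex, of degree at least \<open>k\<close>, against a tip of degree at most \<open>k + 1\<close>.
  With \<open>k\<close> the least degree of a set around a vertex, this form shows that in a canvas
  critical for a single preflow every vertex has degree at most that of the tip minus two. This
  margin makes expansions possible: undoing a split raises the degree of a part by at most two,
  undoing a deletion by one, so the restrictions to parts stay within \<open>k + 1\<close>. At
  \<open>k + 1\<close> exactly a preflow that is not uniform is needed; for this, a second extension
  theorem provides flows that both enter and leave the exceptional vertex. Modulo 3 an arc equals
  two reversed arcs, which explains the exchanges at the tip and the doubling.\<close>

text \<open>A set of degree \<open>n\<close> and boundary \<open>b\<close> mod 3 satisfies \<open>n \<ge> 4 + \<bar>\<tau>\<bar>\<close>, respectively \<open>n \<ge> 6 + \<bar>\<tau>\<bar>\<close>.\<close>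

definition tm :: "int => int => bool" where
 "tm n b \<longleftrightarrow> 6 \<le> n \<or> (n = 5 \<and> \<not> 3 dvd b) \<or> (n = 4 \<and> 3 dvd b)"

definition st :: "int => int => bool" where
 "st n b \<longleftrightarrow> 8 \<le> n \<or> (n = 7 \<and> \<not> 3 dvd b) \<or> (n = 6 \<and> 3 dvd b)"

section \<open>Weighted graphs without their tip: multiplicities, degrees and flows\<close>

text \<open>The tip is not a vertex here: \<open>m u t\<close> counts the edges between \<open>u\<close> and \<open>t\<close>, and \<open>e u\<close> those between \<open>u\<close> and
 the tip. A flow \<open>f\<close> gives the number \<open>f u t\<close> of edges directed from \<open>u\<close> to \<open>t\<close>.\<close>

definition mg :: "'a set => ('a => 'a => int) => bool" where
 "mg W m \<longleftrightarrow> finite W \<and> (\<forall>u\<in>W. \<forall>t\<in>W. m u t = m t u \<and> 0 \<le> m u t) \<and> (\<forall>u\<in>W. m u u = 0)"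

definition dg :: "'a set => ('a => 'a => int) => ('a => int) => 'a set => int" where
 "dg W m e A = (\<Sum>u\<in>A. sum (m u) (W - A) + e u)"

abbreviation mass :: "'a set => ('a => 'a => int) => int" where
 "mass W m \<equiv> \<Sum>u\<in>W. \<Sum>t\<in>W. m u t"

definition flow :: "'a set => ('a => 'a => int) => ('a => int) => ('a => 'a => int) => bool" where
 "flow W m c f \<longleftrightarrow> (\<forall>u\<in>W. \<forall>t\<in>W. 0 \<le> f u t \<and> f u t + f t u = m u t) \<and>
   (\<forall>u\<in>W. 3 dvd (\<Sum>t\<in>W. f u t - f t u) - c u)"

definition madd :: "('a => 'a => int) => 'a => 'a => int => 'a => 'a => int" where
 "madd m u w j = (\<lambda>a b. if a = u \<and> b = w \<or> a = w \<and> b = u then m a b + j else m a b)"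

definition arcadd :: "('a => 'a => int) => 'a => 'a => int => 'a => 'a => int" where
 "arcadd f u w j = (\<lambda>a b. if a = u \<and> b = w then f a b + j else f a b)"

lemma mgD: assumes "mg W m" shows "finite W" "\<And>u t. u \<in> W ==> t \<in> W ==> m u t = m t u"
 "\<And>u t. u \<in> W ==> t \<in> W ==> 0 \<le> m u t" "\<And>u. u \<in> W ==> m u u = 0"
 using assms unfolding mg_def by blast+

lemma mg_subset: "mg W m ==> S \<subseteq> W ==> mg S m"
 unfolding mg_def by (meson finite_subset subsetD)

lemma mg_madd: "mg W m ==> u \<noteq> w ==> 0 \<le> m u w + j ==> 0 \<le> m w u + j ==> mg W (madd m u w j)"
 unfolding mg_def madd_def by auto

lemma madd_apply: "madd m u w j a b = m a b + (if a = u \<and> b = w \<or> a = w \<and> b = u then j else 0)"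
 by (simp add: madd_def)

lemma sum_madd:
 assumes "finite B" "u \<noteq> w"
 shows "sum (madd m u w j a) B = sum (m a) B + (if a = u \<and> w \<in> B \<or> a = w \<and> u \<in> B then j else 0)"
proof -
 have "sum (madd m u w j a) B = sum (m a) B + (\<Sum>t\<in>B. if a = u \<and> t = w \<or> a = w \<and> t = u then j else 0)"
  by (simp add: madd_apply sum.distrib)
 also have "(\<Sum>t\<in>B. if a = u \<and> t = w \<or> a = w \<and> t = u then j else 0)
   = (\<Sum>t\<in>B. if t = (if a = u then w else u) then (if a = u \<or> a = w then j else 0) else 0)"
  using assms(2) by (intro sum.cong) auto
 also have "\<dots> = (if a = u \<and> w \<in> B \<or> a = w \<and> u \<in> B then j else 0)"
  using assms by (auto simp: sum.delta')
 finally show ?thesis .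
qed

lemma sum_if_single: "finite A ==> (\<Sum>a\<in>A. if a = u \<and> P then (j::int) else 0) = (if u \<in> A \<and> P then j else 0)"
 by (cases P) (auto simp: sum.delta')

lemma dg_madd:
 assumes "finite W" "A \<subseteq> W" "u \<in> W" "w \<in> W" "u \<noteq> w"
 shows "dg W (madd m u w j) e A = dg W m e A + (if (u \<in> A) \<noteq> (w \<in> A) then j else 0)"
proof -
 have fA: "finite A" "finite (W - A)" using assms finite_subset by auto
 have "dg W (madd m u w j) e A = (\<Sum>a\<in>A. (sum (m a) (W - A) + e a) +
   ((if a = u \<and> w \<in> W - A then j else 0) + (if a = w \<and> u \<in> W - A then j else 0)))"
  unfolding dg_def sum_madd[OF fA(2) assms(5)] by (rule sum.cong) (use assms(5) in auto)
 also have "\<dots> = dg W m e A + ((if u \<in> A \<and> w \<in> W - A then j else 0) + (if w \<in> A \<and> u \<in> W - A then j else 0))"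
  unfolding sum.distrib dg_def using sum_if_single[OF fA(1)] by simp
 finally show ?thesis using assms by auto
qed

lemma sumsum_madd:
 assumes "finite W" "u \<in> W" "w \<in> W" "u \<noteq> w"
 shows "mass W (madd m u w j) = mass W m + 2 * j"
proof -
 have "mass W (madd m u w j) = (\<Sum>a\<in>W. sum (m a) W +
   ((if a = u \<and> w \<in> W then j else 0) + (if a = w \<and> u \<in> W then j else 0)))"
  unfolding sum_madd[OF assms(1,4)] by (rule sum.cong) (use assms(4) in auto)
 also have "\<dots> = mass W m + (j + j)"
  unfolding sum.distrib using sum_if_single[OF assms(1)] assms by simp
 finally show ?thesis by simp
qed

lemma dg_tips: "dg W m e' A = dg W m e A + (\<Sum>u\<in>A. e' u - e u)"
 by (simp add: dg_def sum.distrib sum_subtractf)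

text \<open>\<open>mass A m\<close> runs over ordered pairs, so an edge inside \<open>A\<close> is
  subtracted twice, once for each of its ends.\<close>

lemma dg_alt:
 assumes "mg W m" "A \<subseteq> W"
 shows "dg W m e A = (\<Sum>u\<in>A. sum (m u) W + e u) - mass A m"
proof -
 have f: "finite W" using mgD[OF assms(1)] by auto
 have "\<And>u. sum (m u) (W - A) = sum (m u) W - sum (m u) A"
  using sum_diff[OF f assms(2)] by auto
 thus ?thesis by (simp add: dg_def sum.distrib sum_subtractf)
qed

lemma dg_single:
 assumes "mg W m" "u \<in> W"
 shows "dg W m e {u} = sum (m u) W + e u"
 using dg_alt[of W m "{u}" e] assms mgD[OF assms(1)] by simp

lemma dg_insert:
 assumes mg: "mg W m" and "A \<subseteq> W" "w \<in> W" "w \<notin> A"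
 shows "dg W m e (insert w A) = dg W m e A + dg W m e {w} - 2 * sum (m w) A"
proof -
 note M = mgD[OF mg]
 have fA: "finite A" using M(1) assms(2) finite_subset by auto
 have s: "(\<Sum>t\<in>A. m t w) = sum (m w) A" by (rule sum.cong) (use M assms in auto)
 have "mass (insert w A) m = mass A m + 2 * sum (m w) A"
  using fA assms(3,4) M(4) by (simp add: sum.distrib s)
 moreover have "(\<Sum>u\<in>insert w A. sum (m u) W + e u) = (\<Sum>u\<in>A. sum (m u) W + e u) + (sum (m w) W + e w)"
  using fA assms(4) by simp
 ultimately show ?thesis using dg_alt[OF mg, of "insert w A" e] dg_alt[OF mg assms(2), of e] dg_single[OF mg assms(3)] assms(2,3) by simp
qed

text \<open>The edges to \<open>w\<close> vanish together with \<open>w\<close>; they are not turned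
  into tip edges, in contrast to \<open>dg_restrict\<close>.\<close>

lemma dg_remove:
 assumes "mg W m" "w \<in> W" "A \<subseteq> W - {w}"
 shows "dg (W - {w}) m e A = dg W m e A - sum (m w) A"
proof -
 note M = mgD[OF assms(1)]
 have "W - A = insert w (W - {w} - A)" using assms by auto
 hence "\<And>u. sum (m u) (W - A) = m u w + sum (m u) (W - {w} - A)" using M(1) by simp
 moreover have "(\<Sum>u\<in>A. m u w) = sum (m w) A" by (rule sum.cong) (use M assms in auto)
 ultimately show ?thesis by (simp add: dg_def sum.distrib)
qed

lemma dg_all: "dg W m e W = sum e W" by (simp add: dg_def)

text \<open>An edge that leaves \<open>S\<close> becomes an edge to the tip of the restricted
  instance, so no subset of \<open>S\<close> notices the restriction.\<close>

lemma dg_restrict: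
 assumes "finite W" "A \<subseteq> S" "S \<subseteq> W" "\<And>u. u \<in> S ==> eS u = e u + sum (m u) (W - S)"
 shows "dg S m eS A = dg W m e A"
proof -
 have "\<And>u. sum (m u) (W - A) = sum (m u) (S - A) + sum (m u) (W - S)"
 proof -
  fix u have "W - A = (S - A) \<union> (W - S)" "(S - A) \<inter> (W - S) = {}" using assms by auto
  moreover have "finite (S - A)" "finite (W - S)" using assms finite_subset by blast+
  ultimately show "sum (m u) (W - A) = sum (m u) (S - A) + sum (m u) (W - S)"
   using sum.union_disjoint by metis
 qed
 thus ?thesis unfolding dg_def using assms by (intro sum.cong) auto
qed

lemma dg_disjoint_no_edges:
 assumes "mg W m" "A \<subseteq> W" "\<And>u t. u \<in> A ==> t \<in> W - A ==> m u t = 0"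
 shows "dg W m e A = sum e A"
 using assms by (simp add: dg_def)

lemma st_tm: "st n b ==> tm n b'" by (auto simp: st_def tm_def)
text \<open>\<open>st n b\<close> is \<open>tm (n - 2) b\<close>. The surplus of two pays for one
  edge in either direction, or for a pair of edges that leaves the boundary alone.\<close>

lemma st_tm1: "st n b ==> tm (n - 1) (b - 1) \<and> tm (n - 1) (b + 1)"
 unfolding st_def tm_def by presburger
lemma st_tm2: "st n b ==> tm (n - 2) b" unfolding st_def tm_def by presburger
lemma tm_ge4: "tm n b ==> 4 \<le> n" by (auto simp: tm_def)
lemma tm_cong: "3 dvd b - b' ==> tm n b \<longleftrightarrow> tm n b'" unfolding tm_def by presburger
lemma st_cong: "3 dvd b - b' ==> st n b \<longleftrightarrow> st n b'" unfolding st_def by presburger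

section \<open>Recovering a flow after a reduction\<close>

lemma flowD: assumes "flow W m c f"
 shows "\<And>u t. u \<in> W ==> t \<in> W ==> 0 \<le> f u t" "\<And>u t. u \<in> W ==> t \<in> W ==> f u t + f t u = m u t"
  "\<And>u. u \<in> W ==> 3 dvd (\<Sum>t\<in>W. f u t - f t u) - c u"
 using assms unfolding flow_def by blast+

lemma arcadd_sym: "u \<noteq> w ==> arcadd f u w j a b + arcadd f u w j b a
  = f a b + f b a + (if a = u \<and> b = w \<or> a = w \<and> b = u then j else 0)"
 by (auto simp: arcadd_def)

lemma madd_commute: "madd m u w j = madd m w u j"
 by (auto simp: madd_def fun_eq_iff)

lemma madd_swap: "madd (madd m a b i) c d j = madd (madd m c d j) a b i"
 by (simp add: fun_eq_iff madd_apply)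

lemma arcadd_apply: "arcadd f u w j a b = f a b + (if a = u \<and> b = w then j else 0)"
 by (simp add: arcadd_def)

lemma sum_arcadd:
 assumes "finite B"
 shows "sum (arcadd f u w j a) B = sum (f a) B + (if a = u \<and> w \<in> B then j else 0)"
  "(\<Sum>t\<in>B. arcadd f u w j t a) = (\<Sum>t\<in>B. f t a) + (if a = w \<and> u \<in> B then j else 0)"
proof -
 have "sum (arcadd f u w j a) B = (\<Sum>t\<in>B. f a t + (if t = w \<and> a = u then j else 0))"
  by (rule sum.cong) (auto simp: arcadd_def)
 thus "sum (arcadd f u w j a) B = sum (f a) B + (if a = u \<and> w \<in> B then j else 0)"
  using sum_if_single[OF assms] by (auto simp: sum.distrib)
 have "(\<Sum>t\<in>B. arcadd f u w j t a) = (\<Sum>t\<in>B. f t a + (if t = u \<and> a = w then j else 0))"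
  by (rule sum.cong) (auto simp: arcadd_def)
 thus "(\<Sum>t\<in>B. arcadd f u w j t a) = (\<Sum>t\<in>B. f t a) + (if a = w \<and> u \<in> B then j else 0)"
  using sum_if_single[OF assms] by (auto simp: sum.distrib)
qed

text \<open>Undoing the deletion of an edge directed from \<open>u\<close> to \<open>w\<close>.\<close>

lemma flow_add_arc:
 assumes fl: "flow W (madd m u w (- 1)) (c(u := c u - 1, w := c w + 1)) f"
  and "finite W" "u \<in> W" "w \<in> W" "u \<noteq> w"
 shows "flow W m c (arcadd f u w 1)"
 unfolding flow_def
proof (intro conjI ballI)
 note F = flowD[OF fl]
 fix a b assume ab: "a \<in> W" "b \<in> W"
 show "0 \<le> arcadd f u w 1 a b" using F(1)[OF ab] by (auto simp: arcadd_def)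
 show "arcadd f u w 1 a b + arcadd f u w 1 b a = m a b"
  using F(2)[OF ab] assms(5) by (auto simp: arcadd_def madd_def split: if_splits)
next
 note F = flowD[OF fl]
 fix a assume a: "a \<in> W"
 show "3 dvd (\<Sum>t\<in>W. arcadd f u w 1 a t - arcadd f u w 1 t a) - c a"
  using F(3)[OF a] assms(3-5) unfolding sum_subtractf sum_arcadd[OF assms(2)]
  by (cases "a = u"; cases "a = w"; simp add: algebra_simps)
qed

text \<open>Undoing a lift: an edge \<open>ab\<close> is replaced by the path \<open>a w b\<close>.\<close>

lemma flow_unlift:
 assumes fl: "flow W (madd (madd (madd m w a (- 1)) w b (- 1)) a b 1) c f"
  and "finite W" "w \<in> W" "a \<in> W" "b \<in> W" "a \<noteq> w" "b \<noteq> w" "a \<noteq> b" "0 \<le> m a b"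
 shows "\<exists>p q. (p = a \<and> q = b \<or> p = b \<and> q = a) \<and>
   flow W m c (arcadd (arcadd (arcadd f p q (- 1)) p w 1) w q 1) \<and> 0 < f p q"
proof -
 note F = flowD[OF fl]
 have ab: "f a b + f b a = m a b + 1" using F(2)[OF assms(4,5)] assms(6-8) by (auto simp: madd_def)
 \<comment> \<open>The lift puts an additional edge between \<open>a\<close> and \<open>b\<close>,
   so at least one arc of \<open>f\<close> joins them. That arc, in whichever direction it runs, is
   rerouted through \<open>w\<close>.\<close>
 define p where "p = (if 0 < f a b then a else b)"
 define q where "q = (if 0 < f a b then b else a)"
 have pq: "p = a \<and> q = b \<or> p = b \<and> q = a" by (auto simp: p_def q_def)
 have pos: "0 < f p q" using ab assms(9) by (auto simp: p_def q_def)
 have d: "p \<noteq> q" "p \<noteq> w" "q \<noteq> w" "p \<in> W" "q \<in> W" using pq assms by auto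
 have M: "madd (madd (madd m w a (- 1)) w b (- 1)) a b 1 = madd (madd (madd m w p (- 1)) w q (- 1)) p q 1"
  using pq madd_swap[of m w a "- 1" w b "- 1"] madd_commute[of _ a b] by auto
 let ?f = "arcadd (arcadd (arcadd f p q (- 1)) p w 1) w q 1"
 have "flow W m c ?f"
  unfolding flow_def
 proof (intro conjI ballI)
  fix s t assume st: "s \<in> W" "t \<in> W"
  show "0 \<le> ?f s t" using F(1)[OF st] pos by (cases "s = p \<and> t = q") (auto simp: arcadd_apply)
  have "f s t + f t s = madd (madd (madd m p w (- 1)) w q (- 1)) p q 1 s t"
   using F(2)[OF st] unfolding M madd_commute[of m w p] .
  thus "?f s t + ?f t s = m s t"
   unfolding arcadd_sym[OF d(1)] arcadd_sym[OF d(2)] arcadd_sym[OF d(3)[symmetric]] madd_apply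
   by (cases "s = p \<and> t = q \<or> s = q \<and> t = p"; cases "s = p \<and> t = w \<or> s = w \<and> t = p";
     cases "s = w \<and> t = q \<or> s = q \<and> t = w"; simp only: if_True if_False; linarith)
 next
  fix s assume s: "s \<in> W"
  show "3 dvd (\<Sum>t\<in>W. ?f s t - ?f t s) - c s"
   using F(3)[OF s] d assms(3) unfolding sum_subtractf sum_arcadd[OF assms(2)]
   by (cases "s = p"; cases "s = q"; cases "s = w"; simp)
 qed
 thus ?thesis using pq pos by blast
qed

lemma flow_add_isolated:
 assumes fl: "flow (W - {w}) m c f" and mg: "mg W m" and "w \<in> W" "\<And>t. t \<in> W ==> m w t = 0" "3 dvd c w"
 shows "flow W m c (\<lambda>s t. if s = w \<or> t = w then 0 else f s t)" (is "flow W m c ?f")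
 unfolding flow_def
proof (intro conjI ballI)
 note F = flowD[OF fl] and M = mgD[OF mg]
 fix a b assume ab: "a \<in> W" "b \<in> W"
 show "0 \<le> ?f a b" using F(1)[of a b] ab by auto
 show "?f a b + ?f b a = m a b" using F(2)[of a b] ab assms(4) M(2)[of a w] assms(3) by auto
next
 note F = flowD[OF fl] and M = mgD[OF mg]
 fix a assume a: "a \<in> W"
 have "(\<Sum>t\<in>W. ?f a t - ?f t a) = (if a = w then 0 else (\<Sum>t\<in>W - {w}. f a t - f t a))"
  unfolding sum.remove[OF M(1) assms(3)] by (auto intro: sum.cong)
 thus "3 dvd (\<Sum>t\<in>W. ?f a t - ?f t a) - c a" using F(3)[of a] a assms(5) by auto
qed

text \<open>All edges at the removed vertex \<open>w\<close> are directed away from it.\<close>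

lemma flow_raise:
 assumes fl: "flow (W - {w}) m (\<lambda>u. c u + m w u) f" and mg: "mg W m" and "w \<in> W"
  "3 dvd (sum (m w) W) - c w"
 shows "flow W m c (\<lambda>s t. if s = w then m w t else if t = w then 0 else f s t)" (is "flow W m c ?f")
 unfolding flow_def
proof (intro conjI ballI)
 note F = flowD[OF fl] and M = mgD[OF mg]
 fix a b assume ab: "a \<in> W" "b \<in> W"
 show "0 \<le> ?f a b" using F(1)[of a b] ab M(3)[OF assms(3)] by auto
 show "?f a b + ?f b a = m a b" using F(2)[of a b] ab M(2)[of a w] M(4) assms(3) by auto
next
 note F = flowD[OF fl] and M = mgD[OF mg]
 fix a assume a: "a \<in> W"
 have "(\<Sum>t\<in>W. ?f a t - ?f t a) = (if a = w then (sum (m w) W) else (\<Sum>t\<in>W - {w}. f a t - f t a) - m w a)"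
  unfolding sum.remove[OF M(1) assms(3)] using M(4)[OF assms(3)] by (auto intro!: sum.cong)
 thus "3 dvd (\<Sum>t\<in>W. ?f a t - ?f t a) - c a" using F(3)[of a] a assms(4) by (auto simp: algebra_simps split: if_splits)
qed

section \<open>Quotients of weighted graphs and gluing of flows\<close>

definition fib :: "'a set => ('a => 'b) => 'b => 'a set" where
 "fib W f i = {u \<in> W. f u = i}"

text \<open>Edges inside a fibre are discarded, like the loops of a contraction.\<close>

definition qm :: "'a set => ('a => 'b) => ('a => 'a => int) => 'b => 'b => int" where
 "qm W f m i j = (if i = j then 0 else \<Sum>u\<in>fib W f i. \<Sum>t\<in>fib W f j. m u t)"

definition qs :: "'a set => ('a => 'b) => ('a => int) => 'b => int" where
 "qs W f c i = sum c (fib W f i)"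

lemma finite_fib: "finite W ==> finite (fib W f i)"
 by (simp add: fib_def)

lemma sum_fib:
 assumes "finite W" "B \<subseteq> f ` W"
 shows "(\<Sum>i\<in>B. \<Sum>u\<in>fib W f i. h u) = (\<Sum>u\<in>{u\<in>W. f u \<in> B}. h u)"
proof -
 have "finite B" using assms finite_subset by blast
 hence "(\<Sum>i\<in>B. sum h {u \<in> {u\<in>W. f u \<in> B}. f u = i}) = sum h {u\<in>W. f u \<in> B}"
  using assms by (intro sum.group) auto
 moreover have "\<And>i. i \<in> B ==> {u \<in> {u\<in>W. f u \<in> B}. f u = i} = fib W f i" by (auto simp: fib_def)
 ultimately show ?thesis by (metis (no_types, lifting) sum.cong)
qed

lemma sum_qs: "finite W ==> B \<subseteq> f ` W ==> sum (qs W f c) B = sum c {u\<in>W. f u \<in> B}"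
 unfolding qs_def by (rule sum_fib)

lemma sum_qs_all: "finite W ==> sum (qs W f c) (f ` W) = sum c W"
 by (subst sum_qs) (auto intro: sum.cong)

text \<open>Quotient vertices stand for disjoint fibres, so degrees can be read off the preimage;
  every degree condition passes to the quotient in this way.\<close>

lemma qdg:
 assumes "finite W" "B \<subseteq> f ` W"
 shows "dg (f ` W) (qm W f m) (qs W f e) B = dg W m e {u\<in>W. f u \<in> B}"
proof -
 have *: "sum (qm W f m i) (f ` W - B) = (\<Sum>u\<in>fib W f i. \<Sum>t\<in>W - {u\<in>W. f u \<in> B}. m u t)" if "i \<in> B" for i
 proof -
  have "sum (qm W f m i) (f ` W - B) = (\<Sum>j\<in>f ` W - B. \<Sum>u\<in>fib W f i. \<Sum>t\<in>fib W f j. m u t)"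
   using that by (intro sum.cong) (auto simp: qm_def)
  also have "\<dots> = (\<Sum>u\<in>fib W f i. \<Sum>j\<in>f ` W - B. \<Sum>t\<in>fib W f j. m u t)" by (rule sum.swap)
  also have "\<dots> = (\<Sum>u\<in>fib W f i. \<Sum>t\<in>{t\<in>W. f t \<in> f ` W - B}. m u t)"
   by (subst sum_fib[OF assms(1)]) auto
  also have "{t\<in>W. f t \<in> f ` W - B} = W - {u\<in>W. f u \<in> B}" by auto
  finally show ?thesis .
 qed
 have "dg (f ` W) (qm W f m) (qs W f e) B = (\<Sum>i\<in>B. \<Sum>u\<in>fib W f i. (\<Sum>t\<in>W - {u\<in>W. f u \<in> B}. m u t) + e u)"
  unfolding dg_def by (intro sum.cong refl) (simp add: * qs_def sum.distrib)
 also have "\<dots> = dg W m e {u\<in>W. f u \<in> B}" unfolding dg_def by (rule sum_fib[OF assms])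
 finally show ?thesis .
qed

lemma mg_qm:
 assumes "mg W m"
 shows "mg (f ` W) (qm W f m)"
 unfolding mg_def
proof (intro conjI ballI)
 note M = mgD[OF assms]
 show "finite (f ` W)" using M by auto
 fix i j
 have "(\<Sum>u\<in>fib W f i. \<Sum>t\<in>fib W f j. m u t) = (\<Sum>t\<in>fib W f j. \<Sum>u\<in>fib W f i. m t u)"
  by (subst sum.swap) (intro sum.cong refl M(2); simp add: fib_def)
 thus "qm W f m i j = qm W f m j i" by (simp add: qm_def)
 show "0 \<le> qm W f m i j" unfolding qm_def by (auto intro!: sum_nonneg M(3) simp: fib_def)
qed (simp add: qm_def)

text \<open>Greedy filling: each position takes as much of the remaining total as its bound
  permits.\<close>

lemma distribute:
 assumes "finite X" "\<forall>a\<in>X. (0::int) \<le> M a" "0 \<le> n" "n \<le> sum M X"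
 shows "\<exists>g. (\<forall>a\<in>X. 0 \<le> g a \<and> g a \<le> M a) \<and> sum g X = n"
 using assms
proof (induction X arbitrary: n rule: finite_induct)
 case (insert a X)
 define r where "r = min n (M a)"
 have "0 \<le> sum M X" using insert.prems by (intro sum_nonneg) auto
 have "0 \<le> n - r" "n - r \<le> sum M X" "0 \<le> r" "r \<le> M a" using insert.prems insert.hyps \<open>0 \<le> sum M X\<close> by (auto simp: r_def)
 then obtain g where "\<forall>a\<in>X. 0 \<le> g a \<and> g a \<le> M a" "sum g X = n - r"
  using insert.IH[of "n - r"] insert.prems by auto
 moreover have "sum (g(a := r)) X = sum g X" by (rule sum.cong) (use insert.hyps in auto)
 ultimately show ?case using insert.hyps \<open>0 \<le> r\<close> \<open>r \<le> M a\<close>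
  by (intro exI[of _ "g(a := r)"]) auto
qed auto

text \<open>The number of arcs between two quotient vertices is shared out over the pairs of the two
  fibres, within the multiplicities.\<close>

lemma spread_flow:
 assumes mg: "mg W m" and fl: "flow (f ` W) (qm W f m) (qs W f c) g"
 shows "\<exists>ox. (\<forall>u\<in>W. \<forall>t\<in>W. f u \<noteq> f t \<longrightarrow> 0 \<le> ox u t \<and> ox u t + ox t u = m u t) \<and>
  (\<forall>i\<in>f ` W. \<forall>j\<in>f ` W. i \<noteq> j \<longrightarrow> (\<Sum>u\<in>fib W f i. \<Sum>t\<in>fib W f j. ox u t) = g i j)"
proof -
 note M = mgD[OF mg] and F = flowD[OF fl]
 have fin: "finite (fib W f i)" for i by (rule finite_fib[OF M(1)])
 have mf: "0 \<le> m (fst p) (snd p)" if "p \<in> fib W f i \<times> fib W f j" for p i j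
  using that M(3) by (auto simp: fib_def)
 have ex: "\<exists>h. (\<forall>p\<in>fib W f i \<times> fib W f j. 0 \<le> h p \<and> h p \<le> m (fst p) (snd p)) \<and> sum h (fib W f i \<times> fib W f j) = g i j"
  if ij: "i \<in> f ` W" "j \<in> f ` W" "i \<noteq> j" for i j
 proof (rule distribute)
  have "g i j + g j i = qm W f m i j" "0 \<le> g j i" using F(1,2) that by blast+
  moreover have "qm W f m i j = (\<Sum>p\<in>fib W f i \<times> fib W f j. m (fst p) (snd p))"
   using that by (simp add: qm_def sum.cartesian_product split_beta)
  ultimately show "g i j \<le> (\<Sum>p\<in>fib W f i \<times> fib W f j. m (fst p) (snd p))" by linarith
  show "finite (fib W f i \<times> fib W f j)" using fin by blast
  show "\<forall>p\<in>fib W f i \<times> fib W f j. 0 \<le> m (fst p) (snd p)" using mf by blast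
  show "0 \<le> g i j" using F(1) that by blast
 qed
 define H where "H i j = (SOME h. (\<forall>p\<in>fib W f i \<times> fib W f j. 0 \<le> h p \<and> h p \<le> m (fst p) (snd p)) \<and> sum h (fib W f i \<times> fib W f j) = g i j)" for i j
 have H: "(\<forall>p\<in>fib W f i \<times> fib W f j. 0 \<le> H i j p \<and> H i j p \<le> m (fst p) (snd p)) \<and> sum (H i j) (fib W f i \<times> fib W f j) = g i j"
  if ij: "i \<in> f ` W" "j \<in> f ` W" "i \<noteq> j" for i j
  using someI_ex[OF ex[OF that]] unfolding H_def .
 \<comment> \<open>The functions chosen for \<open>(i, j)\<close> and for \<open>(j, i)\<close> are
   unrelated and need not be complementary. An injection into the natural numbers selects one order
   of each pair; the opposite direction is then defined as the complement.\<close>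
 obtain r :: "'b => nat" where r: "inj_on r (f ` W)"
  using finite_imp_inj_to_nat_seg[of "f ` W"] M(1) by auto
 define ox where "ox u t = (if r (f u) < r (f t) then H (f u) (f t) (u, t) else m u t - H (f t) (f u) (t, u))" for u t
 have A: "0 \<le> ox u t \<and> ox u t + ox t u = m u t" if "u \<in> W" "t \<in> W" "f u \<noteq> f t" for u t
 proof -
  have ne: "r (f u) \<noteq> r (f t)" using r that by (auto dest: inj_onD)
  have "0 \<le> H (f u) (f t) (u, t) \<and> H (f u) (f t) (u, t) \<le> m u t"
   "0 \<le> H (f t) (f u) (t, u) \<and> H (f t) (f u) (t, u) \<le> m t u"
   using H[of "f u" "f t"] H[of "f t" "f u"] that by (auto simp: fib_def)
  thus ?thesis using ne M(2)[OF that(1,2)] by (auto simp: ox_def)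
 qed
 have B: "(\<Sum>u\<in>fib W f i. \<Sum>t\<in>fib W f j. ox u t) = g i j" if ij: "i \<in> f ` W" "j \<in> f ` W" "i \<noteq> j" for i j
 proof (cases "r i < r j")
  case True
  hence "(\<Sum>u\<in>fib W f i. \<Sum>t\<in>fib W f j. ox u t) = (\<Sum>u\<in>fib W f i. \<Sum>t\<in>fib W f j. H i j (u, t))"
   by (intro sum.cong refl) (auto simp: ox_def fib_def)
  thus ?thesis using H[OF that] by (simp add: sum.cartesian_product)
 next
  case False
  hence "(\<Sum>u\<in>fib W f i. \<Sum>t\<in>fib W f j. ox u t) = (\<Sum>u\<in>fib W f i. \<Sum>t\<in>fib W f j. m u t - H j i (t, u))"
   by (intro sum.cong refl) (auto simp: ox_def fib_def)
  also have "\<dots> = qm W f m i j - (\<Sum>u\<in>fib W f i. \<Sum>t\<in>fib W f j. H j i (t, u))"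
   using that by (simp add: qm_def sum_subtractf)
  also have "(\<Sum>u\<in>fib W f i. \<Sum>t\<in>fib W f j. H j i (t, u)) = (\<Sum>t\<in>fib W f j. \<Sum>u\<in>fib W f i. H j i (t, u))"
   by (rule sum.swap)
  also have "\<dots> = g j i" using H[of j i] that by (simp add: sum.cartesian_product)
  finally show ?thesis using F(2)[OF that(1,2)] by simp
 qed
 show ?thesis using A B by blast
qed

text \<open>Spreading the quotient flow fixes how many arcs leave and enter each vertex of
  \<open>S\<close>, and thereby the demand \<open>cS\<close> that is left for the inside. The inner
  flow \<open>h\<close> is quantified last so that a separate instance can supply it. In- and
  outflows are recorded because nonuniformity at a vertex has to survive the gluing.\<close>

lemma contract_glue:
 assumes mg: "mg W m" and S: "S \<subseteq> W" "s \<in> S" and f: "f = (\<lambda>u. if u \<in> S then s else u)"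
  and fl: "flow (f ` W) (qm W f m) (qs W f c) g"
 shows "\<exists>xo yo cS. (\<forall>u\<in>S. 0 \<le> xo u \<and> 0 \<le> yo u \<and> xo u + yo u = sum (m u) (W - S) \<and> cS u = c u - xo u + yo u) \<and>
  sum xo S = sum (g s) (f ` W) \<and> sum yo S = (\<Sum>j\<in>f ` W. g j s) \<and> 3 dvd sum cS S \<and>
  (\<forall>h. flow S m cS h \<longrightarrow> (\<exists>F. flow W m c F \<and>
    (\<forall>u\<in>W - S. sum (F u) W = sum (g u) (f ` W) \<and> (\<Sum>t\<in>W. F t u) = (\<Sum>t\<in>f ` W. g t u)) \<and>
    (\<forall>u\<in>S. sum (F u) W = sum (h u) S + xo u \<and> (\<Sum>t\<in>W. F t u) = (\<Sum>t\<in>S. h t u) + yo u)))"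
proof -
 note M = mgD[OF mg] and Fg = flowD[OF fl]
 obtain ox where ox: "\<And>u t. u \<in> W ==> t \<in> W ==> f u \<noteq> f t ==> 0 \<le> ox u t \<and> ox u t + ox t u = m u t"
  and oxs: "\<And>i j. i \<in> f ` W ==> j \<in> f ` W ==> i \<noteq> j ==> (\<Sum>u\<in>fib W f i. \<Sum>t\<in>fib W f j. ox u t) = g i j"
  using spread_flow[OF mg fl] by metis
 have finS: "finite S" "finite (W - S)" using M(1) S finite_subset by blast+
 have fW: "f ` W = insert s (W - S)" using S by (auto simp: f image_iff)
 have fibs: "fib W f s = S" using S by (auto simp: fib_def f)
 have fibu: "fib W f u = {u}" if "u \<in> W - S" for u using that S by (auto simp: fib_def f)
 have sS: "s \<notin> W - S" using S by simp
 have gss: "g s s = 0" using Fg(2)[of s s] fW by (simp add: qm_def)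
 have guu: "g u u = 0" if "u \<in> W - S" for u using Fg(2)[of u u] that fW by (simp add: qm_def)
 have sumfW: "sum h (f ` W) = h s + sum h (W - S)" for h :: "_ => int" unfolding fW using finS sS by simp
 have sumW: "sum h W = sum h S + sum h (W - S)" for h :: "_ => int"
  using sum.subset_diff[OF S(1) M(1), of h] by simp
 have e1: "(\<Sum>t\<in>S. ox t u) = g s u" "sum (ox u) S = g u s" if "u \<in> W - S" for u
  using oxs[of s u] oxs[of u s] fibu[OF that] fibs that fW sS by auto
 have e2: "ox u t = g u t" if "u \<in> W - S" "t \<in> W - S" "u \<noteq> t" for u t
  using oxs[of u t] fibu[OF that(1)] fibu[OF that(2)] that fW by auto
 define xo where "xo u = sum (ox u) (W - S)" for u
 define yo where "yo u = (\<Sum>t\<in>W - S. ox t u)" for u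
 define cS where "cS u = c u - xo u + yo u" for u
 have ff: "f u \<noteq> f t" if "u \<in> S" "t \<in> W - S" for u t using that S f by auto
 have P1: "0 \<le> xo u \<and> 0 \<le> yo u \<and> xo u + yo u = sum (m u) (W - S)" if "u \<in> S" for u
 proof (intro conjI)
  show "0 \<le> xo u" unfolding xo_def by (rule sum_nonneg) (use ox[of u] ff that S in blast)
  show "0 \<le> yo u" unfolding yo_def by (rule sum_nonneg) (use ox[of _ u] ff that S in fastforce)
  show "xo u + yo u = sum (m u) (W - S)" unfolding xo_def yo_def sum.distrib[symmetric]
   by (rule sum.cong) (use ox[of u] ff that S in blast)+
 qed
 have P2: "sum xo S = sum (g s) (f ` W)"
  unfolding xo_def by (subst sum.swap) (simp add: e1 sumfW gss)
 have P3: "sum yo S = (\<Sum>j\<in>f ` W. g j s)"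
  unfolding yo_def by (subst sum.swap) (simp add: e1 sumfW gss)
 \<comment> \<open>The quotient flow meets the demand of the contracted vertex, which makes the
   inner demands sum to zero modulo 3.\<close>
 have "3 dvd (\<Sum>t\<in>f ` W. g s t - g t s) - sum c S" using Fg(3)[of s] fW fibs by (simp add: qs_def)
 moreover have "sum cS S = sum c S - (\<Sum>t\<in>f ` W. g s t - g t s)"
  unfolding cS_def using P2 P3 by (simp add: sum.distrib sum_subtractf)
 ultimately have P4: "3 dvd sum cS S" by presburger
 have P5: "\<exists>F. flow W m c F \<and>
    (\<forall>u\<in>W - S. sum (F u) W = sum (g u) (f ` W) \<and> (\<Sum>t\<in>W. F t u) = (\<Sum>t\<in>f ` W. g t u)) \<and>
    (\<forall>u\<in>S. sum (F u) W = sum (h u) S + xo u \<and> (\<Sum>t\<in>W. F t u) = (\<Sum>t\<in>S. h t u) + yo u)"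
  if h: "flow S m cS h" for h
 proof -
  note Fh = flowD[OF h]
  define F where "F u t = (if u \<in> S \<and> t \<in> S then h u t else if u = t then 0 else ox u t)" for u t
  have s1: "sum (F u) W = sum (g u) (f ` W) \<and> (\<Sum>t\<in>W. F t u) = (\<Sum>t\<in>f ` W. g t u)" if u: "u \<in> W - S" for u
  proof -
   have "sum (F u) S = g u s" "(\<Sum>t\<in>S. F t u) = g s u"
    unfolding e1[OF u, symmetric] by (rule sum.cong; use u in \<open>auto simp: F_def\<close>)+
   moreover have "sum (F u) (W - S) = sum (g u) (W - S)" "(\<Sum>t\<in>W - S. F t u) = (\<Sum>t\<in>W - S. g t u)"
    by (rule sum.cong; use u e2[of u] e2[of _ u] guu in \<open>auto simp: F_def\<close>)+
   ultimately show ?thesis by (simp add: sumW sumfW)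
  qed
  have s2: "sum (F u) W = sum (h u) S + xo u \<and> (\<Sum>t\<in>W. F t u) = (\<Sum>t\<in>S. h t u) + yo u" if u: "u \<in> S" for u
  proof -
   have "sum (F u) S = sum (h u) S" "(\<Sum>t\<in>S. F t u) = (\<Sum>t\<in>S. h t u)"
    by (rule sum.cong; use u in \<open>auto simp: F_def\<close>)+
   moreover have "sum (F u) (W - S) = xo u" "(\<Sum>t\<in>W - S. F t u) = yo u"
    unfolding xo_def yo_def by (rule sum.cong; use u in \<open>auto simp: F_def\<close>)+
   ultimately show ?thesis by (simp add: sumW)
  qed
  have "flow W m c F"
   unfolding flow_def
  proof (intro conjI ballI)
   fix u t assume ut: "u \<in> W" "t \<in> W"
   have 1: "0 \<le> ox u t \<and> ox u t + ox t u = m u t" if "\<not> (u \<in> S \<and> t \<in> S)" "u \<noteq> t"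
   proof -
    have "f u \<noteq> f t" using that S(2) unfolding f by metis
    thus ?thesis using ox[OF ut] by blast
   qed
   show "0 \<le> F u t" using Fh(1)[of u t] 1 by (auto simp: F_def)
   show "F u t + F t u = m u t" using Fh(2)[of u t] 1 M(4)[OF ut(1)] by (auto simp: F_def)
  next
   fix u assume u: "u \<in> W"
   show "3 dvd (\<Sum>t\<in>W. F u t - F t u) - c u"
   proof (cases "u \<in> S")
    case True
    have "(\<Sum>t\<in>W. F u t - F t u) - c u = (\<Sum>t\<in>S. h u t - h t u) - cS u"
     using s2[OF True] by (simp add: sum_subtractf cS_def)
    thus ?thesis using Fh(3)[OF True] by simp
   next
    case False
    hence us: "u \<in> W - S" using u by simp
    have "(\<Sum>t\<in>W. F u t - F t u) = (\<Sum>t\<in>f ` W. g u t - g t u)" using s1[OF us] by (simp add: sum_subtractf)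
    thus ?thesis using Fg(3)[of u] us fW by (simp add: qs_def fibu[OF us])
   qed
  qed
  thus ?thesis using s1 s2 by blast
 qed
 have Q: "\<forall>u\<in>S. 0 \<le> xo u \<and> 0 \<le> yo u \<and> xo u + yo u = sum (m u) (W - S) \<and> cS u = c u - xo u + yo u"
  using P1 cS_def by blast
 show ?thesis
  apply (rule exI[of _ xo], rule exI[of _ yo], rule exI[of _ cS])
  apply (intro conjI)
    apply (rule Q)
    apply (rule P2)
   apply (rule P3)
   apply (rule P4)
  apply (intro allI impI)
  apply (rule P5)
  apply assumption
  done
qed

lemma contract_dims:
 assumes mg: "mg W m" and S: "S \<subseteq> W" "s \<in> S" and f: "f = (\<lambda>u. if u \<in> S then s else u)"
 shows "f ` W = insert s (W - S)" "card (f ` W) = card W - card S + 1" "card S \<le> card W"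
  "mass (f ` W) (qm W f m) \<le> mass W m"
  "\<And>B. B \<subseteq> f ` W ==> {u\<in>W. f u \<in> B} = (if s \<in> B then (B - {s}) \<union> S else B)"
proof -
 note M = mgD[OF mg]
 show fW: "f ` W = insert s (W - S)" using S by (auto simp: f image_iff)
 show "card S \<le> card W" using S M(1) by (simp add: card_mono)
 have "finite S" using M(1) S finite_subset by blast
 thus "card (f ` W) = card W - card S + 1" unfolding fW using S M(1) by (simp add: card_Diff_subset)
 show "{u\<in>W. f u \<in> B} = (if s \<in> B then (B - {s}) \<union> S else B)" if "B \<subseteq> f ` W" for B
  using that S unfolding fW by (auto simp: f)
 have q: "qm W f m a t \<le> (\<Sum>u\<in>fib W f a. \<Sum>v\<in>fib W f t. m u v)" for a t
  unfolding qm_def using M(3) by (auto intro!: sum_nonneg simp: fib_def)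
 have "mass (f ` W) (qm W f m) \<le> (\<Sum>a\<in>f ` W. \<Sum>t\<in>f ` W. \<Sum>u\<in>fib W f a. \<Sum>v\<in>fib W f t. m u v)"
  by (intro sum_mono q)
 also have "\<dots> = (\<Sum>a\<in>f ` W. \<Sum>u\<in>fib W f a. \<Sum>t\<in>f ` W. \<Sum>v\<in>fib W f t. m u v)"
  by (intro sum.cong refl sum.swap)
 also have "\<dots> = (\<Sum>a\<in>f ` W. \<Sum>u\<in>fib W f a. \<Sum>v\<in>W. m u v)"
  by (subst sum_fib[OF M(1)]) (auto intro!: sum.cong)
 also have "\<dots> = mass W m"
  by (subst sum_fib[OF M(1)]) (auto intro!: sum.cong)
 finally show "mass (f ` W) (qm W f m) \<le> mass W m" .
qed

section \<open>Instances of the extension problem, their restrictions and their quotients\<close>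

text \<open>Here \<open>x u\<close> arcs lead from \<open>u\<close> to the tip, \<open>y u\<close> arcs lead from the tip to \<open>u\<close>, and \<open>c u\<close> is the net outflow mod 3
 that remains for the other edges at \<open>u\<close>, so that the boundary is \<open>c u + x u - y u\<close>.\<close>

abbreviation bs :: "('a => int) => ('a => int) => ('a => int) => 'a set => int" where
 "bs c x y A \<equiv> (\<Sum>u\<in>A. c u + x u - y u)"

abbreviation es :: "('a => int) => ('a => int) => 'a => int" where
 "es x y \<equiv> (\<lambda>u. x u + y u)"

text \<open>Tip arcs influence flows only through \<open>c\<close>. A reduction that deletes or
  exchanges tip arcs and keeps \<open>c\<close> therefore has nothing to undo.\<close>

definition ext :: "'a set => ('a => 'a => int) => ('a => int) => bool" where
 "ext W m c \<longleftrightarrow> (\<exists>f. flow W m c f)"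

text \<open>The set \<open>F\<close> contains at most one vertex, which instead of \<open>tm\<close> only has to have degree at least \<open>k\<close>.\<close>

definition good :: "'a set => int => 'a set => ('a => 'a => int) => ('a => int) => ('a => int) => ('a => int) => bool" where
 "good F k W m c x y \<longleftrightarrow> mg W m \<and> (\<forall>u\<in>W. 0 \<le> x u \<and> 0 \<le> y u) \<and> 3 dvd sum c W \<and>
  (\<forall>A. A \<noteq> {} \<and> A \<subset> W \<longrightarrow> (A \<inter> F = {} \<longrightarrow> tm (dg W m (es x y) A) (bs c x y A)) \<and>
    (A \<inter> F \<noteq> {} \<longrightarrow> k \<le> dg W m (es x y) A))"

text \<open>The set \<open>W\<close> of all other vertices has the degree of the tip and the
  opposite boundary, and \<open>st\<close> is insensitive to the sign. So the first alternative says
  that the tip has degree less than 6 plus the absolute value of its parameter.\<close>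

definition tipok :: "'a set => int => 'a set => ('a => int) => ('a => int) => ('a => int) => bool" where
 "tipok F k W c x y \<longleftrightarrow> F = {} \<and> \<not> st (sum (es x y) W) (bs c x y W) \<or>
   (\<exists>v\<in>W. F = {v}) \<and> sum (es x y) W \<le> k + 1"

text \<open>\<open>mass\<close> counts every edge twice, so an edge weighs four and a tip edge one.
  Deleting an edge can then pay for up to three new tip edges, and turning an edge into a tip edge
  lowers the volume.\<close>

definition vol :: "'a set => ('a => 'a => int) => ('a => int) => ('a => int) => int" where
 "vol W m x y = int (card W) + 2 * mass W m + sum (es x y) W"

text \<open>The instance on \<open>S\<close> with everything else merged into the tip. How its tip
  edges divide into \<open>xS\<close> and \<open>yS\<close> is left open; degrees and boundaries,
  which decide goodness, are the same for every division.\<close>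

definition rinst :: "'a set => ('a => 'a => int) => ('a => int) => ('a => int) => ('a => int) =>
  'a set => ('a => int) => ('a => int) => ('a => int) => bool" where
 "rinst W m c x y S cS xS yS \<longleftrightarrow> 3 dvd sum cS S \<and>
  (\<forall>u\<in>S. 0 \<le> xS u \<and> 0 \<le> yS u \<and> xS u + yS u = x u + y u + sum (m u) (W - S) \<and>
    cS u + xS u - yS u = c u + x u - y u)"

lemma goodD:
 assumes "good F k W m c x y"
 shows "mg W m" "\<And>u. u \<in> W ==> 0 \<le> x u" "\<And>u. u \<in> W ==> 0 \<le> y u" "3 dvd sum c W"
  "\<And>A. A \<noteq> {} ==> A \<subset> W ==> A \<inter> F = {} ==> tm (dg W m (es x y) A) (bs c x y A)"
  "\<And>A. A \<noteq> {} ==> A \<subset> W ==> A \<inter> F \<noteq> {} ==> k \<le> dg W m (es x y) A"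
 using assms unfolding good_def by auto

lemma vol_nonneg:
 assumes "mg W m" "\<forall>u\<in>W. 0 \<le> x u \<and> 0 \<le> y u"
 shows "0 \<le> vol W m x y"
 unfolding vol_def using assms mgD[OF assms(1)] by (auto intro!: add_nonneg_nonneg sum_nonneg)

lemma rinst_dg:
 assumes "finite W" "S \<subseteq> W" "rinst W m c x y S cS xS yS" "A \<subseteq> S"
 shows "dg S m (es xS yS) A = dg W m (es x y) A" "bs cS xS yS A = bs c x y A"
proof -
 show "dg S m (es xS yS) A = dg W m (es x y) A"
  by (rule dg_restrict) (use assms in \<open>auto simp: rinst_def\<close>)
 show "bs cS xS yS A = bs c x y A" using assms by (intro sum.cong) (auto simp: rinst_def)
qed

lemma rinst_good:
 assumes "good F k W m c x y" "S \<subset> W" "rinst W m c x y S cS xS yS"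
  and "\<And>A. A \<noteq> {} ==> A \<subset> S ==> A \<inter> F' = {} ==> tm (dg W m (es x y) A) (bs c x y A)"
  and "\<And>A. A \<noteq> {} ==> A \<subset> S ==> A \<inter> F' \<noteq> {} ==> k' \<le> dg W m (es x y) A"
 shows "good F' k' S m cS xS yS"
proof -
 note G = goodD[OF assms(1)]
 have fin: "finite W" using mgD[OF G(1)] by auto
 have sub: "S \<subseteq> W" using assms(2) by auto
 show ?thesis unfolding good_def
  using mg_subset[OF G(1) sub] assms(3-5) rinst_dg[OF fin sub assms(3)]
  by (auto simp: rinst_def psubset_imp_subset)
qed

lemma rinst_vol:
 assumes g: "good F k W m c x y" and S: "S \<subset> W" and r: "rinst W m c x y S cS xS yS"
 shows "vol S m xS yS < vol W m x y"
proof -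
 note G = goodD[OF g] and M = mgD[OF goodD(1)[OF g]]
 have fS: "finite S" "finite (W - S)" using M(1) S finite_subset by blast+
 have c: "card S < card W" using M(1) S by (simp add: psubset_card_mono)
 have spl: "sum h W = sum h S + sum h (W - S)" for h :: "_ => int"
  using sum.subset_diff[of S W h] S M(1) by auto
 have e: "sum (es xS yS) S = sum (es x y) S + (\<Sum>u\<in>S. \<Sum>t\<in>W - S. m u t)"
  unfolding sum.distrib[symmetric] using r by (intro sum.cong) (auto simp: rinst_def)
 have "mass W m = mass S m + (\<Sum>u\<in>S. \<Sum>t\<in>W - S. m u t) + (\<Sum>a\<in>W - S. \<Sum>t\<in>W. m a t)"
  by (subst spl) (simp add: spl sum.distrib)
 moreover have "0 \<le> (\<Sum>u\<in>S. \<Sum>t\<in>W - S. m u t)" "0 \<le> (\<Sum>a\<in>W - S. \<Sum>t\<in>W. m a t)" "0 \<le> sum (es x y) (W - S)"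
  using M(3) G(2,3) S by (auto intro!: sum_nonneg add_nonneg_nonneg)
 ultimately show ?thesis unfolding vol_def e using c spl[of "es x y"] by linarith
qed

text \<open>An exceptional vertex inside \<open>S\<close> has to be the representative
  \<open>s\<close>, so that the merged vertex inherits its degree condition.\<close>

lemma quot_good:
 assumes g: "good F k W m c x y" and S: "S \<subseteq> W" "s \<in> S" and f: "f = (\<lambda>u. if u \<in> S then s else u)"
  and F: "F \<inter> S \<subseteq> {s}" "s \<in> F \<or> F \<inter> S = {}"
 shows "good F k (f ` W) (qm W f m) (qs W f c) (qs W f x) (qs W f y)"
  "sum (es (qs W f x) (qs W f y)) (f ` W) = sum (es x y) W"
  "bs (qs W f c) (qs W f x) (qs W f y) (f ` W) = bs c x y W"
proof -
 note G = goodD[OF g] and M = mgD[OF goodD(1)[OF g]]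
 note D = contract_dims[OF G(1) S f]
 have e: "es (qs W f x) (qs W f y) = qs W f (es x y)" by (simp add: fun_eq_iff qs_def sum.distrib)
 have b: "(\<lambda>u. qs W f c u + qs W f x u - qs W f y u) = qs W f (\<lambda>u. c u + x u - y u)"
  by (simp add: fun_eq_iff qs_def sum.distrib sum_subtractf)
 show "sum (es (qs W f x) (qs W f y)) (f ` W) = sum (es x y) W" unfolding e by (rule sum_qs_all[OF M(1)])
 show "bs (qs W f c) (qs W f x) (qs W f y) (f ` W) = bs c x y W" unfolding b by (rule sum_qs_all[OF M(1)])
 show "good F k (f ` W) (qm W f m) (qs W f c) (qs W f x) (qs W f y)"
  unfolding good_def
 proof (intro conjI allI impI ballI)
  show "mg (f ` W) (qm W f m)" by (rule mg_qm[OF G(1)])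
  show "0 \<le> qs W f x u" "0 \<le> qs W f y u" for u
   unfolding qs_def using G(2,3) by (auto intro!: sum_nonneg simp: fib_def)
  show "3 dvd sum (qs W f c) (f ` W)" unfolding sum_qs_all[OF M(1)] by (rule G(4))
 next
  fix B assume B: "B \<noteq> {} \<and> B \<subset> f ` W"
  hence Bs: "B \<subseteq> f ` W" by auto
  have P: "{u\<in>W. f u \<in> B} \<noteq> {}" "{u\<in>W. f u \<in> B} \<subset> W" using B by auto
  have I: "{u\<in>W. f u \<in> B} \<inter> F = {} \<longleftrightarrow> B \<inter> F = {}"
   unfolding D(5)[OF Bs] using F S B D(1) by (auto split: if_splits)
  show "tm (dg (f ` W) (qm W f m) (es (qs W f x) (qs W f y)) B) (bs (qs W f c) (qs W f x) (qs W f y) B)" if "B \<inter> F = {}"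
   unfolding e b qdg[OF M(1) Bs] sum_qs[OF M(1) Bs] using G(5)[OF P] I that by auto
  show "k \<le> dg (f ` W) (qm W f m) (es (qs W f x) (qs W f y)) B" if "B \<inter> F \<noteq> {}"
   unfolding e qdg[OF M(1) Bs] using G(6)[OF P] I that by auto
 qed
qed

lemma quot_vol:
 assumes g: "good F k W m c x y" and S: "S \<subseteq> W" "s \<in> S" "2 \<le> card S" and f: "f = (\<lambda>u. if u \<in> S then s else u)"
 shows "vol (f ` W) (qm W f m) (qs W f x) (qs W f y) < vol W m x y"
proof -
 note D = contract_dims[OF goodD(1)[OF g] S(1,2) f]
 have "sum (es (qs W f x) (qs W f y)) (f ` W) = sum (es x y) W"
  using sum_qs_all[OF mgD(1)[OF goodD(1)[OF g]], of f "es x y"] by (simp add: qs_def sum.distrib)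
 moreover have "int (card (f ` W)) < int (card W)" using D(2,3) S(3) by linarith
 ultimately show ?thesis unfolding vol_def using D(4) by linarith
qed

text \<open>With at least two edges available, 0, 1 or 2 of them can be directed from
  \<open>u\<close> to \<open>w\<close>, and these choices produce all net outflows modulo 3.\<close>

lemma two_ext:
 assumes mg: "mg {u, w} m" and "u \<noteq> w" "2 \<le> m u w" "3 dvd c u + c w"
 shows "ext {u, w} m c"
proof -
 note M = mgD[OF mg]
 \<comment> \<open>2 is its own inverse modulo 3, so this solves \<open>2 * j = c u + m u w\<close>
   modulo 3.\<close>
 define j where "j = (2 * (c u + m u w)) mod 3"
 have j: "0 \<le> j" "j \<le> m u w" "3 dvd 2 * j - m u w - c u" using assms(3) unfolding j_def by presburger+
 define f where "f a b = (if a = u \<and> b = w then j else if a = w \<and> b = u then m u w - j else 0)" for a b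
 have "3 dvd (m u w - 2 * j) - c w" using j(3) assms(4) by presburger
 hence "flow {u, w} m c f" unfolding flow_def f_def using assms(2) j M(2)[of u w] M(4) by (auto simp: algebra_simps)
 thus ?thesis by (auto simp: ext_def)
qed

section \<open>Reversal of all arcs, and a minimal counterexample to tip extension\<close>

lemma ext_mirror: "ext W m (\<lambda>u. - c u) ==> ext W m c"
 unfolding ext_def flow_def
 apply (elim exE)
 subgoal for f
  apply (rule exI[of _ "\<lambda>u t. f t u"])
  apply (auto simp: add.commute sum_subtractf)
  apply (drule (1) bspec)+
  apply presburger
  done
 done

lemma es_comm: "es y x = es x y" by (simp add: fun_eq_iff)

lemma bs_neg: "bs (\<lambda>u. - c u) y x A = - bs c x y A"
 by (simp add: sum_negf[symmetric] algebra_simps)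

lemma tm_neg: "tm n (- b) = tm n b" by (simp add: tm_def)
lemma st_neg: "st n (- b) = st n b" by (simp add: st_def)

lemma good_mirror: "good F k W m c x y ==> good F k W m (\<lambda>u. - c u) y x"
 unfolding good_def bs_neg tm_neg es_comm[of y x] by (simp add: sum_negf)

lemma tipok_mirror: "tipok F k W c x y ==> tipok F k W (\<lambda>u. - c u) y x"
 unfolding tipok_def bs_neg st_neg es_comm[of y x] .

lemma vol_mirror: "vol W m y x = vol W m x y"
 unfolding vol_def es_comm[of y x] ..

lemma vol_arith: "j \<le> 3 ==> a + 2 * (s + 2 * - 1) + (e + j) < a + 2 * s + (e :: int)"
 by simp

text \<open>The induction hypothesis ranges over every exceptional set and every \<open>k\<close>,
  because the reductions introduce, move and drop the exceptional vertex and lower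
  \<open>k\<close>.\<close>

locale mincx =
 fixes F :: "'a set" and k :: int and W :: "'a set" and m :: "'a => 'a => int" and c x y :: "'a => int"
 assumes g: "good F k W m c x y" and tip: "tipok F k W c x y"
  and IH: "\<And>(F' :: 'a set) k' W' m' c' x' y'. good F' k' W' m' c' x' y' ==> tipok F' k' W' c' x' y' ==>
   vol W' m' x' y' < vol W m x y ==> ext W' m' c'"
  and nx: "\<not> ext W m c"
begin

abbreviation D :: "'a set => int" where "D A \<equiv> dg W m (es x y) A"
abbreviation B :: "'a set => int" where "B A \<equiv> bs c x y A"
abbreviation d :: int where "d \<equiv> sum (es x y) W"

lemmas G = goodD[OF g]
lemmas M = mgD[OF goodD(1)[OF g]]

text \<open>Reversing all arcs negates the demands and exchanges \<open>x\<close> and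
  \<open>y\<close>. Every argument about outgoing arcs thus has its counterpart for incoming
  arcs.\<close>

lemma mirror: "mincx F k W m (\<lambda>u. - c u) y x"
proof
 show "good F k W m (\<lambda>u. - c u) y x" by (rule good_mirror[OF g])
 show "tipok F k W (\<lambda>u. - c u) y x" by (rule tipok_mirror[OF tip])
 show "\<not> ext W m (\<lambda>u. - c u)" using nx ext_mirror by blast
 show "\<And>(F' :: 'a set) k' W' m' c' x' y'. good F' k' W' m' c' x' y' ==> tipok F' k' W' c' x' y' ==>
   vol W' m' x' y' < vol W m y x ==> ext W' m' c'" unfolding vol_mirror[of W m y x] by (rule IH)
qed

lemma Fcases: "F = {} \<or> (\<exists>v\<in>W. F = {v})" using tip unfolding tipok_def by auto

text \<open>Contracting \<open>S\<close> gives a smaller instance. Its flow leaves an instance on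
  \<open>S\<close> to be filled in, and if that always succeeds the counterexample has a
  flow.\<close>

lemma contr:
 assumes S: "S \<subset> W" "2 \<le> card S" and R: "\<And>cS xS yS. rinst W m c x y S cS xS yS ==> ext S m cS"
 shows False
proof -
 have Sn: "S \<subseteq> W" "S \<noteq> {}" using S by auto
 obtain s where s: "s \<in> S" "F \<inter> S \<subseteq> {s}" "s \<in> F \<or> F \<inter> S = {}"
  using Fcases Sn by (cases "F \<inter> S = {}") blast+
 define f where "f = (\<lambda>u. if u \<in> S then s else u)"
 note Q = quot_good[OF g Sn(1) s(1) f_def s(2,3)]
 have "tipok F k (f ` W) (qs W f c) (qs W f x) (qs W f y)"
 proof (cases "F = {}")
  case True thus ?thesis using tip Q(2,3) by (auto simp: tipok_def)
 next
  case False
  then obtain v where v: "v \<in> W" "F = {v}" "d \<le> k + 1" using tip by (auto simp: tipok_def)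
  have "v \<in> f ` W" using v s contract_dims(1)[OF G(1) Sn(1) s(1) f_def] by auto
  thus ?thesis using v Q(2) by (auto simp: tipok_def)
 qed
 then obtain h where h: "flow (f ` W) (qm W f m) (qs W f c) h"
  using IH[OF Q(1)] quot_vol[OF g Sn(1) s(1) S(2) f_def] unfolding ext_def by blast
 obtain xo yo cS where o: "\<forall>u\<in>S. 0 \<le> xo u \<and> 0 \<le> yo u \<and> xo u + yo u = sum (m u) (W - S) \<and> cS u = c u - xo u + yo u"
  "3 dvd sum cS S" "\<And>h. flow S m cS h ==> \<exists>F. flow W m c F"
  using contract_glue[OF G(1) Sn(1) s(1) f_def h] by blast
 have "rinst W m c x y S cS (\<lambda>u. x u + xo u) (\<lambda>u. y u + yo u)"
  unfolding rinst_def using o G(2,3) Sn by auto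
 thus False using R o(3) nx unfolding ext_def by blast
qed

text \<open>If the bound fails, the restriction to \<open>S\<close> satisfies the tip condition and
  has smaller volume, so it can be filled in after contracting \<open>S\<close>.\<close>

lemma strong:
 assumes S: "S \<subset> W" "2 \<le> card S"
 shows "S \<inter> F = {} ==> st (D S) (B S)" "S \<inter> F \<noteq> {} ==> k + 2 \<le> D S"
proof -
 have Sn: "S \<subseteq> W" "finite W" using S M(1) by auto
 have tipS: "sum (es xS yS) S = D S" "bs cS xS yS S = B S" if r: "rinst W m c x y S cS xS yS" for cS xS yS
  using rinst_dg[OF Sn(2,1) r, of S] by (auto simp: dg_all)
 show "st (D S) (B S)" if "S \<inter> F = {}"
 proof (rule ccontr)
  assume n: "\<not> st (D S) (B S)"
  show False
  proof (rule contr[OF S])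
   fix cS xS yS assume r: "rinst W m c x y S cS xS yS"
   have "good {} 0 S m cS xS yS" by (rule rinst_good[OF g S(1) r]; (rule G(5))?; use S that in auto)
   moreover have "tipok {} 0 S cS xS yS" using n tipS[OF r] by (simp add: tipok_def)
   ultimately show "ext S m cS" using IH rinst_vol[OF g S(1) r] by blast
  qed
 qed
 show "k + 2 \<le> D S" if "S \<inter> F \<noteq> {}"
 proof (rule ccontr)
  assume n: "\<not> k + 2 \<le> D S"
  show False
  proof (rule contr[OF S])
   fix cS xS yS assume r: "rinst W m c x y S cS xS yS"
   have "good F k S m cS xS yS" by (rule rinst_good[OF g S(1) r]; (rule G(5) | rule G(6)); use S that in auto)
   moreover have "tipok F k S cS xS yS" using n tipS[OF r] Fcases that by (auto simp: tipok_def)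
   ultimately show "ext S m cS" using IH rinst_vol[OF g S(1) r] by blast
  qed
 qed
qed

text \<open>By \<open>two_ext\<close> a pair joined twice can be filled in for every demand,
  whatever its degree.\<close>

lemma simple:
 assumes "u \<in> W" "t \<in> W"
 shows "m u t \<le> 1"
proof (rule ccontr)
 assume n: "\<not> m u t \<le> 1"
 hence ne: "u \<noteq> t" using M(4) assms by auto
 have E: "ext {u, t} m c'" if "3 dvd sum c' {u, t}" for c'
  by (rule two_ext) (use n ne assms that mg_subset[OF G(1), of "{u, t}"] in auto)
 show False
 proof (cases "W = {u, t}")
  case True thus False using E[of c] G(4) nx by simp
 next
  case False
  show False
   by (rule contr[of "{u, t}"]) (use False assms ne E in \<open>auto simp: rinst_def\<close>)
 qed
qed

lemma D_insert: "A \<subseteq> W ==> w \<in> W ==> w \<notin> A ==> D (insert w A) = D A + D {w} - 2 * sum (m w) A"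
 by (rule dg_insert[OF G(1)])

text \<open>Two vertices joined at most once leave the tip at least the sum of their degrees minus
  two. Two bounds \<open>tm\<close> add up to \<open>st\<close> in this way, with 4 + 4 - 2 = 6 as
  the tight case, and with an exceptional vertex \<open>k + 4 - 2\<close> exceeds
  \<open>k + 1\<close>.\<close>

lemma card3: "3 \<le> card W"
proof (rule ccontr)
 assume n: "\<not> 3 \<le> card W"
 consider "W = {}" | u where "W = {u}" | u w where "W = {u, w}" "u \<noteq> w"
  using n M(1) by (metis One_nat_def card_0_eq card_1_singletonE card_2_iff le_SucE less_Suc_eq_le not_le numeral_2_eq_2 numeral_3_eq_3 le_zero_eq)
 thus False
 proof cases
  case 1 thus False using nx by (auto simp: ext_def flow_def)
 next
  case 2
  thus False using nx G(4) M(4)[of u] by (auto simp: ext_def flow_def intro!: exI[of _ "\<lambda>_ _. 0"])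
 next
  case 3
  have dW: "d = D {u} + D {w} - 2 * m u w"
   using D_insert[of "{w}" u] 3 dg_all[of W m "es x y"] by simp
  have mb: "0 \<le> m u w" "m u w \<le> 1" using simple M(3) 3 by auto
  have B2: "B W = B {u} + B {w}" using 3 by simp
  show False
  proof (cases "F = {}")
   case True
   have "tm (D {u}) (B {u})" "tm (D {w}) (B {w})" by (rule G(5); use True 3 in auto)+
   moreover have "\<not> st d (B W)" using tip True by (auto simp: tipok_def)
   moreover have "m u w = 0 \<or> m u w = 1" using mb by auto
   ultimately show False unfolding dW B2 tm_def st_def by presburger
  next
   case False
   then obtain v where v: "v \<in> W" "F = {v}" "d \<le> k + 1" using tip by (auto simp: tipok_def)
   obtain w' where w': "w' \<in> W" "w' \<noteq> v" "D {v} + D {w'} = D {u} + D {w}" using 3 v(1) by fastforce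
   have "k \<le> D {v}" by (rule G(6)) (use v w' in auto)
   moreover have "4 \<le> D {w'}" by (rule tm_ge4, rule G(5)) (use v w' in auto)
   ultimately show False using v(3) dW mb w'(3) by linarith
  qed
 qed
qed

lemma card2: "A \<noteq> {} ==> A \<subseteq> W ==> (\<exists>a. A = {a}) \<or> 2 \<le> card A"
proof -
 assume A: "A \<noteq> {}" "A \<subseteq> W"
 hence "finite A" using M(1) finite_subset by blast
 hence "card A \<noteq> 0" using A by simp
 thus ?thesis by (metis One_nat_def Suc_1 card_1_singletonE le_SucE not_less_eq_eq le_zero_eq)
qed

text \<open>Deletion of an edge directed from \<open>u\<close> to \<open>w\<close>, while the arcs between \<open>u\<close> and the tip are
 exchanged for \<open>p\<close> arcs towards and \<open>q\<close> arcs from the tip.\<close>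

lemma delete_edge_change_tip:
 assumes uw: "u \<in> W" "w \<in> W" "u \<noteq> w" "u \<notin> F" "w \<notin> F" "1 \<le> m u w"
  and pq: "0 \<le> p" "0 \<le> q" "0 \<le> p + q - (x u + y u)" "p + q - (x u + y u) \<le> 3"
  and tu: "tm (D {u} + (p + q - (x u + y u)) - 1) (B {u} + (p - q - (x u - y u)) - 1)"
  and tw: "tm (D {w} - 1) (B {w} + 1)"
  and side: "1 \<le> p + q - (x u + y u) \<or> p - q = x u - y u \<or> (\<forall>A\<subseteq>W - F. 2 \<le> card A \<longrightarrow> 8 \<le> D A)"
  and tip': "F = {} ==> \<not> st (d + (p + q - (x u + y u))) (B W + (p - q - (x u - y u)))"
   "F \<noteq> {} ==> d + (p + q - (x u + y u)) \<le> k + 1"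
 shows False
proof -
 define j where "j = p + q - (x u + y u)"
 define \<kappa> where "\<kappa> = p - q - (x u - y u)"
 let ?m = "madd m u w (- 1)" and ?c = "c(u := c u - 1, w := c w + 1)" and ?x = "x(u := p)" and ?y = "y(u := q)"
 have fA: "finite A" if "A \<subseteq> W" for A using that M(1) finite_subset by blast
 have e: "(\<Sum>a\<in>A. es ?x ?y a - es x y a) = (if u \<in> A then j else 0)" if "A \<subseteq> W" for A
 proof -
  have "(\<Sum>a\<in>A. es ?x ?y a - es x y a) = (\<Sum>a\<in>A. if a = u then j else 0)"
   by (rule sum.cong) (auto simp: j_def)
  thus ?thesis using fA[OF that] by simp
 qed
 have dA: "dg W ?m (es ?x ?y) A = D A + (if u \<in> A then j else 0) - (if (u \<in> A) \<noteq> (w \<in> A) then 1 else 0)" if "A \<subseteq> W" for A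
  using dg_madd[OF M(1) that uw(1-3), of m "- 1" "es ?x ?y"] dg_tips[of W m "es ?x ?y" A "es x y"] e[OF that] by auto
 have bA: "bs ?c ?x ?y A = B A + (if u \<in> A then \<kappa> - 1 else 0) + (if w \<in> A then 1 else 0)" if "A \<subseteq> W" for A
 proof -
  have "bs ?c ?x ?y A = (\<Sum>a\<in>A. (c a + x a - y a) + ((if a = u then \<kappa> - 1 else 0) + (if a = w then 1 else 0)))"
   by (rule sum.cong) (use uw(3) in \<open>auto simp: \<kappa>_def\<close>)
  thus ?thesis using fA[OF that] by (simp add: sum.distrib)
 qed
 have cW: "sum ?c W = sum c W"
 proof -
  have "sum ?c W = (\<Sum>a\<in>W. c a + ((if a = u then - 1 else 0) + (if a = w then 1 else 0)))"
   by (rule sum.cong) (use uw(3) in auto)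
  thus ?thesis using M(1) uw by (simp add: sum.distrib)
 qed
 have eW: "sum (es ?x ?y) W = d + j" using e[of W] uw(1) by (simp add: sum_subtractf)
 have bW: "bs ?c ?x ?y W = B W + \<kappa>" using bA[of W] uw by simp
 have "good F k W ?m ?c ?x ?y"
  unfolding good_def
 proof (intro conjI allI impI ballI)
  show "mg W ?m" by (rule mg_madd[OF G(1) uw(3)]) (use uw M(2)[of u w] in auto)
  show "0 \<le> ?x a" "0 \<le> ?y a" if "a \<in> W" for a using G(2,3)[OF that] pq by auto
  show "3 dvd sum ?c W" unfolding cW by (rule G(4))
 next
  fix A assume A: "A \<noteq> {} \<and> A \<subset> W"
  hence As: "A \<subseteq> W" by auto
  have j0: "0 \<le> j" using pq by (simp add: j_def)
  show "k \<le> dg W ?m (es ?x ?y) A" if AF: "A \<inter> F \<noteq> {}"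
  proof (cases "2 \<le> card A")
   case True
   thus ?thesis unfolding dA[OF As] using strong(2)[of A] A AF j0 by auto
  next
   case False
   then obtain a where "A = {a}" using card2 A As by blast
   hence "a \<in> F" "A = {a}" using AF by auto
   thus ?thesis unfolding dA[OF As] using G(6)[of A] A AF uw by auto
  qed
  show "tm (dg W ?m (es ?x ?y) A) (bs ?c ?x ?y A)" if AF: "A \<inter> F = {}"
  proof (cases "2 \<le> card A")
   case True
   hence s: "st (D A) (B A)" using strong(1)[of A] A AF by auto
   hence D6: "6 \<le> D A" by (auto simp: st_def)
   have AWF: "A \<subseteq> W - F" using As AF by auto
   show ?thesis
   proof (cases "u \<in> A")
    case False
    thus ?thesis unfolding dA[OF As] bA[OF As] using st_tm1[OF s] st_tm[OF s, of "B A"] by auto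
   next
    case uA: True
    show ?thesis
    proof (cases "w \<in> A")
     case True
     thus ?thesis unfolding dA[OF As] bA[OF As] using uA D6 j0 by (simp add: tm_def)
    next
     case wA: False
     \<comment> \<open>For a set with \<open>u\<close> inside and \<open>w\<close> outside, degree
       and boundary both change. Either the new tip arcs pay for the deleted edge, or they leave the
       boundary alone and \<open>st\<close> absorbs the deletion, or the degree is at least eight to
       begin with.\<close>
     have "6 \<le> D A + j - 1 \<or> (j = 0 \<and> \<kappa> = 0)"
      using side unfolding j_def[symmetric]
     proof (elim disjE)
      assume "p - q = x u - y u"
      thus ?thesis using D6 j0 unfolding \<kappa>_def by linarith
     next
      assume "\<forall>A\<subseteq>W - F. 2 \<le> card A \<longrightarrow> 8 \<le> D A"
      hence "8 \<le> D A" using AWF True by blast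
      thus ?thesis using j0 by linarith
     qed (use D6 in linarith)
     thus ?thesis unfolding dA[OF As] bA[OF As] using uA wA st_tm1[OF s] by (auto simp: tm_def)
    qed
   qed
  next
   case False
   then obtain a where a: "A = {a}" using card2 A As by blast
   thus ?thesis unfolding dA[OF As] bA[OF As]
    using tu tw uw(3) G(5)[of A] A AF unfolding j_def[symmetric] \<kappa>_def[symmetric]
    by (cases "a = u"; cases "a = w") (auto simp: algebra_simps)
  qed
 qed
 moreover have "tipok F k W ?c ?x ?y"
  unfolding tipok_def eW bW using Fcases tip' unfolding j_def[symmetric] \<kappa>_def[symmetric] by auto
 moreover have "vol W ?m ?x ?y < vol W m x y"
  unfolding vol_def eW sumsum_madd[OF M(1) uw(1-3)] by (rule vol_arith) (use pq in \<open>simp add: j_def\<close>)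
 ultimately obtain f where "flow W ?m ?c f" using IH unfolding ext_def by blast
 hence "flow W m c (arcadd f u w 1)" by (rule flow_add_arc) (use M uw in auto)
 thus False using nx by (auto simp: ext_def)
qed

text \<open>As \<open>c\<close> is kept, the flows are the same before and after. Only degree and
  boundary of the sets around \<open>w\<close>, and of the tip, move by one.\<close>

lemma delete_tip_arc:
 assumes w: "w \<in> W" "w \<notin> F" "1 \<le> x w" "tm (D {w} - 1) (B {w} - 1)" "F = {} ==> \<not> st (d - 1) (B W - 1)"
 shows False
proof -
 let ?x = "x(w := x w - 1)"
 have fA: "finite A" if "A \<subseteq> W" for A using that M(1) finite_subset by blast
 have e: "(\<Sum>a\<in>A. es ?x y a - es x y a) = (if w \<in> A then - 1 else 0)" if "A \<subseteq> W" for A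
 proof -
  have "(\<Sum>a\<in>A. es ?x y a - es x y a) = (\<Sum>a\<in>A. if a = w then - 1 else 0)"
   by (rule sum.cong) auto
  thus ?thesis using fA[OF that] by simp
 qed
 have dA: "dg W m (es ?x y) A = D A - (if w \<in> A then 1 else 0)" if "A \<subseteq> W" for A
  using dg_tips[of W m "es ?x y" A "es x y"] e[OF that] by auto
 have bA: "bs c ?x y A = B A - (if w \<in> A then 1 else 0)" if "A \<subseteq> W" for A
  using e[OF that] by (auto simp: sum_subtractf sum.distrib algebra_simps)
 have "sum (es ?x y) W - d = (\<Sum>a\<in>W. es ?x y a - es x y a)" by (rule sum_subtractf[symmetric])
 hence eW: "sum (es ?x y) W = d - 1" using e[of W] w(1) by simp
 have "good F k W m c ?x y"
  unfolding good_def
 proof (intro conjI allI impI ballI)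
  show "mg W m" "3 dvd sum c W" using G by auto
  show "0 \<le> ?x a" "0 \<le> y a" if "a \<in> W" for a using G(2,3)[OF that] w by auto
 next
  fix A assume A: "A \<noteq> {} \<and> A \<subset> W"
  hence As: "A \<subseteq> W" by auto
  show "k \<le> dg W m (es ?x y) A" if AF: "A \<inter> F \<noteq> {}"
  proof (cases "2 \<le> card A")
   case True
   thus ?thesis unfolding dA[OF As] using strong(2)[of A] A AF by auto
  next
   case False
   then obtain a where "A = {a}" using card2 A As by blast
   thus ?thesis unfolding dA[OF As] using G(6)[of A] A AF w by auto
  qed
  show "tm (dg W m (es ?x y) A) (bs c ?x y A)" if AF: "A \<inter> F = {}"
  proof (cases "2 \<le> card A")
   case True
   hence s: "st (D A) (B A)" using strong(1)[of A] A AF by auto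
   thus ?thesis unfolding dA[OF As] bA[OF As] using st_tm1[OF s] st_tm[OF s, of "B A"] by auto
  next
   case False
   then obtain a where a: "A = {a}" using card2 A As by blast
   thus ?thesis unfolding dA[OF As] bA[OF As] using w G(5)[of A] A AF by (cases "a = w") auto
  qed
 qed
 moreover have "tipok F k W c ?x y"
  using tip w unfolding tipok_def eW bA[OF subset_refl] by auto
 moreover have "vol W m ?x y < vol W m x y" unfolding vol_def eW by linarith
 ultimately show False using IH nx by blast
qed

text \<open>The exceptional vertex and the tip lose one degree each, so lowering \<open>k\<close> by
  one preserves the relation between the two.\<close>

lemma delete_tip_arc_special:
 assumes w: "w \<in> W" "w \<in> F" "1 \<le> x w"
 shows False
proof -
 let ?x = "x(w := x w - 1)"
 have Fw: "F = {w}" using Fcases w by auto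
 have fA: "finite A" if "A \<subseteq> W" for A using that M(1) finite_subset by blast
 have e: "(\<Sum>a\<in>A. es ?x y a - es x y a) = (if w \<in> A then - 1 else 0)" if "A \<subseteq> W" for A
 proof -
  have "(\<Sum>a\<in>A. es ?x y a - es x y a) = (\<Sum>a\<in>A. if a = w then - 1 else 0)"
   by (rule sum.cong) auto
  thus ?thesis using fA[OF that] by simp
 qed
 have dA: "dg W m (es ?x y) A = D A - (if w \<in> A then 1 else 0)" if "A \<subseteq> W" for A
  using dg_tips[of W m "es ?x y" A "es x y"] e[OF that] by auto
 have bA: "bs c ?x y A = B A - (if w \<in> A then 1 else 0)" if "A \<subseteq> W" for A
  using e[OF that] by (auto simp: sum_subtractf sum.distrib algebra_simps)
 have "sum (es ?x y) W - d = (\<Sum>a\<in>W. es ?x y a - es x y a)" by (rule sum_subtractf[symmetric])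
 hence eW: "sum (es ?x y) W = d - 1" using e[of W] w(1) by simp
 have "good F (k - 1) W m c ?x y"
  unfolding good_def
 proof (intro conjI allI impI ballI)
  show "mg W m" "3 dvd sum c W" using G by auto
  show "0 \<le> ?x a" "0 \<le> y a" if "a \<in> W" for a using G(2,3)[OF that] w by auto
 next
  fix A assume A: "A \<noteq> {} \<and> A \<subset> W"
  hence As: "A \<subseteq> W" by auto
  show "k - 1 \<le> dg W m (es ?x y) A" if AF: "A \<inter> F \<noteq> {}"
   unfolding dA[OF As] using G(6)[of A] A AF by auto
  show "tm (dg W m (es ?x y) A) (bs c ?x y A)" if AF: "A \<inter> F = {}"
   unfolding dA[OF As] bA[OF As] using G(5)[of A] A AF Fw by auto
 qed
 moreover have "tipok F (k - 1) W c ?x y"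
  using tip w Fw unfolding tipok_def eW by auto
 moreover have "vol W m ?x y < vol W m x y" unfolding vol_def eW by linarith
 ultimately show False using IH nx by blast
qed

end

section \<open>Splitting off vertices of degree four in weighted graphs\<close>

definition lift :: "('a => 'a => int) => 'a => 'a => 'a => 'a => 'a => int" where
 "lift m w a b = madd (madd (madd m w a (- 1)) w b (- 1)) a b 1"

lemma lift_facts:
 assumes mg: "mg W m" and i: "w \<in> W" "a \<in> W" "b \<in> W" "a \<noteq> w" "b \<noteq> w" "a \<noteq> b" and p: "1 \<le> m w a" "1 \<le> m w b"
 shows "mg W (lift m w a b)"
  "A \<subseteq> W ==> dg W (lift m w a b) e A = dg W m e A - (if a \<in> A \<and> b \<in> A \<and> w \<notin> A \<or> a \<notin> A \<and> b \<notin> A \<and> w \<in> A then 2 else 0)"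
  "mass W (lift m w a b) = mass W m - 2"
  "lift m w a b w t = m w t - (if t = a then 1 else 0) - (if t = b then 1 else 0)"
proof -
 note M = mgD[OF mg]
 have s: "m a w = m w a" "m b w = m w b" "m b a = m a b" "0 \<le> m a b" using M(2,3) i by auto
 show "mg W (lift m w a b)" unfolding lift_def
  by (intro mg_madd mg) (use i p s in \<open>auto simp: madd_apply\<close>)
 show "A \<subseteq> W ==> dg W (lift m w a b) e A = dg W m e A - (if a \<in> A \<and> b \<in> A \<and> w \<notin> A \<or> a \<notin> A \<and> b \<notin> A \<and> w \<in> A then 2 else 0)"
  unfolding lift_def using i by (simp add: dg_madd[OF M(1)])
 show "mass W (lift m w a b) = mass W m - 2"
  unfolding lift_def using i by (simp add: sumsum_madd[OF M(1)])
 show "lift m w a b w t = m w t - (if t = a then 1 else 0) - (if t = b then 1 else 0)"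
  unfolding lift_def using i by (simp add: madd_apply)
qed

lemma ext_unlift:
 assumes "ext W (lift m w a b) c" "mg W m" "w \<in> W" "a \<in> W" "b \<in> W" "a \<noteq> w" "b \<noteq> w" "a \<noteq> b"
 shows "ext W m c"
proof -
 note M = mgD[OF assms(2)]
 obtain f where f: "flow W (madd (madd (madd m w a (- 1)) w b (- 1)) a b 1) c f"
  using assms(1) unfolding ext_def lift_def by auto
 have "0 \<le> m a b" using M(3) assms by auto
 thus ?thesis using flow_unlift[OF f M(1) assms(3-8)] unfolding ext_def by metis
qed

lemma ext_isolated:
 assumes "ext (W - {w}) m c" "mg W m" "w \<in> W" "\<And>t. t \<in> W ==> m w t = 0" "3 dvd c w"
 shows "ext W m c"
proof -
 obtain f where f: "flow (W - {w}) m c f" using assms(1) unfolding ext_def by auto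
 show ?thesis unfolding ext_def by (rule exI, rule flow_add_isolated[OF f assms(2-5)])
qed

lemma card_4_obtain:
 assumes "card N = 4"
 obtains a b p q where "N = {a, b, p, q}" "a \<noteq> b" "a \<noteq> p" "a \<noteq> q" "b \<noteq> p" "b \<noteq> q" "p \<noteq> q"
proof -
 obtain a R where "N = insert a R" "a \<notin> R" "card R = 3" using assms card_Suc_eq[of N 3] by auto
 moreover obtain b p q where "R = {b, p, q}" "b \<noteq> p" "p \<noteq> q" "b \<noteq> q" using \<open>card R = 3\<close> unfolding card_3_iff by auto
 ultimately show ?thesis using that[of a b p q] by auto
qed

lemma two_le_card: "finite W ==> A \<subseteq> W ==> a \<in> A ==> b \<in> A ==> a \<noteq> b ==> 2 \<le> card A"
 using card_mono[of A "{a, b}"] finite_subset[of A W] by simp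

lemma sumsum_sub:
 assumes "mg W m"
 shows "mass (W - {w}) m \<le> mass W m"
proof -
 note M' = mgD[OF assms]
 have "mass (W - {w}) m \<le> (\<Sum>s\<in>W - {w}. \<Sum>t\<in>W. m s t)"
  by (intro sum_mono sum_mono2) (use M' in auto)
 also have "\<dots> \<le> mass W m"
  by (intro sum_mono2) (use M' in \<open>auto intro!: sum_nonneg\<close>)
 finally show ?thesis .
qed

lemma simple_neighbours:
 assumes mg: "mg W m" and w: "w \<in> W" and s: "\<And>t. t \<in> W ==> m w t \<le> 1"
 obtains N where "N \<subseteq> W" "w \<notin> N" "\<And>t. t \<in> W ==> m w t = (if t \<in> N then 1 else 0)"
  "int (card N) = dg W m e {w} - e w"
  "\<And>A. A \<subseteq> W - {w} ==> dg W m e (insert w A) = dg W m e A + dg W m e {w} - 2 * int (card (N \<inter> A))"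
proof -
 note M = mgD[OF mg]
 define N where "N = {t\<in>W. m w t = 1}"
 have m01: "m w t = (if t \<in> N then 1 else 0)" if "t \<in> W" for t
  using s[OF that] M(3)[OF w that] that by (auto simp: N_def)
 have sm: "sum (m w) A = int (card (N \<inter> A))" if "A \<subseteq> W" for A
 proof -
  have "sum (m w) A = (\<Sum>t\<in>A. if t \<in> N then 1 else 0)" by (rule sum.cong) (use m01 that in auto)
  also have "\<dots> = int (card (A \<inter> N))" using finite_subset[OF that M(1)] by (simp add: sum.If_cases)
  finally show ?thesis by (simp add: Int_commute)
 qed
 have NW: "N \<subseteq> W" "w \<notin> N" using M(4)[OF w] by (auto simp: N_def)
 have cN: "int (card N) = dg W m e {w} - e w" using dg_single[OF mg w, of e] sm[of W] NW by (simp add: Int_absorb2)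
 have Di: "dg W m e (insert w A) = dg W m e A + dg W m e {w} - 2 * int (card (N \<inter> A))" if A: "A \<subseteq> W - {w}" for A
 proof -
  have "A \<subseteq> W" "w \<notin> A" using A by auto
  thus ?thesis using dg_insert[OF mg _ w, of A e] sm[of A] by simp
 qed
 show ?thesis by (rule that) (fact NW m01 cN Di)+
qed

text \<open>The price of a lift at a vertex outside \<open>A\<close>: if both \<open>a\<close> and
  \<open>b\<close> lie in \<open>A\<close>, two cut edges are replaced by one edge inside
  \<open>A\<close>; otherwise the cut keeps its size.\<close>

definition lifted :: "'a => 'a => 'a set => int" where
 "lifted a b A = (if a \<in> A \<and> b \<in> A then 2 else 0)"

lemma lift_four:
 assumes mg: "mg W m" and w: "w \<in> W"
  and i: "a \<in> W" "b \<in> W" "p \<in> W" "q \<in> W" "a \<noteq> w" "b \<noteq> w" "p \<noteq> w" "q \<noteq> w"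
  and N: "a \<noteq> b" "a \<noteq> p" "a \<noteq> q" "b \<noteq> p" "b \<noteq> q" "p \<noteq> q"
  and m01: "\<And>t. t \<in> W ==> m w t = (if t \<in> {a, b, p, q} then 1 else 0)"
 shows "mg W (lift m w a b)" (is "mg W ?m1") and "mg W (lift (lift m w a b) w p q)" (is "mg W ?m2")
  and "\<And>t. t \<in> W ==> lift (lift m w a b) w p q w t = 0"
  and "\<And>A. A \<subseteq> W - {w} ==> dg (W - {w}) (lift (lift m w a b) w p q) e A = dg W m e A - (lifted a b A + lifted p q A)"
  and "(\<Sum>s\<in>W - {w}. \<Sum>t\<in>W - {w}. lift (lift m w a b) w p q s t) \<le> mass W m"
proof -
 have v: "m w a = 1" "m w b = 1" "m w p = 1" "m w q = 1" using m01 i by auto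
 note L1 = lift_facts[OF mg w i(1,2,5,6) N(1), unfolded v, OF order_refl order_refl]
 have v1: "?m1 w p = 1" "?m1 w q = 1" using v N i unfolding L1(4) by auto
 note L2 = lift_facts[OF L1(1) w i(3,4,7,8) N(6), unfolded v1, OF order_refl order_refl]
 show "mg W ?m1" "mg W ?m2" by (rule L1(1), rule L2(1))
 show z: "?m2 w t = 0" if "t \<in> W" for t unfolding L2(4) L1(4) using m01[OF that] N by auto
 show "dg (W - {w}) ?m2 e A = dg W m e A - (lifted a b A + lifted p q A)" if "A \<subseteq> W - {w}" for A
 proof -
  have As: "A \<subseteq> W" "w \<notin> A" using that by auto
  have "sum (?m2 w) A = 0" using z As by (intro sum.neutral) auto
  thus ?thesis unfolding dg_remove[OF L2(1) w that] L2(2)[OF As(1)] L1(2)[OF As(1)] lifted_def using As(2) by simp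
 qed
 show "mass (W - {w}) ?m2 \<le> mass W m"
  using sumsum_sub[OF L2(1), of w] unfolding L2(3) L1(3) by linarith
qed

text \<open>The alternatives are the ways in which a degree bound is kept: nothing is lost, the loss
  is covered by the surplus of two in \<open>st\<close>, or all four neighbours lie in
  \<open>A\<close> and the new degree is that of \<open>A\<close> with \<open>w\<close>
  added.\<close>

lemma lifted_four_cases:
 assumes f: "finite W" "A \<subseteq> W - {w}" and N: "a \<noteq> b" "a \<noteq> p" "a \<noteq> q" "b \<noteq> p" "b \<noteq> q" "p \<noteq> q"
  and Di: "D' = D + 4 - 2 * int (card ({a, b, p, q} \<inter> A))"
 shows "lifted a b A + lifted p q A = 0 \<or> lifted a b A + lifted p q A = 2 \<and> 2 \<le> card A \<or>
  D' = D - (lifted a b A + lifted p q A) \<and> 2 \<le> card A"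
proof -
 have AW: "A \<subseteq> W" using f(2) by blast
 note c = two_le_card[OF f(1) AW, of a b] two_le_card[OF f(1) AW, of p q]
 show ?thesis
 proof (cases "a \<in> A \<and> b \<in> A \<and> p \<in> A \<and> q \<in> A")
  case True
  hence "card ({a, b, p, q} \<inter> A) = 4" using N by (simp add: Int_insert_left)
  thus ?thesis using True Di c N by (simp add: lifted_def)
 next
  case False
  thus ?thesis using c N by (auto simp: lifted_def)
 qed
qed

text \<open>One edge at \<open>w\<close> goes to the tip. Two of the other three are lifted, and the
  third is joined with the tip arc into a single arc from \<open>p\<close> to the tip.\<close>

lemma lift_three:
 assumes mg: "mg W m" and w: "w \<in> W" and i: "a \<in> W" "b \<in> W" "p \<in> W" "a \<noteq> w" "b \<noteq> w" "p \<noteq> w"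
  and N: "a \<noteq> b" "a \<noteq> p" "b \<noteq> p"
  and m01: "\<And>t. t \<in> W ==> m w t = (if t \<in> {a, b, p} then 1 else 0)"
  and e: "x w = 1" "y w = 0" and c3: "3 dvd sum c W" "3 dvd bs c x y {w}"
 shows "mg W (lift m w a b)" (is "mg W ?m1") and "mg W (madd (lift m w a b) p w (- 1))" (is "mg W ?m2")
  and "\<And>t. t \<in> W ==> madd (lift m w a b) p w (- 1) w t = 0"
  and "\<And>A. A \<subseteq> W - {w} ==> dg (W - {w}) (madd (lift m w a b) p w (- 1)) (es (x(p := x p + 1)) y) A =
   dg W m (es x y) A - lifted a b A \<and> bs (c(p := c p - 1, w := c w + 1)) (x(p := x p + 1)) y A = bs c x y A"
  and "(\<Sum>s\<in>W - {w}. \<Sum>t\<in>W - {w}. madd (lift m w a b) p w (- 1) s t) \<le> mass W m"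
  and "3 dvd sum (c(p := c p - 1, w := c w + 1)) (W - {w})"
  and "sum (x(p := x p + 1)) (W - {w}) = sum x W" and "sum y (W - {w}) = sum y W"
proof -
 note M = mgD[OF mg]
 let ?c = "c(p := c p - 1, w := c w + 1)" and ?x = "x(p := x p + 1)"
 have v: "m w a = 1" "m w b = 1" "m w p = 1" using m01 i by auto
 note L1 = lift_facts[OF mg w i(1,2,4,5) N(1), unfolded v, OF order_refl order_refl]
 have v1: "?m1 w p = 1" "?m1 p w = 1" using v N i mgD(2)[OF L1(1), of w p] w unfolding L1(4) by auto
 show "mg W ?m1" by (rule L1(1))
 show mg2: "mg W ?m2" by (rule mg_madd[OF L1(1) i(6)]) (use v1 in auto)
 show z: "?m2 w t = 0" if "t \<in> W" for t using m01[OF that] N i unfolding madd_apply L1(4) by auto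
 show "dg (W - {w}) ?m2 (es ?x y) A = dg W m (es x y) A - lifted a b A \<and> bs ?c ?x y A = bs c x y A" if "A \<subseteq> W - {w}" for A
 proof
  have As: "A \<subseteq> W" "w \<notin> A" using that by auto
  have "(\<Sum>u\<in>A. es ?x y u - es x y u) = (\<Sum>u\<in>A. if u = p then 1 else 0)" by (rule sum.cong) auto
  moreover have "sum (?m2 w) A = 0" using z As by (intro sum.neutral) auto
  ultimately show "dg (W - {w}) ?m2 (es ?x y) A = dg W m (es x y) A - lifted a b A"
   unfolding dg_remove[OF mg2 w that] dg_madd[OF M(1) As(1) i(3) w i(6)] L1(2)[OF As(1)] lifted_def
   using dg_tips[of W m "es ?x y" A "es x y"] As(2) finite_subset[OF As(1) M(1)] by simp
  show "bs ?c ?x y A = bs c x y A" by (rule sum.cong) (use As in auto)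
 qed
 show "mass (W - {w}) ?m2 \<le> mass W m"
  using sumsum_sub[OF mg2, of w] unfolding sumsum_madd[OF M(1) i(3) w i(6)] L1(3) by linarith
 have "sum ?c (W - {w}) = (\<Sum>u\<in>W - {w}. c u + (if u = p then - 1 else 0))" by (rule sum.cong) auto
 hence "sum ?c (W - {w}) = sum c (W - {w}) - 1" using M(1) i by (simp add: sum.distrib)
 thus "3 dvd sum ?c (W - {w})" using c3 e sum.remove[OF M(1) w, of c] by simp presburger
 have "sum ?x (W - {w}) = (\<Sum>u\<in>W - {w}. x u + (if u = p then 1 else 0))" by (rule sum.cong) auto
 thus "sum ?x (W - {w}) = sum x W" using M(1) i e sum.remove[OF M(1) w, of x] by (simp add: sum.distrib)
 show "sum y (W - {w}) = sum y W" using e sum.remove[OF M(1) w, of y] by simp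
qed

text \<open>This is shared by both extension theorems. A set that loses more than two has the degree
  of \<open>insert w A\<close>; since \<open>st\<close> forces degree six, \<open>tm\<close> then
  holds for every boundary.\<close>

lemma reduce_good:
 assumes g: "good F k W m c x y" and w: "w \<in> W" "w \<notin> F" "3 dvd bs c x y {w}"
  and st1: "\<And>A. A \<subset> W ==> A \<inter> F = {} ==> 2 \<le> card A ==> st (dg W m (es x y) A) (bs c x y A)"
  and q: "mg (W - {w}) m2" "\<And>u. u \<in> W ==> 0 \<le> x2 u \<and> 0 \<le> y u" "3 dvd sum c2 (W - {w})"
  and dB: "\<And>A. A \<subseteq> W - {w} ==> dg (W - {w}) m2 (es x2 y) A = dg W m (es x y) A - \<delta> A \<and> bs c2 x2 y A = bs c x y A"
  and del: "\<And>A. A \<subseteq> W - {w} ==> \<delta> A = 0 \<or> \<delta> A = 2 \<and> 2 \<le> card A \<or>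
   dg W m (es x y) (insert w A) = dg W m (es x y) A - \<delta> A \<and> 2 \<le> card A"
  and delF: "\<And>A. A \<subset> W - {w} ==> A \<inter> F \<noteq> {} ==> k \<le> dg W m (es x y) A - \<delta> A"
 shows "good F k (W - {w}) m2 c2 x2 y"
 unfolding good_def
proof (intro conjI allI impI ballI)
 note G = goodD[OF g]
 show "mg (W - {w}) m2" "3 dvd sum c2 (W - {w})" by fact+
 show "0 \<le> x2 u" "0 \<le> y u" if "u \<in> W - {w}" for u using q(2) that by auto
 fix A assume A: "A \<noteq> {} \<and> A \<subset> W - {w}"
 hence As: "A \<subseteq> W - {w}" "A \<subset> W" "insert w A \<subset> W" "w \<notin> A" using w by auto
 have fA: "finite A" using As(2) mgD(1)[OF G(1)] finite_subset by blast
 note del[OF As(1)]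
 thus "tm (dg (W - {w}) m2 (es x2 y) A) (bs c2 x2 y A)" if AF: "A \<inter> F = {}"
 proof (elim disjE conjE)
  assume "\<delta> A = 0" thus ?thesis using dB[OF As(1)] G(5)[of A] A As AF by simp
 next
  assume "\<delta> A = 2" "2 \<le> card A"
  thus ?thesis using dB[OF As(1)] st_tm2[OF st1[of A]] As AF by simp
 next
  assume "dg W m (es x y) (insert w A) = dg W m (es x y) A - \<delta> A" "2 \<le> card A"
  thus ?thesis using dB[OF As(1)] st_tm[OF st1[of "insert w A"]] As AF w(2) fA by simp
 qed
 show "k \<le> dg (W - {w}) m2 (es x2 y) A" if AF: "A \<inter> F \<noteq> {}"
  using dB[OF As(1)] delF[of A] A AF by simp
qed

context mincx
begin

text \<open>With the tip restored, \<open>W - {w}\<close> is the complement of \<open>w\<close> and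
  the tip, so this is the degree of a pair of vertices joined by \<open>x w + y w\<close>
  edges.\<close>

lemma D_compl: "w \<in> W ==> D (W - {w}) = d + D {w} - 2 * x w - 2 * y w"
proof -
 assume w: "w \<in> W"
 have "sum (m w) (W - {w}) = sum (m w) W" using sum.remove[OF M(1) w, of "m w"] M(4)[OF w] by simp
 hence "sum (m w) (W - {w}) = D {w} - (x w + y w)" using dg_single[OF G(1) w, of "es x y"] by simp
 moreover have "D W = D (W - {w}) + D {w} - 2 * sum (m w) (W - {w})"
  using D_insert[of "W - {w}" w] w by (simp add: insert_absorb)
 ultimately show ?thesis by (simp add: dg_all)
qed

lemma B_compl: "w \<in> W ==> B (W - {w}) = B W - B {w}"
proof -
 assume w: "w \<in> W"
 have "B {w} = c w + x w - y w" by simp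
 thus ?thesis using sum.remove[OF M(1) w, of "\<lambda>u. c u + x u - y u"] by linarith
qed

lemma compl_proper: "w \<in> W ==> W - {w} \<subset> W \<and> 2 \<le> card (W - {w})"
proof -
 assume w: "w \<in> W"
 have "card (W - {w}) = card W - 1" using w by (rule card_Diff_singleton)
 thus ?thesis using card3 w by auto
qed

lemma tm1: "w \<in> W ==> w \<notin> F ==> tm (D {w}) (B {w})"
proof (rule G(5))
 assume "w \<in> W"
 thus "{w} \<subset> W" using card3 by (cases "W = {w}") auto
qed auto

lemma reduce_remove:
 assumes w: "w \<in> W" "w \<notin> F" "D {w} = 4" and q: "mg (W - {w}) m2" "\<And>u. u \<in> W ==> 0 \<le> x2 u \<and> 0 \<le> y u" "3 dvd sum c2 (W - {w})"
  and dB: "\<And>A. A \<subseteq> W - {w} ==> dg (W - {w}) m2 (es x2 y) A = D A - \<delta> A \<and> bs c2 x2 y A = B A"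
  and del: "\<And>A. A \<subseteq> W - {w} ==> \<delta> A = 0 \<or> \<delta> A = 2 \<and> 2 \<le> card A \<or> D (insert w A) = D A - \<delta> A \<and> 2 \<le> card A"
  and tot: "sum (es x2 y) (W - {w}) = d"
  and vl: "mass (W - {w}) m2 \<le> mass W m"
 shows "ext (W - {w}) m2 c2"
proof (rule IH)
 have b: "3 dvd B {w}" using tm1[OF w(1,2)] w(3) unfolding tm_def by presburger
 show "good F k (W - {w}) m2 c2 x2 y"
 proof (rule reduce_good[OF g w(1,2) b _ q dB del])
  show "st (D A) (B A)" if "A \<subset> W" "A \<inter> F = {}" "2 \<le> card A" for A by (rule strong(1)[OF that(1,3,2)])
  show "k \<le> D A - \<delta> A" if A: "A \<subset> W - {w}" "A \<inter> F \<noteq> {}" for A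
  proof -
   have As: "A \<subseteq> W - {w}" "A \<subset> W" "insert w A \<subset> W" "w \<notin> A" "A \<noteq> {}" using w A by auto
   have "finite A" using As M(1) finite_subset by blast
   thus ?thesis using del[OF As(1)] G(6)[of A] strong(2)[of A] strong(2)[of "insert w A"] As A(2) by auto
  qed
 qed
 have e: "bs c2 x2 y (W - {w}) = B W - B {w}" using dB[of "W - {w}"] B_compl[OF w(1)] by simp
 have "3 dvd (B W - B {w}) - B W" using b by presburger
 hence "st d (bs c2 x2 y (W - {w})) = st d (B W)" unfolding e by (rule st_cong)
 thus "tipok F k (W - {w}) c2 x2 y" using tip w unfolding tipok_def tot by auto
 have "card (W - {w}) < card W" using w M(1) by (metis card_Diff1_less)
 thus "vol (W - {w}) m2 x2 y < vol W m x y" unfolding vol_def tot using vl by linarith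
qed

lemmas card_ge2 = two_le_card[OF M(1)]

text \<open>At degree four the boundary vanishes, so \<open>w\<close> can be replaced by two paths
  through it, one of which may end in the tip. Here all tip arcs at \<open>w\<close> lead to the
  tip; the opposite case is reached by \<open>mirror\<close>.\<close>

lemma four_absent_y0:
 assumes w: "w \<in> W" "w \<notin> F" "D {w} = 4" and y0: "y w = 0"
 shows False
proof -
 have b: "3 dvd B {w}" using tm1[OF w(1,2)] w(3) unfolding tm_def by presburger
 \<comment> \<open>With two or more tip arcs at \<open>w\<close>, the set \<open>W - {w}\<close>
   would have degree at most \<open>d\<close> and, modulo 3, the boundary of \<open>W\<close>. The
   tip condition would then contradict \<open>strong\<close>.\<close>
 have e1: "x w \<le> 1"
 proof (cases "F = {}")
  case True
  have "st (d + 4 - 2 * x w) (B W - B {w})"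
   using strong(1)[of "W - {w}"] compl_proper[OF w(1)] D_compl[OF w(1)] B_compl[OF w(1)] True w y0 by auto
  moreover have "\<not> st d (B W)" using tip True by (simp add: tipok_def)
  ultimately show ?thesis using b unfolding st_def by presburger
 next
  case False
  hence "k + 2 \<le> d + 4 - 2 * x w"
   using strong(2)[of "W - {w}"] compl_proper[OF w(1)] D_compl[OF w(1)] Fcases w y0 by auto
  moreover have "d \<le> k + 1" using tip False by (auto simp: tipok_def)
  ultimately show ?thesis by linarith
 qed
 have "m w t \<le> 1" if "t \<in> W" for t using simple[OF w(1) that] by simp
 note simple_neighbours[OF G(1) w(1) this, of "es x y"]
 then obtain N where NW: "N \<subseteq> W" "w \<notin> N" and m01: "\<And>t. t \<in> W ==> m w t = (if t \<in> N then 1 else 0)"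
  and cN: "int (card N) = D {w} - es x y w"
  and Di: "\<And>A. A \<subseteq> W - {w} ==> D (insert w A) = D A + D {w} - 2 * int (card (N \<inter> A))"
  by blast
 consider "x w = 0" | "x w = 1" using e1 G(2)[OF w(1)] by linarith
 thus False
 proof cases
  case 1
  hence "card N = 4" using cN w(3) y0 by simp
  then obtain a b' p q where N: "N = {a, b', p, q}" "a \<noteq> b'" "a \<noteq> p" "a \<noteq> q" "b' \<noteq> p" "b' \<noteq> q" "p \<noteq> q"
   by (rule card_4_obtain)
  have i: "a \<in> W" "b' \<in> W" "p \<in> W" "q \<in> W" "a \<noteq> w" "b' \<noteq> w" "p \<noteq> w" "q \<noteq> w" using N NW by auto
  note L = lift_four[OF G(1) w(1) i N(2-7) m01[unfolded N(1)]]
  have "ext (W - {w}) (lift (lift m w a b') w p q) c"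
  proof (rule reduce_remove[OF w, of _ x c "\<lambda>A. lifted a b' A + lifted p q A"])
   show "mg (W - {w}) (lift (lift m w a b') w p q)" by (rule mg_subset[OF L(2)]) auto
   show "3 dvd sum c (W - {w})" using G(4) b 1 y0 sum.remove[OF M(1) w(1), of c] by simp presburger
   show "sum (es x y) (W - {w}) = d" using sum.remove[OF M(1) w(1), of "es x y"] 1 y0 by simp
   show "lifted a b' A + lifted p q A = 0 \<or> lifted a b' A + lifted p q A = 2 \<and> 2 \<le> card A \<or>
    D (insert w A) = D A - (lifted a b' A + lifted p q A) \<and> 2 \<le> card A" if "A \<subseteq> W - {w}" for A
    by (rule lifted_four_cases[OF M(1) that N(2-7)]) (use Di[OF that] w(3) N(1) in simp)
  qed (use L(4,5) G(2,3) in auto)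
  hence "ext W (lift (lift m w a b') w p q) c" using ext_isolated[OF _ L(2) w(1) L(3)] b 1 y0 by simp
  hence "ext W m c"
   using ext_unlift[OF _ L(1) w(1) i(3,4,7,8) N(7)] ext_unlift[OF _ G(1) w(1) i(1,2,5,6) N(2)] by blast
  thus False using nx by blast
 next
  case 2
  hence "card N = 3" using cN w(3) y0 by simp
  then obtain a b' p where N: "N = {a, b', p}" "a \<noteq> b'" "b' \<noteq> p" "a \<noteq> p" using card_3_iff[of N] by blast
  have i: "a \<in> W" "b' \<in> W" "p \<in> W" "a \<noteq> w" "b' \<noteq> w" "p \<noteq> w" using N NW by auto
  note L = lift_three[OF G(1) w(1) i N(2,4,3) m01[unfolded N(1)] 2 y0 G(4) b]
  have "ext (W - {w}) (madd (lift m w a b') p w (- 1)) (c(p := c p - 1, w := c w + 1))"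
  proof (rule reduce_remove[OF w, of _ "x(p := x p + 1)" _ "lifted a b'"])
   show "mg (W - {w}) (madd (lift m w a b') p w (- 1))" by (rule mg_subset[OF L(2)]) auto
   show "sum (es (x(p := x p + 1)) y) (W - {w}) = d" using L(7,8) by (simp add: sum.distrib del: fun_upd_apply)
   show "lifted a b' A = 0 \<or> lifted a b' A = 2 \<and> 2 \<le> card A \<or> D (insert w A) = D A - lifted a b' A \<and> 2 \<le> card A"
    if "A \<subseteq> W - {w}" for A
    using card_ge2[of A a b'] N that by (auto simp: lifted_def)
  qed (use L(4,5,6) G(2,3) in auto)
  hence "ext W (madd (lift m w a b') p w (- 1)) (c(p := c p - 1, w := c w + 1))"
   using ext_isolated[OF _ L(2) w(1) L(3)] b 2 y0 by simp
  hence "ext W (lift m w a b') c" unfolding ext_def using flow_add_arc[OF _ M(1) i(3) w(1) i(6)] by blast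
  hence "ext W m c" using ext_unlift[OF _ G(1) w(1) i(1,2,4,5) N(2)] by blast
  thus False using nx by blast
 qed
qed

end

section \<open>Vertices that may lose an outgoing or an incoming edge\<close>

lemma rinst_mirror:
 "rinst W m c x y S cS xS yS ==> rinst W m (\<lambda>u. - c u) y x S (\<lambda>u. - cS u) yS xS"
 unfolding rinst_def by (auto simp: sum_negf algebra_simps)

text \<open>At degree 5 the nonzero boundary selects a direction, at degree 6 at most one direction
  fails, and above that both work.\<close>

lemma tm_drop: "5 \<le> n ==> tm n b ==> tm (n - 1) (b - 1) \<or> tm (n - 1) (b + 1)"
 unfolding tm_def by presburger

lemma tm_drop_in: "5 \<le> n ==> tm n b ==> tm (n - 1) (b + 1) ==> \<not> tm (n - 1) (b - 1) ==>
  n = 5 \<and> 3 dvd b + 1 \<or> n = 6 \<and> 3 dvd b - 1"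
 unfolding tm_def by presburger

context mincx
begin

lemma five:
 assumes "w \<in> W" "w \<notin> F"
 shows "5 \<le> D {w}"
proof (rule ccontr)
 assume n: "\<not> 5 \<le> D {w}"
 have t: "tm (D {w}) (B {w})" by (rule tm1[OF assms])
 hence D4: "D {w} = 4" and b: "3 dvd B {w}" using n by (auto simp: tm_def)
 have "x w + y w \<le> 1"
 proof (cases "F = {}")
  case True
  have "st (d + 4 - 2 * x w - 2 * y w) (B W - B {w})"
   using strong(1)[of "W - {w}"] compl_proper[OF assms(1)] D_compl[OF assms(1)] B_compl[OF assms(1)] True D4 by auto
  moreover have "\<not> st d (B W)" using tip True by (simp add: tipok_def)
  ultimately show ?thesis using b unfolding st_def by presburger
 next
  case False
  hence "k + 2 \<le> d + 4 - 2 * x w - 2 * y w"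
   using strong(2)[of "W - {w}"] compl_proper[OF assms(1)] D_compl[OF assms(1)] Fcases assms D4 by auto
  moreover have "d \<le> k + 1" using tip False by (auto simp: tipok_def)
  ultimately show ?thesis by presburger
 qed
 then consider "y w = 0" | "x w = 0" using G(2,3)[OF assms(1)] by linarith
 thus False
 proof cases
  case 1 thus False using four_absent_y0[OF assms D4] by blast
 next
  case 2
  interpret M: mincx F k W m "\<lambda>u. - c u" y x by (rule mirror)
  show False using M.four_absent_y0[OF assms _ 2] D4 unfolding es_comm[of y x] by blast
 qed
qed

text \<open>\<open>oo\<close> stands for a vertex that can afford to lose an outgoing edge,
  \<open>io\<close> for one that can afford to lose an incoming edge. In canvases this ability comes
  from being out-friendly or in-friendly.\<close>

definition oo :: "'a => bool" where "oo w \<longleftrightarrow> tm (D {w} - 1) (B {w} - 1)"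
definition io :: "'a => bool" where "io w \<longleftrightarrow> tm (D {w} - 1) (B {w} + 1)"

lemma oo_or_io: "w \<in> W ==> w \<notin> F ==> oo w \<or> io w"
 using five[of w] tm1[of w] tm_drop unfolding oo_def io_def by blast

text \<open>Otherwise the edge could be directed from \<open>u\<close> to \<open>w\<close> and
  deleted, without any change at the tip.\<close>

lemma nomix:
 assumes "u \<in> W" "w \<in> W" "u \<noteq> w" "u \<notin> F" "w \<notin> F" "1 \<le> m u w"
 shows "\<not> (oo u \<and> io w)"
proof
 assume a: "oo u \<and> io w"
 show False
  by (rule delete_edge_change_tip[of u w "x u" "y u"])
   (use assms a G(2,3) tip in \<open>auto simp: oo_def io_def tipok_def\<close>)
qed

text \<open>If almost all edges at \<open>w\<close> went to the tip, moving \<open>w\<close> across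
  would lower the degree of \<open>W - {w}\<close> below what \<open>strong\<close> demands.\<close>

lemma has_nbr:
 assumes w: "w \<in> W" "w \<notin> F"
 shows "\<exists>t\<in>W. t \<notin> F \<and> t \<noteq> w \<and> 1 \<le> m w t"
proof (rule ccontr)
 assume n: "\<not> ?thesis"
 have m0: "m w t = 0" if "t \<in> W" "t \<notin> F" for t
  using n that M(3)[OF w(1) that(1)] M(4)[OF w(1)] by force
 have Dw: "D {w} = sum (m w) W + (x w + y w)" by (rule dg_single[OF G(1) w(1)])
 have P: "W - {w} \<subset> W" "2 \<le> card (W - {w})" using compl_proper[OF w(1)] by auto
 show False
 proof (cases "F = {}")
  case True
  have "sum (m w) W = 0" using m0 True by (intro sum.neutral) auto
  hence e: "5 \<le> x w + y w" "D {w} = x w + y w" using five[OF w] Dw by auto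
  have "st (d + D {w} - 2 * x w - 2 * y w) (B (W - {w}))"
   using strong(1)[OF P] D_compl[OF w(1)] True by auto
  moreover have "d \<le> 7" using tip True unfolding tipok_def st_def by auto
  ultimately show False using e unfolding st_def by presburger
 next
  case False
  then obtain v where v: "v \<in> W" "F = {v}" "d \<le> k + 1" using tip by (auto simp: tipok_def)
  have "sum (m w) W = m w v + sum (m w) (W - {v})" by (rule sum.remove[OF M(1) v(1)])
  moreover have "sum (m w) (W - {v}) = 0" using m0 v by (intro sum.neutral) auto
  ultimately have e: "D {w} \<le> 1 + (x w + y w)" using Dw simple[OF w(1) v(1)] by simp
  have "k + 2 \<le> d + D {w} - 2 * x w - 2 * y w"
   using strong(2)[OF P] D_compl[OF w(1)] v w by auto
  thus False using e v(3) five[OF w] by linarith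
 qed
qed

lemma io_nbr:
 assumes "w \<in> W" "w \<notin> F" "t \<in> W" "t \<notin> F" "t \<noteq> w" "1 \<le> m w t" "io w"
 shows "io t \<and> \<not> oo t"
proof -
 have "1 \<le> m t w" using assms M(2) by auto
 hence "\<not> (oo t \<and> io w)" using nomix[of t w] assms by blast
 thus ?thesis using oo_or_io[of t] assms by blast
qed

text \<open>A neighbour exists and inherits \<open>io\<close>, and then the edge to it could be
  deleted. So each vertex is of one kind only, and the kind is constant along edges that avoid
  \<open>F\<close>.\<close>

lemma io_not_oo:
 assumes "w \<in> W" "w \<notin> F" "io w"
 shows "\<not> oo w"
proof
 assume o: "oo w"
 obtain t where t: "t \<in> W" "t \<notin> F" "t \<noteq> w" "1 \<le> m w t" using has_nbr[OF assms(1,2)] by blast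
 have "io t" using io_nbr[OF assms(1,2) t assms(3)] by blast
 thus False using nomix[of w t] o t assms by auto
qed

lemma io_vals:
 assumes "w \<in> W" "w \<notin> F" "io w"
 shows "D {w} = 5 \<and> 3 dvd B {w} + 1 \<or> D {w} = 6 \<and> 3 dvd B {w} - 1"
 using tm_drop_in[OF five[OF assms(1,2)] tm1[OF assms(1,2)]] io_not_oo[OF assms] assms(3)
 unfolding oo_def io_def by blast

lemma oo_mirror: "mincx.oo W m (\<lambda>u. - c u) y x w = io w" "mincx.io W m (\<lambda>u. - c u) y x w = oo w"
proof -
 interpret M: mincx F k W m "\<lambda>u. - c u" y x by (rule mirror)
 have e: "- bs c x y {w} - 1 = - (bs c x y {w} + 1)" "- bs c x y {w} + 1 = - (bs c x y {w} - 1)" by auto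
 show "M.oo w = io w" "M.io w = oo w"
  unfolding M.oo_def M.io_def oo_def io_def es_comm[of y x] bs_neg e tm_neg by auto
qed

text \<open>Modulo 3 an arc between \<open>w\<close> and the tip may be exchanged for two reversed
  ones. The tip degree grows by one, and so does the degree of \<open>w\<close>, which pays for
  deleting an edge from \<open>w\<close> to a neighbour.\<close>

lemma rem_io:
 assumes w: "w \<in> W" "w \<notin> F" "io w" "1 \<le> x w + y w"
  and t: "F = {} ==> \<not> st (d + 1) (B W)" "F \<noteq> {} ==> d + 1 \<le> k + 1"
 shows False
proof -
 obtain t where t': "t \<in> W" "t \<notin> F" "t \<noteq> w" "1 \<le> m w t" using has_nbr[OF w(1,2)] by blast
 have it: "io t" using io_nbr[OF w(1,2) t' w(3)] by blast
 have st3: "st n (b + 3) = st n b" "st n (b - 3) = st n b" for n b unfolding st_def by presburger+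
 note v = io_vals[OF w(1-3)]
 have tm': "tm (D {w} + 1 - 1) (B {w} - 3 - 1)" "tm (D {w} + 1 - 1) (B {w} + 3 - 1)"
  using v unfolding tm_def by presburger+
 consider "1 \<le> x w" | "1 \<le> y w" using w(4) by linarith
 thus False
 proof cases
  case 1
  have a: "x w - 1 + (y w + 2) - (x w + y w) = 1" "x w - 1 - (y w + 2) - (x w - y w) = - 3" by auto
  show False
   by (rule delete_edge_change_tip[of w t "x w - 1" "y w + 2", unfolded a])
    (use w t t' it 1 G(2,3)[OF w(1)] tm' st3[of "d + 1" "B W"] in \<open>auto simp: io_def\<close>)
 next
  case 2
  have a: "x w + 2 + (y w - 1) - (x w + y w) = 1" "x w + 2 - (y w - 1) - (x w - y w) = 3" by auto
  show False
   by (rule delete_edge_change_tip[of w t "x w + 2" "y w - 1", unfolded a])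
    (use w t t' it 2 G(2,3)[OF w(1)] tm' st3[of "d + 1" "B W"] in \<open>auto simp: io_def\<close>)
 qed
qed

lemma rem:
 assumes w: "w \<in> W" "w \<notin> F" "1 \<le> x w + y w"
  and t: "F = {} ==> \<not> st (d + 1) (B W)" "F \<noteq> {} ==> d + 1 \<le> k + 1"
 shows False
proof (cases "io w")
 case True thus False using rem_io w t by blast
next
 case False
 hence o: "oo w" using oo_or_io w by blast
 interpret M: mincx F k W m "\<lambda>u. - c u" y x by (rule mirror)
 show False using M.rem_io[of w] w t o unfolding oo_mirror es_comm[of y x] bs_neg st_neg by auto
qed

text \<open>Two opposite arcs between \<open>w\<close> and the tip leave all boundaries alone. They
  raise the degree of \<open>w\<close> by two, so that it stays at least six after an edge to a
  neighbour is deleted.\<close>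

lemma pair_io:
 assumes w: "w \<in> W" "w \<notin> F" "io w"
  and t: "F = {} ==> \<not> st (d + 2) (B W)" "F \<noteq> {} ==> d + 2 \<le> k + 1"
 shows False
proof -
 obtain t where t': "t \<in> W" "t \<notin> F" "t \<noteq> w" "1 \<le> m w t" using has_nbr[OF w(1,2)] by blast
 have it: "io t" using io_nbr[OF w(1,2) t' w(3)] by blast
 have a: "x w + 1 + (y w + 1) - (x w + y w) = 2" "x w + 1 - (y w + 1) - (x w - y w) = 0" by auto
 have tm': "tm (D {w} + 2 - 1) (B {w} + 0 - 1)" using five[OF w(1,2)] unfolding tm_def by linarith
 show False
  by (rule delete_edge_change_tip[of w t "x w + 1" "y w + 1", unfolded a])
   (use w t t' it G(2,3)[OF w(1)] tm' in \<open>auto simp: io_def\<close>)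
qed

lemma pair:
 assumes w: "w \<in> W" "w \<notin> F"
  and t: "F = {} ==> \<not> st (d + 2) (B W)" "F \<noteq> {} ==> d + 2 \<le> k + 1"
 shows False
proof (cases "io w")
 case True thus False using pair_io w t by blast
next
 case False
 hence o: "oo w" using oo_or_io w by blast
 interpret M: mincx F k W m "\<lambda>u. - c u" y x by (rule mirror)
 show False using M.pair_io[of w] w t o unfolding oo_mirror es_comm[of y x] bs_neg st_neg by auto
qed

lemma delete_tip_y:
 assumes w: "w \<in> W" "w \<notin> F" "1 \<le> y w" "io w" "F = {} ==> \<not> st (d - 1) (B W + 1)"
 shows False
proof -
 interpret M: mincx F k W m "\<lambda>u. - c u" y x by (rule mirror)
 have e: "- bs c x y A - 1 = - (bs c x y A + 1)" for A by auto
 show False using M.delete_tip_arc[of w] w unfolding io_def es_comm[of y x] bs_neg e tm_neg st_neg by auto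
qed

lemma delete_tip_y_special:
 assumes w: "w \<in> W" "w \<in> F" "1 \<le> y w"
 shows False
proof -
 interpret M: mincx F k W m "\<lambda>u. - c u" y x by (rule mirror)
 show False using M.delete_tip_arc_special[of w] w by auto
qed

text \<open>Every arc from the tip can be deleted, so there are none. The boundary of
  \<open>W\<close> is then its degree modulo 3, which contradicts each of the listed cases.\<close>

lemma final_empty_uniform:
 assumes F: "F = {}" and io: "\<And>w. w \<in> W ==> io w"
  and dd: "d = 5 \<and> 3 dvd B W \<or> d = 6 \<and> \<not> 3 dvd B W \<or> d = 7 \<and> 3 dvd B W"
 shows False
proof -
 have "y w = 0" if "w \<in> W" for w
 proof (rule ccontr)
  assume "y w \<noteq> 0"
  hence "1 \<le> y w" using G(3)[OF that] by linarith
  moreover have "\<not> st (d - 1) (B W + 1)" using dd unfolding st_def by presburger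
  ultimately show False using delete_tip_y that io F by blast
 qed
 hence y: "sum y W = 0" by simp
 hence "d = sum x W" "B W = sum c W + sum x W" by (auto simp: sum.distrib sum_subtractf)
 thus False using dd G(4) by presburger
qed

lemma final_empty:
 assumes F: "F = {}"
 shows False
proof -
 have ns: "\<not> st d (B W)" using tip F by (simp add: tipok_def)
 obtain w0 where w0: "w0 \<in> W" using card3 by fastforce
 have e0: "0 \<le> es x y w" if "w \<in> W" for w using G(2,3)[OF that] by simp
 have d0: "0 \<le> d" by (rule sum_nonneg) (use e0 in auto)
 \<comment> \<open>The tip degrees to which two edges, one edge, or no edge can be added without
   reaching \<open>st\<close>.\<close>
 consider "d = 0" | "1 \<le> d" "d \<le> 4 \<or> d = 5 \<and> \<not> 3 dvd B W"
  | "d = 5 \<and> 3 dvd B W \<or> d = 6 \<and> \<not> 3 dvd B W \<or> d = 7 \<and> 3 dvd B W"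
  using ns d0 unfolding st_def by linarith
 thus False
 proof cases
  case 1
  thus False using pair[of w0] w0 F by (simp add: st_def)
 next
  case 2
  have "\<exists>w\<in>W. es x y w \<noteq> 0"
  proof (rule ccontr)
   assume "\<not> ?thesis"
   hence "d = 0" by (intro sum.neutral) auto
   thus False using 2 by simp
  qed
  then obtain w where "w \<in> W" "es x y w \<noteq> 0" by blast
  hence "w \<in> W" "1 \<le> x w + y w" using e0[of w] by auto
  moreover have "\<not> st (d + 1) (B W)" using 2 unfolding st_def by presburger
  ultimately show False using rem F by blast
 next
  case 3
  define I where "I = {w \<in> W. io w}"
  consider "I = W" | "I = {}" | "I \<noteq> {}" "I \<subset> W" by (auto simp: I_def)
  thus False
  proof cases
   case 1 thus False using final_empty_uniform[OF F _ 3] by (auto simp: I_def)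
  next
   case 2
   hence o: "oo w" if "w \<in> W" for w using that oo_or_io[of w] F by (auto simp: I_def)
   interpret M: mincx F k W m "\<lambda>u. - c u" y x by (rule mirror)
   show False using M.final_empty_uniform[OF F] o 3 unfolding oo_mirror es_comm[of y x] bs_neg dvd_minus_iff by blast
  next
   case 3
   \<comment> \<open>If both kinds occur, no edge joins them, so the tip carries all edges leaving
     either side: at least 4 + 4, while \<open>d\<close> is at most 7.\<close>
   have ne: "m u t = 0" if "u \<in> I" "t \<in> W - I" for u t
   proof (rule ccontr)
    assume "m u t \<noteq> 0"
    hence "1 \<le> m u t" using M(3)[of u t] that by (auto simp: I_def)
    thus False using io_nbr[of u t] that F by (auto simp: I_def)
   qed
   have ne': "m u t = 0" if "u \<in> W - I" "t \<in> W - (W - I)" for u t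
    using ne[of t u] that M(2)[of t u] by (auto simp: I_def)
   have "D I = sum (es x y) I" "D (W - I) = sum (es x y) (W - I)"
    by (rule dg_disjoint_no_edges[OF G(1)]; use 3 ne ne' in blast)+
   hence "D I + D (W - I) = d" using sum.subset_diff[of I W "es x y"] 3 M(1) by auto
   moreover have "4 \<le> D I" "4 \<le> D (W - I)" by (rule tm_ge4, rule G(5); use 3 F in auto)+
   moreover have "d \<le> 7" using ns by (auto simp: st_def)
   ultimately show False by linarith
  qed
 qed
qed

end

section \<open>Sets of degree six and seven\<close>

lemma tm_ge6: "6 \<le> n ==> tm n b" by (simp add: tm_def)

context mincx
begin

text \<open>Deleting one tip arc brings the tip of the restriction to \<open>A\<close> down to
  degree six. Any vertex other than \<open>u\<close> still has degree at least five and can serve as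
  the exceptional one with \<open>k = 5\<close>.\<close>

lemma small_friendly:
 assumes A: "A \<subset> W" "A \<inter> F = {}" "2 \<le> card A" "D A = 7"
  and sub: "\<And>T. T \<subset> A ==> 2 \<le> card T ==> 8 \<le> D T"
  and r: "rinst W m c x y A cS xS yS" and u: "u \<in> A" "1 \<le> xS u" "oo u"
 shows "ext A m cS"
proof -
 have AW: "A \<subseteq> W" using A by auto
 have fA: "finite A" by (rule finite_subset[OF AW M(1)])
 obtain v' where v': "v' \<in> A" "v' \<noteq> u"
 proof -
  have "A \<noteq> {u}" using A(3) by auto
  thus ?thesis using that u(1) by blast
 qed
 let ?x = "xS(u := xS u - 1)"
 note R = rinst_dg[OF M(1) AW r]
 have tp: "(\<Sum>a\<in>T. es ?x yS a - es xS yS a) = (if u \<in> T then - 1 else 0)" if "T \<subseteq> A" for T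
 proof -
  have "(\<Sum>a\<in>T. es ?x yS a - es xS yS a) = (\<Sum>a\<in>T. if a = u then - 1 else 0)" by (rule sum.cong) auto
  thus ?thesis using finite_subset[OF that fA] by simp
 qed
 have dT: "dg A m (es ?x yS) T = D T - (if u \<in> T then 1 else 0)" if "T \<subseteq> A" for T
  using dg_tips[of A m "es ?x yS" T "es xS yS"] tp[OF that] R(1)[OF that] by auto
 have bT: "bs cS ?x yS T = B T - (if u \<in> T then 1 else 0)" if "T \<subseteq> A" for T
 proof -
  have "bs cS ?x yS T = (\<Sum>a\<in>T. (cS a + xS a - yS a) + (if a = u then - 1 else 0))" by (rule sum.cong) auto
  thus ?thesis using finite_subset[OF that fA] R(2)[OF that] by (simp add: sum.distrib)
 qed
 have "good {v'} 5 A m cS ?x yS"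
  unfolding good_def
 proof (intro conjI allI impI ballI)
  show "mg A m" by (rule mg_subset[OF G(1) AW])
  show "3 dvd sum cS A" using r by (simp add: rinst_def)
  show "0 \<le> ?x a" "0 \<le> yS a" if "a \<in> A" for a using r that u by (auto simp: rinst_def)
 next
  fix T assume T: "T \<noteq> {} \<and> T \<subset> A"
  hence TA: "T \<subseteq> A" and TW: "T \<subseteq> W" "T \<inter> F = {}" "T \<subset> W" using AW A by auto
  show "5 \<le> dg A m (es ?x yS) T" if "T \<inter> {v'} \<noteq> {}"
   unfolding dT[OF TA]
  proof (cases "2 \<le> card T")
   case True thus "5 \<le> D T - (if u \<in> T then 1 else 0)" using sub[of T] T by auto
  next
   case False
   hence "T = {v'}" using card2[of T] T TW that by auto
   thus "5 \<le> D T - (if u \<in> T then 1 else 0)" using five[of v'] v' TW by auto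
  qed
  show "tm (dg A m (es ?x yS) T) (bs cS ?x yS T)"
   unfolding dT[OF TA] bT[OF TA]
  proof (cases "2 \<le> card T")
   case True thus "tm (D T - (if u \<in> T then 1 else 0)) (B T - (if u \<in> T then 1 else 0))"
    using sub[of T] T by (intro tm_ge6) auto
  next
   case False
   then obtain t where t: "T = {t}" using card2[of T] T TW by auto
   thus "tm (D T - (if u \<in> T then 1 else 0)) (B T - (if u \<in> T then 1 else 0))"
    using u(3) tm1[of t] TW unfolding oo_def by (cases "t = u") auto
  qed
 qed
 moreover have sum6: "sum (es ?x yS) A = 6"
  using dT[of A] A u by (simp add: dg_all)
 hence "tipok {v'} 5 A cS ?x yS" using v' by (simp add: tipok_def)
 moreover have "vol A m ?x yS < vol W m x y"
 proof -
  have "sum (es xS yS) A = 7" using R(1)[of A] A by (simp add: dg_all)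
  hence "vol A m ?x yS < vol A m xS yS" unfolding vol_def sum6 by simp
  thus ?thesis using rinst_vol[OF g A(1) r] by linarith
 qed
 ultimately show ?thesis using IH by blast
qed

lemma raised_sums:
 assumes A: "A \<subseteq> W" "w \<in> A" "w \<notin> F" "D {w} = 5" and T: "T \<subseteq> A - {w}"
 shows "D (insert w T) = D T + 5 - 2 * sum (m w) T" "0 \<le> sum (m w) T"
  "t \<in> A ==> m w t = 0 \<or> m w t = 1"
proof -
 show "D (insert w T) = D T + 5 - 2 * sum (m w) T" using D_insert[of T w] A T by auto
 show "0 \<le> sum (m w) T" by (rule sum_nonneg, rule M(3)) (use A T in auto)
 show "t \<in> A ==> m w t = 0 \<or> m w t = 1" using simple[of w t] M(3)[of w t] A by force
qed

text \<open>The arcs from \<open>w\<close> to the tip are completed by directing all other edges at \<open>w\<close> away from it too.\<close>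

lemma small_raise:
 assumes A: "A \<subset> W" "A \<inter> F = {}" "2 \<le> card A" "D A = 7"
  and sub: "\<And>T. T \<subset> A ==> 2 \<le> card T ==> 8 \<le> D T"
  and r: "rinst W m c x y A cS xS yS" and w: "w \<in> A" "io w" "D {w} = 5" "yS w = 0" "1 \<le> xS w"
  and v': "2 \<le> xS w \<or> (\<exists>v'\<in>A - {w}. m w v' = 0)"
 shows "ext A m cS"
proof -
 have AW: "A \<subseteq> W" using A by auto
 have fA: "finite A" by (rule finite_subset[OF AW M(1)])
 note R = rinst_dg[OF M(1) AW r]
 note mgA = mg_subset[OF G(1) AW]
 have wW: "w \<in> W" "w \<notin> F" using w A by auto
 note rs = raised_sums[OF AW w(1) wW(2) w(3)]
 \<comment> \<open>With two tip arcs at \<open>w\<close>, removing \<open>w\<close> leaves a tip of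
   degree at most five, and no exceptional vertex is called for. With one, the tip has degree six; a
   vertex not adjacent to \<open>w\<close> keeps its degree of at least five and becomes
   exceptional.\<close>
 define F' where "F' = (if 2 \<le> xS w then {} else {SOME v'. v' \<in> A - {w} \<and> m w v' = 0})"
 have F': "F' = {} \<and> 2 \<le> xS w \<or> (\<exists>v'\<in>A - {w}. m w v' = 0 \<and> F' = {v'})"
  using v' someI_ex[of "\<lambda>v'. v' \<in> A - {w} \<and> m w v' = 0"] unfolding F'_def by auto
 let ?c = "\<lambda>u. cS u + m w u"
 have Sm: "sum (m w) A = 5 - xS w"
  using dg_single[OF mgA w(1), of "es xS yS"] R(1)[of "{w}"] w by simp
 have ww: "m w w = 0" using M(4) wW by blast
 have Sm': "sum (m w) (A - {w}) = 5 - xS w" using Sm ww sum.remove[OF fA w(1), of "m w"] by simp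
 \<comment> \<open>All five edges at \<open>w\<close> lead away from it, which fits because its
   boundary is -1, that is 5 modulo 3.\<close>
 have b5: "3 dvd B {w} + 1" using io_vals[OF wW w(2)] w(3) by auto
 have cw: "cS w = B {w} - xS w" using R(2)[of "{w}"] w by simp
 have dT: "dg (A - {w}) m (es xS yS) T = D T - sum (m w) T" if "T \<subseteq> A - {w}" for T
  using dg_remove[OF mgA w(1) that] R(1)[of T] that by auto
 have bT: "bs ?c xS yS T = B T + sum (m w) T" if "T \<subseteq> A - {w}" for T
 proof -
  have "bs ?c xS yS T = (\<Sum>a\<in>T. (cS a + xS a - yS a) + m w a)" by (rule sum.cong) auto
  moreover have "T \<subseteq> A" using that by auto
  ultimately show ?thesis using R(2)[of T] by (simp add: sum.distrib)
 qed
 have big: "6 \<le> D T - sum (m w) T" if T: "T \<subset> A - {w}" "2 \<le> card T" for T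
 proof -
  have "finite T" using fA T finite_subset[of T A] by auto
  moreover have "w \<notin> T" using T by blast
  ultimately have c: "card (insert w T) = Suc (card T)" by simp
  have "insert w T \<subset> A" "T \<subset> A" using T w by blast+
  hence "8 \<le> D T" "8 \<le> D (insert w T)" using sub[of T] sub[of "insert w T"] T c by auto
  moreover have "T \<subseteq> A - {w}" using T by auto
  ultimately show ?thesis using rs(1)[of T] by linarith
 qed
 have "good F' 5 (A - {w}) m ?c xS yS"
  unfolding good_def
 proof (intro conjI allI impI ballI)
  show "mg (A - {w}) m" by (rule mg_subset[OF mgA]) auto
  have "sum ?c (A - {w}) = sum cS A - cS w + (5 - xS w)"
   using sum.remove[OF fA w(1), of cS] by (simp add: sum.distrib Sm')
  moreover have "3 dvd sum cS A" using r by (simp add: rinst_def)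
  ultimately show "3 dvd sum ?c (A - {w})" using cw b5 by presburger
  show "0 \<le> xS a" "0 \<le> yS a" if "a \<in> A - {w}" for a using r that by (auto simp: rinst_def)
 next
  fix T assume T: "T \<noteq> {} \<and> T \<subset> A - {w}"
  hence TA: "T \<subseteq> A - {w}" and TW: "T \<subseteq> W" "T \<inter> F = {}" using AW A by auto
  show "5 \<le> dg (A - {w}) m (es xS yS) T" if TF: "T \<inter> F' \<noteq> {}"
   unfolding dT[OF TA]
  proof (cases "2 \<le> card T")
   case True thus "5 \<le> D T - sum (m w) T" using big[of T] T by auto
  next
   case False
   obtain v'' where v: "v'' \<in> A - {w}" "m w v'' = 0" "F' = {v''}" using F' TF by auto
   have "T = {v''}" using card2[of T] T TW TF v False by auto
   thus "5 \<le> D T - sum (m w) T" using five[of v''] v TW by auto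
  qed
  show "tm (dg (A - {w}) m (es xS yS) T) (bs ?c xS yS T)"
   unfolding dT[OF TA] bT[OF TA]
  proof (cases "2 \<le> card T")
   case True thus "tm (D T - sum (m w) T) (B T + sum (m w) T)"
    using big[of T] T by (intro tm_ge6) auto
  next
   case False
   then obtain t where t: "T = {t}" using card2[of T] T TW by auto
   have tt: "t \<in> W" "t \<notin> F" "t \<noteq> w" "t \<in> A" using t TA TW by auto
   show "tm (D T - sum (m w) T) (B T + sum (m w) T)"
   proof (cases "m w t = 0")
    case True thus ?thesis using tm1[OF tt(1,2)] t by simp
   next
    case False
    \<comment> \<open>The edge from \<open>w\<close> enters \<open>t\<close>, so \<open>t\<close>
      loses an incoming edge; this is covered by \<open>io t\<close>.\<close>
    hence "m w t = 1" using rs(3)[OF _ tt(4), of "{}"] by auto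
    moreover have "io t" using io_nbr[OF wW tt(1-3) _ w(2)] \<open>m w t = 1\<close> by auto
    ultimately show ?thesis using t by (simp add: io_def)
   qed
  qed
 qed
 moreover have s7: "sum (es xS yS) A = 7" using R(1)[of A] A by (simp add: dg_all)
 have s: "sum (es xS yS) (A - {w}) = 7 - xS w" using sum.remove[OF fA w(1), of "es xS yS"] s7 w by simp
 hence "tipok F' 5 (A - {w}) ?c xS yS" using F' w(5) unfolding tipok_def s by (auto simp: st_def)
 moreover have "vol (A - {w}) m xS yS < vol W m x y"
 proof -
  have "mass (A - {w}) m \<le> (\<Sum>a\<in>A - {w}. \<Sum>t\<in>A. m a t)"
   by (intro sum_mono sum_mono2) (use fA M(3) AW in auto)
  also have "\<dots> \<le> mass A m"
   by (intro sum_mono2) (use fA M(3) AW in \<open>auto intro!: sum_nonneg\<close>)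
  finally have "vol (A - {w}) m xS yS \<le> vol A m xS yS" unfolding vol_def s s7 using w fA
   by (simp add: card_Diff_singleton)
  thus ?thesis using rinst_vol[OF g A(1) r] by linarith
 qed
 ultimately obtain f where f: "flow (A - {w}) m ?c f" using IH unfolding ext_def by blast
 have "3 dvd (sum (m w) A) - cS w" unfolding Sm cw using b5 by presburger
 thus ?thesis using flow_raise[OF f mgA w(1)] unfolding ext_def by blast
qed

text \<open>By \<open>strong\<close>, sets of degree six and seven can occur for some boundaries
  only; here they are excluded altogether. The proper subsets of a smallest one are large, so one of
  its vertices can be made exceptional: with \<open>k = 5\<close> for degree six, with
  \<open>k = 6\<close> for degree seven if some vertex has degree six. If all its vertices have
  degree five, the directions of its tip arcs decide.\<close>

lemma big_sets:
 assumes "A \<subset> W" "A \<inter> F = {}" "2 \<le> card A"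
 shows "8 \<le> D A"
 using assms
proof (induction "card A" arbitrary: A rule: less_induct)
 case less
 note A = less.prems
 have AW: "A \<subseteq> W" using A by auto
 have fA: "finite A" by (rule finite_subset[OF AW M(1)])
 have sub: "8 \<le> D T" if "T \<subset> A" "2 \<le> card T" for T
  using less.hyps[of T] that A psubset_card_mono[OF fA] by blast
 have one: "T = {t} ==> t \<in> A ==> 5 \<le> D T" for T t using five[of t] A by auto
 show ?case
 proof (rule ccontr)
  assume n: "\<not> 8 \<le> D A"
  hence D67: "D A = 6 \<or> D A = 7" using strong(1)[OF A(1,3,2)] by (auto simp: st_def)
  show False
  proof (rule contr[OF A(1,3)])
   fix cS xS yS assume r: "rinst W m c x y A cS xS yS"
   note R = rinst_dg[OF M(1) AW r]
   have dA: "sum (es xS yS) A = D A" using R(1)[of A] by (simp add: dg_all)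
   have nn: "0 \<le> xS u" "0 \<le> yS u" if "u \<in> A" for u using r that by (auto simp: rinst_def)
   have E: "ext A m cS" if k: "v' \<in> A" "k' \<le> D {v'}" "k' \<le> 8" "D A \<le> k' + 1" for v' k'
   proof (rule IH)
    show "good {v'} k' A m cS xS yS"
    proof (rule rinst_good[OF g A(1) r])
     show "tm (D T) (B T)" if "T \<noteq> {}" "T \<subset> A" for T by (rule G(5)) (use that A in auto)
     show "k' \<le> D T" if T: "T \<noteq> {}" "T \<subset> A" "T \<inter> {v'} \<noteq> {}" for T
     proof (cases "2 \<le> card T")
      case True thus ?thesis using sub[OF T(2)] k by linarith
     next
      case False
      hence "T = {v'}" using card2[of T] T AW by auto
      thus ?thesis using k by simp
     qed
    qed
    show "tipok {v'} k' A cS xS yS" using k dA by (simp add: tipok_def)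
    show "vol A m xS yS < vol W m x y" by (rule rinst_vol[OF g A(1) r])
   qed
   show "ext A m cS"
   proof (cases "D A = 6")
    case True
    obtain v' where "v' \<in> A" using A by fastforce
    thus ?thesis using E[of v' 5] one True by auto
   next
    case False
    hence D7: "D A = 7" using D67 by auto
    interpret M: mincx F k W m "\<lambda>u. - c u" y x by (rule mirror)
    note r' = rinst_mirror[OF r]
    have sub': "\<And>T. T \<subset> A ==> 2 \<le> card T ==> 8 \<le> dg W m (es y x) T" unfolding es_comm[of y x] by (rule sub)
    have D7': "dg W m (es y x) A = 7" using D7 unfolding es_comm[of y x] .
    show ?thesis
    proof (cases "\<exists>u\<in>A. 6 \<le> D {u}")
     case True thus ?thesis using E[of _ 6] D7 by auto
    next
     case False
     hence D5: "D {u} = 5" if "u \<in> A" for u using one[of "{u}" u] that by force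
     show ?thesis
     proof (cases "\<exists>u\<in>A. 1 \<le> xS u \<and> oo u \<or> 1 \<le> yS u \<and> io u")
      case True
      then obtain u where u: "u \<in> A" "1 \<le> xS u \<and> oo u \<or> 1 \<le> yS u \<and> io u" by blast
      thus ?thesis
      proof (elim disjE)
       assume "1 \<le> xS u \<and> oo u"
       thus ?thesis using small_friendly[OF A D7 sub r u(1)] by blast
      next
       assume "1 \<le> yS u \<and> io u"
       hence "ext A m (\<lambda>u. - cS u)" using M.small_friendly[OF A D7' sub' r' u(1)] unfolding oo_mirror by blast
       thus ?thesis by (rule ext_mirror)
      qed
     next
      case unf: False
      \<comment> \<open>If no vertex carries two of the seven tip edges, \<open>A\<close> has at
        least seven vertices, too many for a vertex of degree five with a tip edge to be adjacent to
        all others.\<close>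
      have "\<exists>w\<in>A. 1 \<le> es xS yS w \<and> (2 \<le> es xS yS w \<or> (\<exists>v'\<in>A - {w}. m w v' = 0))"
      proof (cases "\<exists>w\<in>A. 2 \<le> es xS yS w")
       case True
       then obtain w where w: "w \<in> A" "2 \<le> es xS yS w" by blast
       moreover have "1 \<le> es xS yS w" using w(2) by linarith
       ultimately show ?thesis by blast
      next
       case False
       hence le1: "es xS yS w \<le> 1" if "w \<in> A" for w using that by force
       have "sum (es xS yS) A \<le> (\<Sum>w\<in>A. 1)" by (rule sum_mono) (use le1 in auto)
       hence c7: "7 \<le> card A" using dA D7 by simp
       obtain w where w: "w \<in> A" "es xS yS w \<noteq> 0"
       proof -
        have "\<exists>w\<in>A. es xS yS w \<noteq> 0"
        proof (rule ccontr)
         assume "\<not> ?thesis"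
         hence "sum (es xS yS) A = 0" by (intro sum.neutral) auto
         thus False using dA D7 by simp
        qed
        thus ?thesis using that by blast
       qed
       have w1: "1 \<le> es xS yS w" using w nn[OF w(1)] by simp
       have "\<exists>v'\<in>A - {w}. m w v' = 0"
       proof (rule ccontr)
        assume nv: "\<not> ?thesis"
        have "(\<Sum>t\<in>A - {w}. 1) \<le> sum (m w) (A - {w})"
        proof (rule sum_mono)
         fix t assume t: "t \<in> A - {w}"
         hence "m w t \<noteq> 0" "0 \<le> m w t" using nv M(3)[of w t] w AW by auto
         thus "1 \<le> m w t" by simp
        qed
        moreover have "card (A - {w}) = card A - 1" using w by (simp add: card_Diff_singleton)
        ultimately have "6 \<le> sum (m w) (A - {w})" using c7 by simp
        also have "\<dots> \<le> sum (m w) A" by (rule sum_mono2) (use fA M(3) w AW in auto)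
        also have "\<dots> \<le> sum (m w) W" by (rule sum_mono2) (use M w AW in auto)
        also have "\<dots> \<le> D {w}" using dg_single[OF G(1), of w "es x y"] w AW G(2,3)[of w] by auto
        finally show False using D5[OF w(1)] by simp
       qed
       thus ?thesis using w w1 by blast
      qed
      then obtain w where w: "w \<in> A" "1 \<le> es xS yS w" "2 \<le> es xS yS w \<or> (\<exists>v'\<in>A - {w}. m w v' = 0)" by blast
      have wW: "w \<in> W" "w \<notin> F" using w A by auto
      show ?thesis
      proof (cases "io w")
       case True
       hence "yS w = 0" using unf w nn[of w] by force
       thus ?thesis using small_raise[OF A D7 sub r w(1) True D5[OF w(1)]] w by auto
      next
       case False
       hence o: "oo w" using oo_or_io[OF wW] by blast
       hence x0: "xS w = 0" using unf w nn[of w] by force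
       have D5': "dg W m (es y x) {w} = 5" using D5[OF w(1)] unfolding es_comm[of y x] .
       have "M.io w" using o unfolding oo_mirror .
       hence "ext A m (\<lambda>u. - cS u)"
        using M.small_raise[OF A D7' sub' r' w(1) _ D5'] w x0 by auto
       thus ?thesis by (rule ext_mirror)
      qed
     qed
    qed
   qed
  qed
 qed
qed

end

section \<open>The case of an exceptional vertex\<close>

context mincx
begin

text \<open>The construction of \<open>small_raise\<close>, carried out on all of \<open>W\<close>.
  The exceptional vertex is joined to \<open>w\<close> at most once and the tip loses at least one
  edge, so \<open>k\<close> can be lowered by one.\<close>

lemma raise_final:
 assumes F: "F = {v}" and w: "w \<in> W" "w \<notin> F" "io w" "D {w} = 5" "y w = 0" "1 \<le> x w"
 shows False
proof -
 have vW: "v \<in> W" "d \<le> k + 1" using tip F by (auto simp: tipok_def)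
 note rs = raised_sums[OF order_refl w(1,2,4)]
 let ?c = "\<lambda>u. c u + m w u"
 have Sm: "sum (m w) W = 5 - x w" using dg_single[OF G(1) w(1), of "es x y"] w by simp
 have ww: "m w w = 0" using M(4) w by blast
 have Sm': "sum (m w) (W - {w}) = 5 - x w" using Sm ww sum.remove[OF M(1) w(1), of "m w"] by simp
 have b5: "3 dvd B {w} + 1" using io_vals[OF w(1-3)] w(4) by auto
 have cw: "c w = B {w} - x w" using w by simp
 have dT: "dg (W - {w}) m (es x y) T = D T - sum (m w) T" if "T \<subseteq> W - {w}" for T
  by (rule dg_remove[OF G(1) w(1) that])
 have bT: "bs ?c x y T = B T + sum (m w) T" for T
 proof -
  have "bs ?c x y T = (\<Sum>a\<in>T. (c a + x a - y a) + m w a)" by (rule sum.cong) auto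
  thus ?thesis by (simp add: sum.distrib)
 qed
 have c2: "2 \<le> card (insert w T)" if "2 \<le> card T" "T \<subset> W - {w}" for T
 proof -
  have "finite T" using that M(1) finite_subset[of T W] by auto
  hence "card T \<le> card (insert w T)" by (simp add: card_insert_le)
  thus ?thesis using that by linarith
 qed
 have "good F (k - 1) (W - {w}) m ?c x y"
  unfolding good_def
 proof (intro conjI allI impI ballI)
  show "mg (W - {w}) m" by (rule mg_subset[OF G(1)]) auto
  have "sum ?c (W - {w}) = sum c W - c w + (5 - x w)"
   using sum.remove[OF M(1) w(1), of c] by (simp add: sum.distrib Sm')
  thus "3 dvd sum ?c (W - {w})" using cw b5 G(4) by presburger
  show "0 \<le> x a" "0 \<le> y a" if "a \<in> W - {w}" for a using G(2,3) that by auto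
 next
  fix T assume T: "T \<noteq> {} \<and> T \<subset> W - {w}"
  hence TA: "T \<subseteq> W - {w}" and TW: "T \<subseteq> W" "T \<subset> W" "insert w T \<subset> W" using w by auto
  show "k - 1 \<le> dg (W - {w}) m (es x y) T" if TF: "T \<inter> F \<noteq> {}"
   unfolding dT[OF TA]
  proof (cases "2 \<le> card T")
   case True
   have "k + 2 \<le> D T" "k + 2 \<le> D (insert w T)" using strong(2)[OF TW(2) True TF] strong(2)[OF TW(3) c2[OF True]] T TF by auto
   thus "k - 1 \<le> D T - sum (m w) T" using rs(1)[OF TA] by linarith
  next
   case False
   hence Tv: "T = {v}" using card2[of T] T TW TF F by auto
   have "k \<le> D {v}" using G(6)[OF _ TW(2) TF] T Tv by auto
   moreover have "m w v \<le> 1" by (rule simple) (use w vW in auto)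
   ultimately show "k - 1 \<le> D T - sum (m w) T" using Tv by simp
  qed
  show "tm (dg (W - {w}) m (es x y) T) (bs ?c x y T)" if TF: "T \<inter> F = {}"
   unfolding dT[OF TA] bT
  proof (cases "2 \<le> card T")
   case True
   have "8 \<le> D T" "8 \<le> D (insert w T)" using big_sets[OF TW(2) TF True] big_sets[OF TW(3) _ c2[OF True]] T TF w by auto
   thus "tm (D T - sum (m w) T) (B T + sum (m w) T)" using rs(1)[OF TA] by (intro tm_ge6) linarith
  next
   case False
   then obtain t where t: "T = {t}" using card2[of T] T TW by auto
   have tt: "t \<in> W" "t \<notin> F" "t \<noteq> w" using t TA TW TF by auto
   show "tm (D T - sum (m w) T) (B T + sum (m w) T)"
   proof (cases "m w t = 0")
    case True thus ?thesis using tm1[OF tt(1,2)] t by simp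
   next
    case False
    hence "m w t = 1" using rs(3)[OF _ tt(1), of "{}"] by auto
    moreover have "io t" using io_nbr[OF w(1,2) tt _ w(3)] \<open>m w t = 1\<close> by auto
    ultimately show ?thesis using t by (simp add: io_def)
   qed
  qed
 qed
 moreover have s: "sum (es x y) (W - {w}) = d - x w" using sum.remove[OF M(1) w(1), of "es x y"] w by simp
 hence "tipok F (k - 1) (W - {w}) ?c x y" using F vW w unfolding tipok_def s by auto
 moreover have "vol (W - {w}) m x y < vol W m x y"
 proof -
  have "card (W - {w}) < card W" using w M(1) by (metis card_Diff1_less)
  thus ?thesis unfolding vol_def s using sumsum_sub[OF G(1), of w] w by linarith
 qed
 ultimately obtain f where f: "flow (W - {w}) m ?c f" using IH unfolding ext_def by blast
 have "3 dvd (sum (m w) W) - c w" unfolding Sm cw using b5 by presburger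
 thus False using flow_raise[OF f G(1) w(1)] nx unfolding ext_def by blast
qed

lemma special_io:
 assumes F: "F = {v}" and w: "w \<in> W" "w \<notin> F" "io w" "1 \<le> x w + y w"
 shows False
proof (cases "1 \<le> y w")
 case True thus False using delete_tip_y[of w] w F by auto
next
 case False
 hence y0: "y w = 0" "1 \<le> x w" using G(3)[OF w(1)] w(4) by auto
 consider "D {w} = 5" | "D {w} = 6" "3 dvd B {w} - 1" using io_vals[OF w(1-3)] by blast
 thus False
 proof cases
  case 1 thus False using raise_final[OF F w(1-3)] y0 by blast
 next
  case 2
  obtain t where t': "t \<in> W" "t \<notin> F" "t \<noteq> w" "1 \<le> m w t" using has_nbr[OF w(1,2)] by blast
  have it: "io t" using io_nbr[OF w(1,2) t' w(3)] by blast
  \<comment> \<open>Turning a tip arc around lowers the boundary by 2, and deleting an outgoing edge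
    lowers it by 1; together nothing changes modulo 3. So \<open>w\<close> ends at degree five with
    boundary 1 while the tip keeps its degree. Larger sets around \<open>w\<close> survive since
    they have degree at least eight.\<close>
  have a: "x w - 1 + (y w + 1) - (x w + y w) = 0" "x w - 1 - (y w + 1) - (x w - y w) = - 2" by auto
  have tm': "tm (D {w} + 0 - 1) (B {w} + - 2 - 1)" using 2 unfolding tm_def by presburger
  have bg: "\<forall>A\<subseteq>W - F. 2 \<le> card A \<longrightarrow> 8 \<le> D A"
  proof (intro allI impI)
   fix A assume "A \<subseteq> W - F" "2 \<le> card A"
   moreover have "v \<in> W" using tip F by (auto simp: tipok_def)
   ultimately show "8 \<le> D A" using F by (intro big_sets) auto
  qed
  have tp: "d + 0 \<le> k + 1" using tip F by (auto simp: tipok_def)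
  show False
   by (rule delete_edge_change_tip[of w t "x w - 1" "y w + 1", unfolded a])
    (use w t' it y0 tm' bg tp F in \<open>auto simp: io_def\<close>)
 qed
qed

lemma final_special:
 assumes F: "F = {v}"
 shows False
proof -
 have v: "v \<in> W" "d \<le> k + 1" using tip F by (auto simp: tipok_def)
 have e0: "0 \<le> es x y w" if "w \<in> W" for w using G(2,3)[OF that] by simp
 have "\<exists>w0\<in>W. w0 \<notin> F"
 proof (rule ccontr)
  assume "\<not> ?thesis"
  hence "W \<subseteq> {v}" using F by blast
  hence "card W \<le> 1" using card_mono[of "{v}" W] by simp
  thus False using card3 by simp
 qed
 then obtain w0 where w0: "w0 \<in> W" "w0 \<notin> F" by blast
 show False
 proof (cases "\<exists>w\<in>W. 1 \<le> es x y w")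
  case False
  hence z: "es x y w = 0" if "w \<in> W" for w using e0[OF that] that by force
  hence d0: "d = 0" by simp
  \<comment> \<open>Without tip edges a set around the exceptional vertex has the degree of its
    complement, hence at least 4. So \<open>k\<close> can be reset to 1, and a tip of degree zero
    may then receive two edges, as \<open>pair\<close> requires.\<close>
  have "good F 1 W m c x y"
   unfolding good_def
  proof (intro conjI allI impI ballI)
   fix A assume A: "A \<noteq> {} \<and> A \<subset> W"
   show "1 \<le> D A" if AF: "A \<inter> F \<noteq> {}"
   proof -
    have AW: "A \<subseteq> W" "W - (W - A) = A" using A by auto
    have "D A = (\<Sum>u\<in>A. \<Sum>t\<in>W - A. m u t)" unfolding dg_def by (rule sum.cong) (use z AW in auto)
    also have "\<dots> = (\<Sum>t\<in>W - A. \<Sum>u\<in>A. m u t)" by (rule sum.swap)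
    also have "\<dots> = D (W - A)" unfolding dg_def AW(2)
    proof (rule sum.cong[OF refl])
     fix t assume t: "t \<in> W - A"
     have "(\<Sum>u\<in>A. m u t) = sum (m t) A" by (rule sum.cong) (use M(2) t AW in auto)
     thus "(\<Sum>u\<in>A. m u t) = sum (m t) A + (x t + y t)" using z[of t] t by simp
    qed
    finally have "D A = D (W - A)" .
    moreover have "4 \<le> D (W - A)" by (rule tm_ge4, rule G(5)) (use A AF F in auto)
    ultimately show ?thesis by simp
   qed
  qed (use G in auto)
  moreover have "tipok F 1 W c x y" using F v d0 by (simp add: tipok_def)
  ultimately interpret N: mincx F 1 W m c x y using IH nx by unfold_locales
  show False using N.pair[OF w0] F d0 by simp
 next
  case True
  then obtain w where w: "w \<in> W" "1 \<le> x w + y w" by blast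
  have wF: "w \<notin> F"
  proof
   assume wF: "w \<in> F"
   have "\<not> 1 \<le> x w" "\<not> 1 \<le> y w" using delete_tip_arc_special[OF w(1) wF] delete_tip_y_special[OF w(1) wF] by blast+
   thus False using w by linarith
  qed
  show False
  proof (cases "io w")
   case True thus False using special_io[OF F w(1) wF] w by blast
  next
   case False
   hence o: "oo w" using oo_or_io w wF by blast
   interpret M: mincx F k W m "\<lambda>u. - c u" y x by (rule mirror)
   show False using M.special_io[OF F w(1) wF] w o unfolding oo_mirror by auto
  qed
 qed
qed

lemma impossible: False
 using final_empty final_special Fcases by blast

end

theorem tip_extension:
 assumes "good F k W m c x y" "tipok F k W c x y"
 shows "ext W m c"
 using assms
proof (induction "nat (vol W m x y)" arbitrary: F k W m c x y rule: less_induct)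
 case less
 show ?case
 proof (rule ccontr)
  assume nx: "\<not> ext W m c"
  have v0: "0 \<le> vol W' m' x' y'" if "good F' k' W' m' c' x' y'"
   for F' :: "'a set" and k' W' m' c' x' y'
   using that by (intro vol_nonneg) (auto simp: good_def)
  interpret mincx F k W m c x y
  proof
   fix F' :: "'a set" and k' W' m' c' x' y'
   assume h: "good F' k' W' m' c' x' y'" "tipok F' k' W' c' x' y'" "vol W' m' x' y' < vol W m x y"
   have "nat (vol W' m' x' y') < nat (vol W m x y)" using h(3) v0[OF h(1)] by linarith
   thus "ext W' m' c'" by (rule less.hyps) (rule h)+
  qed (use less.prems nx in auto)
  show False by (rule impossible)
 qed
qed

section \<open>Flows that both enter and leave a given vertex\<close>

definition nuext :: "'a set => ('a => 'a => int) => ('a => int) => ('a => int) => ('a => int) => 'a => bool" where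
 "nuext W m c x y v \<longleftrightarrow> (\<exists>f. flow W m c f \<and> 0 < x v + sum (f v) W \<and> 0 < y v + (\<Sum>t\<in>W. f t v))"

lemma nuext_mirror:
 assumes "nuext W m (\<lambda>u. - c u) y x v"
 shows "nuext W m c x y v"
proof -
 obtain f where f: "flow W m (\<lambda>u. - c u) f" "0 < y v + sum (f v) W" "0 < x v + (\<Sum>t\<in>W. f t v)"
  using assms unfolding nuext_def by blast
 note F = flowD[OF f(1)]
 have "flow W m c (\<lambda>u t. f t u)"
  unfolding flow_def
 proof (intro conjI ballI)
  fix u t assume "u \<in> W" "t \<in> W"
  thus "0 \<le> f t u" "f t u + f u t = m u t" using F(1)[of t u] F(2)[of u t] by auto
 next
  fix u assume "u \<in> W"
  hence "3 dvd (\<Sum>t\<in>W. f u t - f t u) - - c u" by (rule F(3))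
  thus "3 dvd (\<Sum>t\<in>W. f t u - f u t) - c u" unfolding sum_subtractf by presburger
 qed
 thus ?thesis unfolding nuext_def using f by blast
qed

lemma nuext_unlift:
 assumes "nuext W (lift m w a b) c x y v" "mg W m" "w \<in> W" "a \<in> W" "b \<in> W" "a \<noteq> w" "b \<noteq> w" "a \<noteq> b" "v \<noteq> w"
 shows "nuext W m c x y v"
proof -
 note M = mgD[OF assms(2)]
 obtain f where f: "flow W (madd (madd (madd m w a (- 1)) w b (- 1)) a b 1) c f"
  "0 < x v + sum (f v) W" "0 < y v + (\<Sum>t\<in>W. f t v)"
  using assms(1) unfolding nuext_def lift_def by auto
 have "0 \<le> m a b" using M(3) assms by auto
 then obtain p q where pq: "p = a \<and> q = b \<or> p = b \<and> q = a"
  "flow W m c (arcadd (arcadd (arcadd f p q (- 1)) p w 1) w q 1)" (is "flow W m c ?F")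
  using flow_unlift[OF f(1) M(1) assms(3-8)] by blast
 have "sum (?F v) W = sum (f v) W" "(\<Sum>t\<in>W. ?F t v) = (\<Sum>t\<in>W. f t v)"
  using pq(1) assms(3-9) unfolding sum_arcadd[OF M(1)] by auto
 thus ?thesis unfolding nuext_def using f pq(2) by (intro exI[of _ ?F] conjI) (simp_all only:)
qed

lemma nuext_isolated:
 assumes "nuext (W - {w}) m c x y v" "mg W m" "w \<in> W" "\<And>t. t \<in> W ==> m w t = 0" "3 dvd c w" "v \<noteq> w"
 shows "nuext W m c x y v"
proof -
 note M = mgD[OF assms(2)]
 obtain f where f: "flow (W - {w}) m c f"
  "0 < x v + sum (f v) (W - {w})" "0 < y v + (\<Sum>t\<in>W - {w}. f t v)"
  using assms(1) unfolding nuext_def by auto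
 let ?F = "\<lambda>s t. if s = w \<or> t = w then 0 else f s t"
 have "sum (?F v) W = sum (f v) (W - {w})" "(\<Sum>t\<in>W. ?F t v) = (\<Sum>t\<in>W - {w}. f t v)"
  using assms(6) by (auto simp: sum.remove[OF M(1) assms(3)] intro!: sum.cong)
 thus ?thesis unfolding nuext_def using f flow_add_isolated[OF f(1) assms(2-5)]
  by (intro exI[of _ ?F] conjI) (simp_all only:)
qed

lemma nuext_add_arc:
 assumes "nuext W (madd m u w (- 1)) (c(u := c u - 1, w := c w + 1)) x' y' v" "finite W" "u \<in> W" "w \<in> W" "u \<noteq> w"
  "x' v = x v + (if v = u then 1 else 0)" "y' v = y v + (if v = w then 1 else 0)"
 shows "nuext W m c x y v"
proof -
 obtain f where f: "flow W (madd m u w (- 1)) (c(u := c u - 1, w := c w + 1)) f"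
  "0 < x' v + sum (f v) W" "0 < y' v + (\<Sum>t\<in>W. f t v)"
  using assms(1) unfolding nuext_def by auto
 have "0 < x v + sum (arcadd f u w 1 v) W" "0 < y v + (\<Sum>t\<in>W. arcadd f u w 1 t v)"
  using f(2,3) assms(2-7) unfolding sum_arcadd[OF assms(2)] by (auto split: if_splits)
 thus ?thesis unfolding nuext_def using flow_add_arc[OF f(1) assms(2-5)] by blast
qed

lemma nuextI_arcs:
 assumes fl: "flow W m c f" and "finite W" "v \<in> W" "0 \<le> x v" "0 \<le> y v"
  and "0 < x v \<or> (\<exists>t\<in>W. 0 < f v t)" "0 < y v \<or> (\<exists>t\<in>W. 0 < f t v)"
 shows "nuext W m c x y v"
proof -
 note F = flowD[OF fl]
 have n: "0 \<le> sum (f v) W" "0 \<le> (\<Sum>t\<in>W. f t v)" using F(1) assms(3) by (auto intro!: sum_nonneg)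
 have p: "0 < sum (f v) W" if "t \<in> W" "0 < f v t" for t
  by (rule sum_pos2[of W t]) (use that F(1) assms(2,3) in auto)
 have q: "0 < (\<Sum>t\<in>W. f t v)" if "t \<in> W" "0 < f t v" for t
  by (rule sum_pos2[of W t]) (use that F(1) assms(2,3) in auto)
 have "0 < x v + sum (f v) W"
  using assms(6)
 proof
  assume "\<exists>t\<in>W. 0 < f v t" thus ?thesis using p assms(4) by fastforce
 qed (use n in linarith)
 moreover have "0 < y v + (\<Sum>t\<in>W. f t v)"
  using assms(7)
 proof
  assume "\<exists>t\<in>W. 0 < f t v" thus ?thesis using q assms(5) by fastforce
 qed (use n in linarith)
 ultimately show ?thesis unfolding nuext_def using fl by blast
qed

lemma rinst_ext_tight:
 assumes g: "good F k W m c x y" and S: "S \<subset> W" "S \<inter> F = {}" "\<not> st (dg W m (es x y) S) (bs c x y S)"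
  and r: "rinst W m c x y S cS xS yS"
 shows "ext S m cS"
proof (rule tip_extension)
 note G = goodD[OF g]
 show "good {} 0 S m cS xS yS"
  by (rule rinst_good[OF g S(1) r]; (rule G(5))?; use S in auto)
 show "tipok {} 0 S cS xS yS"
  using rinst_dg[OF mgD(1)[OF G(1)] _ r, of S] S by (auto simp: tipok_def dg_all)
qed

text \<open>The arcs at \<open>v\<close> are settled in the quotient, and filling in
  \<open>S\<close> does not touch them because \<open>v\<close> lies outside. The long list of
  hypotheses in \<open>IH\<close> lets two different inductions use this step.\<close>

lemma nuext_contract:
 assumes g: "good {v} k W m c x y" and v: "v \<in> W" "v \<notin> S" and S: "S \<subset> W" "2 \<le> card S"
  and R: "\<And>cS xS yS. rinst W m c x y S cS xS yS ==> ext S m cS"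
  and IH: "\<And>W' m' c' x' y'. good {v} k W' m' c' x' y' ==> v \<in> W' ==>
    sum (es x' y') W' = sum (es x y) W ==> sum x' W' = sum x W ==> sum y' W' = sum y W ==>
    dg W' m' (es x' y') {v} = dg W m (es x y) {v} ==> card W' < card W ==>
    vol W' m' x' y' < vol W m x y ==> nuext W' m' c' x' y' v"
 shows "nuext W m c x y v"
proof -
 note G = goodD[OF g] and M = mgD[OF goodD(1)[OF g]]
 have Sn: "S \<subseteq> W" "S \<noteq> {}" using S by auto
 obtain s where s: "s \<in> S" using Sn by blast
 define f where "f = (\<lambda>u. if u \<in> S then s else u)"
 have Fs: "{v} \<inter> S \<subseteq> {s}" "s \<in> {v} \<or> {v} \<inter> S = {}" using v by auto
 note Q = quot_good[OF g Sn(1) s f_def Fs]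
 note C = contract_dims[OF G(1) Sn(1) s f_def]
 have vf: "v \<in> f ` W" "{u \<in> W. f u \<in> {v}} = {v}" "fib W f v = {v}" using v s by (auto simp: f_def fib_def)
 have e: "es (qs W f x) (qs W f y) = qs W f (es x y)" by (simp add: fun_eq_iff qs_def sum.distrib)
 have "dg (f ` W) (qm W f m) (es (qs W f x) (qs W f y)) {v} = dg W m (es x y) {v}"
  unfolding e using qdg[OF M(1), of "{v}" f m "es x y"] vf by simp
 moreover have "card (f ` W) < card W" using C(2,3) S(2) by linarith
 ultimately have "nuext (f ` W) (qm W f m) (qs W f c) (qs W f x) (qs W f y) v"
  using IH[OF Q(1) vf(1) Q(2)] quot_vol[OF g Sn(1) s S(2) f_def] by (simp add: sum_qs_all[OF M(1)])
 then obtain h where h: "flow (f ` W) (qm W f m) (qs W f c) h"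
  "0 < x v + sum (h v) (f ` W)" "0 < y v + (\<Sum>t\<in>f ` W. h t v)"
  unfolding nuext_def by (auto simp: qs_def vf(3))
 obtain xo yo cS where o: "\<forall>u\<in>S. 0 \<le> xo u \<and> 0 \<le> yo u \<and> xo u + yo u = sum (m u) (W - S) \<and> cS u = c u - xo u + yo u"
  "3 dvd sum cS S" "\<And>h'. flow S m cS h' ==> \<exists>F. flow W m c F \<and>
    (\<forall>u\<in>W - S. sum (F u) W = sum (h u) (f ` W) \<and> (\<Sum>t\<in>W. F t u) = (\<Sum>t\<in>f ` W. h t u))"
  using contract_glue[OF G(1) Sn(1) s f_def h(1)] by blast
 have "rinst W m c x y S cS (\<lambda>u. x u + xo u) (\<lambda>u. y u + yo u)"
  unfolding rinst_def using o G(2,3) Sn by auto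
 then obtain h' where "flow S m cS h'" using R unfolding ext_def by blast
 then obtain F where F: "flow W m c F"
    "\<forall>u\<in>W - S. sum (F u) W = sum (h u) (f ` W) \<and> (\<Sum>t\<in>W. F t u) = (\<Sum>t\<in>f ` W. h t u)"
  using o(3) by blast
 have "v \<in> W - S" using v by simp
 thus ?thesis unfolding nuext_def using F h by metis
qed

lemma card2_iff': "finite A ==> A \<noteq> {} ==> (\<exists>a. A = {a}) \<or> 2 \<le> card A"
proof -
 assume A: "finite A" "A \<noteq> {}"
 hence "card A \<noteq> 0" by simp
 then consider "card A = 1" | "2 \<le> card A" by linarith
 thus ?thesis by cases (auto simp: card_1_singleton_iff)
qed

text \<open>A lift of a pair of edges at \<open>v\<close> lowers the degrees of the sets containing \<open>v\<close> by at most two,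
 and forces the flow to both enter and leave \<open>v\<close>.\<close>

lemma nuext_via_tip_x:
 assumes g: "good {v} k W m c x y" and v: "v \<in> W" and d: "sum (es x y) W \<le> k - 1"
  and s: "\<And>S. S \<subset> W ==> v \<notin> S ==> 2 \<le> card S ==> st (dg W m (es x y) S) (bs c x y S)"
  and u: "u \<in> W" "u \<noteq> v" "1 \<le> m v u" and x: "1 \<le> x v"
 shows "nuext W m c x y v"
proof -
 note G = goodD[OF g] and M = mgD[OF goodD(1)[OF g]]
 \<comment> \<open>The path from \<open>u\<close> through \<open>v\<close> to the tip is shortened
   to a tip arc at \<open>u\<close>; restored, it contains an arc into \<open>v\<close> and an arc
   out of it.\<close>
 let ?m = "madd m u v (- 1)" and ?c = "c(u := c u - 1, v := c v + 1)" and ?x = "x(v := x v - 1, u := x u + 1)"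
 have e: "(\<Sum>a\<in>A. es ?x y a - es x y a) = (if u \<in> A then 1 else 0) - (if v \<in> A then 1 else 0)" if "A \<subseteq> W" for A
 proof -
  have "(\<Sum>a\<in>A. es ?x y a - es x y a) = (\<Sum>a\<in>A. (if a = u then 1 else 0) - (if a = v then 1 else 0))"
   by (rule sum.cong) (use u(2) in auto)
  thus ?thesis using finite_subset[OF that M(1)] by (simp add: sum_subtractf)
 qed
 have dA: "dg W ?m (es ?x y) A = dg W m (es x y) A - (if v \<in> A \<and> u \<notin> A then 2 else 0)" if "A \<subseteq> W" for A
  using dg_madd[OF M(1) that u(1) v u(2), of m "- 1" "es ?x y"] dg_tips[of W m "es ?x y" A "es x y"] e[OF that] by auto
 have bA: "bs ?c ?x y A = bs c x y A" for A by (rule sum.cong) (use u(2) in auto)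
 have cW: "sum ?c W = sum c W"
 proof -
  have "sum ?c W = (\<Sum>a\<in>W. c a + ((if a = u then - 1 else 0) + (if a = v then 1 else 0)))"
   by (rule sum.cong) (use u(2) in auto)
  thus ?thesis using M(1) u v by (simp add: sum.distrib)
 qed
 have "sum (es ?x y) W - sum (es x y) W = (\<Sum>a\<in>W. es ?x y a - es x y a)" by (rule sum_subtractf[symmetric])
 hence eW: "sum (es ?x y) W = sum (es x y) W" using e[of W] u v by simp
 have "ext W ?m ?c"
 proof (rule tip_extension)
  show "good {v} (k - 2) W ?m ?c ?x y"
   unfolding good_def
  proof (intro conjI allI impI ballI)
   show "mg W ?m" by (rule mg_madd[OF G(1) u(2)]) (use u v M(2)[of u v] in auto)
   show "0 \<le> ?x a" "0 \<le> y a" if "a \<in> W" for a using G(2,3)[OF that] x G(2)[OF u(1)] by auto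
   show "3 dvd sum ?c W" unfolding cW by (rule G(4))
  next
   fix A assume A: "A \<noteq> {} \<and> A \<subset> W"
   hence As: "A \<subseteq> W" by auto
   show "k - 2 \<le> dg W ?m (es ?x y) A" if "A \<inter> {v} \<noteq> {}" unfolding dA[OF As] using G(6)[of A] A that by auto
   show "tm (dg W ?m (es ?x y) A) (bs ?c ?x y A)" if "A \<inter> {v} = {}"
    unfolding dA[OF As] bA using G(5)[of A] A that by auto
  qed
  show "tipok {v} (k - 2) W ?c ?x y" unfolding tipok_def eW using v d by auto
 qed
 then obtain f where f: "flow W ?m ?c f" unfolding ext_def by blast
 have "0 < arcadd f u v 1 u v" using flowD(1)[OF f u(1) v] by (simp add: arcadd_def)
 thus ?thesis using flow_add_arc[OF f M(1) u(1) v u(2)] M(1) v G(2,3)[OF v] x u(1) by (intro nuextI_arcs) auto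
qed

text \<open>A tip of degree at most \<open>k - 1\<close> lets the sets around \<open>v\<close> drop
  by two. So one arc into \<open>v\<close> and one arc out of \<open>v\<close> can be set aside and
  returned afterwards, whatever the flow in between does.\<close>

lemma nonuniform_extension_small:
 assumes "good {v} k W m c x y" "v \<in> W" "sum (es x y) W \<le> k - 1" "2 \<le> sum (es x y) W" "6 \<le> k"
  "k \<le> dg W m (es x y) {v}"
 shows "nuext W m c x y v"
 using assms
proof (induction "card W" arbitrary: W m c x y rule: less_induct)
 case less
 note g = less.prems(1) and v = less.prems(2) and d = less.prems(3,4) and k = less.prems(5) and Dk = less.prems(6)
 note G = goodD[OF g] and M = mgD[OF goodD(1)[OF g]]
 let ?D = "dg W m (es x y)"
 show ?case
 proof (cases "\<exists>S. S \<subset> W \<and> v \<notin> S \<and> 2 \<le> card S \<and> \<not> st (?D S) (bs c x y S)")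
  case True
  then obtain S where S: "S \<subset> W" "v \<notin> S" "2 \<le> card S" "\<not> st (?D S) (bs c x y S)" by blast
  show ?thesis
  proof (rule nuext_contract[OF g v S(2,1,3)])
   show "ext S m cS" if "rinst W m c x y S cS xS yS" for cS xS yS
    by (rule rinst_ext_tight[OF g S(1) _ S(4) that]) (use S in auto)
   show "nuext W' m' c' x' y' v"
    if "good {v} k W' m' c' x' y'" "v \<in> W'" "sum (es x' y') W' = sum (es x y) W"
     "dg W' m' (es x' y') {v} = ?D {v}" "card W' < card W" for W' m' c' x' y'
    by (rule less.hyps[OF that(5,1,2)]) (use that d k Dk in auto)
  qed
 next
  case False
  hence s: "\<And>S. S \<subset> W ==> v \<notin> S ==> 2 \<le> card S ==> st (?D S) (bs c x y S)" by blast
  have Dv: "?D {v} = sum (m v) W + (x v + y v)" by (rule dg_single[OF G(1) v])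
  have "x v + y v \<le> sum (es x y) W"
   using sum_mono2[of W "{v}" "es x y"] M(1) v G(2,3) by auto
  hence "0 < sum (m v) W" using Dv Dk d by linarith
  then obtain u where u: "u \<in> W" "m v u \<noteq> 0" by (metis less_irrefl sum.neutral)
  hence u1: "1 \<le> m v u" "u \<noteq> v" using M(3)[OF v u(1)] M(4)[OF v] by auto
  \<comment> \<open>The possible partners of an edge \<open>vu\<close>: a tip arc of either
    direction, an edge to another vertex, or, failing these, a parallel edge.\<close>
  consider "1 \<le> x v" | "1 \<le> y v" | u' where "u' \<in> W" "u' \<noteq> u" "1 \<le> m v u'"
   | "x v = 0" "y v = 0" "\<And>t. t \<in> W ==> t \<noteq> u ==> m v t = 0"
   using G(2,3)[OF v] M(3)[OF v] by (metis dual_order.antisym int_one_le_iff_zero_less not_le)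
  thus ?thesis
  proof cases
   case 1 thus ?thesis using nuext_via_tip_x[OF g v d(1) s u(1) u1(2,1)] by blast
  next
   case 2
   have "nuext W m (\<lambda>u. - c u) y x v"
    by (rule nuext_via_tip_x[OF good_mirror[OF g] v _ _ u(1) u1(2,1) 2])
     (use d s in \<open>simp_all only: es_comm[of y x] bs_neg st_neg\<close>)
   thus ?thesis by (rule nuext_mirror)
  next
   case (3 u')
   have d3: "u' \<noteq> v" using 3 M(4)[OF v] by auto
   note L = lift_facts[OF G(1) v u(1) 3(1) u1(2) d3 3(2)[symmetric] u1(1) 3(3)]
   have "ext W (lift m v u u') c"
   proof (rule tip_extension)
    show "good {v} (k - 2) W (lift m v u u') c x y"
     unfolding good_def
    proof (intro conjI allI impI ballI)
     fix A assume A: "A \<noteq> {} \<and> A \<subset> W"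
     hence As: "A \<subseteq> W" "finite A" using M(1) finite_subset by auto
     show "k - 2 \<le> dg W (lift m v u u') (es x y) A" if "A \<inter> {v} \<noteq> {}" unfolding L(2)[OF As(1)] using G(6)[of A] A that by auto
     show "tm (dg W (lift m v u u') (es x y) A) (bs c x y A)" if vA: "A \<inter> {v} = {}"
     proof (cases "u \<in> A \<and> u' \<in> A")
      case True
      have "2 \<le> card A" using card_mono[of A "{u, u'}"] True 3(2) As by auto
      thus ?thesis unfolding L(2)[OF As(1)] using st_tm2[OF s[of A]] A vA True by auto
     next
      case False
      thus ?thesis unfolding L(2)[OF As(1)] using G(5)[of A] A vA by auto
     qed
    qed (use L(1) G in auto)
    show "tipok {v} (k - 2) W c x y" unfolding tipok_def using v d by auto
   qed
   then obtain f where f: "flow W (madd (madd (madd m v u (- 1)) v u' (- 1)) u u' 1) c f" unfolding ext_def lift_def by blast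
   obtain p q where pq: "p = u \<and> q = u' \<or> p = u' \<and> q = u"
    "flow W m c (arcadd (arcadd (arcadd f p q (- 1)) p v 1) v q 1)" (is "flow W m c ?F")
    using flow_unlift[OF f M(1) v u(1) 3(1) u1(2) d3 3(2)[symmetric] M(3)[OF u(1) 3(1)]] by blast
   have "p \<in> W" "q \<in> W" "p \<noteq> v" "q \<noteq> v" "p \<noteq> q" using pq(1) u u1 3 d3 by auto
   hence "0 < ?F p v" "0 < ?F v q" using flowD(1)[OF f, of p v] flowD(1)[OF f, of v q] v by (auto simp: arcadd_def)
   thus ?thesis using pq(2) M(1) v G(2,3)[OF v] \<open>p \<in> W\<close> \<open>q \<in> W\<close> by (intro nuextI_arcs) auto
  next
   case 4
   have "sum (m v) W = m v u + sum (m v) (W - {u})" by (rule sum.remove[OF M(1) u(1)])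
   also have "sum (m v) (W - {u}) = 0" by (rule sum.neutral) (use 4 in auto)
   finally have mvu: "m v u = ?D {v}" "6 \<le> m v u" using Dv 4 Dk k by auto
   have vu: "?D {v, u} = ?D {u} - ?D {v}"
    using dg_insert[OF G(1), of "{u}" v "es x y"] u u1 v mvu by simp
   \<comment> \<open>All edges at \<open>v\<close> end in \<open>u\<close>, which gives
     \<open>u\<close> enough degree to lose two of them in opposite directions.\<close>
   have Du: "8 \<le> ?D {u}"
   proof (cases "{v, u} = W")
    case True
    hence "?D {u} = sum (es x y) W + ?D {v}" using vu dg_all[of W m "es x y"] by simp
    thus ?thesis using d Dk k by linarith
   next
    case False
    hence "k \<le> ?D {v, u}" using G(6)[of "{v, u}"] v u by auto
    thus ?thesis using vu Dk k by linarith
   qed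
   let ?m = "madd m u v (- 2)"
   have muv: "m u v = m v u" using M(2) u v by auto
   have dA: "dg W ?m (es x y) A = ?D A - (if (u \<in> A) \<noteq> (v \<in> A) then 2 else 0)" if "A \<subseteq> W" for A
    using dg_madd[OF M(1) that u(1) v u1(2), of m "- 2" "es x y"] by auto
   have "ext W ?m c"
   proof (rule tip_extension)
    show "good {v} (k - 2) W ?m c x y"
     unfolding good_def
    proof (intro conjI allI impI ballI)
     show "mg W ?m" by (rule mg_madd[OF G(1) u1(2)]) (use mvu muv in auto)
    next
     fix A assume A: "A \<noteq> {} \<and> A \<subset> W"
     hence As: "A \<subseteq> W" "finite A" using M(1) finite_subset by auto
     show "k - 2 \<le> dg W ?m (es x y) A" if "A \<inter> {v} \<noteq> {}" unfolding dA[OF As(1)] using G(6)[of A] A that by auto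
     show "tm (dg W ?m (es x y) A) (bs c x y A)" if vA: "A \<inter> {v} = {}"
     proof (cases "2 \<le> card A")
      case True
      hence "st (?D A) (bs c x y A)" using s[of A] A vA by auto
      thus ?thesis unfolding dA[OF As(1)] using st_tm2 st_tm vA by auto
     next
      case False
      then obtain a where "A = {a}" using card2_iff'[OF As(2)] A by auto
      thus ?thesis unfolding dA[OF As(1)] using G(5)[of A] A vA Du by (auto simp: tm_def)
     qed
    qed (use G in auto)
    show "tipok {v} (k - 2) W c x y" unfolding tipok_def using v d by auto
   qed
   then obtain f where f: "flow W ?m c f" unfolding ext_def by blast
   note F = flowD[OF f]
   let ?F = "arcadd (arcadd f u v 1) v u 1"
   have "flow W m c ?F"
    unfolding flow_def
   proof (intro conjI ballI)
    fix a b assume ab: "a \<in> W" "b \<in> W"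
    show "0 \<le> ?F a b" using F(1)[OF ab] by (simp add: arcadd_apply)
    define P where "P \<longleftrightarrow> a = u \<and> b = v \<or> a = v \<and> b = u"
    have P': "a = v \<and> b = u \<or> a = u \<and> b = v \<longleftrightarrow> P" by (auto simp: P_def)
    have "f a b + f b a = m a b + (if P then - 2 else 0)" using F(2)[OF ab] unfolding madd_apply P_def .
    moreover have "?F a b + ?F b a = f a b + f b a + (if P then 1 else 0) + (if P then 1 else 0)"
     unfolding arcadd_sym[OF u1(2)[symmetric], of "arcadd f u v 1"] arcadd_sym[OF u1(2), of f] P' P_def[symmetric] ..
    ultimately show "?F a b + ?F b a = m a b" by (cases P) simp_all
   next
    fix a assume a: "a \<in> W"
    show "3 dvd (\<Sum>t\<in>W. ?F a t - ?F t a) - c a"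
     using F(3)[OF a] u v unfolding sum_subtractf sum_arcadd[OF M(1)] by auto
   qed
   moreover have "0 < ?F u v" "0 < ?F v u" using F(1)[OF u(1) v] F(1)[OF v u(1)] u1 by (auto simp: arcadd_def)
   ultimately show ?thesis using M(1) v G(2,3)[OF v] u(1) by (intro nuextI_arcs) auto
  qed
 qed
qed

section \<open>A minimal counterexample to nonuniform extension\<close>

lemma dg_submod:
 assumes "mg W m" "A \<subseteq> W" "C \<subseteq> W"
 shows "dg W m e (A \<inter> C) + dg W m e (A \<union> C) \<le> dg W m e A + dg W m e C"
proof -
 note M = mgD[OF assms(1)]
 have fin: "finite A" "finite C" using M(1) assms finite_subset by blast+
 define X where "X = A - C" define Y where "Y = C - A" define I where "I = A \<inter> C"
 have sets: "A = X \<union> I" "C = Y \<union> I" "A \<union> C = X \<union> Y \<union> I" and dis: "X \<inter> I = {}" "Y \<inter> I = {}" "X \<inter> Y = {}"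
  by (auto simp: X_def Y_def I_def)
 have f: "finite X" "finite Y" "finite I" using fin by (auto simp: X_def Y_def I_def)
 have sW: "X \<subseteq> W" "Y \<subseteq> W" "I \<subseteq> W" using assms by (auto simp: X_def Y_def I_def)
 have sA: "sum h A = sum h X + sum h I" for h :: "'a => int"
  unfolding sets(1) by (rule sum.union_disjoint[OF f(1,3) dis(1)])
 have sC: "sum h C = sum h Y + sum h I" for h :: "'a => int"
  unfolding sets(2) by (rule sum.union_disjoint[OF f(2,3) dis(2)])
 have sU: "sum h (A \<union> C) = sum h X + sum h Y + sum h I" for h :: "'a => int"
 proof -
  have "sum h (X \<union> Y \<union> I) = sum h (X \<union> Y) + sum h I"
   by (rule sum.union_disjoint) (use f dis in auto)
  thus ?thesis unfolding sets(3) using sum.union_disjoint[OF f(1,2) dis(3)] by simp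
 qed
 have n: "0 \<le> (\<Sum>u\<in>X. \<Sum>t\<in>Y. m u t)" "0 \<le> (\<Sum>u\<in>Y. \<Sum>t\<in>X. m u t)" using M(3) sW by (auto intro!: sum_nonneg)
 have "dg W m e I + dg W m e (A \<union> C) + (\<Sum>u\<in>X. \<Sum>t\<in>Y. m u t) + (\<Sum>u\<in>Y. \<Sum>t\<in>X. m u t) = dg W m e A + dg W m e C"
  using assms sW by (simp add: dg_alt[OF assms(1)] sA sC sU sum.distrib)
 thus ?thesis using n unfolding I_def by linarith
qed

text \<open>The tip degree is now exactly \<open>k\<close>, one more than
  \<open>nonuniform_extension_small\<close> permits. In return the tip has arcs of both directions,
  by \<open>px\<close> and \<open>py\<close>.\<close>

locale nucx =
 fixes v :: 'a and k :: int and W :: "'a set" and m :: "'a => 'a => int" and c x y :: "'a => int"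
 assumes g: "good {v} k W m c x y" and v: "v \<in> W" and dk: "sum (es x y) W = k" and Dk: "k \<le> dg W m (es x y) {v}"
  and px: "0 < sum x W" and py: "0 < sum y W" and k6: "6 \<le> k"
  and IH: "\<And>(v' :: 'a) k' W' m' c' x' y'. good {v'} k' W' m' c' x' y' ==> v' \<in> W' ==> sum (es x' y') W' = k' ==>
    k' \<le> dg W' m' (es x' y') {v'} ==> 0 < sum x' W' ==> 0 < sum y' W' ==> 6 \<le> k' ==>
    vol W' m' x' y' < vol W m x y ==> nuext W' m' c' x' y' v'"
  and nx: "\<not> nuext W m c x y v"
begin

abbreviation D :: "'a set => int" where "D A \<equiv> dg W m (es x y) A"
abbreviation B :: "'a set => int" where "B A \<equiv> bs c x y A"

lemmas G = goodD[OF g]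
lemmas M = mgD[OF goodD(1)[OF g]]

lemma mirror: "nucx v k W m (\<lambda>u. - c u) y x"
proof
 show "good {v} k W m (\<lambda>u. - c u) y x" by (rule good_mirror[OF g])
 show "\<not> nuext W m (\<lambda>u. - c u) y x v" using nx nuext_mirror[of W m c y x v] by blast
 show "sum (es y x) W = k" "k \<le> dg W m (es y x) {v}" unfolding es_comm[of y x] by (rule dk, rule Dk)
 show "\<And>(v' :: 'a) k' W' m' c' x' y'. good {v'} k' W' m' c' x' y' ==> v' \<in> W' ==> sum (es x' y') W' = k' ==>
    k' \<le> dg W' m' (es x' y') {v'} ==> 0 < sum x' W' ==> 0 < sum y' W' ==> 6 \<le> k' ==>
    vol W' m' x' y' < vol W m y x ==> nuext W' m' c' x' y' v'" unfolding vol_mirror[of W m y x] by (rule IH)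
qed (use v px py k6 in auto)

lemma contr:
 assumes S: "S \<subset> W" "v \<notin> S" "2 \<le> card S" and R: "\<And>cS xS yS. rinst W m c x y S cS xS yS ==> ext S m cS"
 shows False
proof -
 have "nuext W m c x y v"
 proof (rule nuext_contract[OF g v S(2,1,3) R])
  fix W' m' c' x' y'
  assume a: "good {v} k W' m' c' x' y'" "v \<in> W'" "sum (es x' y') W' = sum (es x y) W" "sum x' W' = sum x W" "sum y' W' = sum y W"
    "dg W' m' (es x' y') {v} = dg W m (es x y) {v}" "vol W' m' x' y' < vol W m x y"
  show "nuext W' m' c' x' y' v" by (rule IH[OF a(1,2) _ _ _ _ k6 a(7)]) (use a dk Dk px py in auto)
 qed
 thus False using nx by blast
qed

lemma strong:
 assumes S: "S \<subset> W" "v \<notin> S" "2 \<le> card S"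
 shows "st (D S) (B S)"
proof (rule ccontr)
 assume n: "\<not> st (D S) (B S)"
 show False by (rule contr[OF S], rule rinst_ext_tight[OF g S(1) _ n]) (use S in auto)
qed

text \<open>A set \<open>S\<close> around \<open>v\<close> of degree exactly \<open>k\<close> is
  treated by induction twice. Contracted into a vertex it receives a flow that is not uniform around
  \<open>S\<close>; the restriction to \<open>S\<close> then has tip arcs of both directions, as the
  second use requires.\<close>

lemma strong_v:
 assumes S: "S \<subset> W" "v \<in> S" "2 \<le> card S"
 shows "k + 1 \<le> D S"
proof (rule ccontr)
 assume n: "\<not> k + 1 \<le> D S"
 have Sn: "S \<subseteq> W" using S by auto
 have DS: "D S = k" using n G(6)[of S] S by fastforce
 define f where "f = (\<lambda>u. if u \<in> S then v else u)"
 have Fs: "{v} \<inter> S \<subseteq> {v}" "v \<in> {v} \<or> {v} \<inter> S = {}" by auto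
 note Q = quot_good[OF g Sn S(2) f_def Fs]
 note C = contract_dims[OF G(1) Sn S(2) f_def]
 have vf: "v \<in> f ` W" "{u \<in> W. f u \<in> {v}} = S" "fib W f v = S" using v S by (auto simp: f_def fib_def)
 have e: "es (qs W f x) (qs W f y) = qs W f (es x y)" by (simp add: fun_eq_iff qs_def sum.distrib)
 have "dg (f ` W) (qm W f m) (es (qs W f x) (qs W f y)) {v} = k"
  unfolding e using qdg[OF M(1), of "{v}" f m "es x y"] vf DS by simp
 hence "nuext (f ` W) (qm W f m) (qs W f c) (qs W f x) (qs W f y) v"
  using IH[OF Q(1) vf(1)] Q(2) quot_vol[OF g Sn S(2,3) f_def] dk px py k6 by (simp add: sum_qs_all[OF M(1)])
 then obtain h where h: "flow (f ` W) (qm W f m) (qs W f c) h"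
  "0 < sum x S + sum (h v) (f ` W)" "0 < sum y S + (\<Sum>t\<in>f ` W. h t v)"
  unfolding nuext_def by (auto simp: qs_def vf(3))
 obtain xo yo cS where o: "\<forall>u\<in>S. 0 \<le> xo u \<and> 0 \<le> yo u \<and> xo u + yo u = sum (m u) (W - S) \<and> cS u = c u - xo u + yo u"
  "sum xo S = sum (h v) (f ` W)" "sum yo S = (\<Sum>j\<in>f ` W. h j v)"
  "3 dvd sum cS S" "\<And>h'. flow S m cS h' ==> \<exists>F. flow W m c F \<and>
    (\<forall>u\<in>S. sum (F u) W = sum (h' u) S + xo u \<and> (\<Sum>t\<in>W. F t u) = (\<Sum>t\<in>S. h' t u) + yo u)"
  using contract_glue[OF G(1) Sn S(2) f_def h(1)] by blast
 let ?xS = "\<lambda>u. x u + xo u" and ?yS = "\<lambda>u. y u + yo u"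
 have r: "rinst W m c x y S cS ?xS ?yS"
  unfolding rinst_def using o G(2,3) Sn by auto
 have gS: "good {v} k S m cS ?xS ?yS"
  by (rule rinst_good[OF g S(1) r]; (rule G(5) | rule G(6)); use S in auto)
 note R = rinst_dg[OF M(1) Sn r]
 have "nuext S m cS ?xS ?yS v"
 proof (rule IH[OF gS S(2)])
  show "sum (es ?xS ?yS) S = k" using R(1)[of S] DS by (simp add: dg_all)
  show "k \<le> dg S m (es ?xS ?yS) {v}" using R(1)[of "{v}"] S Dk by simp
  show "0 < sum ?xS S" "0 < sum ?yS S" using h o by (simp_all add: sum.distrib)
 qed (use k6 rinst_vol[OF g S(1) r] in auto)
 then obtain h' where h': "flow S m cS h'" "0 < ?xS v + sum (h' v) S" "0 < ?yS v + (\<Sum>t\<in>S. h' t v)"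
  unfolding nuext_def by blast
 then obtain F where "flow W m c F" "sum (F v) W = sum (h' v) S + xo v" "(\<Sum>t\<in>W. F t v) = (\<Sum>t\<in>S. h' t v) + yo v"
  using o(5) S(2) by blast
 hence "nuext W m c x y v" unfolding nuext_def using h' by (intro exI[of _ F]) auto
 thus False using nx by blast
qed

lemma cardA: "A \<noteq> {} ==> A \<subseteq> W ==> (\<exists>a. A = {a}) \<or> 2 \<le> card A"
 using card2_iff'[of A] finite_subset[OF _ M(1)] by blast

text \<open>If \<open>v\<close> has larger degree, then \<open>k + 1\<close> bounds all sets around
  \<open>v\<close>, and the tip has degree one less than that.\<close>

lemma Dv: "D {v} = k"
proof (rule ccontr)
 assume "D {v} \<noteq> k"
 hence d: "k + 1 \<le> D {v}" using Dk by linarith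
 have "good {v} (k + 1) W m c x y"
  unfolding good_def
 proof (intro conjI allI impI ballI)
  fix A assume A: "A \<noteq> {} \<and> A \<subset> W"
  hence AW: "A \<subseteq> W" by auto
  show "k + 1 \<le> D A" if vA: "A \<inter> {v} \<noteq> {}"
  proof (cases "2 \<le> card A")
   case True thus ?thesis using strong_v[of A] A vA by auto
  next
   case False
   hence "A = {v}" using cardA[of A] A AW vA by auto
   thus ?thesis using d by simp
  qed
 qed (use G in auto)
 hence "nuext W m c x y v" by (rule nonuniform_extension_small) (use v dk k6 d in auto)
 thus False using nx by blast
qed

lemma simple:
 assumes "u \<in> W" "t \<in> W" "u \<noteq> v" "t \<noteq> v"
 shows "m u t \<le> 1"
proof (rule ccontr)
 assume n: "\<not> m u t \<le> 1"
 hence ne: "u \<noteq> t" using M(4) assms by auto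
 have E: "ext {u, t} m c'" if "3 dvd sum c' {u, t}" for c'
  by (rule two_ext) (use n ne assms that mg_subset[OF G(1), of "{u, t}"] in auto)
 show False
  by (rule contr[of "{u, t}"]) (use assms v ne E in \<open>auto simp: rinst_def\<close>)
qed

lemma D_insert: "A \<subseteq> W ==> w \<in> W ==> w \<notin> A ==> D (insert w A) = D A + D {w} - 2 * sum (m w) A"
 by (rule dg_insert[OF G(1)])

lemma D_compl: "w \<in> W ==> D (W - {w}) = k + D {w} - 2 * x w - 2 * y w"
proof -
 assume w: "w \<in> W"
 have "sum (m w) (W - {w}) = sum (m w) W" using sum.remove[OF M(1) w, of "m w"] M(4)[OF w] by simp
 hence "sum (m w) (W - {w}) = D {w} - (x w + y w)" using dg_single[OF G(1) w, of "es x y"] by simp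
 moreover have "D W = D (W - {w}) + D {w} - 2 * sum (m w) (W - {w})"
  using D_insert[of "W - {w}" w] w by (simp add: insert_absorb)
 ultimately show ?thesis using dk by (simp add: dg_all)
qed

lemma v_nonneg: "0 \<le> x v" "0 \<le> y v" using G(2,3) v by auto

text \<open>The case of three vertices including the tip is settled by choosing the number of edges from
 \<open>v\<close> to \<open>w\<close>.\<close>

lemma not_two: "W \<noteq> {v, w}"
proof
 assume W: "W = {v, w}"
 show False
 proof (cases "v = w")
  case True
  hence "W = {v}" using W by simp
  hence "flow W m c (\<lambda>_ _. 0)" using G(4) M(4)[OF v] by (auto simp: flow_def)
  hence "nuext W m c x y v" unfolding nuext_def using px py \<open>W = {v}\<close> by (intro exI[of _ "\<lambda>_ _. 0"]) auto
  thus False using nx by blast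
 next
  case ne: False
  define n where "n = m v w"
  have n0: "0 \<le> n" "m w v = n" using M(2,3)[of v w] W by (auto simp: n_def)
  have Dvn: "n + (x v + y v) = k" using dg_single[OF G(1) v, of "es x y"] Dv W ne M(4)[OF v] by (simp add: n_def)
  have ew: "(x v + y v) + (x w + y w) = k" using dk W ne by simp
  have Dw: "D {w} = 2 * n" using dg_single[OF G(1), of w "es x y"] W ne M(4)[of w] n0 Dvn ew by simp
  have tw: "tm (D {w}) (B {w})" by (rule G(5)) (use W ne in auto)
  have cs: "3 dvd c v + c w" using G(4) W ne by simp
  have pp: "0 < x v + x w" "0 < y v + y w" using px py W ne by auto
  have wn: "0 \<le> x w" "0 \<le> y w" using G(2,3) W by auto
  have "\<exists>j. 0 \<le> j \<and> j \<le> n \<and> 3 dvd 2 * j - n - c v \<and> 0 < x v + j \<and> 0 < y v + (n - j)"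
  proof -
   \<comment> \<open>\<open>r\<close> is the residue forced on the number of arcs from
     \<open>v\<close> to \<open>w\<close>. The extreme values 0 and \<open>n\<close> are acceptable
     only if a tip arc at \<open>v\<close> has the missing direction.\<close>
   define r where "r = (2 * (c v + n)) mod 3"
   have r: "3 dvd 2 * r - n - c v" "0 \<le> r" "r \<le> 2" unfolding r_def by presburger+
   consider "4 \<le> n" | "n = 3" | "n = 2" using tw Dw unfolding tm_def by linarith
   thus ?thesis
   proof cases
    case 1
    thus ?thesis using r v_nonneg by (intro exI[of _ "if r = 0 then 3 else r"]) (auto, presburger)
   next
    case 2
    have "1 \<le> x v \<or> 1 \<le> y v" using Dvn 2 k6 by linarith
    thus ?thesis using r v_nonneg 2
     by (intro exI[of _ "if r = 0 then (if 1 \<le> x v then 0 else 3) else r"]) (auto, presburger)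
   next
    case 3
    \<comment> \<open>Here \<open>w\<close> has degree four, boundary zero and two tip arcs. If both
      edges between \<open>v\<close> and \<open>w\<close> had the same direction, the tip arcs at
      \<open>w\<close> would agree as well, and \<open>px\<close> or \<open>py\<close> would supply
      the missing direction at \<open>v\<close>.\<close>
    have b: "3 dvd c w + x w - y w" using tw Dw 3 by (simp add: tm_def)
    have "x w + y w = 2" using Dvn ew 3 by linarith
    hence c: "r = 0 ==> 0 < x v" "r = 2 ==> 0 < y v"
     using r(1) b cs pp 3 wn v_nonneg by presburger+
    have "r = 0 \<or> r = 1 \<or> r = 2" using r by linarith
    thus ?thesis using r v_nonneg 3 c by (intro exI[of _ r]) auto
   qed
  qed
  then obtain j where j: "0 \<le> j" "j \<le> n" "3 dvd 2 * j - n - c v" "0 < x v + j" "0 < y v + (n - j)" by blast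
  define f where "f a b = (if a = v \<and> b = w then j else if a = w \<and> b = v then n - j else 0)" for a b
  have "3 dvd (n - 2 * j) - c w" using j(3) cs by presburger
  hence "flow W m c f" unfolding flow_def f_def W using ne j n0 M(4) W by (auto simp: algebra_simps n_def)
  moreover have "sum (f v) W = j" "(\<Sum>t\<in>W. f t v) = n - j" using W ne by (auto simp: f_def)
  ultimately have "nuext W m c x y v" unfolding nuext_def using j by (intro exI[of _ f]) auto
  thus False using nx by blast
 qed
qed

lemma card3: "3 \<le> card W"
proof (rule ccontr)
 assume n: "\<not> 3 \<le> card W"
 have "card (W - {v}) = card W - 1" using v by (rule card_Diff_singleton)
 hence "card (W - {v}) \<le> 1" using n by simp
 hence e: "\<And>a b. a \<in> W - {v} ==> b \<in> W - {v} ==> a = b" using card_le_Suc0_iff_eq[of "W - {v}"] M(1) by auto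
 have "\<exists>w. W - {v} \<subseteq> {w}"
 proof (cases "W - {v} = {}")
  case False
  then obtain w where "w \<in> W - {v}" by blast
  thus ?thesis using e by blast
 qed blast
 then obtain w where "W - {v} \<subseteq> {w}" by blast
 hence "W = {v, w} \<or> W = {v, v}" using v by auto
 thus False using not_two by blast
qed

lemma compl_proper: "w \<in> W ==> W - {w} \<subset> W \<and> 2 \<le> card (W - {w})"
proof -
 assume w: "w \<in> W"
 have "card (W - {w}) = card W - 1" using w by (rule card_Diff_singleton)
 thus ?thesis using card3 w by auto
qed

lemma tm1: "w \<in> W ==> w \<noteq> v ==> tm (D {w}) (B {w})"
 using v by (intro G(5)) auto

text \<open>Uncrossing shows that the vertices other than \<open>v\<close> form a connected graph.\<close>

lemma connected_rest:
 assumes A: "A \<noteq> {}" "A \<subset> W - {v}"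
 shows "\<exists>u\<in>A. \<exists>t\<in>W - {v} - A. 1 \<le> m u t"
proof (rule ccontr)
 assume n: "\<not> ?thesis"
 let ?C = "W - {v} - A"
 have AW: "A \<subseteq> W" "v \<notin> A" "?C \<subseteq> W" using A by auto
 have fA: "finite A" "finite ?C" using AW M(1) finite_subset by auto
 have z: "m u t = 0" if "u \<in> A" "t \<in> ?C" for u t
 proof -
  have "0 \<le> m u t" "\<not> 1 \<le> m u t" using n that M(3)[of u t] AW by auto
  thus ?thesis by linarith
 qed
 have "W - A = insert v ?C" "W - ?C = insert v A" using A v by auto
 hence sA: "sum (m u) (W - A) = m u v + sum (m u) (?C)" "sum (m u) (W - ?C) = m u v + sum (m u) A" for u
  using fA AW by auto
 have "D A = (\<Sum>u\<in>A. m v u + es x y u)" unfolding dg_def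
 proof (rule sum.cong[OF refl])
  fix u assume u: "u \<in> A"
  have "sum (m u) (?C) = 0" using z u by (intro sum.neutral) auto
  thus "sum (m u) (W - A) + (x u + y u) = m v u + (x u + y u)" unfolding sA(1) using M(2)[of u v] u AW v by auto
 qed
 moreover have "D ?C = (\<Sum>u\<in>?C. m v u + es x y u)" unfolding dg_def
 proof (rule sum.cong[OF refl])
  fix u assume u: "u \<in> ?C"
  have "sum (m u) A = 0"
  proof (rule sum.neutral, intro ballI)
   fix t assume t: "t \<in> A"
   have "m u t = m t u" using M(2)[of u t] t u AW by auto
   thus "m u t = 0" using z[OF t u] by simp
  qed
  thus "sum (m u) (W - ?C) + (x u + y u) = m v u + (x u + y u)" unfolding sA(2) using M(2)[of u v] u v by auto
 qed
 ultimately have DD: "D A = sum (m v) A + sum (es x y) A" "D ?C = sum (m v) (?C) + sum (es x y) ?C"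
  by (simp_all add: sum.distrib)
 have i: "D (insert v A) = D A + k - 2 * sum (m v) A" "D (insert v ?C) = D ?C + k - 2 * sum (m v) (?C)"
  using D_insert[of A v] D_insert[of ?C v] AW v Dv by auto
 have WW: "W = insert v (A \<union> ?C)" using A v by auto
 have sW: "sum h W = h v + (sum h A + sum h ?C)" for h :: "'a => int"
 proof -
  have "sum h W = sum h (insert v (A \<union> ?C))" using WW by simp
  also have "\<dots> = h v + sum h (A \<union> ?C)" using fA AW by simp
  also have "sum h (A \<union> ?C) = sum h A + sum h ?C" using fA by (intro sum.union_disjoint) auto
  finally show ?thesis .
 qed
 have "sum (m v) W + (x v + y v) = k" using dg_single[OF G(1) v, of "es x y"] Dv by simp
 hence s1: "sum (m v) A + sum (m v) (?C) + (x v + y v) = k" using sW[of "m v"] M(4)[OF v] by simp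
 have s2: "(x v + y v) + (sum (es x y) A + sum (es x y) ?C) = k" using dk sW[of "es x y"] by simp
 \<comment> \<open>If no edges join the two sides, the excesses over \<open>k\<close> of their
   unions with \<open>v\<close> sum to zero, so they cannot both be positive.\<close>
 have "k + 1 \<le> D (insert v A)" "k + 1 \<le> D (insert v ?C)"
 proof -
  have "card A \<noteq> 0" "card ?C \<noteq> 0" using A fA by auto
  moreover have "card (insert v A) = Suc (card A)" "card (insert v ?C) = Suc (card ?C)"
   using AW fA by (simp_all del: Diff_insert0)
  ultimately have c: "2 \<le> card (insert v A)" and c': "2 \<le> card (insert v ?C)" by linarith+
  show "k + 1 \<le> D (insert v A)" by (rule strong_v) (use c A v in auto)
  show "k + 1 \<le> D (insert v ?C)" by (rule strong_v) (use c' A v in auto)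
 qed
 thus False using i s1 s2 DD by linarith
qed

end

section \<open>Degree-four vertices and deletable edges around the exceptional vertex\<close>

context nucx
begin

lemma reduce_remove:
 assumes w: "w \<in> W" "w \<noteq> v" "D {w} = 4" and q: "mg (W - {w}) m2" "\<And>u. u \<in> W ==> 0 \<le> x2 u \<and> 0 \<le> y u" "3 dvd sum c2 (W - {w})"
  and dB: "\<And>A. A \<subseteq> W - {w} ==> dg (W - {w}) m2 (es x2 y) A = D A - \<delta> A \<and> bs c2 x2 y A = B A"
  and del: "\<And>A. A \<subseteq> W - {w} ==> \<delta> A = 0 \<or> \<delta> A = 2 \<and> 2 \<le> card A \<or> D (insert w A) = D A - \<delta> A \<and> 2 \<le> card A"
  and delv: "\<And>A. A \<subset> W - {w} ==> v \<in> A ==> k \<le> D A - \<delta> A"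
  and tot: "sum (es x2 y) (W - {w}) = k" "0 < sum x2 (W - {w})" "0 < sum y (W - {w})"
  and vl: "mass (W - {w}) m2 \<le> mass W m"
 shows "nuext (W - {w}) m2 c2 x2 y v"
proof (rule IH[OF _ _ tot(1) _ tot(2,3) k6])
 have b: "3 dvd B {w}" using tm1[OF w(1,2)] w(3) unfolding tm_def by presburger
 show vW: "v \<in> W - {w}" using v w by auto
 have "\<delta> {v} = 0" using del[of "{v}"] vW by auto
 thus "k \<le> dg (W - {w}) m2 (es x2 y) {v}" using dB[of "{v}"] vW Dk by auto
 have wv: "w \<notin> {v}" using w(2) by simp
 show "good {v} k (W - {w}) m2 c2 x2 y"
  by (rule reduce_good[OF g w(1) wv b _ q dB del]) (use strong delv in auto)
 have "card (W - {w}) < card W" using w M(1) by (metis card_Diff1_less)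
 thus "vol (W - {w}) m2 x2 y < vol W m x y" unfolding vol_def tot dk using vl by linarith
qed

lemmas card_ge2 = two_le_card[OF M(1)]

text \<open>The hypothesis \<open>ok\<close> isolates the only obstruction to the lifts: sets around
  \<open>v\<close>, whose surplus over \<open>k\<close> may be smaller than two.\<close>

lemma four_nbrs_split:
 assumes w: "w \<in> W" "w \<noteq> v" "D {w} = 4" and e0: "x w = 0" "y w = 0"
  and i: "a \<in> W" "b' \<in> W" "p \<in> W" "q \<in> W" "a \<noteq> w" "b' \<noteq> w" "p \<noteq> w" "q \<noteq> w"
  and N: "a \<noteq> b'" "a \<noteq> p" "a \<noteq> q" "b' \<noteq> p" "b' \<noteq> q" "p \<noteq> q"
  and m01: "\<And>t. t \<in> W ==> m w t = (if t \<in> {a, b', p, q} then 1 else 0)"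
  and Di: "\<And>A. A \<subseteq> W - {w} ==> D (insert w A) = D A + 4 - 2 * int (card ({a, b', p, q} \<inter> A))"
  and ok: "\<And>A. A \<subset> W - {w} ==> v \<in> A ==> k \<le> D A - (lifted a b' A + lifted p q A)"
 shows False
proof -
 have b: "3 dvd B {w}" using tm1[OF w(1,2)] w(3) unfolding tm_def by presburger
 note L = lift_four[OF G(1) w(1) i N m01]
 have "nuext (W - {w}) (lift (lift m w a b') w p q) c x y v"
 proof (rule reduce_remove[OF w, of _ x c "\<lambda>A. lifted a b' A + lifted p q A"])
  show "mg (W - {w}) (lift (lift m w a b') w p q)" by (rule mg_subset[OF L(2)]) auto
  show "3 dvd sum c (W - {w})" using G(4) b e0 sum.remove[OF M(1) w(1), of c] by simp presburger
  show "sum (es x y) (W - {w}) = k" using sum.remove[OF M(1) w(1), of "es x y"] e0 dk by simp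
  show "0 < sum x (W - {w})" "0 < sum y (W - {w})"
   using sum.remove[OF M(1) w(1), of x] sum.remove[OF M(1) w(1), of y] e0 px py by simp_all
  show "lifted a b' A + lifted p q A = 0 \<or> lifted a b' A + lifted p q A = 2 \<and> 2 \<le> card A \<or>
   D (insert w A) = D A - (lifted a b' A + lifted p q A) \<and> 2 \<le> card A" if "A \<subseteq> W - {w}" for A
   by (rule lifted_four_cases[OF M(1) that N]) (use Di[OF that] in simp)
 qed (use L(4,5) G(2,3) ok in auto)
 hence "nuext W (lift (lift m w a b') w p q) c x y v" using nuext_isolated[OF _ L(2) w(1) L(3)] b e0 w by simp
 hence "nuext W m c x y v"
  using nuext_unlift[OF _ L(1) w(1) i(3,4,7,8) N(6) w(2)[symmetric]] nuext_unlift[OF _ G(1) w(1) i(1,2,5,6) N(1) w(2)[symmetric]] by blast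
 thus False using nx by blast
qed

lemma three_nbrs_split:
 assumes w: "w \<in> W" "w \<noteq> v" "D {w} = 4" and e1: "x w = 1" "y w = 0"
  and i: "a \<in> W" "b' \<in> W" "p \<in> W" "a \<noteq> w" "b' \<noteq> w" "p \<noteq> w"
  and N: "a \<noteq> b'" "a \<noteq> p" "b' \<noteq> p"
  and m01: "\<And>t. t \<in> W ==> m w t = (if t \<in> {a, b', p} then 1 else 0)"
  and ok: "\<And>A. A \<subset> W - {w} ==> v \<in> A ==> k \<le> D A - lifted a b' A"
 shows False
proof -
 have b: "3 dvd B {w}" using tm1[OF w(1,2)] w(3) unfolding tm_def by presburger
 note L = lift_three[OF G(1) w(1) i N m01 e1 G(4) b]
 let ?c = "c(p := c p - 1, w := c w + 1)" and ?x = "x(p := x p + 1)"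
 have "nuext (W - {w}) (madd (lift m w a b') p w (- 1)) ?c ?x y v"
 proof (rule reduce_remove[OF w, of _ ?x ?c "lifted a b'"])
  show "mg (W - {w}) (madd (lift m w a b') p w (- 1))" by (rule mg_subset[OF L(2)]) auto
  show "sum (es ?x y) (W - {w}) = k" using L(7,8) dk by (simp add: sum.distrib del: fun_upd_apply)
  show "0 < sum ?x (W - {w})" "0 < sum y (W - {w})" using L(7,8) px py by (simp_all del: fun_upd_apply)
  show "lifted a b' A = 0 \<or> lifted a b' A = 2 \<and> 2 \<le> card A \<or> D (insert w A) = D A - lifted a b' A \<and> 2 \<le> card A"
   if "A \<subseteq> W - {w}" for A
   using card_ge2[of A a b'] N that by (auto simp: lifted_def)
 qed (use L(4,5,6) G(2,3) ok in auto)
 hence "nuext W (madd (lift m w a b') p w (- 1)) ?c ?x y v" using nuext_isolated[OF _ L(2) w(1) L(3)] b e1 w by simp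
 hence "nuext W (lift m w a b') c x y v" by (rule nuext_add_arc[OF _ M(1) i(3) w(1) i(6)]) (use w in auto)
 hence "nuext W m c x y v" using nuext_unlift[OF _ G(1) w(1) i(1,2,4,5) N(1) w(2)[symmetric]] by blast
 thus False using nx by blast
qed

text \<open>A lift is blocked by a set around \<open>v\<close> of degree at most
  \<open>k + 1\<close> that contains a lifted pair but not the remaining neighbours. Two different
  choices of pairs yield two blocking sets, and uncrossing them makes union and intersection too
  large in total.\<close>

lemma four_absent_y0:
 assumes w: "w \<in> W" "w \<noteq> v" "D {w} = 4" and y0: "y w = 0"
 shows False
proof -
 have e1: "x w \<le> 1"
  using strong_v[of "W - {w}"] compl_proper[OF w(1)] D_compl[OF w(1)] v w y0 by auto
 \<comment> \<open>Only edges at \<open>v\<close> could still be parallel; two edges between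
   \<open>v\<close> and \<open>w\<close> would give \<open>{v, w}\<close> degree at most
   \<open>k\<close>.\<close>
 have vw: "m w v \<le> 1"
 proof -
  have "{v, w} \<noteq> W" using not_two by blast
  hence "k + 1 \<le> D {v, w}" by (intro strong_v) (use v w card_ge2[of "{v, w}" v w] in auto)
  moreover have "D {v, w} = D {v} + 4 - 2 * m w v" using D_insert[of "{v}" w] v w by (simp add: insert_commute)
  ultimately show ?thesis using Dv by linarith
 qed
 have "m w t \<le> 1" if "t \<in> W" for t using simple[OF w(1) that w(2)] vw by auto
 note simple_neighbours[OF G(1) w(1) this, of "es x y"]
 then obtain N where NW: "N \<subseteq> W" "w \<notin> N" and m01: "\<And>t. t \<in> W ==> m w t = (if t \<in> N then 1 else 0)"
  and cN: "int (card N) = D {w} - es x y w"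
  and Di: "\<And>A. A \<subseteq> W - {w} ==> D (insert w A) = D A + D {w} - 2 * int (card (N \<inter> A))"
  by blast
 note cN = cN[unfolded w(3) y0] and Di = Di[unfolded w(3)]
 have kA: "k \<le> D (insert w A)" if "A \<subset> W - {w}" "v \<in> A" for A
  by (rule G(6)) (use that w in auto)
 have kU: "D U + D I \<le> 2 * k + 2" if "A1 \<subset> W" "A2 \<subset> W" "D A1 \<le> k + 1" "D A2 \<le> k + 1" "U = A1 \<union> A2" "I = A1 \<inter> A2" for A1 A2 U I
  using dg_submod[OF G(1), of A1 A2 "es x y"] that by auto
 consider "x w = 0" | "x w = 1" using e1 G(2)[OF w(1)] by linarith
 thus False
 proof cases
  case 1
  hence "card N = 4" using cN by simp
  then obtain a b' p q where N: "N = {a, b', p, q}" "a \<noteq> b'" "a \<noteq> p" "a \<noteq> q" "b' \<noteq> p" "b' \<noteq> q" "p \<noteq> q"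
   by (rule card_4_obtain)
  have i: "a \<in> W" "b' \<in> W" "p \<in> W" "q \<in> W" "a \<noteq> w" "b' \<noteq> w" "p \<noteq> w" "q \<noteq> w" using N NW by auto
  have bad: "\<exists>A. A \<subset> W - {w} \<and> v \<in> A \<and> (N \<inter> A = {s, t} \<or> N \<inter> A = {s', t'}) \<and> D A \<le> k + 1"
   if P: "N = {s, t, s', t'}" "s \<noteq> t" "s \<noteq> s'" "s \<noteq> t'" "t \<noteq> s'" "t \<noteq> t'" "s' \<noteq> t'" for s t s' t'
  proof (rule ccontr)
   assume nb: "\<not> ?thesis"
   have ist: "s \<in> W" "t \<in> W" "s' \<in> W" "t' \<in> W" "s \<noteq> w" "t \<noteq> w" "s' \<noteq> w" "t' \<noteq> w" using P NW by auto
   show False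
   proof (rule four_nbrs_split[OF w 1 y0 ist P(2-7)])
    show "m w u = (if u \<in> {s, t, s', t'} then 1 else 0)" if "u \<in> W" for u using m01[OF that] P(1) by simp
    show "D (insert w A) = D A + 4 - 2 * int (card ({s, t, s', t'} \<inter> A))" if "A \<subseteq> W - {w}" for A using Di[OF that] P(1) by simp
   next
    fix A assume A: "A \<subset> W - {w}" "v \<in> A"
    have Ds: "k \<le> D A + 4 - 2 * int (card (N \<inter> A))" using Di[of A] kA[OF A] A by auto
    have DA: "k \<le> D A" by (rule G(6)) (use A in auto)
    have nA: "N \<inter> A = {s, t} \<or> N \<inter> A = {s', t'} ==> k + 2 \<le> D A" using nb A by fastforce
    show "k \<le> D A - (lifted s t A + lifted s' t' A)"
     unfolding lifted_def using Ds DA nA P by (cases "s \<in> A"; cases "t \<in> A"; cases "s' \<in> A"; cases "t' \<in> A") (simp_all add: Int_insert_left)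
   qed
  qed
  obtain A1 where A1: "A1 \<subset> W - {w}" "v \<in> A1" "N \<inter> A1 = {a, b'} \<or> N \<inter> A1 = {p, q}" "D A1 \<le> k + 1"
   using bad[OF N] by blast
  have N': "N = {a, p, b', q}" using N by auto
  obtain A2 where A2: "A2 \<subset> W - {w}" "v \<in> A2" "N \<inter> A2 = {a, p} \<or> N \<inter> A2 = {b', q}" "D A2 \<le> k + 1"
   using bad[OF N'] N by blast
  have NU: "N \<inter> (A1 \<union> A2) = (N \<inter> A1) \<union> (N \<inter> A2)" by auto
  \<comment> \<open>Pairs taken from different pairings share exactly one neighbour, so the union of
    the two blocking sets contains three of the four.\<close>
  have cs: "card ({a, b'} \<union> {a, p}) = 3" "card ({a, b'} \<union> {b', q}) = 3" "card ({p, q} \<union> {a, p}) = 3" "card ({p, q} \<union> {b', q}) = 3"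
   using N(2-7) N(2-7)[symmetric] by (simp_all add: card_insert_if)
  have c3: "card (N \<inter> (A1 \<union> A2)) = 3"
   using A1(3)
  proof
   assume e1: "N \<inter> A1 = {a, b'}"
   show ?thesis using A2(3) by (rule disjE) (simp_all only: NU e1 cs)
  next
   assume e1: "N \<inter> A1 = {p, q}"
   show ?thesis using A2(3) by (rule disjE) (simp_all only: NU e1 cs)
  qed
  have nN: "\<not> N \<subseteq> A1 \<union> A2"
  proof
   assume "N \<subseteq> A1 \<union> A2"
   hence "N \<inter> (A1 \<union> A2) = N" by blast
   thus False using c3 \<open>card N = 4\<close> by simp
  qed
  have U2: "A1 \<union> A2 \<subseteq> W - {w}" using A1(1) A2(1) by blast
  have U1: "insert w (A1 \<union> A2) \<subset> W"
  proof -
   obtain n where "n \<in> N" "n \<notin> A1 \<union> A2" using nN by blast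
   hence "n \<in> W" "n \<notin> insert w (A1 \<union> A2)" using NW by auto
   thus ?thesis using U2 w(1) by blast
  qed
  have "2 \<le> card (insert w (A1 \<union> A2))" by (rule card_ge2[of _ v w]) (use A1(2) w(2) U1 in auto)
  hence "k + 1 \<le> D (insert w (A1 \<union> A2))" by (intro strong_v U1) (use A1(2) in auto)
  hence k3: "k + 3 \<le> D (A1 \<union> A2)" using Di[OF U2] c3 by simp
  have W12: "A1 \<subset> W" "A2 \<subset> W" using A1(1) A2(1) by auto
  have "k \<le> D (A1 \<inter> A2)" by (rule G(6)) (use A1(2) A2(2) W12 in auto)
  thus False using kU[OF W12 A1(4) A2(4) refl refl] k3 by linarith
 next
  case 2
  hence "card N = 3" using cN by simp
  then obtain a b' p where N: "N = {a, b', p}" "a \<noteq> b'" "b' \<noteq> p" "a \<noteq> p" using card_3_iff[of N] by blast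
  have bad: "\<exists>A. A \<subset> W - {w} \<and> v \<in> A \<and> s \<in> A \<and> t \<in> A \<and> s' \<notin> A \<and> D A \<le> k + 1"
   if P: "N = {s, t, s'}" "s \<noteq> t" "s \<noteq> s'" "t \<noteq> s'" for s t s'
  proof (rule ccontr)
   assume nb: "\<not> ?thesis"
   have ist: "s \<in> W" "t \<in> W" "s' \<in> W" "s \<noteq> w" "t \<noteq> w" "s' \<noteq> w" using P NW by auto
   show False
   proof (rule three_nbrs_split[OF w 2 y0 ist P(2-4)])
    show "m w u = (if u \<in> {s, t, s'} then 1 else 0)" if "u \<in> W" for u using m01[OF that] P(1) by simp
   next
    fix A assume A: "A \<subset> W - {w}" "v \<in> A"
    have Ds: "k \<le> D A + 4 - 2 * int (card (N \<inter> A))" using Di[of A] kA[OF A] A by auto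
    have DA: "k \<le> D A" by (rule G(6)) (use A in auto)
    have nA: "s \<in> A ==> t \<in> A ==> s' \<notin> A ==> k + 2 \<le> D A" using nb A by fastforce
    show "k \<le> D A - lifted s t A"
     unfolding lifted_def using Ds DA nA P by (cases "s \<in> A"; cases "t \<in> A"; cases "s' \<in> A") (simp_all add: Int_insert_left)
   qed
  qed
  \<comment> \<open>If \<open>v\<close> were a neighbour of \<open>w\<close>, lifting the other two
    edges could only be blocked by a set that avoids \<open>v\<close>, whereas blocking sets contain
    it.\<close>
  have nv: "v \<notin> N"
  proof
   assume "v \<in> N"
   then consider "v = a" | "v = b'" | "v = p" using N(1) by blast
   thus False
   proof cases
    case 1
    have "N = {b', p, v}" using N(1) 1 by auto
    thus False using bad[of b' p v] N 1 by auto
   next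
    case 2
    have "N = {a, p, v}" using N(1) 2 by auto
    thus False using bad[of a p v] N 2 by auto
   next
    case 3
    thus False using bad[of a b' v] N by auto
   qed
  qed
  obtain A1 where A1: "A1 \<subset> W - {w}" "v \<in> A1" "a \<in> A1" "b' \<in> A1" "D A1 \<le> k + 1"
   using bad[OF N(1,2,4,3)] by blast
  have N': "N = {a, p, b'}" using N by auto
  obtain A2 where A2: "A2 \<subset> W - {w}" "v \<in> A2" "a \<in> A2" "p \<in> A2" "D A2 \<le> k + 1"
   using bad[OF N'] N by blast
  have U: "A1 \<union> A2 \<subseteq> W - {w}" "N \<subseteq> A1 \<union> A2" using A1 A2 N(1) by blast+
  hence "N \<inter> (A1 \<union> A2) = N" by blast
  hence D1: "D (insert w (A1 \<union> A2)) = D (A1 \<union> A2) - 2" using Di[OF U(1)] \<open>card N = 3\<close> by simp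
  have W12: "A1 \<subset> W" "A2 \<subset> W" using A1(1) A2(1) by auto
  \<comment> \<open>This set may be all of \<open>W\<close>, whose degree is that of the tip, namely
    \<open>k\<close>.\<close>
  have k1: "k \<le> D (insert w (A1 \<union> A2))"
  proof (cases "insert w (A1 \<union> A2) = W")
   case True thus ?thesis using dk by (simp add: dg_all)
  next
   case False
   hence "insert w (A1 \<union> A2) \<subset> W" using U(1) w(1) by blast
   thus ?thesis by (intro G(6)) (use A1(2) in auto)
  qed
  have "a \<noteq> v" using nv N(1) by blast
  hence "2 \<le> card (A1 \<inter> A2)" by (intro card_ge2[of _ a v]) (use A1 A2 in auto)
  hence "k + 1 \<le> D (A1 \<inter> A2)" by (intro strong_v) (use A1(2) A2(2) W12 in auto)
  thus False using kU[OF W12 A1(5) A2(5) refl refl] k1 D1 by linarith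
 qed
qed

lemma five:
 assumes "w \<in> W" "w \<noteq> v"
 shows "5 \<le> D {w}"
proof (rule ccontr)
 assume n: "\<not> 5 \<le> D {w}"
 have t: "tm (D {w}) (B {w})" by (rule tm1[OF assms])
 hence D4: "D {w} = 4" using n by (auto simp: tm_def)
 have "k + 1 \<le> k + 4 - 2 * x w - 2 * y w"
  using strong_v[of "W - {w}"] compl_proper[OF assms(1)] D_compl[OF assms(1)] v assms D4 by auto
 hence "y w = 0 \<or> x w = 0" using G(2,3)[OF assms(1)] by linarith
 thus False
 proof
  assume "y w = 0" thus False using four_absent_y0[OF assms D4] by blast
 next
  assume x0: "x w = 0"
  interpret M: nucx v k W m "\<lambda>u. - c u" y x by (rule mirror)
  show False using M.four_absent_y0[OF assms _ x0] D4 unfolding es_comm[of y x] by blast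
 qed
qed

definition oo :: "'a => bool" where "oo w \<longleftrightarrow> tm (D {w} - 1) (B {w} - 1)"
definition io :: "'a => bool" where "io w \<longleftrightarrow> tm (D {w} - 1) (B {w} + 1)"

lemma oo_or_io: "w \<in> W ==> w \<noteq> v ==> oo w \<or> io w"
 using five[of w] tm1[of w] tm_drop unfolding oo_def io_def by blast

lemma oo_mirror: "nucx.oo W m (\<lambda>u. - c u) y x w = io w" "nucx.io W m (\<lambda>u. - c u) y x w = oo w"
proof -
 interpret M: nucx v k W m "\<lambda>u. - c u" y x by (rule mirror)
 have e: "- bs c x y {w} - 1 = - (bs c x y {w} + 1)" "- bs c x y {w} + 1 = - (bs c x y {w} - 1)" by auto
 show "M.oo w = io w" "M.io w = oo w"
  unfolding M.oo_def M.io_def oo_def io_def es_comm[of y x] bs_neg e tm_neg by auto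
qed

text \<open>One end may be \<open>v\<close> itself, and then \<open>k\<close> drops by one for the
  sake of \<open>{v}\<close>. Larger sets around \<open>v\<close> afford the loss because of
  \<open>strong_v\<close>.\<close>

lemma delete_edge_good:
 assumes uw: "u \<in> W" "w \<in> W" "u \<noteq> w" "1 \<le> m u w" and o: "u \<noteq> v ==> oo u" "w \<noteq> v ==> io w"
  and k': "k' \<le> k" "u = v \<or> w = v ==> k' \<le> k - 1"
 shows "good {v} k' W (madd m u w (- 1)) (c(u := c u - 1, w := c w + 1)) x y"
proof -
 let ?m = "madd m u w (- 1)" and ?c = "c(u := c u - 1, w := c w + 1)"
 have dA: "dg W ?m (es x y) A = D A - (if (u \<in> A) \<noteq> (w \<in> A) then 1 else 0)" if "A \<subseteq> W" for A
  using dg_madd[OF M(1) that uw(1-3), of m "- 1" "es x y"] by auto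
 have bA: "bs ?c x y A = B A - (if u \<in> A then 1 else 0) + (if w \<in> A then 1 else 0)" if "A \<subseteq> W" for A
 proof -
  have "bs ?c x y A = (\<Sum>a\<in>A. (c a + x a - y a) + ((if a = u then - 1 else 0) + (if a = w then 1 else 0)))"
   by (rule sum.cong) (use uw(3) in auto)
  thus ?thesis using finite_subset[OF that M(1)] by (simp add: sum.distrib)
 qed
 have cW: "sum ?c W = sum c W"
 proof -
  have "sum ?c W = (\<Sum>a\<in>W. c a + ((if a = u then - 1 else 0) + (if a = w then 1 else 0)))"
   by (rule sum.cong) (use uw(3) in auto)
  thus ?thesis using M(1) uw by (simp add: sum.distrib)
 qed
 show ?thesis
  unfolding good_def
 proof (intro conjI allI impI ballI)
  show "mg W ?m" by (rule mg_madd[OF G(1) uw(3)]) (use uw M(2)[of u w] in auto)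
  show "3 dvd sum ?c W" unfolding cW by (rule G(4))
 next
  fix A assume A: "A \<noteq> {} \<and> A \<subset> W"
  hence As: "A \<subseteq> W" by auto
  show "k' \<le> dg W ?m (es x y) A" if AF: "A \<inter> {v} \<noteq> {}"
  proof (cases "2 \<le> card A")
   case True
   thus ?thesis unfolding dA[OF As] using strong_v[of A] A AF k' by auto
  next
   case False
   hence "A = {v}" using cardA[of A] A As AF by auto
   thus ?thesis unfolding dA[OF As] using Dv k' by auto
  qed
  show "tm (dg W ?m (es x y) A) (bs ?c x y A)" if AF: "A \<inter> {v} = {}"
  proof (cases "2 \<le> card A")
   case True
   hence s: "st (D A) (B A)" using strong[of A] A AF by auto
   show ?thesis unfolding dA[OF As] bA[OF As] using st_tm1[OF s] st_tm[OF s, of "B A"] by auto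
  next
   case False
   then obtain a where a: "A = {a}" using cardA A As by blast
   thus ?thesis unfolding dA[OF As] bA[OF As]
    using o uw(3) G(5)[of A] A AF unfolding oo_def io_def
    by (cases "a = u"; cases "a = w") auto
  qed
 qed (use G in auto)
qed

lemma nomix:
 assumes uw: "u \<in> W" "w \<in> W" "u \<noteq> w" "u \<noteq> v" "w \<noteq> v" "1 \<le> m u w"
 shows "\<not> (oo u \<and> io w)"
proof
 assume o: "oo u \<and> io w"
 let ?m = "madd m u w (- 1)" and ?c = "c(u := c u - 1, w := c w + 1)"
 have "nuext W ?m ?c x y v"
 proof (rule IH[OF delete_edge_good[OF uw(1-3,6)] v dk _ px py k6])
  show "k \<le> dg W ?m (es x y) {v}" using dg_madd[OF M(1) _ uw(1-3), of "{v}" m "- 1" "es x y"] v uw Dk by auto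
  show "vol W ?m x y < vol W m x y" unfolding vol_def sumsum_madd[OF M(1) uw(1-3)] by simp
 qed (use o uw in auto)
 hence "nuext W m c x y v" by (rule nuext_add_arc[OF _ M(1) uw(1-3)]) (use uw in auto)
 thus False using nx by blast
qed

text \<open>An arc from the tip to another vertex can be deleted, leaving a tip of degree
  \<open>k - 1\<close>. If there is none, an arc from the tip already enters \<open>v\<close>, and
  it suffices to force one edge out of \<open>v\<close>; that edge is deleted and
  \<open>tip_extension\<close> used with \<open>k - 1\<close>.\<close>

lemma final_io:
 assumes io: "\<And>w. w \<in> W ==> w \<noteq> v ==> io w"
 shows False
proof (cases "\<exists>w\<in>W. w \<noteq> v \<and> 1 \<le> y w")
 case True
 then obtain w where w: "w \<in> W" "w \<noteq> v" "1 \<le> y w" by blast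
 let ?y = "y(w := y w - 1)"
 have fA: "finite A" if "A \<subseteq> W" for A using that M(1) finite_subset by blast
 have e: "(\<Sum>a\<in>A. es x ?y a - es x y a) = (if w \<in> A then - 1 else 0)" if "A \<subseteq> W" for A
 proof -
  have "(\<Sum>a\<in>A. es x ?y a - es x y a) = (\<Sum>a\<in>A. if a = w then - 1 else 0)"
   by (rule sum.cong) auto
  thus ?thesis using fA[OF that] by simp
 qed
 have dA: "dg W m (es x ?y) A = D A - (if w \<in> A then 1 else 0)" if "A \<subseteq> W" for A
  using dg_tips[of W m "es x ?y" A "es x y"] e[OF that] by auto
 have bA: "bs c x ?y A = B A + (if w \<in> A then 1 else 0)" if "A \<subseteq> W" for A
 proof -
  have "bs c x ?y A = (\<Sum>a\<in>A. (c a + x a - y a) + (if a = w then 1 else 0))" by (rule sum.cong) auto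
  thus ?thesis using fA[OF that] by (simp add: sum.distrib)
 qed
 have "sum (es x ?y) W - sum (es x y) W = (\<Sum>a\<in>W. es x ?y a - es x y a)" by (rule sum_subtractf[symmetric])
 hence eW: "sum (es x ?y) W = k - 1" using e[of W] w(1) dk by simp
 have "good {v} k W m c x ?y"
  unfolding good_def
 proof (intro conjI allI impI ballI)
  show "mg W m" "3 dvd sum c W" using G by auto
  show "0 \<le> x a" "0 \<le> ?y a" if "a \<in> W" for a using G(2,3)[OF that] w by auto
 next
  fix A assume A: "A \<noteq> {} \<and> A \<subset> W"
  hence As: "A \<subseteq> W" by auto
  show "k \<le> dg W m (es x ?y) A" if AF: "A \<inter> {v} \<noteq> {}"
  proof (cases "2 \<le> card A")
   case True
   thus ?thesis unfolding dA[OF As] using strong_v[of A] A AF by auto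
  next
   case False
   hence "A = {v}" using cardA[of A] A As AF by auto
   thus ?thesis unfolding dA[OF As] using Dv w by auto
  qed
  show "tm (dg W m (es x ?y) A) (bs c x ?y A)" if AF: "A \<inter> {v} = {}"
  proof (cases "2 \<le> card A")
   case True
   hence s: "st (D A) (B A)" using strong[of A] A AF by auto
   thus ?thesis unfolding dA[OF As] bA[OF As] using st_tm1[OF s] st_tm[OF s, of "B A"] by auto
  next
   case False
   then obtain a where a: "A = {a}" using cardA A As by blast
   thus ?thesis unfolding dA[OF As] bA[OF As] using io[OF w(1,2)] G(5)[of A] A AF
    unfolding io_def by (cases "a = w") auto
  qed
 qed
 hence "nuext W m c x ?y v"
  by (rule nonuniform_extension_small) (use v eW k6 dA[of "{v}"] w Dv in auto)
 hence "nuext W m c x y v" using w(2) by (simp add: nuext_def)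
 thus False using nx by blast
next
 case False
 have "sum y W = y v + sum y (W - {v})" by (rule sum.remove[OF M(1) v])
 moreover have "sum y (W - {v}) = 0"
 proof (rule sum.neutral, intro ballI)
  fix w assume "w \<in> W - {v}"
  thus "y w = 0" using False G(3)[of w] by force
 qed
 ultimately have yv: "0 < y v" using py by simp
 have "\<exists>t\<in>W. m v t \<noteq> 0"
 proof (rule ccontr)
  assume n: "\<not> ?thesis"
  hence "sum (m v) W = 0" by (intro sum.neutral) auto
  hence "x v + y v = k" using dg_single[OF G(1) v, of "es x y"] Dv by simp
  hence "sum (es x y) (W - {v}) = 0" using sum.remove[OF M(1) v, of "es x y"] dk by simp
  moreover have "D (W - {v}) = sum (es x y) (W - {v})"
  proof (rule dg_disjoint_no_edges[OF G(1)])
   fix u t assume "u \<in> W - {v}" "t \<in> W - (W - {v})"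
   hence "t = v" "u \<in> W" by auto
   thus "m u t = 0" using n M(2)[of u v] v by auto
  qed auto
  moreover have ne: "W - {v} \<noteq> {}"
  proof
   assume "W - {v} = {}"
   hence "card (W - {v}) = 0" by (simp only: card.empty)
   thus False using compl_proper[OF v] by simp
  qed
  have "4 \<le> D (W - {v})" by (rule tm_ge4, rule G(5)) (use v ne in auto)
  ultimately show False by simp
 qed
 then obtain t where t: "t \<in> W" "m v t \<noteq> 0" by blast
 hence t1: "1 \<le> m v t" "t \<noteq> v" using M(3)[OF v t(1)] M(4)[OF v] by auto
 have "ext W (madd m v t (- 1)) (c(v := c v - 1, t := c t + 1))"
  by (rule tip_extension[OF delete_edge_good[OF v t(1) t1(2)[symmetric] t1(1), of "k - 1"]])
   (use io t t1 v dk in \<open>auto simp: tipok_def\<close>)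
 then obtain f where f: "flow W (madd m v t (- 1)) (c(v := c v - 1, t := c t + 1)) f" unfolding ext_def by blast
 have "0 < arcadd f v t 1 v t" using flowD(1)[OF f v t(1)] by (simp add: arcadd_def)
 hence "nuext W m c x y v"
  using flow_add_arc[OF f M(1) v t(1) t1(2)[symmetric]] M(1) v v_nonneg yv t(1) by (intro nuextI_arcs) auto
 thus False using nx by blast
qed

lemma impossible: False
proof -
 define I where "I = {w \<in> W. w \<noteq> v \<and> io w}"
 consider "I = W - {v}" | "I = {}" | "I \<noteq> {}" "I \<subset> W - {v}" by (auto simp: I_def)
 thus False
 proof cases
  case 1 thus False by (intro final_io) (auto simp: I_def)
 next
  case 2
  hence o: "oo w" if "w \<in> W" "w \<noteq> v" for w using that oo_or_io[of w] by (auto simp: I_def)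
  interpret M: nucx v k W m "\<lambda>u. - c u" y x by (rule mirror)
  show False using M.final_io o unfolding oo_mirror by blast
 next
  case 3
  then obtain u t where ut: "u \<in> I" "t \<in> W - {v} - I" "1 \<le> m u t" using connected_rest[OF 3] by blast
  have "oo t" using oo_or_io[of t] ut by (auto simp: I_def)
  moreover have "1 \<le> m t u" using ut M(2)[of u t] by (auto simp: I_def)
  ultimately show False using nomix[of t u] ut by (auto simp: I_def)
 qed
qed

end

theorem nonuniform_extension:
 assumes "good {v} k W m c x y" "v \<in> W" "sum (es x y) W = k" "k \<le> dg W m (es x y) {v}" "0 < sum x W" "0 < sum y W" "6 \<le> k"
 shows "nuext W m c x y v"
 using assms
proof (induction "nat (vol W m x y)" arbitrary: v k W m c x y rule: less_induct)
 case less
 show ?case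
 proof (rule ccontr)
  assume nx: "\<not> nuext W m c x y v"
  have v0: "0 \<le> vol W' m' x' y'" if "good F' k' W' m' c' x' y'"
   for F' :: "'a set" and k' W' m' c' x' y'
   using that by (intro vol_nonneg) (auto simp: good_def)
  interpret nucx v k W m c x y
  proof
   fix v' :: 'a and k' W' m' c' x' y'
   assume h: "good {v'} k' W' m' c' x' y'" "v' \<in> W'" "sum (es x' y') W' = k'" "k' \<le> dg W' m' (es x' y') {v'}"
    "0 < sum x' W'" "0 < sum y' W'" "6 \<le> k'" "vol W' m' x' y' < vol W m x y"
   have "nat (vol W' m' x' y') < nat (vol W m x y)" using h(8) v0[OF h(1)] by linarith
   thus "nuext W' m' c' x' y' v'" by (rule less.hyps) (rule h)+
  qed (use less.prems nx in auto)
  show False by (rule impossible)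
 qed
qed

section \<open>Flows of bordered multigraphs\<close>

text \<open>Any integer representative will do, since \<open>tm\<close>, \<open>st\<close> and
  \<open>flow\<close> see boundaries and demands only modulo 3.\<close>

definition lft :: "3 => int" where "lft a = (SOME i. of_int i = a)"

lemma of_int_lft [simp]: "of_int (lft a) = a"
proof -
 have "\<exists>i. of_int i = a" by (metis bit1_cases)
 thus ?thesis unfolding lft_def by (rule someI_ex)
qed

lemma of_int_3_eq_0: "(of_int i :: 3) = 0 \<longleftrightarrow> 3 dvd i"
proof -
 have "(of_int i :: 3) = 0 \<longleftrightarrow> Rep_bit1 (of_int i :: 3) = Rep_bit1 (0 :: 3)"
  by (rule Rep_bit1_inject[symmetric])
 thus ?thesis by (simp add: bit1.Rep_0 bit1.of_int_eq Abs_bit1_inverse dvd_eq_mod_eq_0)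
qed

lemma of_int_3_eq: "(of_int i :: 3) = of_int j \<longleftrightarrow> 3 dvd i - j"
 using of_int_3_eq_0[of "i - j"] by simp

lemma three_eq_0: "(3 :: 3) = 0" using of_int_3_eq_0[of 3] by simp

lemma three_cases: "(a :: 3) = 0 \<or> a = 1 \<or> a = - 1"
proof -
 have "3 dvd lft a - 0 \<or> 3 dvd lft a - 1 \<or> 3 dvd lft a - (- 1)" by presburger
 thus ?thesis unfolding of_int_3_eq[symmetric] by simp
qed

text \<open>The identity behind doubling: two arcs count like one reversed arc.\<close>

lemma three_double: "(a :: 3) + a = - a"
proof -
 have "a + a + a = 3 * a" by simp
 hence "a + a + a = 0" by (simp only: three_eq_0 mult_zero_left)
 thus ?thesis by (simp add: eq_neg_iff_add_eq_0)
qed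

lemma one_neq_3: "(1 :: 3) \<noteq> 0" "(1 :: 3) \<noteq> - 1" "(- 1 :: 3) \<noteq> 0" "(2 :: 3) = - 1"
 using of_int_3_eq_0[of 1] of_int_3_eq[of 1 "- 1"] of_int_3_eq_0[of "- 1"] of_int_3_eq[of 2 "- 1"] by simp_all

abbreviation bd :: "('v, 'e) bgraph => 'v set => 3" where "bd G \<equiv> sum (bdry G)"

abbreviation singles :: "'a set => 'a set set" where "singles A \<equiv> (\<lambda>a. {a}) ` A"

lemma multigraphD:
 assumes "multigraph G"
 shows "finite (verts G)" "finite (edges G)" "\<And>e. e \<in> edges G ==> ends G e \<subseteq> verts G"
  "\<And>e. e \<in> edges G ==> card (ends G e) = 2"
 using assms unfolding multigraph_def by blast+

lemma edge_obtain:
 assumes "multigraph G" "e \<in> edges G"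
 obtains u v where "ends G e = {u, v}" "u \<noteq> v" "u \<in> verts G" "v \<in> verts G"
proof -
 obtain u v where "ends G e = {u, v}" "u \<noteq> v"
  using multigraphD(4)[OF assms] by (meson card_2_iff)
 thus ?thesis using that multigraphD(3)[OF assms] by blast
qed

lemma edge_obtain_tail:
 assumes "multigraph G" "e \<in> edges G" "u \<in> ends G e"
 obtains v where "ends G e = {u, v}" "u \<noteq> v" "v \<in> verts G"
proof -
 obtain a b where ab: "ends G e = {a, b}" "a \<noteq> b" "a \<in> verts G" "b \<in> verts G"
  using edge_obtain[OF assms(1,2)] .
 then consider "u = a" | "u = b" using assms(3) by auto
 thus ?thesis using ab that[of a] that[of b] by cases auto
qed

lemma card_pair_Int: "u \<noteq> v ==> card ({u, v} \<inter> A) = 1 \<longleftrightarrow> (u \<in> A) \<noteq> (v \<in> A)"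
 by (cases "u \<in> A"; cases "v \<in> A") (auto simp: Int_insert_left)

lemma in_cut_pair:
 assumes "ends G e = {u, v}" "u \<noteq> v"
 shows "e \<in> cut G A \<longleftrightarrow> e \<in> edges G \<and> (u \<in> A) \<noteq> (v \<in> A)"
 unfolding cut_def using assms card_pair_Int[of u v A] by simp

lemma cut_subset: "cut G A \<subseteq> edges G" by (auto simp: cut_def)

lemma cut_edge: "e \<in> cut G A ==> e \<in> edges G" by (simp add: cut_def)

lemma finite_cut: "multigraph G ==> finite (cut G A)"
 using finite_subset[OF cut_subset multigraphD(2)] .

lemma cut_obtain:
 assumes "multigraph G" "e \<in> cut G A"
 obtains u v where "ends G e = {u, v}" "u \<noteq> v" "u \<in> A" "v \<notin> A" "u \<in> verts G" "v \<in> verts G"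
proof -
 have e: "e \<in> edges G" by (rule cut_edge[OF assms(2)])
 obtain a b where ab: "ends G e = {a, b}" "a \<noteq> b" "a \<in> verts G" "b \<in> verts G"
  using edge_obtain[OF assms(1) e] .
 have "(a \<in> A) \<noteq> (b \<in> A)" using in_cut_pair[OF ab(1,2)] assms(2) by simp
 thus ?thesis using ab that[of a b] that[of b a] by (cases "a \<in> A") (auto simp: insert_commute)
qed

lemma cut_compl:
 assumes "multigraph G" shows "cut G (verts G - A) = cut G A"
proof -
 have "e \<in> cut G (verts G - A) \<longleftrightarrow> e \<in> cut G A" if e: "e \<in> edges G" for e
 proof -
  obtain u v where uv: "ends G e = {u, v}" "u \<noteq> v" "u \<in> verts G" "v \<in> verts G"
   using edge_obtain[OF assms e] .
  show ?thesis unfolding in_cut_pair[OF uv(1,2)] using uv(3,4) by auto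
 qed
 thus ?thesis using cut_subset[of G A] cut_subset[of G "verts G - A"] by blast
qed

lemma deg_compl: "multigraph G ==> deg G (verts G - A) = deg G A"
 unfolding deg_def by (simp add: cut_compl)

text \<open>The contribution of an edge with ends \<open>D\<close> and tail \<open>a\<close> to the
  net outflow of \<open>X\<close>. The head is addressed as \<open>D - {a}\<close>, so that it need
  not be named.\<close>

definition cn :: "'v set => 'v => 'v set => 3" where
 "cn D a X = (if a \<in> X then 1 else 0) - (if D - {a} \<subseteq> X then 1 else 0)"

lemma cn_pair: "a \<noteq> c ==> cn {a, c} a X = (if a \<in> X then 1 else 0) - (if c \<in> X then 1 else 0)"
 by (simp add: cn_def)

lemma cn_pair': "a \<noteq> c ==> cn {c, a} a X = (if a \<in> X then 1 else 0) - (if c \<in> X then 1 else 0)"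
 by (simp add: cn_def insert_Diff_if)

definition net :: "('v, 'e) bgraph => ('e => 'v) => 'v set => 3" where
 "net G t X = (\<Sum>e\<in>edges G. cn (ends G e) (t e) X)"

definition outset :: "('v, 'e) bgraph => ('e => 'v) => 'v set => 'e set" where
 "outset G t A = {e \<in> cut G A. t e \<in> A}"

definition balance :: "('v, 'e) bgraph => 'e set => 'v set => 3" where
 "balance G S A = of_nat (card S) - of_nat (card (cut G A - S))"

lemma outset_subset: "outset G t A \<subseteq> cut G A" by (auto simp: outset_def)

lemma orientationD: "orientation G t ==> e \<in> edges G ==> t e \<in> ends G e"
 by (simp add: orientation_def)

lemma net_balance:
 assumes G: "multigraph G" and t: "orientation G t"
 shows "net G t A = balance G (outset G t A) A"
proof -
 have cn: "cn (ends G e) (t e) A = (if e \<in> outset G t A then 1 else 0) - (if e \<in> cut G A - outset G t A then 1 else 0)"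
  if e: "e \<in> edges G" for e
 proof -
  obtain c where c: "ends G e = {t e, c}" "t e \<noteq> c" using edge_obtain_tail[OF G e orientationD[OF t e]] .
  show ?thesis unfolding c(1) cn_pair[OF c(2)] outset_def using in_cut_pair[OF c] e by simp
 qed
 have f: "finite (edges G)" using multigraphD(2)[OF G] .
 have i: "(\<Sum>e\<in>edges G. if e \<in> B then 1 else 0 :: 3) = of_nat (card B)" if "B \<subseteq> edges G" for B
  using that by (simp add: sum.If_cases[OF f] Int_absorb1)
 have "net G t A = (\<Sum>e\<in>edges G. (if e \<in> outset G t A then 1 else 0) - (if e \<in> cut G A - outset G t A then 1 else 0))"
  unfolding net_def by (rule sum.cong[OF refl cn])
 also have "\<dots> = of_nat (card (outset G t A)) - of_nat (card (cut G A - outset G t A))"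
 proof -
  have "outset G t A \<subseteq> edges G" "cut G A - outset G t A \<subseteq> edges G"
   using outset_subset[of G t A] cut_subset[of G A] by auto
  thus ?thesis unfolding sum_subtractf by (simp only: i)
 qed
 finally show ?thesis unfolding balance_def .
qed

lemma net_Un:
 assumes G: "multigraph G" and t: "orientation G t" and "A \<inter> B = {}"
 shows "net G t (A \<union> B) = net G t A + net G t B"
proof -
 have "cn (ends G e) (t e) (A \<union> B) = cn (ends G e) (t e) A + cn (ends G e) (t e) B" if e: "e \<in> edges G" for e
 proof -
  obtain c where c: "ends G e = {t e, c}" "t e \<noteq> c" using edge_obtain_tail[OF G e orientationD[OF t e]] .
  show ?thesis unfolding c(1) cn_pair[OF c(2)] using assms(3) by auto
 qed
 thus ?thesis unfolding net_def by (simp add: sum.distrib)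
qed

lemma net_empty:
 assumes G: "multigraph G" and t: "orientation G t"
 shows "net G t {} = 0"
 using net_Un[OF G t, of "{}" "{}"] by simp

lemma net_verts:
 assumes G: "multigraph G" and t: "orientation G t"
 shows "net G t (verts G) = 0"
proof -
 have "cut G (verts G) = {}" using cut_compl[OF G, of "{}"] by (simp add: cut_def)
 thus ?thesis unfolding net_balance[OF G t] balance_def outset_def by simp
qed

lemma net_Union:
 assumes G: "multigraph G" and t: "orientation G t" and "finite P" "disjoint P"
 shows "net G t (\<Union>P) = sum (net G t) P"
 using assms(3,4)
proof (induction P rule: finite_induct)
 case empty
 thus ?case using net_empty[OF G t] by simp
next
 case (insert p P)
 have "p \<inter> q = {}" if "q \<in> P" for q
  using disjointD[OF insert.prems, of p q] that insert.hyps(2) by auto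
 hence "p \<inter> \<Union>P = {}" by auto
 moreover have "disjoint P" using pairwise_subset[OF insert.prems, of P] by (simp add: subset_insertI)
 ultimately show ?case using insert net_Un[OF G t, of p "\<Union>P"] by simp
qed

lemma disjoint_singletons: "disjoint (singles A)" by (auto simp: disjoint_def)

lemma net_singletons:
 assumes "multigraph G" "orientation G t" "finite A"
 shows "net G t A = (\<Sum>v\<in>A. net G t {v})"
 using net_Union[OF assms(1,2), of "singles A"] assms(3)
 by (simp add: disjoint_singletons sum.reindex inj_on_def)

lemma outset_singleton: "outset G t {v} = {e \<in> cut G {v}. t e = v}" by (auto simp: outset_def)

lemma nowhere_zero_flow_net:
 assumes G: "multigraph G"
 shows "nowhere_zero_flow G t \<longleftrightarrow> orientation G t \<and> (\<forall>v\<in>verts G. net G t {v} = bdry G v)"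
proof -
 have "of_nat (outdeg G t v) - of_nat (indeg G t v) = net G t {v}" if "orientation G t" for v
 proof -
  have "{e \<in> cut G {v}. t e \<noteq> v} = cut G {v} - outset G t {v}" by (auto simp: outset_def)
  thus ?thesis unfolding net_balance[OF G that] balance_def outdeg_def indeg_def outset_singleton[symmetric] by simp
 qed
 thus ?thesis unfolding nowhere_zero_flow_def by auto
qed

text \<open>A flow of the quotient by \<open>P\<close> in which exactly the edges of
  \<open>S\<close> leave the part \<open>b\<close>, expressed through orientations of
  \<open>G\<close> itself. The direction of an edge inside a part has no effect. Different quotients
  of one graph can thus be compared without forming contractions.\<close>

definition part_ext :: "('v, 'e) bgraph => 'v set set => 'v set => 'e set => bool" where
 "part_ext G P b S \<longleftrightarrow>
   (\<exists>t. orientation G t \<and> (\<forall>p\<in>P. net G t p = bd G p) \<and> outset G t b = S)"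

lemma extends_part_ext:
 assumes "multigraph G"
 shows "extends G z S \<longleftrightarrow> part_ext G (singles (verts G)) {z} S"
 unfolding extends_def part_ext_def nowhere_zero_flow_net[OF assms] outset_singleton by auto

lemma tip_preflow_balance: "tip_preflow G z S \<longleftrightarrow> S \<subseteq> cut G {z} \<and> balance G S {z} = bdry G z"
 by (simp add: tip_preflow_def balance_def)

lemma part_ext_preflow:
 assumes "multigraph G" "part_ext G P b S" "b \<in> P"
 shows "S \<subseteq> cut G b" "balance G S b = bd G b"
proof -
 obtain t where t: "orientation G t" "\<forall>p\<in>P. net G t p = bd G p" "outset G t b = S"
  using assms(2) part_ext_def by metis
 show "S \<subseteq> cut G b" using t(3) outset_subset by metis
 show "balance G S b = bd G b" using net_balance[OF assms(1) t(1), of b] t assms(3) by simp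
qed

section \<open>Contraction\<close>

lemma part_mem:
 assumes "partition_on V P" "p \<in> P" "a \<in> p" "r \<in> P"
 shows "a \<in> r \<longleftrightarrow> r = p"
 using disjointD[OF partition_onD2[OF assms(1)] assms(2,4)] assms(3) by blast

lemma part_mem_Union:
 assumes "partition_on V P" "p \<in> P" "a \<in> p" "\<A> \<subseteq> P"
 shows "a \<in> \<Union>\<A> \<longleftrightarrow> p \<in> \<A>"
proof
 assume "a \<in> \<Union>\<A>"
 then obtain r where r: "r \<in> \<A>" "a \<in> r" by blast
 hence "r = p" using part_mem[OF assms(1-3)] assms(4) by blast
 thus "p \<in> \<A>" using r by simp
qed (use assms(3) in blast)

lemma multigraph_contract:
 assumes G: "multigraph G" and P: "partition_on (verts G) P"
 shows "multigraph (contract G P)"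
  and "\<And>\<A>. \<A> \<subseteq> P ==> cut (contract G P) \<A> = cut G (\<Union>\<A>)"
  and "\<And>e u v. e \<in> edges G ==> ends G e = {u, v} ==> p \<in> P ==> u \<in> p ==> q \<in> P ==> v \<in> q ==>
     ends (contract G P) e = {p, q} \<and> (e \<in> edges (contract G P) \<longleftrightarrow> p \<noteq> q)"
proof -
 have ex: "\<exists>p. p \<in> P \<and> a \<in> p" if "a \<in> verts G" for a using partition_onD1[OF P] that by blast
 show E: "ends (contract G P) e = {p, q} \<and> (e \<in> edges (contract G P) \<longleftrightarrow> p \<noteq> q)"
  if "e \<in> edges G" "ends G e = {u, v}" "p \<in> P" "u \<in> p" "q \<in> P" "v \<in> q" for e u v p q
 proof -
  note ru = part_mem[OF P that(3,4)] and rv = part_mem[OF P that(5,6)]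
  have "r \<in> P \<and> r \<inter> {u, v} \<noteq> {} \<longleftrightarrow> r = p \<or> r = q" for r
   using ru[of r] rv[of r] that(3,5) by auto
  hence "{r \<in> P. r \<inter> {u, v} \<noteq> {}} = {p, q}" by auto
  moreover have "{u, v} \<subseteq> r \<longleftrightarrow> r = p \<and> r = q" if "r \<in> P" for r
   using ru[OF that] rv[OF that] by simp
  hence "(\<exists>r\<in>P. {u, v} \<subseteq> r) \<longleftrightarrow> p = q" using that(3) by blast
  ultimately show ?thesis unfolding contract_def bgraph.simps that(2) using that(1,2) by auto
 qed
 have ob: "\<exists>p q u v. ends G e = {u, v} \<and> u \<noteq> v \<and> p \<in> P \<and> u \<in> p \<and> q \<in> P \<and> v \<in> q" if e: "e \<in> edges G" for e
 proof -
  obtain u v where uv: "ends G e = {u, v}" "u \<noteq> v" "u \<in> verts G" "v \<in> verts G"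
   using edge_obtain[OF G e] .
  obtain p q where "p \<in> P" "u \<in> p" "q \<in> P" "v \<in> q" using ex[OF uv(3)] ex[OF uv(4)] by auto
  thus ?thesis using uv(1,2) by blast
 qed
 have sub: "edges (contract G P) \<subseteq> edges G" by (auto simp: contract_def)
 have "finite P" using finite_elements[OF multigraphD(1)[OF G] P] .
 moreover have "finite (edges (contract G P))" using finite_subset[OF sub multigraphD(2)[OF G]] .
 moreover have "ends (contract G P) e \<subseteq> P \<and> card (ends (contract G P) e) = 2" if e: "e \<in> edges (contract G P)" for e
 proof -
  obtain p q u v where o: "ends G e = {u, v}" "p \<in> P" "u \<in> p" "q \<in> P" "v \<in> q" using ob[OF subsetD[OF sub e]] by blast
  have "ends (contract G P) e = {p, q}" "p \<noteq> q" using E[OF _ o] e sub by auto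
  thus ?thesis using o by simp
 qed
 ultimately show "multigraph (contract G P)" unfolding multigraph_def by (simp add: contract_def)
 show "cut (contract G P) \<A> = cut G (\<Union>\<A>)" if A: "\<A> \<subseteq> P" for \<A>
 proof -
  have "e \<in> cut (contract G P) \<A> \<longleftrightarrow> e \<in> cut G (\<Union>\<A>)" if e: "e \<in> edges G" for e
  proof -
   obtain p q u v where o: "ends G e = {u, v}" "p \<in> P" "u \<in> p" "q \<in> P" "v \<in> q" and uv: "u \<noteq> v" using ob[OF e] by blast
   have E': "ends (contract G P) e = {p, q}" "e \<in> edges (contract G P) \<longleftrightarrow> p \<noteq> q" using E[OF e o] by auto
   have pu: "p \<in> \<A> \<longleftrightarrow> u \<in> \<Union>\<A>" and qv: "q \<in> \<A> \<longleftrightarrow> v \<in> \<Union>\<A>"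
    using part_mem_Union[OF P o(2,3) A] part_mem_Union[OF P o(4,5) A] by simp_all
   show ?thesis
   proof (cases "p = q")
    case True
    thus ?thesis using in_cut_pair[OF o(1) uv, of "\<Union>\<A>"] pu qv E' cut_subset[of "contract G P"] by blast
   next
    case False
    thus ?thesis using in_cut_pair[OF o(1) uv, of "\<Union>\<A>"] in_cut_pair[OF E'(1) False, of \<A>] pu qv E' e by simp
   qed
  qed
  thus ?thesis using sub cut_subset[of G] cut_subset[of "contract G P"] by blast
 qed
qed

lemmas contract_multigraph = multigraph_contract(1)
lemmas cut_contract = multigraph_contract(2)
lemmas ends_contract = multigraph_contract(3)

lemma verts_contract [simp]: "verts (contract G P) = P" by (simp add: contract_def)
lemma bdry_contract [simp]: "bdry (contract G P) p = bd G p" by (simp add: contract_def)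

lemma deg_contract:
 "multigraph G ==> partition_on (verts G) P ==> \<A> \<subseteq> P ==> deg (contract G P) \<A> = deg G (\<Union>\<A>)"
 unfolding deg_def by (simp add: cut_contract)

lemma bdry_contract_Union:
 assumes G: "multigraph G" and P: "partition_on (verts G) P" and A: "\<A> \<subseteq> P"
 shows "bd (contract G P) \<A> = bd G (\<Union>\<A>)"
proof -
 have "finite p" if "p \<in> \<A>" for p
  using finite_subset[OF _ multigraphD(1)[OF G]] partition_onD1[OF P] that A by blast
 moreover have "\<forall>p\<in>\<A>. \<forall>q\<in>\<A>. p \<noteq> q \<longrightarrow> p \<inter> q = {}" using partition_onD2[OF P] A unfolding disjoint_def by blast
 ultimately have "bd G (\<Union>\<A>) = (sum \<circ> sum) (bdry G) \<A>" by (intro sum.Union_disjoint) auto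
 moreover have "bd (contract G P) \<A> = (\<Sum>p\<in>\<A>. bd G p)" by simp
 ultimately show ?thesis by (simp add: comp_def)
qed

lemma contract_lift:
 assumes G: "multigraph G" and P: "partition_on (verts G) P" and t: "orientation G t"
 obtains t' where "orientation (contract G P) t'" "\<And>\<A>. \<A> \<subseteq> P ==> outset (contract G P) t' \<A> = outset G t (\<Union>\<A>)"
proof -
 define t' where "t' e = (SOME p. p \<in> P \<and> t e \<in> p)" for e
 have t': "t' e \<in> P \<and> t e \<in> t' e" if e: "e \<in> edges G" for e
 proof -
  have "\<exists>p. p \<in> P \<and> t e \<in> p" using orientationD[OF t e] multigraphD(3)[OF G e] partition_onD1[OF P] by blast
  thus ?thesis unfolding t'_def by (rule someI_ex)
 qed
 have "t' e \<in> ends (contract G P) e" if "e \<in> edges (contract G P)" for e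
 proof -
  have "e \<in> edges G" using that by (simp add: contract_def)
  thus ?thesis using t' orientationD[OF t] unfolding contract_def by fastforce
 qed
 hence "orientation (contract G P) t'" by (simp add: orientation_def)
 moreover have "outset (contract G P) t' \<A> = outset G t (\<Union>\<A>)" if A: "\<A> \<subseteq> P" for \<A>
 proof -
  have "t' e \<in> \<A> \<longleftrightarrow> t e \<in> \<Union>\<A>" if "e \<in> edges G" for e
   using t'[OF that] part_mem_Union[OF P _ _ A, of "t' e" "t e"] by blast
  thus ?thesis unfolding outset_def cut_contract[OF G P A] using cut_subset[of G "\<Union>\<A>"] by blast
 qed
 ultimately show ?thesis using that by blast
qed

lemma contract_unlift:
 assumes G: "multigraph G" and P: "partition_on (verts G) P" and t': "orientation (contract G P) t'"
 obtains t where "orientation G t" "\<And>\<A>. \<A> \<subseteq> P ==> outset (contract G P) t' \<A> = outset G t (\<Union>\<A>)"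
proof -
 \<comment> \<open>Edges inside a part are absent from the contraction, so any of their ends may be
   chosen as tail.\<close>
 define t where "t e = (if e \<in> edges (contract G P) then SOME v. v \<in> ends G e \<and> v \<in> t' e else SOME v. v \<in> ends G e)" for e
 have ne: "\<exists>v. v \<in> ends G e" if "e \<in> edges G" for e using edge_obtain[OF G that] by (metis insertI1)
 have t: "t e \<in> ends G e \<and> t e \<in> t' e \<and> t' e \<in> P" if e: "e \<in> edges (contract G P)" for e
 proof -
  have "t' e \<in> P \<and> t' e \<inter> ends G e \<noteq> {}" using orientationD[OF t' e] by (simp add: contract_def)
  hence "\<exists>v. v \<in> ends G e \<and> v \<in> t' e" "t' e \<in> P" by blast+
  thus ?thesis unfolding t_def using e someI_ex[of "\<lambda>v. v \<in> ends G e \<and> v \<in> t' e"] by simp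
 qed
 have "t e \<in> ends G e" if e: "e \<in> edges G" for e
  using t[of e] ne[OF e] someI_ex[of "\<lambda>v. v \<in> ends G e"] by (cases "e \<in> edges (contract G P)") (simp_all add: t_def)
 hence "orientation G t" by (simp add: orientation_def)
 moreover have "outset (contract G P) t' \<A> = outset G t (\<Union>\<A>)" if A: "\<A> \<subseteq> P" for \<A>
 proof -
  have "t' e \<in> \<A> \<longleftrightarrow> t e \<in> \<Union>\<A>" if "e \<in> edges (contract G P)" for e
   using t[OF that] part_mem_Union[OF P _ _ A, of "t' e" "t e"] by blast
  thus ?thesis unfolding outset_def cut_contract[OF G P A, symmetric] using cut_subset[of "contract G P" \<A>] by blast
 qed
 ultimately show ?thesis using that by blast
qed

lemma balance_contract:
 "multigraph G ==> partition_on (verts G) P ==> \<A> \<subseteq> P ==> balance (contract G P) S \<A> = balance G S (\<Union>\<A>)"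
 unfolding balance_def by (simp add: cut_contract)

text \<open>Contracting twice amounts to contracting the unions, so quotients of a quotient are
  treated as quotients of \<open>G\<close>.\<close>

lemma part_ext_contract:
 assumes G: "multigraph G" and P: "partition_on (verts G) P" and Q: "\<And>\<A>. \<A> \<in> Q ==> \<A> \<subseteq> P" "\<B> \<subseteq> P"
 shows "part_ext (contract G P) Q \<B> S \<longleftrightarrow> part_ext G (Union ` Q) (\<Union>\<B>) S"
proof -
 note H = contract_multigraph[OF G P]
 have net: "net (contract G P) t' \<A> = net G t (\<Union>\<A>)"
  if "orientation G t" "orientation (contract G P) t'" "\<A> \<subseteq> P" "outset (contract G P) t' \<A> = outset G t (\<Union>\<A>)" for t t' \<A>
  using net_balance[OF G that(1)] net_balance[OF H that(2)] balance_contract[OF G P that(3)] that(4) by simp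
 show ?thesis
 proof
  assume "part_ext (contract G P) Q \<B> S"
  then obtain t' where t': "orientation (contract G P) t'" "\<forall>p\<in>Q. net (contract G P) t' p = bd (contract G P) p"
   "outset (contract G P) t' \<B> = S" unfolding part_ext_def by blast
  obtain t where t: "orientation G t" "\<And>\<A>. \<A> \<subseteq> P ==> outset (contract G P) t' \<A> = outset G t (\<Union>\<A>)"
   using contract_unlift[OF G P t'(1)] by blast
  have "net G t (\<Union>q) = bd G (\<Union>q)" if "q \<in> Q" for q
   using net[OF t(1) t'(1) Q(1)[OF that] t(2)[OF Q(1)[OF that]]] t'(2) that bdry_contract_Union[OF G P Q(1)[OF that]] by simp
  thus "part_ext G (Union ` Q) (\<Union>\<B>) S" unfolding part_ext_def using t(1) t(2)[OF Q(2)] t'(3) by auto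
 next
  assume "part_ext G (Union ` Q) (\<Union>\<B>) S"
  then obtain t where t: "orientation G t" "\<forall>p\<in>Union ` Q. net G t p = bd G p"
   "outset G t (\<Union>\<B>) = S" unfolding part_ext_def by blast
  obtain t' where t': "orientation (contract G P) t'" "\<And>\<A>. \<A> \<subseteq> P ==> outset (contract G P) t' \<A> = outset G t (\<Union>\<A>)"
   using contract_lift[OF G P t(1)] by blast
  have "net (contract G P) t' q = bd (contract G P) q" if "q \<in> Q" for q
   using net[OF t(1) t'(1) Q(1)[OF that] t'(2)[OF Q(1)[OF that]]] t(2) that bdry_contract_Union[OF G P Q(1)[OF that]] by simp
  thus "part_ext (contract G P) Q \<B> S" unfolding part_ext_def using t'(1) t'(2)[OF Q(2)] t(3) by auto
 qed
qed

lemma extends_contract: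
 assumes G: "multigraph G" and P: "partition_on (verts G) P" and b: "b \<in> P"
 shows "extends (contract G P) b S \<longleftrightarrow> part_ext G P b S"
proof -
 have "Union ` singles P = P" by auto
 thus ?thesis
  using extends_part_ext[OF contract_multigraph[OF G P], of b S] part_ext_contract[OF G P, of "singles P" "{b}" S] b by auto
qed

section \<open>Local extension of flows\<close>

definition mult :: "('v, 'e) bgraph => 'v => 'v => int" where
 "mult G u t = int (card {e \<in> edges G. ends G e = {u, t}})"

definition cutcard :: "('v, 'e) bgraph => 'v set => ('e => bool) => 'v => int" where
 "cutcard G A Q u = int (card {e \<in> cut G A. u \<in> ends G e \<and> Q e})"

abbreviation outs :: "('v, 'e) bgraph => 'v set => 'e set => 'v => int" where
 "outs G A S \<equiv> cutcard G A (\<lambda>e. e \<in> S)"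

abbreviation ins :: "('v, 'e) bgraph => 'v set => 'e set => 'v => int" where
 "ins G A S \<equiv> cutcard G A (\<lambda>e. e \<notin> S)"

text \<open>The part of the boundary at \<open>u\<close> that falls to the edges inside
  \<open>A\<close>, once the cut edges in \<open>S\<close> leave \<open>A\<close> and the others
  enter it.\<close>

definition demand :: "('v, 'e) bgraph => 'v set => 'e set => 'v => int" where
 "demand G A S u = lft (bdry G u) - outs G A S u + ins G A S u"

definition tms :: "('v, 'e) bgraph => 'v set => bool" where
 "tms G A \<longleftrightarrow> tm (int (deg G A)) (lft (bd G A))"

definition sts :: "('v, 'e) bgraph => 'v set => bool" where
 "sts G A \<longleftrightarrow> st (int (deg G A)) (lft (bd G A))"

definition loc :: "('v, 'e) bgraph => 'v set => ('e => 'v) => bool" where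
 "loc G A t \<longleftrightarrow> orientation G t \<and> (\<forall>a\<in>A. net G t {a} = bdry G a)"

lemma multD: "multigraph G ==> mult G u u = 0"
proof -
 assume G: "multigraph G"
 have "{e \<in> edges G. ends G e = {u, u}} = {}" using multigraphD(4)[OF G] by fastforce
 thus ?thesis by (simp only: mult_def card.empty of_nat_0)
qed

lemma mg_mult: "multigraph G ==> A \<subseteq> verts G ==> mg A (mult G)"
 unfolding mg_def using finite_subset[OF _ multigraphD(1)] multD[of G] by (auto simp: mult_def insert_commute)

lemma cutcard_split:
 assumes G: "multigraph G" and A: "finite A" "U \<subseteq> A" "u \<in> U"
 shows "cutcard G U Q u = (\<Sum>t\<in>A - U. int (card {e \<in> edges G. ends G e = {u, t} \<and> Q e})) + cutcard G A Q u"
proof -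
 let ?T = "\<lambda>t. {e \<in> edges G. ends G e = {u, t} \<and> Q e}"
 let ?R = "{e \<in> cut G A. u \<in> ends G e \<and> Q e}"
 have fin: "finite (?T t)" for t using multigraphD(2)[OF G] by simp
 have ut: "u \<noteq> t" if "t \<in> A - U" for t using that A(3) by blast
 have eq: "{e \<in> cut G U. u \<in> ends G e \<and> Q e} = (\<Union>t\<in>A - U. ?T t) \<union> ?R" (is "?L = ?M \<union> _")
 proof (intro set_eqI iffI)
  fix e assume e: "e \<in> ?L"
  hence eE: "e \<in> edges G" using cut_subset[of G U] by auto
  obtain t where t: "ends G e = {u, t}" "u \<noteq> t" using edge_obtain_tail[OF G eE] e by blast
  have "t \<notin> U" using e in_cut_pair[OF t, of U] A(3) by simp
  thus "e \<in> ?M \<union> ?R" using t eE e in_cut_pair[OF t, of A] A(2,3) by (cases "t \<in> A") auto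
 next
  fix e assume e: "e \<in> ?M \<union> ?R"
  hence eE: "e \<in> edges G" "u \<in> ends G e" using cut_subset[of G A] by auto
  obtain t where t: "ends G e = {u, t}" "u \<noteq> t" using edge_obtain_tail[OF G eE] by blast
  have "t \<notin> U"
  proof (cases "e \<in> ?R")
   case True
   thus ?thesis using in_cut_pair[OF t, of A] A(2,3) by auto
  next
   case False
   then obtain s where "s \<in> A - U" "ends G e = {u, s}" using e by auto
   thus ?thesis using t by (auto simp: doubleton_eq_iff)
  qed
  thus "e \<in> ?L" using in_cut_pair[OF t, of U] A(3) eE e by auto
 qed
 have "?M \<inter> ?R = {}"
 proof -
  have "e \<notin> ?R" if "t \<in> A - U" "e \<in> ?T t" for e t
   using that in_cut_pair[of G e u t A] ut[OF that(1)] A(2,3) by auto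
  thus ?thesis by blast
 qed
 moreover have "finite ?M" "finite ?R" using fin A(1) finite_cut[OF G, of A] by auto
 ultimately have "card ?L = card ?M + card ?R" unfolding eq by (rule card_Un_disjoint[rotated 2])
 moreover have "card ?M = (\<Sum>t\<in>A - U. card (?T t))"
  by (rule card_UN_disjoint) (use A(1) fin in \<open>auto simp: doubleton_eq_iff\<close>)
 ultimately show ?thesis unfolding cutcard_def by simp
qed

lemma cutcard_sum:
 assumes G: "multigraph G" and A: "finite A"
 shows "sum (cutcard G A Q) A = int (card {e \<in> cut G A. Q e})"
proof -
 let ?T = "\<lambda>u. {e \<in> cut G A. u \<in> ends G e \<and> Q e}"
 have "\<exists>u\<in>A. u \<in> ends G e" if e: "e \<in> cut G A" for e
 proof -
  obtain a b where "ends G e = {a, b}" "a \<in> A" "b \<notin> A" using cut_obtain[OF G e] by metis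
  thus ?thesis by auto
 qed
 hence "{e \<in> cut G A. Q e} = (\<Union>u\<in>A. ?T u)" by blast
 moreover have "card (\<Union>u\<in>A. ?T u) = (\<Sum>u\<in>A. card (?T u))"
 proof (rule card_UN_disjoint)
  show "\<forall>u\<in>A. \<forall>v\<in>A. u \<noteq> v \<longrightarrow> ?T u \<inter> ?T v = {}"
  proof (intro ballI impI)
   fix u v assume uv: "u \<in> A" "v \<in> A" "u \<noteq> v"
   have False if e: "e \<in> cut G A" "u \<in> ends G e" "v \<in> ends G e" for e
   proof -
    obtain a b where "ends G e = {a, b}" "a \<in> A" "b \<notin> A" using cut_obtain[OF G e(1)] by metis
    thus False using uv e(2,3) by auto
   qed
   thus "?T u \<inter> ?T v = {}" by blast
  qed
 qed (use A finite_cut[OF G, of A] in auto)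
 ultimately show ?thesis unfolding cutcard_def by simp
qed

text \<open>The tip of the weighted instance is everything outside \<open>A\<close>: cut edges in
  \<open>S\<close> are arcs to that tip, the other cut edges are arcs from it.\<close>

lemma dg_deg:
 assumes G: "multigraph G" and A: "finite A" "U \<subseteq> A"
 shows "dg A (mult G) (es (outs G A S) (ins G A S)) U = int (deg G U)"
proof -
 have fU: "finite U" using finite_subset[OF A(2,1)] .
 have "sum (mult G u) (A - U) + es (outs G A S) (ins G A S) u
   = cutcard G U (\<lambda>e. True) u" if u: "u \<in> U" for u
 proof -
  have "{e \<in> cut G A. u \<in> ends G e} = {e \<in> cut G A. u \<in> ends G e \<and> e \<in> S} \<union> {e \<in> cut G A. u \<in> ends G e \<and> e \<notin> S}" by auto
  hence "card {e \<in> cut G A. u \<in> ends G e} = card {e \<in> cut G A. u \<in> ends G e \<and> e \<in> S} + card {e \<in> cut G A. u \<in> ends G e \<and> e \<notin> S}"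
   using finite_cut[OF G, of A] card_Un_disjoint[of "{e \<in> cut G A. u \<in> ends G e \<and> e \<in> S}" "{e \<in> cut G A. u \<in> ends G e \<and> e \<notin> S}"] by auto
  thus ?thesis unfolding cutcard_split[OF G A u] mult_def by (simp add: cutcard_def)
 qed
 hence "dg A (mult G) (es (outs G A S) (ins G A S)) U = (\<Sum>u\<in>U. cutcard G U (\<lambda>e. True) u)"
  unfolding dg_def by (intro sum.cong) auto
 thus ?thesis unfolding cutcard_sum[OF G fU] deg_def by simp
qed

lemma lft_sum: "3 dvd (\<Sum>u\<in>U. lft (f u)) - lft (sum f U)"
 unfolding of_int_3_eq[symmetric] by simp

lemma bs_demand:
 "bs (demand G A S) (outs G A S) (ins G A S) U = (\<Sum>u\<in>U. lft (bdry G u))"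
 by (rule sum.cong) (simp_all add: demand_def)

lemma demand_sum:
 assumes G: "multigraph G" and A: "finite A" and S: "S \<subseteq> cut G A" and b: "balance G S A = bd G A"
 shows "3 dvd sum (demand G A S) A"
proof -
 have "{e \<in> cut G A. e \<in> S} = S" "{e \<in> cut G A. e \<notin> S} = cut G A - S" using S by auto
 hence "sum (demand G A S) A = (\<Sum>u\<in>A. lft (bdry G u)) - int (card S) + int (card (cut G A - S))"
  unfolding demand_def sum.distrib sum_subtractf cutcard_sum[OF G A] by simp
 moreover have "3 dvd (\<Sum>u\<in>A. lft (bdry G u)) - (int (card S) - int (card (cut G A - S)))"
  unfolding of_int_3_eq[symmetric] using b by (simp add: balance_def)
 moreover have "x - a + c = x - (a - c)" for x a c :: int by simp
 ultimately show ?thesis by (simp only:)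
qed

lemma good_local:
 assumes G: "multigraph G" and A: "A \<subseteq> verts G" and S: "S \<subseteq> cut G A" and b: "balance G S A = bd G A"
  and t: "\<And>B. B \<noteq> {} ==> B \<subset> A ==> B \<inter> F = {} ==> tms G B"
  and k: "\<And>B. B \<noteq> {} ==> B \<subset> A ==> B \<inter> F \<noteq> {} ==> k \<le> int (deg G B)"
 shows "good F k A (mult G) (demand G A S) (outs G A S) (ins G A S)"
proof -
 have fA: "finite A" using finite_subset[OF A multigraphD(1)[OF G]] .
 have "tm (int (deg G B)) (bs (demand G A S) (outs G A S) (ins G A S) B)" if "tms G B" for B
  using that tm_cong[OF lft_sum[where f = "bdry G" and U = B]] unfolding bs_demand tms_def by simp
 note tb = this
 have nn: "\<forall>u\<in>A. 0 \<le> outs G A S u \<and> 0 \<le> ins G A S u" by (simp add: cutcard_def)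
 show ?thesis unfolding good_def
 proof (intro conjI allI impI mg_mult[OF G A] nn demand_sum[OF G fA S b])
  fix B assume B: "B \<noteq> {} \<and> B \<subset> A"
  hence "B \<subseteq> A" by blast
  note d = dg_deg[OF G fA this, of S]
  show "tm (dg A (mult G) (es (outs G A S) (ins G A S)) B)
     (bs (demand G A S) (outs G A S) (ins G A S) B)" if "B \<inter> F = {}"
   unfolding d using tb[OF t[of B]] B that by blast
  show "k \<le> dg A (mult G) (es (outs G A S) (ins G A S)) B" if "B \<inter> F \<noteq> {}"
   unfolding d using k[of B] B that by blast
 qed
qed

text \<open>A weighted flow only counts arcs between two vertices. It is realised by directing that
  many of the parallel edges one way and the rest back; the counts at each vertex are passed on for
  the sake of nonuniformity.\<close>

lemma flow_local:
 assumes G: "multigraph G" and A: "A \<subseteq> verts G" and S: "S \<subseteq> cut G A" and f: "flow A (mult G) (demand G A S) f"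
 shows "\<exists>t. loc G A t \<and> outset G t A = S \<and>
  (\<forall>v\<in>A. int (card (outset G t {v})) = outs G A S v + sum (f v) A \<and>
   int (card (cut G {v} - outset G t {v})) = ins G A S v + (\<Sum>u\<in>A. f u v))"
proof -
 note F = flowD[OF f]
 have fA: "finite A" using finite_subset[OF A multigraphD(1)[OF G]] .
 \<comment> \<open>\<open>r\<close> and \<open>s\<close> fix an order of the ends of an edge. Among
   the edges with a given pair of ends, \<open>X\<close> selects those that run from
   \<open>r\<close> to \<open>s\<close>.\<close>
 define r where "r D = (SOME v. v \<in> D)" for D :: "'a set"
 define s where "s D = (SOME v. v \<in> D \<and> v \<noteq> r D)" for D :: "'a set"
 define E where "E D = {e \<in> edges G. ends G e = D}" for D
 define X where "X D = (SOME X. X \<subseteq> E D \<and> card X = nat (f (r D) (s D)))" for D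
 have fE: "finite (E D)" for D unfolding E_def using multigraphD(2)[OF G] by simp
 have rs: "r {u, v} = u \<and> s {u, v} = v \<or> r {u, v} = v \<and> s {u, v} = u" if "u \<noteq> v" for u v
 proof -
  have r: "r {u, v} \<in> {u, v}" unfolding r_def by (rule someI_ex) auto
  hence "\<exists>w. w \<in> {u, v} \<and> w \<noteq> r {u, v}" using that by auto
  hence "s {u, v} \<in> {u, v} \<and> s {u, v} \<noteq> r {u, v}" unfolding s_def by (rule someI_ex)
  thus ?thesis using r by auto
 qed
 have m: "int (card (E {u, v})) = f u v + f v u" if "u \<in> A" "v \<in> A" for u v
  using F(2)[OF that] unfolding mult_def E_def by simp
 have X: "X {u, v} \<subseteq> E {u, v} \<and> card (X {u, v}) = nat (f (r {u, v}) (s {u, v}))" if "u \<in> A" "v \<in> A" "u \<noteq> v" for u v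
 proof -
  have "nat (f (r {u, v}) (s {u, v})) \<le> card (E {u, v})"
   using rs[OF that(3)] m[OF that(1,2)] F(1)[OF that(1,2)] F(1)[OF that(2,1)] by auto
  hence "\<exists>X. X \<subseteq> E {u, v} \<and> card X = nat (f (r {u, v}) (s {u, v}))" by (meson obtain_subset_with_card_n)
  thus ?thesis unfolding X_def by (rule someI_ex)
 qed
 define t where "t e = (if e \<in> cut G A then (if e \<in> S then SOME v. v \<in> ends G e \<and> v \<in> A else SOME v. v \<in> ends G e \<and> v \<notin> A)
  else if e \<in> X (ends G e) then r (ends G e) else s (ends G e))" for e
 have tcut: "t e = (if e \<in> S then u else v)" if "e \<in> edges G" "ends G e = {u, v}" "u \<in> A" "v \<notin> A" for e u v
 proof -
  have "e \<in> cut G A" using in_cut_pair[OF that(2), of A] that by auto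
  moreover have "(SOME w. w \<in> ends G e \<and> w \<in> A) = u" using that by (intro some_equality) auto
  moreover have "(SOME w. w \<in> ends G e \<and> w \<notin> A) = v" using that by (intro some_equality) auto
  ultimately show ?thesis unfolding t_def by simp
 qed
 have o: "orientation G t"
  unfolding orientation_def
 proof
  fix e assume e: "e \<in> edges G"
  show "t e \<in> ends G e"
  proof (cases "e \<in> cut G A")
   case True
   obtain u v where uv: "ends G e = {u, v}" "u \<in> A" "v \<notin> A" using cut_obtain[OF G True] by metis
   show ?thesis using tcut[OF e uv] uv(1) by auto
  next
   case False
   obtain u v where uv: "ends G e = {u, v}" "u \<noteq> v" using edge_obtain[OF G e] .
   show ?thesis using rs[OF uv(2)] False unfolding t_def uv(1) by auto
  qed
 qed
 have inner: "int (card {e \<in> edges G. ends G e = {u, v} \<and> t e = u}) = f u v" if uv: "u \<in> A" "v \<in> A" "u \<noteq> v" for u v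
 proof -
  have nc: "e \<notin> cut G A" if "ends G e = {u, v}" for e using in_cut_pair[OF that uv(3), of A] uv by simp
  note x = X[OF uv]
  have fx: "finite (X {u, v})" using finite_subset[OF _ fE] x by blast
  show ?thesis
  proof (cases "r {u, v} = u")
   case True
   hence "s {u, v} = v" using rs[OF uv(3)] uv(3) by auto
   hence "{e \<in> edges G. ends G e = {u, v} \<and> t e = u} = X {u, v}"
    using x True uv(3) nc unfolding t_def E_def by auto
   thus ?thesis using x True \<open>s {u, v} = v\<close> F(1)[OF uv(1,2)] by simp
  next
   case False
   hence rs': "r {u, v} = v" "s {u, v} = u" using rs[OF uv(3)] by auto
   hence eq: "{e \<in> edges G. ends G e = {u, v} \<and> t e = u} = E {u, v} - X {u, v}"
    using x uv(3) nc unfolding t_def E_def by auto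
   have "card (E {u, v} - X {u, v}) = card (E {u, v}) - card (X {u, v})" by (rule card_Diff_subset) (use x fx in auto)
   moreover have "card (X {u, v}) \<le> card (E {u, v})" using x card_mono[OF fE] by blast
   ultimately show ?thesis unfolding eq using m[OF uv(1,2)] x rs' F(1)[OF uv(1,2)] F(1)[OF uv(2,1)] by simp
  qed
 qed
 have inner': "int (card {e \<in> edges G. ends G e = {u, v} \<and> t e \<noteq> u}) = f v u" if uv: "u \<in> A" "v \<in> A" "u \<noteq> v" for u v
 proof -
  have "t e \<in> {u, v}" if "e \<in> edges G" "ends G e = {u, v}" for e using orientationD[OF o that(1)] that(2) by simp
  hence "{e \<in> edges G. ends G e = {u, v} \<and> t e \<noteq> u} = {e \<in> edges G. ends G e = {v, u} \<and> t e = v}"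
   using uv(3) by (auto simp: insert_commute)
  thus ?thesis using inner[OF uv(2,1)] uv(3) by simp
 qed
 have S: "e \<in> S \<longleftrightarrow> t e = v" if e: "e \<in> cut G A" "v \<in> ends G e" "v \<in> A" for e v
 proof -
  obtain a b where ab: "ends G e = {a, b}" "a \<in> A" "b \<notin> A" using cut_obtain[OF G e(1)] by metis
  hence "v = a" "a \<noteq> b" using e(2,3) by auto
  moreover have "e \<in> edges G" by (rule cut_edge[OF e(1)])
  ultimately show ?thesis using tcut[OF _ ab] by simp
 qed
 have out: "int (card (outset G t {v})) = outs G A S v + sum (f v) A" if v: "v \<in> A" for v
 proof -
  have "outset G t {v} = {e \<in> cut G {v}. v \<in> ends G e \<and> t e = v}"
   using orientationD[OF o] cut_subset[of G "{v}"] by (auto simp: outset_def)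
  hence "int (card (outset G t {v})) = cutcard G {v} (\<lambda>e. t e = v) v" by (simp add: cutcard_def)
  also have "\<dots> = (\<Sum>u\<in>A - {v}. int (card {e \<in> edges G. ends G e = {v, u} \<and> t e = v})) + cutcard G A (\<lambda>e. t e = v) v"
   by (rule cutcard_split[OF G fA]) (use v in auto)
  also have "(\<Sum>u\<in>A - {v}. int (card {e \<in> edges G. ends G e = {v, u} \<and> t e = v})) = sum (f v) (A - {v})"
   by (rule sum.cong) (use inner[OF v] in auto)
  also have "cutcard G A (\<lambda>e. t e = v) v = outs G A S v"
   unfolding cutcard_def using S[OF _ _ v]
   by (intro arg_cong[where f = "\<lambda>X. int (card X)"] Collect_cong) auto
  finally show ?thesis using F(2)[OF v v] multD[OF G, of v] sum.remove[OF fA v, of "f v"] by simp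
 qed
 have inn: "int (card (cut G {v} - outset G t {v})) = ins G A S v + (\<Sum>u\<in>A. f u v)" if v: "v \<in> A" for v
 proof -
  have "v \<in> ends G e" if e: "e \<in> cut G {v}" for e
  proof -
   obtain a b where "ends G e = {a, b}" "a \<in> {v}" using cut_obtain[OF G e] by metis
   thus ?thesis by auto
  qed
  hence "cut G {v} - outset G t {v} = {e \<in> cut G {v}. v \<in> ends G e \<and> t e \<noteq> v}" by (auto simp: outset_def)
  hence "int (card (cut G {v} - outset G t {v})) = cutcard G {v} (\<lambda>e. t e \<noteq> v) v" by (simp add: cutcard_def)
  also have "\<dots> = (\<Sum>u\<in>A - {v}. int (card {e \<in> edges G. ends G e = {v, u} \<and> t e \<noteq> v})) + cutcard G A (\<lambda>e. t e \<noteq> v) v"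
   by (rule cutcard_split[OF G fA]) (use v in auto)
  also have "(\<Sum>u\<in>A - {v}. int (card {e \<in> edges G. ends G e = {v, u} \<and> t e \<noteq> v})) = (\<Sum>u\<in>A - {v}. f u v)"
   by (rule sum.cong) (use inner'[OF v] in auto)
  also have "cutcard G A (\<lambda>e. t e \<noteq> v) v = ins G A S v"
   unfolding cutcard_def using S[OF _ _ v]
   by (intro arg_cong[where f = "\<lambda>X. int (card X)"] Collect_cong) auto
  finally show ?thesis using F(2)[OF v v] multD[OF G, of v] sum.remove[OF fA v, of "\<lambda>u. f u v"] by simp
 qed
 have "net G t {v} = bdry G v" if v: "v \<in> A" for v
 proof -
  have "net G t {v} = of_int (int (card (outset G t {v})) - int (card (cut G {v} - outset G t {v})))"
   unfolding net_balance[OF G o] balance_def by simp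
  also have "\<dots> = of_int (lft (bdry G v))"
   unfolding of_int_3_eq out[OF v] inn[OF v] using F(3)[OF v] unfolding demand_def sum_subtractf by (simp add: algebra_simps)
  finally show ?thesis by simp
 qed
 hence "loc G A t" using o by (simp add: loc_def)
 moreover have "outset G t A = S"
 proof -
  have "t e \<in> A \<longleftrightarrow> e \<in> S" if e: "e \<in> cut G A" for e
  proof -
   obtain u v where uv: "ends G e = {u, v}" "u \<in> A" "v \<notin> A" using cut_obtain[OF G e] by metis
   have "e \<in> edges G" by (rule cut_edge[OF e])
   thus ?thesis using tcut[OF _ uv] uv by simp
  qed
  thus ?thesis unfolding outset_def using assms(3) by blast
 qed
 ultimately show ?thesis using out inn by (intro exI[of _ t]) simp
qed

lemma local_ext:
 assumes "multigraph G" "A \<subseteq> verts G" "S \<subseteq> cut G A" "ext A (mult G) (demand G A S)"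
 shows "\<exists>t. loc G A t \<and> outset G t A = S"
proof -
 obtain f where "flow A (mult G) (demand G A S) f" using assms(4) unfolding ext_def by blast
 from flow_local[OF assms(1-3) this] show ?thesis by blast
qed

lemma local_extension:
 assumes G: "multigraph G" and A: "A \<subseteq> verts G" and S: "S \<subseteq> cut G A" and b: "balance G S A = bd G A"
  and t: "\<And>B. B \<noteq> {} ==> B \<subset> A ==> tms G B" and n: "\<not> sts G A"
 shows "\<exists>t. loc G A t \<and> outset G t A = S"
proof (rule local_ext[OF G A S])
 let ?x = "outs G A S" and ?y = "ins G A S"
 have fA: "finite A" using finite_subset[OF A multigraphD(1)[OF G]] .
 have g: "good {} 0 A (mult G) (demand G A S) ?x ?y"
  by (rule good_local[OF G A S b]) (use t in auto)
 have "sum (es ?x ?y) A = int (deg G A)" using dg_deg[OF G fA order.refl, of S] unfolding dg_all .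
 hence "\<not> st (sum (es ?x ?y) A) (bs (demand G A S) ?x ?y A)"
  using n st_cong[OF lft_sum[where f = "bdry G" and U = A]] unfolding sts_def bs_demand by simp
 thus "ext A (mult G) (demand G A S)" using tip_extension[OF g] unfolding tipok_def by simp
qed

lemma local_extension_at:
 assumes G: "multigraph G" and A: "A \<subseteq> verts G" and S: "S \<subseteq> cut G A" and b: "balance G S A = bd G A" and v: "v \<in> A"
  and t: "\<And>B. B \<noteq> {} ==> B \<subset> A ==> v \<notin> B ==> tms G B"
  and k: "\<And>B. B \<subset> A ==> v \<in> B ==> k \<le> deg G B" "deg G A \<le> k + 1"
 shows "\<exists>t. loc G A t \<and> outset G t A = S"
proof (rule local_ext[OF G A S])
 let ?x = "outs G A S" and ?y = "ins G A S"
 have fA: "finite A" using finite_subset[OF A multigraphD(1)[OF G]] .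
 have g: "good {v} (int k) A (mult G) (demand G A S) ?x ?y"
  by (rule good_local[OF G A S b]) (use t k(1) in auto)
 have "sum (es ?x ?y) A = int (deg G A)" using dg_deg[OF G fA order.refl, of S] unfolding dg_all .
 hence "tipok {v} (int k) A (demand G A S) ?x ?y" using k(2) v unfolding tipok_def by simp
 thus "ext A (mult G) (demand G A S)" using tip_extension[OF g] by simp
qed

lemma nuext_local:
 assumes G: "multigraph G" and A: "A \<subseteq> verts G" and S: "S \<subseteq> cut G A" and v: "v \<in> A"
  and n: "nuext A (mult G) (demand G A S) (outs G A S) (ins G A S) v"
 shows "\<exists>t. loc G A t \<and> outset G t A = S \<and> outset G t {v} \<noteq> {} \<and> outset G t {v} \<noteq> cut G {v}"
proof -
 obtain f where f: "flow A (mult G) (demand G A S) f" "0 < outs G A S v + sum (f v) A"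
   "0 < ins G A S v + (\<Sum>t\<in>A. f t v)" using n unfolding nuext_def by blast
 from flow_local[OF G A S f(1)] v obtain t where t: "loc G A t" "outset G t A = S"
  "int (card (outset G t {v})) = outs G A S v + sum (f v) A"
  "int (card (cut G {v} - outset G t {v})) = ins G A S v + (\<Sum>u\<in>A. f u v)"
  by blast
 have "0 < int (card (outset G t {v}))" "0 < int (card (cut G {v} - outset G t {v}))" unfolding t(3,4) using f(2,3) by blast+
 thus ?thesis using t(1,2) by (intro exI[of _ t]) auto
qed

lemma local_nonuniform_small:
 assumes G: "multigraph G" and A: "A \<subseteq> verts G" and S: "S \<subseteq> cut G A" and b: "balance G S A = bd G A" and v: "v \<in> A"
  and t: "\<And>B. B \<noteq> {} ==> B \<subset> A ==> v \<notin> B ==> tms G B"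
  and k: "\<And>B. B \<subset> A ==> v \<in> B ==> k \<le> deg G B" "deg G A + 1 \<le> k" "2 \<le> deg G A" "6 \<le> k" "k \<le> deg G {v}"
 shows "\<exists>t. loc G A t \<and> outset G t A = S \<and> outset G t {v} \<noteq> {} \<and> outset G t {v} \<noteq> cut G {v}"
proof (rule nuext_local[OF G A S v])
 let ?x = "outs G A S" and ?y = "ins G A S"
 have fA: "finite A" using finite_subset[OF A multigraphD(1)[OF G]] .
 have g: "good {v} (int k) A (mult G) (demand G A S) ?x ?y"
  by (rule good_local[OF G A S b]) (use t k(1) in auto)
 have "sum (es ?x ?y) A = int (deg G A)" using dg_deg[OF G fA order.refl, of S] unfolding dg_all .
 moreover have "dg A (mult G) (es ?x ?y) {v} = int (deg G {v})" using v by (intro dg_deg[OF G fA]) simp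
 ultimately show "nuext A (mult G) (demand G A S) ?x ?y v"
  using k by (intro nonuniform_extension_small[OF g v]) auto
qed

lemma local_nonuniform:
 assumes G: "multigraph G" and A: "A \<subseteq> verts G" and S: "S \<subseteq> cut G A" and b: "balance G S A = bd G A" and v: "v \<in> A"
  and t: "\<And>B. B \<noteq> {} ==> B \<subset> A ==> v \<notin> B ==> tms G B"
  and k: "\<And>B. B \<subset> A ==> v \<in> B ==> deg G A \<le> deg G B" "6 \<le> deg G A" "deg G A \<le> deg G {v}"
  and nu: "S \<noteq> {}" "S \<noteq> cut G A"
 shows "\<exists>t. loc G A t \<and> outset G t A = S \<and> outset G t {v} \<noteq> {} \<and> outset G t {v} \<noteq> cut G {v}"
proof (rule nuext_local[OF G A S v])
 let ?x = "outs G A S" and ?y = "ins G A S"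
 have fA: "finite A" using finite_subset[OF A multigraphD(1)[OF G]] .
 have g: "good {v} (int (deg G A)) A (mult G) (demand G A S) ?x ?y"
  by (rule good_local[OF G A S b]) (use t k(1) in auto)
 have "sum (es ?x ?y) A = int (deg G A)" using dg_deg[OF G fA order.refl, of S] unfolding dg_all .
 moreover have "dg A (mult G) (es ?x ?y) {v} = int (deg G {v})" using v by (intro dg_deg[OF G fA]) simp
 moreover have "0 < sum ?x A" "0 < sum ?y A"
 proof -
  have eq: "{e \<in> cut G A. e \<in> S} = S" "{e \<in> cut G A. e \<notin> S} = cut G A - S" using S by auto
  have "finite S" "finite (cut G A - S)" using finite_cut[OF G, of A] finite_subset[OF S] by auto
  thus "0 < sum ?x A" "0 < sum ?y A" unfolding cutcard_sum[OF G fA] eq using nu S by (auto simp: card_gt_0_iff)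
 qed
 ultimately show "nuext A (mult G) (demand G A S) ?x ?y v"
  using k by (intro nonuniform_extension[OF g v]) auto
qed

lemma local_two:
 assumes G: "multigraph G" and A: "{u, v} \<subseteq> verts G" "u \<noteq> v" and S: "S \<subseteq> cut G {u, v}" and b: "balance G S {u, v} = bd G {u, v}"
  and e: "e \<in> edges G" "f \<in> edges G" "e \<noteq> f" "ends G e = {u, v}" "ends G f = {u, v}"
 shows "\<exists>t. loc G {u, v} t \<and> outset G t {u, v} = S"
proof (rule local_ext[OF G A(1) S])
 have "card {e, f} \<le> card {e \<in> edges G. ends G e = {u, v}}" using e multigraphD(2)[OF G] by (intro card_mono) auto
 hence "2 \<le> mult G u v" using e(3) unfolding mult_def by simp
 moreover have "3 dvd demand G {u, v} S u + demand G {u, v} S v" using demand_sum[OF G _ S b] A(2) by simp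
 ultimately show "ext {u, v} (mult G) (demand G {u, v} S)" by (intro two_ext[OF mg_mult[OF G A(1)] A(2)])
qed

section \<open>Gluing and critical canvases\<close>

definition collapse :: "'v set => 'v set => 'v set set" where
 "collapse V A = insert A (singles (V - A))"

lemma partition_collapse: "A \<subseteq> V ==> A \<noteq> {} ==> partition_on V (collapse V A)"
 unfolding collapse_def by (intro partition_onI) (auto simp: disjnt_def)

lemma partition_singletons: "partition_on V (singles V)"
 by (intro partition_onI) (auto simp: disjnt_def)

lemma restriction_eq: "A \<subseteq> verts G ==> restriction G A = (contract G (collapse (verts G) (verts G - A)), verts G - A)"
 unfolding restriction_def collapse_def by (simp add: double_diff)

text \<open>Edges with both ends in \<open>A\<close> follow \<open>t2\<close> and all others follow
  \<open>t\<close>; the two agree on the cut of \<open>A\<close>.\<close>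

lemma glue:
 assumes G: "multigraph G" and t: "orientation G t" and t2: "orientation G t2" and eq: "outset G t2 A = outset G t A"
 obtains t3 where "orientation G t3" "\<And>X. X \<subseteq> A ==> outset G t3 X = outset G t2 X"
  "\<And>X. X \<inter> A = {} ==> outset G t3 X = outset G t X"
proof -
 define t3 where "t3 e = (if ends G e \<subseteq> A then t2 e else t e)" for e
 have "orientation G t3" using t t2 unfolding orientation_def t3_def by simp
 moreover have "outset G t3 X = outset G t2 X" if X: "X \<subseteq> A" for X
 proof -
  have "t3 e \<in> X \<longleftrightarrow> t2 e \<in> X" if e: "e \<in> cut G X" for e
  proof (cases "ends G e \<subseteq> A")
   case True
   thus ?thesis by (simp add: t3_def)
  next
   case False
   have eE: "e \<in> edges G" by (rule cut_edge[OF e])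
   obtain u v where uv: "ends G e = {u, v}" "u \<noteq> v" "u \<in> X" "v \<notin> X" using cut_obtain[OF G e] by metis
   have v: "v \<notin> A" using False uv X by auto
   have "e \<in> cut G A" using in_cut_pair[OF uv(1,2), of A] eE uv(3) X v by auto
   hence "t2 e \<in> A \<longleftrightarrow> t e \<in> A" using eq unfolding outset_def by blast
   moreover have "t e \<in> {u, v}" "t2 e \<in> {u, v}" using orientationD[OF t eE] orientationD[OF t2 eE] uv(1) by auto
   ultimately have "t e \<in> X \<longleftrightarrow> t2 e \<in> X" using uv(3,4) v X by auto
   thus ?thesis using False by (simp add: t3_def)
  qed
  thus ?thesis unfolding outset_def by blast
 qed
 moreover have "outset G t3 X = outset G t X" if X: "X \<inter> A = {}" for X
 proof -
  have "t3 e = t e" if e: "e \<in> cut G X" for e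
  proof -
   obtain u v where "ends G e = {u, v}" "u \<in> X" using cut_obtain[OF G e] by metis
   thus ?thesis using X unfolding t3_def by auto
  qed
  thus ?thesis unfolding outset_def by auto
 qed
 ultimately show ?thesis using that by blast
qed

lemma outset_compl:
 assumes G: "multigraph G" and t: "orientation G t"
 shows "outset G t (verts G - A) = cut G A - outset G t A"
 unfolding outset_def cut_compl[OF G]
 using orientationD[OF t] multigraphD(3)[OF G] cut_subset[of G A] by blast

lemma net_eq_outset:
 "multigraph G ==> orientation G t ==> orientation G t2 ==> outset G t2 X = outset G t X ==> net G t2 X = net G t X"
 by (simp add: net_balance)

lemma loc_net:
 assumes "multigraph G" "loc G A t" "finite A"
 shows "net G t A = bd G A"
proof -
 have "orientation G t" using assms(2) by (simp add: loc_def)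
 hence "net G t A = (\<Sum>v\<in>A. net G t {v})" by (rule net_singletons[OF assms(1) _ assms(3)])
 also have "\<dots> = bd G A" by (rule sum.cong) (use assms(2) in \<open>simp_all add: loc_def\<close>)
 finally show ?thesis .
qed

lemma extends_loc: "multigraph G ==> extends G z S \<longleftrightarrow> (\<exists>t. loc G (verts G) t \<and> outset G t {z} = S)"
 unfolding extends_part_ext part_ext_def loc_def by auto

lemma loc_cong:
 assumes "multigraph G" "loc G A t" "orientation G t3" "\<And>a. a \<in> A ==> outset G t3 {a} = outset G t {a}"
 shows "loc G A t3"
proof -
 have o: "orientation G t" using assms(2) by (simp add: loc_def)
 show ?thesis using assms(2-4) net_eq_outset[OF assms(1) o assms(3)] unfolding loc_def by simp
qed

lemma expand:
 assumes G: "multigraph G" and A: "A \<subseteq> verts G" and z: "X \<inter> A = {}"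
  and t: "loc G (verts G - A) t" and t2: "loc G A t2" and eq: "outset G t2 A = outset G t A"
 shows "\<exists>t3. loc G (verts G) t3 \<and> outset G t3 X = outset G t X \<and> (\<forall>v\<in>A. outset G t3 {v} = outset G t2 {v})"
proof -
 have o: "orientation G t" "orientation G t2" using t t2 by (auto simp: loc_def)
 obtain t3 where t3: "orientation G t3" "\<And>X. X \<subseteq> A ==> outset G t3 X = outset G t2 X"
  "\<And>X. X \<inter> A = {} ==> outset G t3 X = outset G t X" using glue[OF G o eq] by blast
 have "loc G A t3" by (rule loc_cong[OF G t2 t3(1)]) (use t3(2) in auto)
 moreover have "loc G (verts G - A) t3" by (rule loc_cong[OF G t t3(1)]) (use t3(3) in auto)
 ultimately have "loc G (verts G) t3" unfolding loc_def by blast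
 thus ?thesis using t3(2,3) z by auto
qed

lemma extends_expand:
 assumes "multigraph G" "A \<subseteq> verts G" "z \<notin> A" "loc G (verts G - A) t" "loc G A t2" "outset G t2 A = outset G t A"
 shows "extends G z (outset G t {z})"
 using expand[OF assms(1,2) _ assms(4-6), of "{z}"] assms(3) unfolding extends_loc[OF assms(1)] by auto

lemma part_ext_collapse:
 assumes "multigraph G"
 shows "part_ext G (collapse (verts G) A) b S \<longleftrightarrow>
  (\<exists>t. loc G (verts G - A) t \<and> net G t A = bd G A \<and> outset G t b = S)"
 unfolding part_ext_def collapse_def loc_def by auto

text \<open>\<open>tm\<close> does not mention parity: among degrees of the appropriate parity, each
  of the thresholds 4, 5, 6 and 7 amounts to it.\<close>

lemma tame_tms: "tame G z \<longleftrightarrow> (\<forall>v\<in>verts G - {z}. tms G {v})"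
proof -
 have "int (deg G {v}) \<ge> 4 + abs_tau G {v} \<longleftrightarrow> tms G {v}" for v
 proof -
  define n where "n = deg G {v}"
  define b where "b = bdry G v"
  have 3: "3 dvd lft b \<longleftrightarrow> b = 0" using of_int_3_eq_0[of "lft b"] by simp
  have a: "abs_tau G {v} = (if even n then if b = 0 then 0 else 2 else if b = 0 then 3 else 1)"
   unfolding abs_tau_def tau_def Let_def n_def[symmetric] by (simp add: b_def)
  have "4 \<le> int n \<longleftrightarrow> 6 \<le> int n \<or> int n = 4" "6 \<le> int n \<longleftrightarrow> 6 \<le> int n \<or> int n = 5" if "even n"
   using that by presburger+
  moreover have "7 \<le> int n \<longleftrightarrow> 6 \<le> int n \<or> int n = 4" "5 \<le> int n \<longleftrightarrow> 6 \<le> int n \<or> int n = 5" if "odd n"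
   using that by presburger+
  ultimately show ?thesis unfolding a tms_def tm_def n_def[symmetric] by (simp add: 3 b_def[symmetric])
 qed
 thus ?thesis unfolding tame_def by blast
qed

lemma sts_tms: "sts G A ==> tms G A" unfolding sts_def tms_def by (rule st_tm)
lemma tms_deg: "tms G A ==> 4 \<le> deg G A" unfolding tms_def using tm_ge4 by fastforce
lemma sts_deg: "sts G A ==> 6 \<le> deg G A" unfolding sts_def st_def by linarith

lemma tms_contract:
 "multigraph G ==> partition_on (verts G) P ==> \<A> \<subseteq> P ==> tms (contract G P) \<A> \<longleftrightarrow> tms G (\<Union>\<A>)"
 unfolding tms_def by (simp only: deg_contract bdry_contract_Union)

lemma set_induct_tms:
 assumes tame: "\<And>v. v \<in> A ==> tms G {v}" and s: "\<And>B. B \<subset> A ==> 2 \<le> card B ==> sts G B" and f: "finite A"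
  and B: "B \<noteq> {}" "B \<subset> A"
 shows "tms G B"
proof -
 have fB: "finite B" using finite_subset[OF _ f] B(2) by blast
 hence "0 < card B" using B(1) by (simp add: card_gt_0_iff)
 then consider "card B = 1" | "2 \<le> card B" by linarith
 thus ?thesis
 proof cases
  case 1
  then obtain v where "B = {v}" by (meson card_1_singletonE)
  thus ?thesis using tame B(2) by blast
 next
  case 2
  thus ?thesis using s[OF B(2)] sts_tms by blast
 qed
qed

text \<open>A smallest exception \<open>A\<close> could be filled in by
  \<open>local_extension\<close> after any flow of the quotient that collapses it. Every preflow
  that extends to this quotient would extend to \<open>G\<close>, against criticality.\<close>

lemma critical_sts:
 assumes G: "multigraph G" and z: "z \<in> verts G" and cr: "flow_critical G z" and tm: "tame G z"
  and A: "A \<subseteq> verts G - {z}" "2 \<le> card A"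
 shows "sts G A"
 using A
proof (induction "card A" arbitrary: A rule: less_induct)
 case less
 have AV: "A \<subseteq> verts G" "z \<notin> A" and fA: "finite A" using less.prems(1) finite_subset[OF _ multigraphD(1)[OF G]] by auto
 have ne: "A \<noteq> {}" using less.prems(2) by auto
 have tms: "tms G B" if B: "B \<noteq> {}" "B \<subset> A" for B
 proof (rule set_induct_tms[OF _ _ fA B])
  show "tms G {v}" if "v \<in> A" for v using tm that less.prems(1) unfolding tame_tms by blast
  show "sts G B" if "B \<subset> A" "2 \<le> card B" for B
   using less.hyps[OF psubset_card_mono[OF fA that(1)] _ that(2)] that(1) less.prems(1) by blast
 qed
 show ?case
 proof (rule ccontr)
  assume n: "\<not> sts G A"
  note P = partition_collapse[OF AV(1) ne]
  have "{z} \<in> collapse (verts G) A" using z AV(2) unfolding collapse_def by blast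
  moreover have "nontrivial (collapse (verts G) A)" unfolding nontrivial_def collapse_def using less.prems(2) by blast
  ultimately obtain S where S: "extends (contract G (collapse (verts G) A)) {z} S" "\<not> extends G z S"
   using cr P unfolding flow_critical_def tip_respecting_def by blast
  have "part_ext G (collapse (verts G) A) {z} S" using S(1) extends_contract[OF G P \<open>{z} \<in> _\<close>] by simp
  then obtain t where t: "loc G (verts G - A) t" "net G t A = bd G A" "outset G t {z} = S"
   unfolding part_ext_collapse[OF G] by blast
  have "balance G (outset G t A) A = bd G A" using net_balance[OF G, of t A] t(1,2) by (simp add: loc_def)
  then obtain t2 where "loc G A t2" "outset G t2 A = outset G t A"
   using local_extension[OF G AV(1) outset_subset _ tms n] by blast
  thus False using extends_expand[OF G AV t(1)] t(3) S(2) by blast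
 qed
qed

lemma component_eq_verts:
 assumes G: "multigraph G" and z: "z \<in> verts G" and c: "\<And>A. A \<noteq> {} ==> A \<subseteq> verts G - {z} ==> cut G A \<noteq> {}"
  and v: "v \<in> verts G"
 shows "component G v = verts G"
proof -
 have step: "b \<in> verts G" if "(a, b) \<in> adj G" for a b using that multigraphD(3)[OF G] unfolding adj_def by fastforce
 have sub: "component G v \<subseteq> verts G"
 proof
  fix w assume "w \<in> component G v"
  hence "(v, w) \<in> (adj G)\<^sup>*" by (simp add: component_def)
  thus "w \<in> verts G" by (induction rule: rtrancl_induct) (use v step in auto)
 qed
 have cut: "cut G (component G v) = {}"
 proof (rule ccontr)
  assume "cut G (component G v) \<noteq> {}"
  then obtain e where e: "e \<in> cut G (component G v)" by blast
  obtain a b where ab: "ends G e = {a, b}" "a \<in> component G v" "b \<notin> component G v" using cut_obtain[OF G e] by metis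
  have "(a, b) \<in> adj G" using ab(1) e cut_subset[of G] unfolding adj_def by blast
  hence "b \<in> component G v" using ab(2) unfolding component_def by (auto intro: rtrancl.rtrancl_into_rtrancl)
  thus False using ab(3) by simp
 qed
 have vc: "v \<in> component G v" by (simp add: component_def)
 have "z \<in> component G v"
 proof (rule ccontr)
  assume "z \<notin> component G v"
  hence "component G v \<subseteq> verts G - {z}" using sub by blast
  thus False using c[of "component G v"] cut vc by blast
 qed
 hence "verts G - component G v \<subseteq> verts G - {z}" by blast
 hence "verts G - component G v = {}" using c[of "verts G - component G v"] cut cut_compl[OF G, of "component G v"] by blast
 thus ?thesis using sub by blast
qed

text \<open>The degree bounds force connectedness, so the condition on components becomes one
  equation, easily checked after a reduction.\<close>

lemma bordered_total:
 assumes "multigraph G" "z \<in> verts G" "\<And>A. A \<noteq> {} ==> A \<subseteq> verts G - {z} ==> tms G A"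
 shows "bordered_graph G \<longleftrightarrow> bd G (verts G) = 0"
proof -
 have "cut G A \<noteq> {}" if "A \<noteq> {}" "A \<subseteq> verts G - {z}" for A
  using tms_deg[OF assms(3)[OF that]] unfolding deg_def by auto
 note c = component_eq_verts[OF assms(1,2) this]
 show ?thesis unfolding bordered_graph_def using c assms(1,2) by auto
qed

lemma critical_tms:
 assumes G: "multigraph G" and z: "z \<in> verts G" and cr: "flow_critical G z" and tm: "tame G z"
  and A: "A \<noteq> {}" "A \<subseteq> verts G - {z}"
 shows "tms G A"
proof (cases "2 \<le> card A")
 case True
 thus ?thesis using critical_sts[OF G z cr tm A(2)] sts_tms by blast
next
 case False
 have "finite A" using A(2) finite_subset[OF _ multigraphD(1)[OF G]] by blast
 hence "card A = 1" using False A(1) card_gt_0_iff[of A] by linarith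
 then obtain v where "A = {v}" by (meson card_1_singletonE)
 thus ?thesis using tm A(2) unfolding tame_tms by blast
qed

text \<open>The tip is the complement of the other vertices, so a tip preflow is an orientation of
  their cut with the directions exchanged.\<close>

lemma tip_local:
 assumes G: "multigraph G" and z: "z \<in> verts G" and b: "bd G (verts G) = 0" and S: "tip_preflow G z S"
 shows "cut G {z} - S \<subseteq> cut G (verts G - {z})"
  and "balance G (cut G {z} - S) (verts G - {z}) = bd G (verts G - {z})"
  and "loc G (verts G - {z}) t ==> outset G t (verts G - {z}) = cut G {z} - S ==> extends G z S"
proof -
 have S': "S \<subseteq> cut G {z}" "balance G S {z} = bdry G z" using S unfolding tip_preflow_balance by auto
 show "cut G {z} - S \<subseteq> cut G (verts G - {z})" using cut_compl[OF G, of "{z}"] by auto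
 have "bd G (verts G) = bdry G z + bd G (verts G - {z})"
  by (rule sum.remove[OF multigraphD(1)[OF G] z])
 moreover have "cut G {z} - (cut G {z} - S) = S" using S'(1) by blast
 ultimately show "balance G (cut G {z} - S) (verts G - {z}) = bd G (verts G - {z})"
  using S'(2) b unfolding balance_def cut_compl[OF G] by (simp add: algebra_simps add_eq_0_iff)
 show "extends G z S" if t: "loc G (verts G - {z}) t" "outset G t (verts G - {z}) = cut G {z} - S"
 proof -
  have o: "orientation G t" using t(1) by (simp add: loc_def)
  have "outset G t {z} = S" using outset_compl[OF G o, of "{z}"] outset_subset[of G t "{z}"] t(2) S'(1) by blast
  moreover have "net G t {z} = bdry G z" using net_balance[OF G o, of "{z}"] calculation S'(2) by simp
  ultimately show ?thesis using t(1) z unfolding extends_loc[OF G] loc_def by (intro exI[of _ t]) auto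
 qed
qed

text \<open>In contrast to criticality, a single preflow \<open>S\<close> has to serve all
  partitions. A coarsest quotient to which \<open>S\<close> does not extend has this
  property.\<close>

definition psicrit :: "('v, 'e) bgraph => 'v => 'e set => bool" where
 "psicrit G z S \<longleftrightarrow> tip_preflow G z S \<and> \<not> extends G z S \<and>
   (\<forall>P. tip_respecting G z P \<and> nontrivial P \<longrightarrow> part_ext G P {z} S)"

lemma psicrit_critical: "multigraph G ==> psicrit G z S ==> flow_critical G z"
 unfolding psicrit_def flow_critical_def tip_respecting_def using extends_contract[of G _ "{z}" S] by blast

lemma psicrit_collapse:
 assumes G: "multigraph G" and z: "z \<in> verts G" and c: "psicrit G z S" and A: "A \<subseteq> verts G - {z}" "2 \<le> card A"
 obtains t where "loc G (verts G - A) t" "net G t A = bd G A" "outset G t {z} = S"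
proof -
 have "A \<noteq> {}" using A(2) by auto
 hence "tip_respecting G z (collapse (verts G) A)" "nontrivial (collapse (verts G) A)"
  using partition_collapse[of A "verts G"] A z unfolding tip_respecting_def nontrivial_def collapse_def by auto
 hence "part_ext G (collapse (verts G) A) {z} S" using c unfolding psicrit_def by blast
 thus ?thesis using that unfolding part_ext_collapse[OF G] by blast
qed

text \<open>Let \<open>A\<close> be a set around \<open>v\<close> of least degree. If the tip has
  degree at most \<open>deg G A + 1\<close>, then extension with \<open>v\<close> exceptional yields
  a flow. Otherwise \<open>A\<close> is more than \<open>{v}\<close>; it is collapsed first and then
  filled in, again with \<open>v\<close> exceptional and \<open>k = deg G A\<close>.\<close>

lemma psicrit_degree:
 assumes G: "multigraph G" and z: "z \<in> verts G" and b: "bd G (verts G) = 0" and c: "psicrit G z S"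
  and tms: "\<And>A. A \<noteq> {} ==> A \<subseteq> verts G - {z} ==> tms G A" and v: "v \<in> verts G - {z}"
 shows "deg G {v} + 2 \<le> deg G {z}"
proof (rule ccontr)
 assume n: "\<not> deg G {v} + 2 \<le> deg G {z}"
 have pre: "tip_preflow G z S" and nx: "\<not> extends G z S" using c unfolding psicrit_def by auto
 define W where "W = verts G - {z}"
 obtain A where A: "A \<subseteq> W" "v \<in> A" "\<And>B. B \<subseteq> W ==> v \<in> B ==> deg G A \<le> deg G B"
 proof -
  have "W \<subseteq> W \<and> v \<in> W" using v W_def by simp
  from ex_has_least_nat[of "\<lambda>B. B \<subseteq> W \<and> v \<in> B", OF this, of "deg G"] show ?thesis using that by auto
 qed
 have ball: "\<exists>t. loc G B t \<and> outset G t B = R"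
  if B: "B \<subseteq> W" "v \<in> B" "R \<subseteq> cut G B" "balance G R B = bd G B" "deg G B \<le> k + 1" "k \<le> deg G A" for B R k
 proof (rule local_extension_at[OF G _ B(3,4,2) _ _ B(5)])
  show "B \<subseteq> verts G" using B(1) W_def by blast
  show "tms G C" if "C \<noteq> {}" "C \<subset> B" for C using tms[of C] that B(1) W_def by blast
  show "k \<le> deg G C" if "C \<subset> B" "v \<in> C" for C using A(3)[of C] that B(1,6) by fastforce
 qed
 show False
 proof (cases "deg G {z} \<le> deg G A + 1")
  case True
  note T = tip_local[OF G z b pre, folded W_def]
  have "deg G W \<le> deg G A + 1" using True deg_compl[OF G, of "{z}"] W_def by simp
  moreover have "v \<in> W" using v W_def by simp
  ultimately obtain t where "loc G W t" "outset G t W = cut G {z} - S" using ball[OF order.refl _ T(1,2)] by blast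
  thus False using T(3) nx by blast
 next
  case False
  have AV: "A \<subseteq> verts G" "z \<notin> A" and fA: "finite A" using A(1) finite_subset[OF _ multigraphD(1)[OF G], of A] unfolding W_def by auto
  have "A \<noteq> {v}" using False n by auto
  hence "card {v} < card A" using A(2) fA by (intro psubset_card_mono) auto
  hence "2 \<le> card A" by simp
  then obtain t where t: "loc G (verts G - A) t" "net G t A = bd G A" "outset G t {z} = S"
   using psicrit_collapse[OF G z c] A(1) W_def by metis
  have "balance G (outset G t A) A = bd G A" using net_balance[OF G, of t A] t(1,2) by (simp add: loc_def)
  then obtain t2 where "loc G A t2" "outset G t2 A = outset G t A"
   using ball[OF A(1,2) outset_subset, of t "deg G A"] by auto
  thus False using extends_expand[OF G AV t(1)] t(3) nx by blast
 qed
qed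

lemma partition_card_less:
 assumes Q: "partition_on P Q" and fP: "finite P" and nt: "nontrivial Q"
 shows "card Q < card P"
proof -
  have fQ: "finite Q" using finite_elements[OF fP Q] .
 have fq: "finite q" if "q \<in> Q" for q using finite_subset[OF _ fP] partition_onD1[OF Q] that by blast
 have "card P = card (\<Union>Q)" using partition_onD1[OF Q] by simp
 also have "\<dots> = sum card Q" by (rule card_Union_disjoint) (use partition_onD2[OF Q] fq in auto)
 also have "\<dots> > (\<Sum>q\<in>Q. 1)"
 proof (rule sum_strict_mono_ex1[OF fQ])
  show "\<forall>q\<in>Q. 1 \<le> card q"
  proof
   fix q assume q: "q \<in> Q"
   hence "q \<noteq> {}" using partition_onD3[OF Q] by blast
   hence "0 < card q" using fq[OF q] by (simp add: card_gt_0_iff)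
   thus "1 \<le> card q" by simp
  qed
  obtain q where q: "q \<in> Q" "2 \<le> card q" using nt unfolding nontrivial_def by blast
  show "\<exists>q\<in>Q. 1 < card q" by (rule bexI[OF _ q(1)]) (use q(2) in linarith)
 qed
 finally show ?thesis by simp
qed

lemma partition_refine:
 assumes P: "partition_on V P" and Q: "partition_on P Q" and f: "finite V"
 shows "partition_on V (Union ` Q)" "card (Union ` Q) = card Q"
  "nontrivial Q ==> card Q < card P"
proof -
 have inj: "q = r" if qr: "q \<in> Q" "r \<in> Q" "a \<in> \<Union>q" "a \<in> \<Union>r" for q r a
 proof -
  obtain p p' where p: "p \<in> q" "a \<in> p" "p' \<in> r" "a \<in> p'" using qr(3,4) by blast
  have pp: "p \<in> P" "p' \<in> P" using p qr(1,2) partition_onD1[OF Q] by auto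
  have "p' = p" using part_mem[OF P pp(1) p(2) pp(2)] p(4) by blast
  thus ?thesis using part_mem[OF Q qr(1) p(1) qr(2)] p(3) by blast
 qed
 have ne: "\<Union>q \<noteq> {}" if q: "q \<in> Q" for q
 proof -
  have "q \<noteq> {}" using partition_onD3[OF Q] q by blast
  then obtain p where p: "p \<in> q" by blast
  hence "p \<in> P" using partition_onD1[OF Q] q by blast
  hence "p \<noteq> {}" using partition_onD3[OF P] by blast
  thus ?thesis using p by blast
 qed
 show "partition_on V (Union ` Q)"
 proof (rule partition_onI)
  show "\<Union>(Union ` Q) = V" unfolding partition_onD1[OF P] partition_onD1[OF Q] by blast
 next
  fix X Y assume XY: "X \<in> Union ` Q" "Y \<in> Union ` Q" "X \<noteq> Y"
  then obtain q r where qr: "q \<in> Q" "r \<in> Q" "X = \<Union>q" "Y = \<Union>r" by blast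
  have False if "a \<in> X" "a \<in> Y" for a using inj[OF qr(1,2), of a] that qr(3,4) XY(3) by simp
  thus "disjnt X Y" unfolding disjnt_def by blast
 next
  show "{} \<notin> Union ` Q" using ne by blast
 qed
 have "inj_on Union Q"
 proof (rule inj_onI)
  fix q r assume qr: "q \<in> Q" "r \<in> Q" "\<Union>q = \<Union>r"
  obtain a where a: "a \<in> \<Union>q" using ne[OF qr(1)] by auto
  show "q = r" using inj[OF qr(1,2) a] a unfolding qr(3) by blast
 qed
 thus "card (Union ` Q) = card Q" by (rule card_image)
 show "nontrivial Q ==> card Q < card P"
  by (rule partition_card_less[OF Q finite_elements[OF f P]])
qed

text \<open>The new tip \<open>b\<close> may be any part: quotients of the canvas use
  \<open>{z}\<close>, restrictions use the complement of a set.\<close>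

lemma contract_canvas:
 assumes G: "multigraph G" and P: "partition_on (verts G) P" and b: "b \<in> P"
  and tms: "\<And>A. A \<noteq> {} ==> A \<subseteq> verts G - b ==> tms G A" and tot: "bd G (verts G) = 0"
 shows "multigraph (contract G P)" "cut (contract G P) {b} = cut G b" "deg (contract G P) {b} = deg G b"
  "bd (contract G P) (verts (contract G P)) = 0"
  "\<And>\<A>. \<A> \<noteq> {} ==> \<A> \<subseteq> verts (contract G P) - {b} ==> tms (contract G P) \<A>"
  "is_canvas (contract G P) b" "tame (contract G P) b"
proof -
 show m: "multigraph (contract G P)" by (rule contract_multigraph[OF G P])
 show c: "cut (contract G P) {b} = cut G b" using cut_contract[OF G P, of "{b}"] b by simp
 thus "deg (contract G P) {b} = deg G b" by (simp add: deg_def)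
 show t: "bd (contract G P) (verts (contract G P)) = 0"
  using bdry_contract_Union[OF G P order.refl] partition_onD1[OF P] tot by simp
 show T: "tms (contract G P) \<A>" if A: "\<A> \<noteq> {}" "\<A> \<subseteq> verts (contract G P) - {b}" for \<A>
 proof -
  have AP: "\<A> \<subseteq> P" "b \<notin> \<A>" using A(2) by auto
  have "a \<notin> \<Union>\<A>" if "a \<in> b" for a using part_mem_Union[OF P b that AP(1)] AP(2) by simp
  hence "\<Union>\<A> \<subseteq> verts G - b" using AP(1) partition_onD1[OF P] by blast
  moreover obtain p where p: "p \<in> \<A>" using A(1) by blast
  hence "p \<noteq> {}" using AP(1) partition_onD3[OF P] by blast
  hence "\<Union>\<A> \<noteq> {}" using p by blast
  ultimately show ?thesis using tms tms_contract[OF G P AP(1)] by simp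
 qed
 have bH: "b \<in> verts (contract G P)" using b by simp
 show "is_canvas (contract G P) b" unfolding is_canvas_def using bordered_total[OF m bH T] t bH by blast
 show "tame (contract G P) b" unfolding tame_tms using T by auto
qed

lemma psicrit_tall_class:
 assumes "is_canvas G z" "tame G z" "psicrit G z S" "deg G {z} \<le> k + 1"
  "deg G {z} = k + 1 ==> S \<noteq> {} \<and> S \<noteq> cut G {z}"
 shows "(G, z) \<in> tall_class k"
proof -
 have "flow_critical G z" using psicrit_critical[OF _ assms(3)] assms(1) unfolding is_canvas_def bordered_graph_def by blast
 moreover have "tallness_witnessing k G z S" using assms(3-5) unfolding tallness_witnessing_def psicrit_def by blast
 ultimately show ?thesis using assms(1,2,4) unfolding tall_class_def by blast
qed

text \<open>Fewest parts means that \<open>S\<close> extends after any further merging. So the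
  quotient is critical for \<open>S\<close>, and \<open>psicrit_degree\<close> bounds the degrees of
  its parts.\<close>

lemma coarse_partition:
 assumes G: "multigraph G" and z: "z \<in> verts G" and b: "bd G (verts G) = 0"
  and tms: "\<And>A. A \<noteq> {} ==> A \<subseteq> verts G - {z} ==> tms G A" and S: "tip_preflow G z S" "\<not> extends G z S"
 obtains P where "tip_respecting G z P" "\<not> part_ext G P {z} S"
  "\<forall>Q. tip_respecting G z Q \<and> \<not> part_ext G Q {z} S \<longrightarrow> card P \<le> card Q" "card P \<le> card (verts G)"
  "\<forall>p\<in>P - {{z}}. deg G p + 2 \<le> deg G {z}"
  "\<forall>k. deg G {z} \<le> k + 1 \<and> (deg G {z} = k + 1 \<longrightarrow> S \<noteq> {} \<and> S \<noteq> cut G {z}) \<longrightarrow> (contract G P, {z}) \<in> tall_class k"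
proof -
 have s: "tip_respecting G z (singles (verts G)) \<and> \<not> part_ext G (singles (verts G)) {z} S"
  using z partition_singletons[of "verts G"] S(2) unfolding tip_respecting_def extends_part_ext[OF G] by auto
 from ex_has_least_nat[of "\<lambda>P. tip_respecting G z P \<and> \<not> part_ext G P {z} S", OF this, of card]
 obtain P where P: "tip_respecting G z P" "\<not> part_ext G P {z} S"
  "\<And>Q. tip_respecting G z Q ==> \<not> part_ext G Q {z} S ==> card P \<le> card Q" by blast
 define H where "H = contract G P"
 have pP: "partition_on (verts G) P" "{z} \<in> P" using P(1) unfolding tip_respecting_def by auto
 note H = contract_canvas[OF G pP tms b, folded H_def]
 have VH: "verts H = P" by (simp add: H_def)
 have crit: "psicrit H {z} S"
  unfolding psicrit_def
 proof (intro conjI allI impI)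
  show "tip_preflow H {z} S" using S(1) H(2) unfolding tip_preflow_balance balance_def by (simp add: H_def)
  show "\<not> extends H {z} S" unfolding H_def extends_contract[OF G pP] by (rule P(2))
  fix Q assume Q: "tip_respecting H {z} Q \<and> nontrivial Q"
  hence pQ: "partition_on P Q" "{{z}} \<in> Q" unfolding tip_respecting_def VH by auto
  note R = partition_refine[OF pP(1) pQ(1) multigraphD(1)[OF G]]
  have "{z} \<in> Union ` Q" using pQ(2) by (intro image_eqI[of _ _ "{{z}}"]) auto
  hence "tip_respecting G z (Union ` Q)" using R(1) unfolding tip_respecting_def by blast
  hence "part_ext G (Union ` Q) {z} S" using P(3)[of "Union ` Q"] R(2,3) Q by force
  thus "part_ext H Q {{z}} S" unfolding H_def
   using part_ext_contract[OF G pP(1), of Q "{{z}}" S] partition_onD1[OF pQ(1)] pP(2) by auto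
 qed
 have zH: "{z} \<in> verts H" using pP(2) VH by simp
 have "deg G p + 2 \<le> deg G {z}" if p: "p \<in> P - {{z}}" for p
 proof -
  have "deg H {p} = deg G p" using deg_contract[OF G pP(1), of "{p}"] p by (simp add: H_def)
  thus ?thesis using psicrit_degree[OF H(1) zH H(4) crit H(5), of p] p VH H(3) by simp
 qed
 hence "\<forall>p\<in>P - {{z}}. deg G p + 2 \<le> deg G {z}" by blast
 moreover have "card P \<le> card (verts G)" using P(3)[of "singles (verts G)"] s by (simp add: card_image)
 moreover have "(H, {z}) \<in> tall_class k"
  if "deg G {z} \<le> k + 1 \<and> (deg G {z} = k + 1 \<longrightarrow> S \<noteq> {} \<and> S \<noteq> cut G {z})" for k
  by (rule psicrit_tall_class[OF H(6,7) crit]) (use that H(2,3) in auto)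
 ultimately show ?thesis using that[OF P(1,2)] P(3) unfolding H_def by simp
qed

lemma net_compl:
 assumes G: "multigraph G" and t: "orientation G t" and A: "A \<subseteq> verts G" and b: "bd G (verts G) = 0"
 shows "net G t (verts G - A) = bd G (verts G - A) \<longleftrightarrow> net G t A = bd G A"
proof -
 have "bd G (verts G - A) + bd G A = 0"
  using sum.subset_diff[OF A multigraphD(1)[OF G], of "bdry G"] b by simp
 moreover have "net G t (verts G - A) + net G t A = 0"
 proof -
  have i: "(verts G - A) \<inter> A = {}" and u: "verts G - A \<union> A = verts G" using A by auto
  show ?thesis using net_Un[OF G t i] net_verts[OF G t] unfolding u by simp
 qed
 ultimately show ?thesis by (auto simp: eq_neg_iff_add_eq_0[symmetric] add.commute)
qed

text \<open>The tip of the restriction is everything outside \<open>A\<close>, so its preflows are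
  orientations of the cut of \<open>A\<close> seen from outside.\<close>

lemma restriction_extends:
 assumes G: "multigraph G" and A: "A \<subseteq> verts G" "A \<noteq> verts G"
  and e: "extends (fst (restriction G A)) (snd (restriction G A)) (outset G t (verts G - A))" and t: "orientation G t"
 shows "\<exists>t2. loc G A t2 \<and> outset G t2 A = outset G t A"
proof -
 define B where "B = verts G - A"
 have B: "B \<subseteq> verts G" "B \<noteq> {}" "verts G - B = A" using A B_def by auto
 note P = partition_collapse[OF B(1,2)]
 have "B \<in> collapse (verts G) B" by (simp add: collapse_def)
 hence "part_ext G (collapse (verts G) B) B (outset G t B)"
  using e extends_contract[OF G P] unfolding restriction_eq[OF A(1)] B_def[symmetric] by simp
 then obtain t2 where t2: "loc G A t2" "outset G t2 B = outset G t B" unfolding part_ext_collapse[OF G] B(3) by blast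
 have o: "orientation G t2" using t2(1) by (simp add: loc_def)
 have "outset G t2 A = outset G t A"
  using outset_compl[OF G t, of A] outset_compl[OF G o, of A] t2(2) outset_subset[of G t A] outset_subset[of G t2 A]
  unfolding B_def by blast
 thus ?thesis using t2(1) by blast
qed

text \<open>A partition of the restriction, completed by singletons outside \<open>A\<close>, is a
  partition of \<open>G\<close>. Criticality of \<open>G\<close> gives a flow of that quotient which
  cannot be completed inside \<open>A\<close>; its values on the cut of \<open>A\<close> form the
  required preflow. Only in degree \<open>k + 1\<close> does tallness ask for more, and
  \<open>nu\<close> supplies it.\<close>

lemma restriction_tall_class:
 assumes G: "is_canvas G z" and cr: "flow_critical G z" and tm: "tame G z"
  and A: "A \<subseteq> verts G - {z}" "2 \<le> card A" and d: "deg G A \<le> k + 1"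
  and nu: "deg G A = k + 1 ==> \<exists>t. loc G (verts G - A) t \<and> net G t A = bd G A \<and> outset G t A \<noteq> {} \<and>
   outset G t A \<noteq> cut G A \<and> \<not> (\<exists>t2. loc G A t2 \<and> outset G t2 A = outset G t A)"
 shows "restriction G A \<in> tall_class k"
proof -
 have mG: "multigraph G" and z: "z \<in> verts G" using G unfolding is_canvas_def bordered_graph_def by auto
 define B where "B = verts G - A"
 define P where "P = collapse (verts G) B"
 define H where "H = contract G P"
 have AV: "A \<subseteq> verts G" "A \<noteq> verts G" "z \<notin> A" "z \<in> B" using A z B_def by auto
 have B: "B \<subseteq> verts G" "B \<noteq> {}" "verts G - B = A" using AV B_def by auto
 have pP: "partition_on (verts G) P" unfolding P_def by (rule partition_collapse[OF B(1,2)])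
 have PA: "P = insert B (singles A)" unfolding P_def collapse_def B(3) ..
 have BP: "B \<in> P" using PA by simp
 have R: "restriction G A = (H, B)" unfolding restriction_eq[OF AV(1)] H_def P_def B_def ..
 have VH: "verts H = P" by (simp add: H_def)
 note T = critical_tms[OF mG z cr tm]
 have tot: "bd G (verts G) = 0" using bordered_total[OF mG z T] G unfolding is_canvas_def by blast
 have "tms G C" if "C \<noteq> {}" "C \<subseteq> verts G - B" for C using T[of C] that A(1) B(3) by blast
 note H = contract_canvas[OF mG pP BP this tot, folded H_def]
 have cB: "cut H {B} = cut G A" using H(2) cut_compl[OF mG, of A] by (simp add: B_def)
 have dB: "deg H {B} = deg G A" by (simp add: deg_def cB)
 have pre: "tip_preflow H B (outset G t B)" if t: "orientation G t" "net G t A = bd G A" for t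
 proof -
  have "net G t B = bd G B" using net_compl[OF mG t(1) AV(1) tot] t(2) B_def by simp
  hence "balance H (outset G t B) {B} = bdry H B"
   using net_balance[OF mG t(1), of B] balance_contract[OF mG pP, of "{B}"] BP by (simp add: H_def)
  thus ?thesis unfolding tip_preflow_balance using outset_subset[of G t B] H(2) by simp
 qed
 have nex: "\<not> extends H B (outset G t B)"
  if t: "orientation G t" "\<not> (\<exists>t2. loc G A t2 \<and> outset G t2 A = outset G t A)" for t
  using restriction_extends[OF mG AV(1,2) _ t(1)] t(2) R B_def by auto
 have key: "\<exists>t. orientation G t \<and> (\<forall>p\<in>Q. net G t p = bd G p) \<and> loc G B t \<and> net G t A = bd G A \<and>
   \<not> (\<exists>t2. loc G A t2 \<and> outset G t2 A = outset G t A)"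
  if Q: "partition_on (verts G) Q" "nontrivial Q" "singles B \<subseteq> Q" for Q
 proof -
  have "{z} \<in> Q" using Q(3) AV(4) by blast
  then obtain S where S: "part_ext G Q {z} S" "\<not> extends G z S"
   using cr Q(1,2) extends_contract[OF mG Q(1)] unfolding flow_critical_def tip_respecting_def by blast
  obtain t where t: "orientation G t" "\<forall>p\<in>Q. net G t p = bd G p" "outset G t {z} = S" using S(1) unfolding part_ext_def by blast
  have "net G t {a} = bdry G a" if "a \<in> B" for a using bspec[OF t(2), of "{a}"] Q(3) that by auto
  hence tl: "loc G (verts G - A) t" using t(1) unfolding loc_def B_def[symmetric] by blast
  have "net G t (verts G - A) = bd G (verts G - A)"
   by (rule loc_net[OF mG tl]) (use multigraphD(1)[OF mG] in simp)
  hence "net G t A = bd G A" unfolding net_compl[OF mG t(1) AV(1) tot] .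
  moreover have "\<not> (\<exists>t2. loc G A t2 \<and> outset G t2 A = outset G t A)"
   using extends_expand[OF mG AV(1,3) tl] t(3) S(2) by blast
  ultimately show ?thesis using t(1,2) tl B_def by blast
 qed
 have crit: "\<exists>S. tip_preflow H B S \<and> part_ext H Q {B} S \<and> \<not> extends H B S" if Q: "tip_respecting H B Q" "nontrivial Q" for Q
 proof -
  have pQ: "partition_on P Q" "{B} \<in> Q" using Q(1) unfolding tip_respecting_def VH by auto
  \<comment> \<open>With singletons outside \<open>A\<close> the quotient flow is correct at every
    vertex there, so it could be combined with a flow inside \<open>A\<close>.\<close>
  define Q' where "Q' = singles B \<union> Union ` (Q - {{B}})"
  have qA: "q \<subseteq> singles A" if q: "q \<in> Q - {{B}}" for q
  proof -
   have "B \<notin> q" using part_mem[OF pQ(1,2), of B q] q by auto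
   thus ?thesis using partition_onD1[OF pQ(1)] q PA by auto
  qed
  hence QA: "\<Union>q \<subseteq> A" if "q \<in> Q - {{B}}" for q using that by fastforce
  note RQ = partition_refine[OF pP pQ(1) multigraphD(1)[OF mG]]
  have "partition_on (verts G) Q'"
  proof (rule partition_onI)
   have "\<Union>(Union ` Q) = verts G" using partition_onD1[OF RQ(1)] by simp
   moreover have "Q = insert {B} (Q - {{B}})" using pQ(2) by blast
   ultimately have "\<Union>(Union ` insert {B} (Q - {{B}})) = verts G" by simp
   thus "\<Union>Q' = verts G" unfolding Q'_def by auto
  next
   have el: "X \<in> singles B \<and> X \<subseteq> B \<or> X \<in> Union ` Q \<and> X \<subseteq> A" if "X \<in> Q'" for X
    using that QA unfolding Q'_def by auto
   fix X Y assume XY: "X \<in> Q'" "Y \<in> Q'" and ne: "X \<noteq> Y"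
   consider "X \<subseteq> B" "Y \<subseteq> B" "X \<in> singles B" "Y \<in> singles B" | "X \<subseteq> B" "Y \<subseteq> A" | "X \<subseteq> A" "Y \<subseteq> B" | "X \<in> Union ` Q" "Y \<in> Union ` Q"
    using el[OF XY(1)] el[OF XY(2)] by auto
   thus "disjnt X Y"
   proof cases
    case 4
    thus ?thesis using disjointD[OF partition_onD2[OF RQ(1)] _ _ ne] by (simp add: disjnt_def)
   qed (use ne B_def in \<open>auto simp: disjnt_def\<close>)
  next
   show "{} \<notin> Q'" using partition_onD3[OF RQ(1)] unfolding Q'_def by auto
  qed
  moreover have "nontrivial Q'"
  proof -
   obtain q where q: "q \<in> Q" "2 \<le> card q" using Q(2) unfolding nontrivial_def by blast
   have qB: "q \<in> Q - {{B}}" using q by auto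
   have fq: "finite (\<Union>q)" using finite_subset[OF QA[OF qB]] finite_subset[OF AV(1) multigraphD(1)[OF mG]] by blast
   have "q \<subseteq> singles (\<Union>q)" using qA[OF qB] by fastforce
   hence "card q \<le> card (\<Union>q)" using surj_card_le[OF fq] by blast
   thus ?thesis unfolding nontrivial_def Q'_def using qB q(2) by (meson UnI2 image_eqI order_trans)
  qed
  moreover have "singles B \<subseteq> Q'" unfolding Q'_def by blast
  ultimately obtain t where t: "orientation G t" "\<forall>p\<in>Q'. net G t p = bd G p" "net G t A = bd G A"
   "\<not> (\<exists>t2. loc G A t2 \<and> outset G t2 A = outset G t A)" using key by blast
  have "net G t B = bd G B" using net_compl[OF mG t(1) AV(1) tot] t(3) B_def by simp
  hence "net G t (\<Union>q) = bd G (\<Union>q)" if "q \<in> Q" for q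
   using that t(2) unfolding Q'_def by (cases "q = {B}") auto
  hence "part_ext G (Union ` Q) B (outset G t B)" unfolding part_ext_def using t(1) by blast
  hence "part_ext H Q {B} (outset G t B)" unfolding H_def
   using part_ext_contract[OF mG pP, of Q "{B}"] partition_onD1[OF pQ(1)] BP by auto
  thus ?thesis using pre[OF t(1,3)] nex[OF t(1,4)] by blast
 qed
 have fc: "flow_critical H B"
  unfolding flow_critical_def
 proof (intro allI impI)
  fix Q assume Q: "tip_respecting H B Q \<and> nontrivial Q"
  hence "partition_on (verts H) Q" "{B} \<in> Q" unfolding tip_respecting_def by auto
  thus "\<exists>S. tip_preflow H B S \<and> extends (contract H Q) {B} S \<and> \<not> extends H B S"
   using crit[of Q] Q extends_contract[OF H(1), of Q "{B}"] by blast
 qed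
 have "\<exists>t. orientation G t \<and> net G t A = bd G A \<and> \<not> (\<exists>t2. loc G A t2 \<and> outset G t2 A = outset G t A) \<and>
  (deg G A = k + 1 \<longrightarrow> outset G t A \<noteq> {} \<and> outset G t A \<noteq> cut G A)"
 proof (cases "deg G A = k + 1")
  case True
  thus ?thesis using nu unfolding loc_def by blast
 next
  case False
  have ne: "A \<noteq> {}" using A(2) by auto
  have "nontrivial (collapse (verts G) A)" "singles B \<subseteq> collapse (verts G) A"
   unfolding nontrivial_def collapse_def B_def using A(2) by blast+
  from key[OF partition_collapse[OF AV(1) ne] this] show ?thesis using False by blast
 qed
 then obtain t where t: "orientation G t" "net G t A = bd G A" "\<not> (\<exists>t2. loc G A t2 \<and> outset G t2 A = outset G t A)"
  "deg G A = k + 1 \<longrightarrow> outset G t A \<noteq> {} \<and> outset G t A \<noteq> cut G A" by blast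
 have "deg G A = k + 1 \<longrightarrow> outset G t B \<noteq> {} \<and> outset G t B \<noteq> cut G A"
  using outset_compl[OF mG t(1), of A] t(4) outset_subset[of G t A] unfolding B_def by auto
 hence "tallness_witnessing k H B (outset G t B)"
  unfolding tallness_witnessing_def using pre[OF t(1,2)] nex[OF t(1,3)] d dB cB by auto
 thus ?thesis unfolding R tall_class_def using H(6,7) fc d dB by auto
qed

section \<open>Isomorphisms\<close>

text \<open>\<open>canvas_iso\<close> with both maps exposed, so that they can be composed and
  applied to parts, preflows and alterations.\<close>

definition giso :: "('v => 'w) => ('e => 'f) => ('v, 'e) bgraph => ('w, 'f) bgraph => bool" where
 "giso f g G H \<longleftrightarrow> bij_betw f (verts G) (verts H) \<and> bij_betw g (edges G) (edges H) \<and>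
   (\<forall>e\<in>edges G. ends H (g e) = f ` ends G e) \<and> (\<forall>v\<in>verts G. bdry H (f v) = bdry G v)"

lemma canvas_iso_giso: "canvas_iso G z H y \<longleftrightarrow> (\<exists>f g. giso f g G H \<and> f z = y)"
 unfolding canvas_iso_def giso_def by auto

lemma gisoD:
 assumes "giso f g G H"
 shows "inj_on f (verts G)" "f ` verts G = verts H" "inj_on g (edges G)" "g ` edges G = edges H"
  "\<And>e. e \<in> edges G ==> ends H (g e) = f ` ends G e" "\<And>v. v \<in> verts G ==> bdry H (f v) = bdry G v"
 using assms unfolding giso_def bij_betw_def by blast+

lemma giso_multigraph:
 assumes G: "multigraph G" and i: "giso f g G H"
 shows "multigraph H"
proof -
 note D = gisoD[OF i]
 have "ends H e' \<subseteq> verts H \<and> card (ends H e') = 2" if e': "e' \<in> edges H" for e'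
 proof -
  obtain e where e: "e \<in> edges G" "e' = g e" using D(4) e' by blast
  have "inj_on f (ends G e)" using inj_on_subset[OF D(1) multigraphD(3)[OF G e(1)]] .
  thus ?thesis unfolding e(2) D(5)[OF e(1)] using card_image[of f "ends G e"] multigraphD(3,4)[OF G e(1)] D(2) by auto
 qed
 moreover have "finite (verts H)" "finite (edges H)"
  using multigraphD(1,2)[OF G] unfolding D(2)[symmetric] D(4)[symmetric] by auto
 ultimately show ?thesis unfolding multigraph_def by blast
qed

lemma giso_inv:
 assumes G: "multigraph G" and i: "giso f g G H"
 shows "giso (inv_into (verts G) f) (inv_into (edges G) g) H G"
proof -
 note D = gisoD[OF i]
 have b: "bij_betw f (verts G) (verts H)" "bij_betw g (edges G) (edges H)" using i unfolding giso_def by auto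
 have "ends G (inv_into (edges G) g e') = inv_into (verts G) f ` ends H e'" if "e' \<in> edges H" for e'
 proof -
  obtain e where e: "e \<in> edges G" "e' = g e" using D(4) \<open>e' \<in> edges H\<close> by blast
  show ?thesis unfolding e(2) inv_into_f_f[OF D(3) e(1)] D(5)[OF e(1)]
   using inv_into_image_cancel[OF D(1) multigraphD(3)[OF G e(1)]] by simp
 qed
 moreover have "bdry G (inv_into (verts G) f v') = bdry H v'" if "v' \<in> verts H" for v'
 proof -
  obtain v where v: "v \<in> verts G" "v' = f v" using D(2) \<open>v' \<in> verts H\<close> by blast
  show ?thesis unfolding v(2) inv_into_f_f[OF D(1) v(1)] D(6)[OF v(1)] ..
 qed
 ultimately show ?thesis unfolding giso_def using bij_betw_inv_into[OF b(1)] bij_betw_inv_into[OF b(2)] by blast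
qed

lemma giso_comp:
 assumes i: "giso f g G H" and j: "giso f' g' H K"
 shows "giso (f' \<circ> f) (g' \<circ> g) G K"
proof -
 note D = gisoD[OF i] and E = gisoD[OF j]
 have "ends K ((g' \<circ> g) e) = (f' \<circ> f) ` ends G e" if "e \<in> edges G" for e
 proof -
  have "g e \<in> edges H" using that D(4) by blast
  thus ?thesis using E(5) D(5)[OF that] by (simp add: image_comp)
 qed
 moreover have "bdry K ((f' \<circ> f) v) = bdry G v" if "v \<in> verts G" for v
 proof -
  have "f v \<in> verts H" using that D(2) by blast
  thus ?thesis using E(6) D(6)[OF that] by simp
 qed
 moreover have "bij_betw f (verts G) (verts H)" "bij_betw f' (verts H) (verts K)"
  "bij_betw g (edges G) (edges H)" "bij_betw g' (edges H) (edges K)" using i j unfolding giso_def by simp_all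
 hence "bij_betw (f' \<circ> f) (verts G) (verts K)" "bij_betw (g' \<circ> g) (edges G) (edges K)"
  by (simp_all add: bij_betw_trans)
 ultimately show ?thesis unfolding giso_def by simp
qed

lemma giso_cut:
 assumes G: "multigraph G" and i: "giso f g G H" and A: "A \<subseteq> verts G"
 shows "cut H (f ` A) = g ` cut G A"
proof -
 note D = gisoD[OF i]
 have "g e \<in> cut H (f ` A) \<longleftrightarrow> e \<in> cut G A" if e: "e \<in> edges G" for e
 proof -
  obtain u v where uv: "ends G e = {u, v}" "u \<noteq> v" "u \<in> verts G" "v \<in> verts G" using edge_obtain[OF G e] .
  have "f u \<noteq> f v" using inj_onD[OF D(1) _ uv(3,4)] uv(2) by blast
  moreover have "ends H (g e) = {f u, f v}" using D(5)[OF e] uv(1) by simp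
  moreover have "f u \<in> f ` A \<longleftrightarrow> u \<in> A" "f v \<in> f ` A \<longleftrightarrow> v \<in> A"
   using inj_on_image_mem_iff[OF D(1) uv(3) A] inj_on_image_mem_iff[OF D(1) uv(4) A] by auto
  moreover have "g e \<in> edges H" using D(4) e by blast
  ultimately show ?thesis using in_cut_pair[of H "g e" "f u" "f v" "f ` A"] in_cut_pair[OF uv(1,2), of A] e by simp
 qed
 moreover have "cut H (f ` A) \<subseteq> g ` edges G" using cut_subset[of H] D(4) by simp
 ultimately show ?thesis using cut_subset[of G A] by auto
qed

lemma giso_deg:
 assumes "multigraph G" "giso f g G H" "A \<subseteq> verts G"
 shows "deg H (f ` A) = deg G A"
 unfolding deg_def giso_cut[OF assms]
 using card_image[OF inj_on_subset[OF gisoD(3)[OF assms(2)] cut_subset]] .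

lemma giso_bdry:
 assumes "giso f g G H" "A \<subseteq> verts G"
 shows "bd H (f ` A) = bd G A"
 using gisoD(6)[OF assms(1)] assms(2) by (subst sum.reindex[OF inj_on_subset[OF gisoD(1)[OF assms(1)] assms(2)]]) (auto intro: sum.cong)

lemma giso_tms: "multigraph G ==> giso f g G H ==> A \<subseteq> verts G ==> tms H (f ` A) \<longleftrightarrow> tms G A"
 unfolding tms_def by (simp only: giso_deg giso_bdry)

lemma giso_tau: "multigraph G ==> giso f g G H ==> A \<subseteq> verts G ==> tau H (f ` A) = tau G A"
 unfolding tau_def by (simp only: giso_deg giso_bdry)

lemma giso_balance:
 assumes G: "multigraph G" and i: "giso f g G H" and A: "A \<subseteq> verts G" and S: "S \<subseteq> cut G A"
 shows "balance H (g ` S) (f ` A) = balance G S A"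
proof -
 have inj: "inj_on g (cut G A)" using inj_on_subset[OF gisoD(3)[OF i] cut_subset] .
 have "g ` cut G A - g ` S = g ` (cut G A - S)" using inj_on_image_set_diff[OF inj _ S] by simp
 thus ?thesis unfolding balance_def giso_cut[OF G i A]
  using card_image[OF inj_on_subset[OF inj S]] card_image[OF inj_on_subset[OF inj, of "cut G A - S"]] by simp
qed

lemma giso_part_ext:
 assumes G: "multigraph G" and i: "giso f g G H" and P: "\<And>p. p \<in> P ==> p \<subseteq> verts G" and b: "b \<subseteq> verts G"
  and e: "part_ext G P b S"
 shows "part_ext H ((`) f ` P) (f ` b) (g ` S)"
proof -
 note D = gisoD[OF i]
 have H: "multigraph H" by (rule giso_multigraph[OF G i])
 obtain t where t: "orientation G t" "\<forall>p\<in>P. net G t p = bd G p" "outset G t b = S" using e unfolding part_ext_def by blast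
 define t' where "t' e' = f (t (inv_into (edges G) g e'))" for e'
 have t': "t' (g e) = f (t e)" if "e \<in> edges G" for e unfolding t'_def using inv_into_f_f[OF D(3) that] by simp
 have o: "orientation H t'"
  unfolding orientation_def D(4)[symmetric] using t' D(5) orientationD[OF t(1)] by auto
 have out: "outset H t' (f ` A) = g ` outset G t A" if A: "A \<subseteq> verts G" for A
 proof -
  have "t' (g e) \<in> f ` A \<longleftrightarrow> t e \<in> A" if "e \<in> cut G A" for e
  proof -
   have e: "e \<in> edges G" using that cut_subset[of G A] by blast
   have "t e \<in> verts G" using orientationD[OF t(1) e] multigraphD(3)[OF G e] by blast
   thus ?thesis using t'[OF e] inj_on_image_mem_iff[OF D(1) _ A] by simp
  qed
  thus ?thesis unfolding outset_def giso_cut[OF G i A] by auto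
 qed
 have "net H t' (f ` p) = bd H (f ` p)" if p: "p \<in> P" for p
  unfolding net_balance[OF H o] out[OF P[OF p]] giso_balance[OF G i P[OF p] outset_subset] giso_bdry[OF i P[OF p]]
  using t(2) p net_balance[OF G t(1)] by simp
 thus ?thesis unfolding part_ext_def using o out[OF b] t(3) by auto
qed

lemma giso_extends:
 assumes "multigraph G" "giso f g G H" "z \<in> verts G" "extends G z S"
 shows "extends H (f z) (g ` S)"
proof -
 have "part_ext G (singles (verts G)) {z} S" using assms(4) unfolding extends_part_ext[OF assms(1)] .
 hence "part_ext H ((`) f ` singles (verts G)) (f ` {z}) (g ` S)"
  using assms(3) by (intro giso_part_ext[OF assms(1,2)]) auto
 moreover have "(`) f ` singles (verts G) = singles (verts H)"
  unfolding gisoD(2)[OF assms(2), symmetric] by (auto simp: image_image)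
 ultimately show ?thesis using extends_part_ext[OF giso_multigraph[OF assms(1,2)]] by simp
qed

lemma giso_tip_preflow:
 assumes G: "multigraph G" and i: "giso f g G H" and z: "z \<in> verts G" and S: "tip_preflow G z S"
 shows "tip_preflow H (f z) (g ` S)"
proof -
 have "S \<subseteq> cut G {z}" "balance G S {z} = bdry G z" using S unfolding tip_preflow_balance by auto
 thus ?thesis unfolding tip_preflow_balance
  using giso_balance[OF G i, of "{z}" S] giso_cut[OF G i, of "{z}"] z gisoD(6)[OF i z] by auto
qed

lemma giso_not_extends:
 assumes G: "multigraph G" and i: "giso f g G H" and z: "z \<in> verts G" and S: "S \<subseteq> edges G" and n: "\<not> extends G z S"
 shows "\<not> extends H (f z) (g ` S)"
proof
 assume "extends H (f z) (g ` S)"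
 moreover have "f z \<in> verts H" using gisoD(2)[OF i] z by blast
 ultimately have "extends G (inv_into (verts G) f (f z)) (inv_into (edges G) g ` g ` S)"
  using giso_extends[OF giso_multigraph[OF G i] giso_inv[OF G i]] by blast
 thus False using n inv_into_f_f[OF gisoD(1)[OF i] z] inv_into_image_cancel[OF gisoD(3)[OF i] S] by simp
qed

text \<open>Partitions are pulled back along the inverse map, and the preflows found there are
  pushed forward.\<close>

lemma giso_tall_class:
 assumes i: "giso f g G H" and G: "(G, z) \<in> tall_class k"
 shows "(H, f z) \<in> tall_class k"
proof -
 have G': "is_canvas G z" "flow_critical G z" "tame G z" "deg G {z} \<le> k + 1" and "\<exists>S. tallness_witnessing k G z S"
  using G unfolding tall_class_def by auto
 then obtain S where S: "tip_preflow G z S" "\<not> extends G z S" "deg G {z} = k + 1 \<longrightarrow> S \<noteq> {} \<and> S \<noteq> cut G {z}"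
  unfolding tallness_witnessing_def by blast
 have mG: "multigraph G" and z: "z \<in> verts G" using G'(1) unfolding is_canvas_def bordered_graph_def by auto
 note D = gisoD[OF i]
 have H: "multigraph H" by (rule giso_multigraph[OF mG i])
 have fz: "f z \<in> verts H" using D(2) z by blast
 define f' where "f' = inv_into (verts G) f"
 have j: "giso f' (inv_into (edges G) g) H G" unfolding f'_def by (rule giso_inv[OF mG i])
 have f'z: "f' (f z) = z" unfolding f'_def by (rule inv_into_f_f[OF D(1) z])
 note T = critical_tms[OF mG z G'(2,3)]
 have tmsH: "tms H A" if A: "A \<noteq> {}" "A \<subseteq> verts H - {f z}" for A
 proof -
  have AH: "A \<subseteq> verts H" "f z \<notin> A" using A(2) by auto
  have "f' ` A \<subseteq> verts G" using gisoD(2)[OF j] AH(1) by blast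
  moreover have "z \<notin> f' ` A" using inj_on_image_mem_iff[OF gisoD(1)[OF j] fz AH(1)] f'z AH(2) by simp
  ultimately have "tms G (f' ` A)" using T[of "f' ` A"] A(1) by blast
  thus ?thesis using giso_tms[OF H j AH(1)] by simp
 qed
 have "bd H (verts H) = bd G (verts G)" using giso_bdry[OF i order.refl] D(2) by simp
 hence "is_canvas H (f z)" unfolding is_canvas_def
  using bordered_total[OF H fz tmsH] bordered_total[OF mG z T] G'(1) fz unfolding is_canvas_def by auto
 moreover have "tame H (f z)" unfolding tame_tms using tmsH by auto
 moreover have cz: "cut H {f z} = g ` cut G {z}" using giso_cut[OF mG i, of "{z}"] z by simp
 moreover have dz: "deg H {f z} = deg G {z}" using giso_deg[OF mG i, of "{z}"] z by simp
 moreover have "flow_critical H (f z)"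
  unfolding flow_critical_def
 proof (intro allI impI)
  fix P' assume P': "tip_respecting H (f z) P' \<and> nontrivial P'"
  hence pP': "partition_on (verts H) P'" "{f z} \<in> P'" unfolding tip_respecting_def by auto
  define P where "P = (`) f' ` P'"
  have sub: "p \<subseteq> verts H" if "p \<in> P'" for p using partition_onD1[OF pP'(1)] that by blast
  have ffp: "f ` f' ` p = p" if "p \<in> P'" for p
   using image_inv_into_cancel[of f "verts G" "verts H" p] D(2) sub[OF that] unfolding f'_def by simp
  have inj': "inj_on f' (verts H)" by (rule gisoD(1)[OF j])
  have pP: "partition_on (verts G) P"
  proof -
   have "{} \<notin> P" unfolding P_def using partition_onD3[OF pP'(1)] by auto
   thus ?thesis using partition_on_inj_image[OF pP'(1) inj'] gisoD(2)[OF j] unfolding P_def by simp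
  qed
  have zP: "{z} \<in> P" unfolding P_def using pP'(2) f'z by (intro image_eqI[of _ _ "{f z}"]) auto
  have "nontrivial P"
  proof -
   obtain p where p: "p \<in> P'" "2 \<le> card p" using P' unfolding nontrivial_def by blast
   hence "card (f' ` p) = card p" using card_image[OF inj_on_subset[OF inj' sub[OF p(1)]]] by simp
   thus ?thesis unfolding nontrivial_def P_def using p by (intro bexI[of _ "f' ` p"]) auto
  qed
  then obtain R where R: "tip_preflow G z R" "extends (contract G P) {z} R" "\<not> extends G z R"
   using G'(2)[unfolded flow_critical_def tip_respecting_def, rule_format, of P] pP zP by auto
  have "part_ext G P {z} R" using R(2) extends_contract[OF mG pP zP] by simp
  hence "part_ext H ((`) f ` P) (f ` {z}) (g ` R)"
   using giso_part_ext[OF mG i] z partition_onD1[OF pP] by blast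
  moreover have "(`) f ` P = (\<lambda>p. f ` f' ` p) ` P'" unfolding P_def by (rule image_image)
  moreover have "\<dots> = (\<lambda>p. p) ` P'" by (rule image_cong[OF refl ffp])
  ultimately have ex: "extends (contract H P') {f z} (g ` R)" using extends_contract[OF H pP'] by simp
  have RE: "R \<subseteq> edges G" using R(1) cut_subset[of G "{z}"] unfolding tip_preflow_def by blast
  show "\<exists>S. tip_preflow H (f z) S \<and> extends (contract H P') {f z} S \<and> \<not> extends H (f z) S"
   by (intro exI[of _ "g ` R"] conjI giso_tip_preflow[OF mG i z R(1)] ex giso_not_extends[OF mG i z RE R(3)])
 qed
 moreover have "tallness_witnessing k H (f z) (g ` S)"
 proof -
  have "S \<subseteq> cut G {z}" using S(1) unfolding tip_preflow_def by blast
  hence Sc: "S \<subseteq> edges G" "S \<subseteq> cut G {z}" using cut_subset[of G "{z}"] by auto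
  have "g ` S = g ` cut G {z} ==> S = cut G {z}" using inj_on_image_eq_iff[OF D(3) Sc(1) cut_subset] by blast
  hence "deg G {z} = k + 1 \<longrightarrow> g ` S \<noteq> {} \<and> g ` S \<noteq> g ` cut G {z}" using S(3) by blast
  thus ?thesis unfolding tallness_witnessing_def dz cz
   by (intro conjI G'(4) giso_tip_preflow[OF mG i z S(1)] giso_not_extends[OF mG i z Sc(1) S(2)])
 qed
 ultimately show ?thesis using G'(4) unfolding tall_class_def by auto
qed

lemma giso_canvas_size:
 assumes G: "multigraph G" and i: "giso f g G H" and z: "z \<in> verts G"
 shows "canvas_size H (f z) = canvas_size G z"
proof -
 note D = gisoD[OF i]
 have "f z \<in> ends H (g e) \<longleftrightarrow> z \<in> ends G e" if "e \<in> edges G" for e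
  using D(5)[OF that] inj_on_image_mem_iff[OF D(1) z multigraphD(3)[OF G that]] by simp
 hence "{e' \<in> edges H. f z \<notin> ends H e'} = g ` {e \<in> edges G. z \<notin> ends G e}" unfolding D(4)[symmetric] by auto
 moreover have "card (g ` {e \<in> edges G. z \<notin> ends G e}) = card {e \<in> edges G. z \<notin> ends G e}"
  by (rule card_image) (rule inj_on_subset[OF D(3)], auto)
 moreover have "card (verts H) = card (verts G)" unfolding D(2)[symmetric] using card_image[OF D(1)] .
 ultimately show ?thesis unfolding canvas_size_def by simp
qed

lemma giso_homogeneous1:
 assumes G: "multigraph G" and i: "giso f g G H" and z: "z \<in> verts G" and h: "homogeneous H (f z)"
 shows "homogeneous G z"
 unfolding homogeneous_def
proof
 assume "\<exists>e\<in>edges G. mixed G z e"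
 then obtain e u v where e: "e \<in> edges G" "ends G e = {u, v}" "u \<noteq> z" "v \<noteq> z" "u \<noteq> v" "in_friendly G u" "out_friendly G v"
  unfolding mixed_def by blast
 note D = gisoD[OF i]
 have uv: "u \<in> verts G" "v \<in> verts G" using multigraphD(3)[OF G e(1)] e(2) by auto
 have "tau H {f w} = tau G {w}" if "w \<in> verts G" for w using giso_tau[OF G i, of "{w}"] that by simp
 hence "in_friendly H (f u)" "out_friendly H (f v)" using e(6,7) uv unfolding in_friendly_def out_friendly_def by auto
 moreover have "f u \<noteq> f z" "f v \<noteq> f z" "f u \<noteq> f v" using inj_onD[OF D(1)] uv z e(3-5) by blast+
 moreover have "ends H (g e) = {f u, f v}" using D(5)[OF e(1)] e(2) by simp
 ultimately have "mixed H (f z) (g e)" unfolding mixed_def by blast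
 moreover have "g e \<in> edges H" using D(4) e(1) by blast
 ultimately show False using h unfolding homogeneous_def by blast
qed

lemma giso_prec:
 assumes G: "multigraph G" and i: "giso f g G H" and z: "z \<in> verts G" and p: "prec G z K y"
 shows "prec H (f z) K y"
proof -
 have "homogeneous H (f z) \<longleftrightarrow> homogeneous G z"
  using giso_homogeneous1[OF G i z] giso_homogeneous1[OF giso_multigraph[OF G i] giso_inv[OF G i], of "f z"]
   inv_into_f_f[OF gisoD(1)[OF i] z] gisoD(2)[OF i] z by auto
 moreover have "deg H {f z} = deg G {z}" using giso_deg[OF G i, of "{z}"] z by simp
 ultimately show ?thesis using p giso_canvas_size[OF G i z] unfolding prec_def by simp
qed

text \<open>The outcomes ask for canvases named by natural numbers, whereas the constructions
  produce other types.\<close>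

lemma nat_copy:
 assumes G: "multigraph G"
 obtains f g and H :: "(nat, nat) bgraph" where "giso f g G H"
proof -
 obtain f :: "'a => nat" where f: "inj_on f (verts G)" using finite_imp_inj_to_nat_seg[OF multigraphD(1)[OF G]] by blast
 obtain g :: "'b => nat" where g: "inj_on g (edges G)" using finite_imp_inj_to_nat_seg[OF multigraphD(2)[OF G]] by blast
 define H where "H = \<lparr>verts = f ` verts G, edges = g ` edges G, ends = (\<lambda>e. f ` ends G (inv_into (edges G) g e)),
  bdry = (\<lambda>v. bdry G (inv_into (verts G) f v))\<rparr>"
 have "giso f g G H" unfolding giso_def H_def using f g by (simp add: bij_betw_def)
 thus ?thesis by (rule that)
qed

lemma tall_class_nat:
 assumes "(G, z) \<in> tall_class k"
 obtains f g and H :: "(nat, nat) bgraph" where "giso f g G H" "(H, f z) \<in> tall_class k" "multigraph G" "z \<in> verts G"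
proof -
 have G: "multigraph G" "z \<in> verts G" using assms unfolding tall_class_def is_canvas_def bordered_graph_def by auto
 obtain f g and H :: "(nat, nat) bgraph" where i: "giso f g G H" using nat_copy[OF G(1)] .
 show ?thesis by (rule that[OF i giso_tall_class[OF i assms] G])
qed

lemma giso_add_edge:
 assumes G: "multigraph G" and i: "giso f g G H" and uv: "u \<in> verts G" "v \<in> verts G"
 shows "giso f (map_option g) (add_edge G u v) (add_edge H (f u) (f v))"
proof -
 note D = gisoD[OF i]
 have "inj_on (map_option g) (insert None (Some ` edges G))" using D(3) by (auto simp: inj_on_def)
 moreover have "map_option g ` insert None (Some ` edges G) = insert None (Some ` edges H)"
  unfolding D(4)[symmetric] by (auto simp: image_image)
 moreover have "bdry (add_edge H (f u) (f v)) (f w) = bdry (add_edge G u v) w" if w: "w \<in> verts G" for w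
 proof -
  have "f w = f u \<longleftrightarrow> w = u" "f w = f v \<longleftrightarrow> w = v" using inj_on_eq_iff[OF D(1) w] uv by auto
  thus ?thesis using D(6) w uv by (auto simp: add_edge_def)
 qed
 ultimately show ?thesis using i D(5) unfolding giso_def by (auto simp: add_edge_def bij_betw_def)
qed

lemma giso_delete_edge:
 assumes i: "giso f g G H" and e: "e \<in> edges G"
 shows "giso f g (delete_edge G e) (delete_edge H (g e))"
proof -
 note D = gisoD[OF i]
 have "g ` (edges G - {e}) = edges H - {g e}" using inj_on_image_set_diff[OF D(3), of "edges G" "{e}"] D(4) e by auto
 moreover have "inj_on g (edges G - {e})" using inj_on_subset[OF D(3)] by blast
 ultimately show ?thesis using i unfolding giso_def by (auto simp: delete_edge_def bij_betw_def)
qed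

lemma giso_two_alteration:
 assumes G: "multigraph G" and i: "giso f g G H" and X: "X \<subseteq> verts G <+> edges G"
 shows "giso (map_option f) (map_alt_edge f g) (two_alteration G X) (two_alteration H (map_sum f g ` X))"
proof -
 note D = gisoD[OF i]
 have V: "w \<in> verts G" if "Inl w \<in> X" for w using X that by auto
 have E: "e \<in> edges G" if "Inr e \<in> X" for e using X that by auto
 have Inl: "Inl w' \<in> map_sum f g ` X \<longleftrightarrow> (\<exists>w. w' = f w \<and> Inl w \<in> X)" for w'
  by (auto simp: image_iff map_sum_def split: sum.splits) (metis sum.simps(5) old.sum.exhaust)+
 have Inr: "Inr e' \<in> map_sum f g ` X \<longleftrightarrow> (\<exists>e. e' = g e \<and> Inr e \<in> X)" for e'
  by (auto simp: image_iff map_sum_def split: sum.splits) (metis sum.simps(6) old.sum.exhaust)+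
 have gX: "Inr (g e) \<in> map_sum f g ` X \<longleftrightarrow> Inr e \<in> X" if e: "e \<in> edges G" for e
  unfolding Inr using inj_onD[OF D(3)] E e by metis
 define EG where "EG = edges (two_alteration G X)"
 have EGD: "a \<in> EG \<longleftrightarrow> (case a of Old e => e \<in> edges G \<and> Inr e \<notin> X | Half e u => Inr e \<in> X \<and> u \<in> ends G e | Double w b => Inl w \<in> X)" for a
  unfolding EG_def by (cases a) (auto simp: two_alteration_def)
 have EHD: "a \<in> edges (two_alteration H (map_sum f g ` X)) \<longleftrightarrow> (case a of Old e => e \<in> edges H \<and> Inr e \<notin> map_sum f g ` X
   | Half e u => Inr e \<in> map_sum f g ` X \<and> u \<in> ends H e | Double w b => Inl w \<in> map_sum f g ` X)" for a
  by (cases a) (auto simp: two_alteration_def)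
 have inj: "inj_on (map_alt_edge f g) EG"
 proof (rule inj_onI)
  fix a b assume ab: "a \<in> EG" "b \<in> EG" "map_alt_edge f g a = map_alt_edge f g b"
  show "a = b"
  proof (cases a)
   case (Old e)
   thus ?thesis using ab inj_onD[OF D(3)] EGD by (cases b) auto
  next
   case (Half e u)
   then obtain e' u' where b: "b = Half e' u'" using ab(3) by (cases b) auto
   have e: "e = e'" "e \<in> edges G" using ab inj_onD[OF D(3)] E EGD Half b by auto
   have "u \<in> verts G" "u' \<in> verts G" using ab(1,2) EGD Half b multigraphD(3)[OF G e(2)] e(1) by auto
   thus ?thesis using ab(3) Half b e(1) inj_onD[OF D(1)] by auto
  next
   case (Double w c)
   thus ?thesis using ab inj_onD[OF D(1)] V EGD by (cases b) auto
  qed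
 qed
 have img: "map_alt_edge f g ` EG = edges (two_alteration H (map_sum f g ` X))"
 proof (intro set_eqI iffI)
  fix a assume "a \<in> map_alt_edge f g ` EG"
  then obtain b where b: "b \<in> EG" "a = map_alt_edge f g b" by blast
  show "a \<in> edges (two_alteration H (map_sum f g ` X))"
  proof (cases b)
   case (Old e)
   thus ?thesis using b EGD EHD gX D(4) by auto
  next
   case (Half e u)
   hence e: "Inr e \<in> X" "u \<in> ends G e" using b EGD by auto
   thus ?thesis using Half b EHD gX[OF E[OF e(1)]] D(5)[OF E[OF e(1)]] by auto
  next
   case (Double w c)
   thus ?thesis using b EGD EHD Inl by auto
  qed
 next
  fix a assume a: "a \<in> edges (two_alteration H (map_sum f g ` X))"
  show "a \<in> map_alt_edge f g ` EG"
  proof (cases a)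
   case (Old e')
   hence e': "e' \<in> edges H" "Inr e' \<notin> map_sum f g ` X" using a EHD by auto
   then obtain e where e: "e \<in> edges G" "e' = g e" using D(4) by blast
   hence "Old e \<in> EG" using e' gX EGD by auto
   thus ?thesis using Old e(2) by (intro image_eqI[of _ _ "Old e"]) auto
  next
   case (Half e' u')
   hence e': "u' \<in> ends H e'" "Inr e' \<in> map_sum f g ` X" using a EHD by auto
   then obtain e where e: "Inr e \<in> X" "e' = g e" using Inr by blast
   then obtain u where u: "u \<in> ends G e" "u' = f u" using e'(1) D(5)[OF E[OF e(1)]] by auto
   hence "Half e u \<in> EG" using e EGD by auto
   thus ?thesis using Half e(2) u(2) by (intro image_eqI[of _ _ "Half e u"]) auto
  next
   case (Double w' c)
   hence "Inl w' \<in> map_sum f g ` X" using a EHD by auto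
   then obtain w where w: "Inl w \<in> X" "w' = f w" using Inl by blast
   hence "Double w c \<in> EG" using EGD by auto
   thus ?thesis using Double w(2) by (intro image_eqI[of _ _ "Double w c"]) auto
  qed
 qed
 have ends: "ends (two_alteration H (map_sum f g ` X)) (map_alt_edge f g a) = map_option f ` ends (two_alteration G X) a" if "a \<in> EG" for a
  using that EGD[of a] D(5) by (cases a) (auto simp: two_alteration_def image_image)
 have "inj_on (map_option f) (insert None (Some ` verts G))" using D(1) by (auto simp: inj_on_def)
 moreover have "map_option f ` insert None (Some ` verts G) = insert None (Some ` verts H)"
  unfolding D(2)[symmetric] by (auto simp: image_image)
 ultimately have v: "bij_betw (map_option f) (verts (two_alteration G X)) (verts (two_alteration H (map_sum f g ` X)))"
  unfolding bij_betw_def two_alteration_def by simp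
 have bd: "bdry (two_alteration H (map_sum f g ` X)) (map_option f w) = bdry (two_alteration G X) w" if "w \<in> verts (two_alteration G X)" for w
  using that D(6) by (auto simp: two_alteration_def)
 have bg: "bij_betw (map_alt_edge f g) EG (edges (two_alteration H (map_sum f g ` X)))"
  using inj img by (simp add: bij_betw_def)
 show ?thesis unfolding giso_def EG_def[symmetric]
  by (intro conjI ballI v bg ends bd)
qed

lemma class_partition_intro:
 assumes "tip_respecting G z P" "\<And>p. p \<in> P ==> 2 \<le> card p ==> restriction G p \<in> tall_class k"
 shows "class_partition (tall_class k) G z P"
 unfolding class_partition_def
proof (intro conjI ballI impI assms(1))
 fix p assume "p \<in> P" "2 \<le> card p"
 hence "(fst (restriction G p), snd (restriction G p)) \<in> tall_class k" using assms(2) by simp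
 then obtain f g and H :: "(nat, nat) bgraph" where H: "giso f g (fst (restriction G p)) H" "(H, f (snd (restriction G p))) \<in> tall_class k"
  by (rule tall_class_nat)
 hence "canvas_iso (fst (restriction G p)) (snd (restriction G p)) H (f (snd (restriction G p)))" unfolding canvas_iso_giso by blast
 thus "\<exists>(H, y)\<in>(tall_class k :: (nat, nat) canvas set). canvas_iso (fst (restriction G p)) (snd (restriction G p)) H y"
  using H(2) by (intro bexI[of _ "(H, f (snd (restriction G p)))"]) auto
qed

lemma canvas_iso_giso_trans: "canvas_iso G z H y ==> giso f g H K ==> f y = x ==> canvas_iso G z K x"
proof -
 assume h: "canvas_iso G z H y" "giso f g H K" "f y = x"
 then obtain f' g' where i: "giso f' g' G H" "f' z = y" unfolding canvas_iso_giso by blast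
 have "giso (f \<circ> f') (g \<circ> g') G K" "(f \<circ> f') z = x" using giso_comp[OF i(1) h(2)] i(2) h(3) by simp_all
 thus ?thesis unfolding canvas_iso_giso by blast
qed

section \<open>Outcomes witnessed by canvases of arbitrary types\<close>

lemma EXPA_intro1:
 assumes G': "(G', z') \<in> tall_class k" "prec G' z' G z" and P: "class_partition (tall_class k) G z P"
  and i: "canvas_iso (contract G P) {z} G' z'"
 shows "EXPA k G z"
proof -
 obtain f g and H :: "(nat, nat) bgraph" where H: "giso f g G' H" "(H, f z') \<in> tall_class k" "multigraph G'" "z' \<in> verts G'"
  using tall_class_nat[OF G'(1)] .
 have "expansion (tall_class k) G z H (f z')" unfolding expansion_def using P canvas_iso_giso_trans[OF i H(1) refl] by blast
 thus ?thesis unfolding EXPA_def using H(2) giso_prec[OF H(3,1,4) G'(2)] by blast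
qed

lemma EXPA_intro2:
 assumes G': "(G', z') \<in> tall_class k" "prec G' z' G z" and P: "class_partition (tall_class k) G z P"
  and X: "two_alteration_on G' X" and i: "canvas_iso (contract G P) {z} (two_alteration G' X) (Some z')"
 shows "EXPA k G z"
proof -
 obtain f g and H :: "(nat, nat) bgraph" where H: "giso f g G' H" "(H, f z') \<in> tall_class k" "multigraph G'" "z' \<in> verts G'"
  using tall_class_nat[OF G'(1)] .
 have XG: "X \<subseteq> verts G' <+> edges G'" "X \<noteq> {}" "card X \<le> 2" using X unfolding two_alteration_on_def by auto
 have fX: "finite X" using finite_subset[OF XG(1) finite_Plus[OF multigraphD(1,2)[OF H(3)]]] .
 have "two_alteration_on H (map_sum f g ` X)"
  unfolding two_alteration_on_def
 proof (intro conjI)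
  show "map_sum f g ` X \<subseteq> verts H <+> edges H"
  proof (rule image_subsetI)
   fix x assume "x \<in> X"
   hence "x \<in> verts G' <+> edges G'" using XG(1) by blast
   thus "map_sum f g x \<in> verts H <+> edges H" using gisoD(2,4)[OF H(1)] by (cases x) auto
  qed
  show "card (map_sum f g ` X) \<le> 2" using card_image_le[OF fX, of "map_sum f g"] XG(3) by linarith
 qed (use XG(2) in simp)
 moreover have "canvas_iso (contract G P) {z} (two_alteration H (map_sum f g ` X)) (Some (f z'))"
  using canvas_iso_giso_trans[OF i giso_two_alteration[OF H(3,1) XG(1)]] by simp
 ultimately show ?thesis unfolding EXPA_def expansion_def using H(2) giso_prec[OF H(3,1,4) G'(2)] P by blast
qed

lemma EXPB_intro:
 assumes G': "(G', z') \<in> tall_class k" "prec G' z' G z" and P: "class_partition (tall_class k) G z P"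
  and uv: "one_alteration_at G' z' u v" and i: "canvas_iso (contract G P) {z} (add_edge G' u v) z'"
 shows "EXPB k G z"
proof -
 obtain f g and H :: "(nat, nat) bgraph" where H: "giso f g G' H" "(H, f z') \<in> tall_class k" "multigraph G'" "z' \<in> verts G'"
  using tall_class_nat[OF G'(1)] .
 have uv': "u \<in> verts G'" "v \<in> verts G'" "u \<noteq> v" "u \<noteq> z'" "v \<noteq> z'" using uv unfolding one_alteration_at_def by auto
 have "one_alteration_at H (f z') (f u) (f v)"
  unfolding one_alteration_at_def using gisoD(2)[OF H(1)] uv' H(4) inj_on_eq_iff[OF gisoD(1)[OF H(1)]] by auto
 moreover have "canvas_iso (contract G P) {z} (add_edge H (f u) (f v)) (f z')"
  using canvas_iso_giso_trans[OF i giso_add_edge[OF H(3,1) uv'(1,2)]] by simp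
 ultimately show ?thesis unfolding EXPB_def expansion_def using H(2) giso_prec[OF H(3,1,4) G'(2)] P by blast
qed

lemma ADD_intro:
 assumes G': "(G', z') \<in> tall_class k" "prec G' z' G z"
  and uv: "tip_alteration_at G' z' u v" and i: "canvas_iso G z (add_edge G' u v) z'"
 shows "ADD k G z"
proof -
 obtain f g and H :: "(nat, nat) bgraph" where H: "giso f g G' H" "(H, f z') \<in> tall_class k" "multigraph G'" "z' \<in> verts G'"
  using tall_class_nat[OF G'(1)] .
 have uv': "u \<in> verts G'" "v \<in> verts G'" "u \<noteq> v" "u = z' \<or> v = z'" using uv unfolding tip_alteration_at_def by auto
 have "tip_alteration_at H (f z') (f u) (f v)"
  unfolding tip_alteration_at_def using gisoD(2)[OF H(1)] uv' H(4) inj_on_eq_iff[OF gisoD(1)[OF H(1)]] by auto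
 moreover have "canvas_iso G z (add_edge H (f u) (f v)) (f z')"
  using canvas_iso_giso_trans[OF i giso_add_edge[OF H(3,1) uv'(1,2)]] by simp
 ultimately show ?thesis unfolding ADD_def using H(2) giso_prec[OF H(3,1,4) G'(2)] by blast
qed

lemma REM_intro:
 assumes G': "(G', z') \<in> tall_class k" "prec G' z' G z"
  and v: "tip_reduction_at G' z' v e" and i: "canvas_iso G z (delete_edge G' e) z'"
 shows "REM k G z"
proof -
 obtain f g and H :: "(nat, nat) bgraph" where H: "giso f g G' H" "(H, f z') \<in> tall_class k" "multigraph G'" "z' \<in> verts G'"
  using tall_class_nat[OF G'(1)] .
 note D = gisoD[OF H(1)]
 have v': "v \<in> verts G'" "v \<noteq> z'" "2 \<le> card {e \<in> edges G'. ends G' e = {v, z'}}" "e \<in> edges G'" "ends G' e = {v, z'}"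
  using v unfolding tip_reduction_at_def by auto
 have "g ` {e \<in> edges G'. ends G' e = {v, z'}} \<subseteq> {e \<in> edges H. ends H e = {f v, f z'}}" using D(4,5) by auto
 hence "card (g ` {e \<in> edges G'. ends G' e = {v, z'}}) \<le> card {e \<in> edges H. ends H e = {f v, f z'}}"
  using multigraphD(2)[OF giso_multigraph[OF H(3,1)]] by (intro card_mono) auto
 moreover have "card (g ` {e \<in> edges G'. ends G' e = {v, z'}}) = card {e \<in> edges G'. ends G' e = {v, z'}}"
  by (rule card_image) (rule inj_on_subset[OF D(3)], auto)
 ultimately have "tip_reduction_at H (f z') (f v) (g e)"
  unfolding tip_reduction_at_def using D(2,4,5) v' H(4) inj_on_eq_iff[OF D(1)] by auto
 moreover have "canvas_iso G z (delete_edge H (g e)) (f z')"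
  using canvas_iso_giso_trans[OF i giso_delete_edge[OF H(1) v'(4)]] by simp
 ultimately show ?thesis unfolding REM_def using H(2) giso_prec[OF H(3,1,4) G'(2)] by blast
qed

section \<open>Reducing tall canvases\<close>

lemma contract_size:
 assumes G: "multigraph G" and P: "tip_respecting G z P"
 shows "canvas_size (contract G P) {z} \<le> card P + card {e \<in> edges G. z \<notin> ends G e}"
proof -
 have z: "{z} \<in> P" using P unfolding tip_respecting_def by blast
 have "{e \<in> edges (contract G P). {z} \<notin> ends (contract G P) e} \<subseteq> {e \<in> edges G. z \<notin> ends G e}"
  using z unfolding contract_def by auto
 hence "card {e \<in> edges (contract G P). {z} \<notin> ends (contract G P) e} \<le> card {e \<in> edges G. z \<notin> ends G e}"
  using multigraphD(2)[OF G] by (intro card_mono) auto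
 thus ?thesis unfolding canvas_size_def by simp
qed

lemma canvas_iso_refl: "canvas_iso G z G z"
 unfolding canvas_iso_giso giso_def by (intro exI[of _ id]) (simp add: bij_betw_def)

lemma in_cut_tip:
 assumes "multigraph G" "e \<in> edges G"
 shows "e \<in> cut G {z} \<longleftrightarrow> z \<in> ends G e"
proof -
 obtain u v where uv: "ends G e = {u, v}" "u \<noteq> v" using edge_obtain[OF assms] .
 show ?thesis using in_cut_pair[OF uv, of "{z}"] uv assms(2) by auto
qed

lemma outset_cong: "(\<And>e. e \<in> cut G X ==> t e = t' e) ==> outset G t X = outset G t' X"
 unfolding outset_def by auto

locale tall =
 fixes k :: nat and G :: "('v, 'e) bgraph" and z :: 'v and S :: "'e set"
 assumes canvas: "is_canvas G z" and crit: "flow_critical G z" and tame: "tame G z"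
  and deg_z: "deg G {z} \<le> k + 1" and pre: "tip_preflow G z S" and nex: "\<not> extends G z S"
  and nonuniform: "deg G {z} = k + 1 ==> S \<noteq> {} \<and> S \<noteq> cut G {z}"
begin

lemma mG: "multigraph G" and z: "z \<in> verts G"
 using canvas unfolding is_canvas_def bordered_graph_def by auto

lemmas tms = critical_tms[OF mG z crit tame]
lemmas sts = critical_sts[OF mG z crit tame]

lemma total: "bd G (verts G) = 0"
 using bordered_total[OF mG z tms] canvas unfolding is_canvas_def by blast

lemma fin: "A \<subseteq> verts G ==> finite A"
 using finite_subset[OF _ multigraphD(1)[OF mG]] .

lemma S_sub: "S \<subseteq> cut G {z}" using pre unfolding tip_preflow_def by blast

text \<open>With at most one vertex besides the tip there is nothing left to choose, so every
  preflow extends. A single vertex can be declared exceptional with its own degree as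
  \<open>k\<close>, since it has no proper nonempty subsets.\<close>

lemma verts_ge_3: "3 \<le> card (verts G)"
proof (rule ccontr)
 assume n: "\<not> 3 \<le> card (verts G)"
 define W where "W = verts G - {z}"
 have WV: "W \<subseteq> verts G" and fW: "finite W" using fin[of W] W_def by auto
 have "card W \<le> 1" using n z multigraphD(1)[OF mG] unfolding W_def by (simp add: card_Diff_singleton)
 note T = tip_local[OF mG z total pre, folded W_def]
 have B: "B = {}" if "B \<subset> W" for B
 proof -
  have "card B < 1" using psubset_card_mono[OF fW that] \<open>card W \<le> 1\<close> by linarith
  thus ?thesis using finite_subset[of B W] that fW by auto
 qed
 have "\<exists>t. loc G W t \<and> outset G t W = cut G {z} - S"
 proof (cases "W = {}")
  case True
  have "\<not> sts G {}" unfolding sts_def st_def deg_def cut_def by simp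
  thus ?thesis using local_extension[OF mG WV T(1,2)] True by blast
 next
  case False
  then obtain v where "v \<in> W" by blast
  thus ?thesis by (rule local_extension_at[OF mG WV T(1,2), of _ "deg G W"]) (use B in auto)
 qed
 thus False using T(3) nex by blast
qed

lemma deg_z_ge_6: "6 \<le> deg G {z}"
proof -
 have "2 \<le> card (verts G - {z})" using verts_ge_3 z multigraphD(1)[OF mG] by (simp add: card_Diff_singleton)
 hence "sts G (verts G - {z})" by (intro sts) auto
 thus ?thesis using sts_deg deg_compl[OF mG, of "{z}"] by fastforce
qed

lemma restriction_in_class: "A \<subseteq> verts G - {z} ==> 2 \<le> card A ==> deg G A \<le> k ==> restriction G A \<in> tall_class k"
 by (rule restriction_tall_class[OF canvas crit tame]) auto

lemma part_sub:
 assumes "tip_respecting G z P" "p \<in> P" "p \<noteq> {z}"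
 shows "p \<subseteq> verts G - {z}"
proof -
 have P: "partition_on (verts G) P" "{z} \<in> P" using assms(1) unfolding tip_respecting_def by auto
 have "z \<notin> p" using part_mem[OF P(1,2) _ assms(2), of z] assms(3) by auto
 thus ?thesis using partition_onD1[OF P(1)] assms(2) by blast
qed

text \<open>Some non-trivial quotient already obstructs \<open>S\<close>, so the coarsest one is
  smaller than \<open>G\<close>. Its parts have degree at most \<open>k - 1\<close>, hence their
  restrictions belong to the class.\<close>

lemma EXPA_of_not_psicrit:
 assumes "\<not> psicrit G z S"
 shows "EXPA k G z"
proof -
 obtain Q where Q: "tip_respecting G z Q" "nontrivial Q" "\<not> part_ext G Q {z} S"
  using assms pre nex unfolding psicrit_def by blast
 obtain P where P: "tip_respecting G z P" "\<forall>Q. tip_respecting G z Q \<and> \<not> part_ext G Q {z} S \<longrightarrow> card P \<le> card Q"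
  "\<forall>p\<in>P - {{z}}. deg G p + 2 \<le> deg G {z}"
  "\<forall>k. deg G {z} \<le> k + 1 \<and> (deg G {z} = k + 1 \<longrightarrow> S \<noteq> {} \<and> S \<noteq> cut G {z}) \<longrightarrow> (contract G P, {z}) \<in> tall_class k"
  by (rule coarse_partition[OF mG z total tms pre nex]) (assumption | rule that)+
 have "(contract G P, {z}) \<in> tall_class k" by (rule P(4)[rule_format]) (use deg_z nonuniform in blast)
 moreover have "card P < card (verts G)"
  using P(2) Q(3) partition_card_less[OF _ multigraphD(1)[OF mG] Q(2)] Q(1) unfolding tip_respecting_def by fastforce
 hence "prec (contract G P) {z} G z"
  using contract_size[OF mG P(1)] unfolding prec_def canvas_size_def[of G z] by linarith
 moreover have "class_partition (tall_class k) G z P"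
 proof (rule class_partition_intro[OF P(1)])
  fix p assume p: "p \<in> P" "2 \<le> card p"
  hence "p \<noteq> {z}" by auto
  thus "restriction G p \<in> tall_class k"
   using restriction_in_class[OF part_sub[OF P(1) p(1)] p(2)] bspec[OF P(3), of p] p(1) deg_z by simp
 qed
 ultimately show ?thesis by (rule EXPA_intro1[OF _ _ _ canvas_iso_refl])
qed

end

locale critical_tall = tall +
 assumes psi: "psicrit G z S"
begin

lemma collapse_ext:
 assumes "A \<subseteq> verts G - {z}" "2 \<le> card A"
 obtains t where "orientation G t" "loc G (verts G - A) t" "net G t A = bd G A" "outset G t {z} = S"
  "\<And>e. e \<in> cut G {z} ==> t e = z \<longleftrightarrow> e \<in> S"
proof -
 obtain t where t: "loc G (verts G - A) t" "net G t A = bd G A" "outset G t {z} = S"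
  using psicrit_collapse[OF mG z psi assms] .
 moreover have "t e = z \<longleftrightarrow> e \<in> S" if "e \<in> cut G {z}" for e using t(3) that unfolding outset_singleton by blast
 ultimately show ?thesis using that unfolding loc_def by blast
qed

lemma no_local: "A \<subseteq> verts G ==> z \<notin> A ==> loc G (verts G - A) t ==> outset G t {z} = S ==>
  loc G A t2 ==> outset G t2 A \<noteq> outset G t A"
 using extends_expand[OF mG, of A z t t2] nex by metis

text \<open>Two parallel edges can meet every demand on their ends, so a flow with these ends
  collapsed could be completed.\<close>

lemma no_parallel:
 assumes "e \<in> edges G" "f \<in> edges G" "ends G e = ends G f" "z \<notin> ends G e"
 shows "e = f"
proof (rule ccontr)
 assume ef: "e \<noteq> f"
 obtain u v where uv: "ends G e = {u, v}" "u \<noteq> v" "u \<in> verts G" "v \<in> verts G" using edge_obtain[OF mG assms(1)] .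
 have A: "{u, v} \<subseteq> verts G - {z}" using uv assms(4) by auto
 have c: "2 \<le> card {u, v}" using uv(2) by simp
 obtain t where t: "orientation G t" "loc G (verts G - {u, v}) t" "net G t {u, v} = bd G {u, v}" "outset G t {z} = S"
  using collapse_ext[OF A c] by metis
 have AV: "{u, v} \<subseteq> verts G" "z \<notin> {u, v}" using A by auto
 have "balance G (outset G t {u, v}) {u, v} = bd G {u, v}" using net_balance[OF mG t(1)] t(3) by simp
 then obtain t2 where "loc G {u, v} t2" "outset G t2 {u, v} = outset G t {u, v}"
  using local_two[OF mG AV(1) uv(2) outset_subset _ assms(1,2) ef uv(1)] uv(1) assms(3) by metis
 thus False using no_local[OF AV t(2,4)] by blast
qed

end

locale large_tall = critical_tall +
 assumes large: "4 \<le> card (verts G)"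
begin

text \<open>If \<open>w\<close> had only the tip and \<open>x\<close> as neighbours, two flows could
  be combined: \<open>t1\<close>, correct at \<open>w\<close>, on the edges at \<open>w\<close>, and
  \<open>t2\<close>, correct away from \<open>w\<close> and \<open>x\<close>, on the rest. The
  result differs from \<open>t2\<close> only between \<open>w\<close> and \<open>x\<close>, so it is
  correct for \<open>{w, x}\<close> as a whole, and being correct at \<open>w\<close> it is correct
  at \<open>x\<close>. A fourth vertex makes the collapse behind \<open>t1\<close>
  non-trivial.\<close>

lemma other_neighbour:
 assumes w: "w \<in> verts G" "w \<noteq> z" and x: "x \<in> verts G" "x \<noteq> z" "x \<noteq> w"
 shows "\<exists>e\<in>cut G {w}. z \<notin> ends G e \<and> x \<notin> ends G e"
proof (rule ccontr)
 assume n: "\<not> (\<exists>e\<in>cut G {w}. z \<notin> ends G e \<and> x \<notin> ends G e)"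
 have we: "ends G e = {w, z} \<or> ends G e = {w, x}" if e: "e \<in> edges G" "w \<in> ends G e" for e
 proof -
  have "e \<in> cut G {w}" using in_cut_tip[OF mG e(1)] e(2) by simp
  hence "z \<in> ends G e \<or> x \<in> ends G e" using n by blast
  moreover obtain v where "ends G e = {w, v}" using edge_obtain_tail[OF mG e] by metis
  ultimately show ?thesis using w(2) x(3) by auto
 qed
 define A where "A = verts G - {z, w}"
 have cA: "card A = card (verts G) - 2" unfolding A_def using w z multigraphD(1)[OF mG] by (subst card_Diff_subset) auto
 have A: "A \<subseteq> verts G - {z}" "2 \<le> card A" using cA large unfolding A_def by auto
 obtain t1 where t1: "orientation G t1" "loc G (verts G - A) t1" "outset G t1 {z} = S"
  "\<And>e. e \<in> cut G {z} ==> t1 e = z \<longleftrightarrow> e \<in> S" using collapse_ext[OF A] by metis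
 have B: "{w, x} \<subseteq> verts G - {z}" "2 \<le> card {w, x}" using w x by auto
 obtain t2 where t2: "orientation G t2" "loc G (verts G - {w, x}) t2" "net G t2 {w, x} = bd G {w, x}" "outset G t2 {z} = S"
  "\<And>e. e \<in> cut G {z} ==> t2 e = z \<longleftrightarrow> e \<in> S" using collapse_ext[OF B] by metis
 define t3 where "t3 e = (if w \<in> ends G e then t1 e else t2 e)" for e
 have o: "orientation G t3" using t1(1) t2(1) unfolding orientation_def t3_def by simp
 have eq: "t3 e = t2 e" if e: "e \<in> edges G" "ends G e \<noteq> {w, x}" for e
 proof (cases "w \<in> ends G e")
  case True
  hence ez: "ends G e = {w, z}" using we[OF e(1)] e(2) by blast
  hence c: "e \<in> cut G {z}" using in_cut_tip[OF mG e(1)] by simp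
  have "t1 e \<in> {w, z}" "t2 e \<in> {w, z}" using orientationD[OF t1(1) e(1)] orientationD[OF t2(1) e(1)] ez by auto
  thus ?thesis using t1(4)[OF c] t2(5)[OF c] w(2) True unfolding t3_def by auto
 qed (simp add: t3_def)
 have "outset G t3 {v} = outset G t2 {v}" if v: "v \<notin> {w, x}" for v
 proof -
  have "t3 e = t2 e" if e: "e \<in> cut G {v}" for e
  proof -
   have "e \<in> edges G" by (rule cut_edge[OF e])
   moreover have "v \<in> ends G e" using in_cut_tip[OF mG calculation] e by simp
   ultimately show ?thesis using eq v by blast
  qed
  thus ?thesis by (rule outset_cong)
 qed
 hence l: "loc G (verts G - {w, x}) t3" "outset G t3 {z} = S"
  using loc_cong[OF mG t2(2) o] t2(4) w x by auto
 have "outset G t3 {w} = outset G t1 {w}"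
 proof -
  have "t3 e = t1 e" if e: "e \<in> cut G {w}" for e
  proof -
   have "e \<in> edges G" by (rule cut_edge[OF e])
   thus ?thesis using in_cut_tip[OF mG] e unfolding t3_def by simp
  qed
  thus ?thesis by (rule outset_cong)
 qed
 hence nw: "net G t3 {w} = bdry G w"
  using net_eq_outset[OF mG t1(1) o] t1(2) w unfolding loc_def A_def by auto
 have "outset G t3 {w, x} = outset G t2 {w, x}"
 proof -
  have "t3 e = t2 e" if e: "e \<in> cut G {w, x}" for e
  proof (rule eq)
   show "e \<in> edges G" by (rule cut_edge[OF e])
   show "ends G e \<noteq> {w, x}"
   proof
    assume "ends G e = {w, x}"
    thus False using in_cut_pair[of G e w x "{w, x}"] x(3) e by auto
   qed
  qed
  thus ?thesis by (rule outset_cong)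
 qed
 hence "net G t3 {w, x} = bdry G w + bdry G x"
  using net_eq_outset[OF mG t2(1) o] t2(3) x(3) by simp
 moreover have "net G t3 {w, x} = net G t3 {w} + net G t3 {x}"
  using net_Un[OF mG o, of "{w}" "{x}"] x(3) by (simp add: insert_commute)
 ultimately have "net G t3 {x} = bdry G x" using nw by simp
 hence "loc G (verts G) t3" using l(1) nw o unfolding loc_def by blast
 thus False using nex l(2) unfolding extends_loc[OF mG] by blast
qed

text \<open>If the two sides were joined only through the tip, their cuts would be oriented by
  \<open>S\<close> alone. Flows obtained by collapsing one side and then the other could be put
  together.\<close>

lemma connected:
 assumes A: "A \<noteq> {}" "A \<subset> verts G - {z}"
 shows "\<exists>e\<in>cut G A. z \<notin> ends G e"
proof (rule ccontr)
 assume n: "\<not> (\<exists>e\<in>cut G A. z \<notin> ends G e)"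
 define B where "B = verts G - {z} - A"
 have AB: "A \<union> B = verts G - {z}" "A \<inter> B = {}" "B \<noteq> {}" "B \<subseteq> verts G - {z}" "A \<subseteq> verts G - {z}" using A B_def by auto
 have fA: "finite A" "finite B" using fin[of A] fin[of B] AB by auto
 \<comment> \<open>A side consisting of one vertex admits no non-trivial collapse; there
   \<open>other_neighbour\<close> provides the edge.\<close>
 have single: False if W: "w \<in> verts G" "w \<noteq> z" "x \<in> verts G" "x \<noteq> z" "x \<noteq> w"
  "\<And>y. y \<noteq> z ==> y \<noteq> w ==> y \<in> verts G ==> (w \<in> A) \<noteq> (y \<in> A)" for w x
 proof -
  obtain e where e: "e \<in> cut G {w}" "z \<notin> ends G e" using other_neighbour[OF W(1-5)] by blast
  have eE: "e \<in> edges G" by (rule cut_edge[OF e(1)])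
  have "w \<in> ends G e" using in_cut_tip[OF mG eE] e(1) by simp
  then obtain y where y: "ends G e = {w, y}" "w \<noteq> y" "y \<in> verts G" using edge_obtain_tail[OF mG eE] by metis
  hence "(w \<in> A) \<noteq> (y \<in> A)" using W(6)[of y] e(2) by auto
  hence "e \<in> cut G A" using in_cut_pair[OF y(1,2)] eE by simp
  thus False using n e(2) by blast
 qed
 obtain a b where ab: "a \<in> A" "b \<in> B" using A(1) AB(3) by blast
 consider "A = {a}" | "B = {b}" | "2 \<le> card A" "2 \<le> card B"
 proof -
  have "X = {x} \<or> 2 \<le> card X" if "x \<in> X" "finite X" for x and X :: "'a set"
  proof (cases "X = {x}")
   case False
   hence "card {x} < card X" using that by (intro psubset_card_mono) auto
   thus ?thesis by simp
  qed simp
  thus ?thesis using that ab fA by blast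
 qed
 thus False
 proof cases
  case 1
  show False by (rule single[of a b]) (use 1 ab AB in auto)
 next
  case 2
  show False by (rule single[of b a]) (use 2 ab AB in auto)
 next
  case 3
  obtain t1 where t1: "orientation G t1" "loc G (verts G - A) t1" "outset G t1 {z} = S"
   "\<And>e. e \<in> cut G {z} ==> t1 e = z \<longleftrightarrow> e \<in> S" using collapse_ext[OF AB(5) 3(1)] by metis
  obtain t2 where t2: "orientation G t2" "loc G (verts G - B) t2" "outset G t2 {z} = S"
   "\<And>e. e \<in> cut G {z} ==> t2 e = z \<longleftrightarrow> e \<in> S" using collapse_ext[OF AB(4) 3(2)] by metis
  have "loc G A t2" using t2(1,2) AB unfolding loc_def by blast
  moreover have "outset G t2 A = outset G t1 A"
  proof -
   have "t2 e \<in> A \<longleftrightarrow> t1 e \<in> A" if e: "e \<in> cut G A" for e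
   proof -
    have eE: "e \<in> edges G" by (rule cut_edge[OF e])
    have "z \<in> ends G e" using n e by blast
    then obtain y where y: "ends G e = {z, y}" "z \<noteq> y" using edge_obtain_tail[OF mG eE] by metis
    have ez: "e \<in> cut G {z}" using in_cut_tip[OF mG eE] y(1) by simp
    have "z \<notin> A" using AB(5) by blast
    hence "y \<in> A" using in_cut_pair[OF y, of A] e by blast
    moreover have "t1 e \<in> {z, y}" "t2 e \<in> {z, y}" using orientationD[OF t1(1) eE] orientationD[OF t2(1) eE] y(1) by auto
    ultimately show ?thesis using t1(4)[OF ez] t2(4)[OF ez] y(2) \<open>z \<notin> A\<close> by auto
   qed
   thus ?thesis unfolding outset_def by blast
  qed
  moreover have "A \<subseteq> verts G" "z \<notin> A" using AB(5) by auto
  ultimately show False using no_local[OF _ _ t1(2,3)] by blast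
 qed
qed

end

section \<open>Deleting an arc\<close>

text \<open>The removed edge counts as directed from \<open>a\<close> to \<open>c\<close>, and the
  boundary takes over its contribution.\<close>

definition del_arc :: "('v, 'e) bgraph => 'e => 'v => 'v => ('v, 'e) bgraph" where
 "del_arc G e a c = G\<lparr>edges := edges G - {e}, bdry := (\<lambda>v. bdry G v - (if v = a then 1 else 0) + (if v = c then 1 else 0))\<rparr>"

lemma del_arc_simps [simp]:
 "verts (del_arc G e a c) = verts G" "edges (del_arc G e a c) = edges G - {e}" "ends (del_arc G e a c) = ends G"
 by (simp_all add: del_arc_def)

lemma multigraph_del_arc: "multigraph G ==> multigraph (del_arc G e a c)"
 unfolding multigraph_def by simp

lemma cut_del_arc: "cut (del_arc G e a c) A = cut G A - {e}"
 unfolding cut_def by auto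

lemma deg_del_arc:
 assumes "multigraph G"
 shows "int (deg (del_arc G e a c) A) = int (deg G A) - (if e \<in> cut G A then 1 else 0)"
proof (cases "e \<in> cut G A")
 case True
 hence "0 < card (cut G A)" using finite_cut[OF assms, of A] card_gt_0_iff by blast
 thus ?thesis using True unfolding deg_def cut_del_arc by (simp add: card_Diff_singleton)
qed (simp add: deg_def cut_del_arc)

lemma bdry_del_arc:
 assumes "finite A"
 shows "bd (del_arc G e a c) A = bd G A - (if a \<in> A then 1 else 0) + (if c \<in> A then 1 else 0)"
 using assms unfolding del_arc_def by (simp add: sum.distrib sum_subtractf)

lemma net_del_arc:
 assumes "multigraph G" "e \<in> edges G" "ends G e = {a, c}" "a \<noteq> c" "t e = a" "\<And>f. f \<in> edges G - {e} ==> t1 f = t f"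
 shows "net G t X = net (del_arc G e a c) t1 X + (if a \<in> X then 1 else 0) - (if c \<in> X then 1 else 0)"
proof -
 have "net G t X = cn (ends G e) (t e) X + (\<Sum>f\<in>edges G - {e}. cn (ends G f) (t f) X)"
  unfolding net_def by (rule sum.remove[OF multigraphD(2)[OF assms(1)] assms(2)])
 also have "(\<Sum>f\<in>edges G - {e}. cn (ends G f) (t f) X) = net (del_arc G e a c) t1 X"
  unfolding net_def by (rule sum.cong) (use assms(6) in auto)
 finally show ?thesis unfolding assms(3,5) cn_pair[OF assms(4)] by simp
qed

lemma part_ext_del_arc1:
 assumes G: "multigraph G" and e: "e \<in> edges G" "ends G e = {a, c}" "a \<noteq> c"
  and P: "\<And>p. p \<in> P ==> p \<subseteq> verts G" and S: "e \<in> S \<longleftrightarrow> a \<in> b \<and> c \<notin> b"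
  and x: "part_ext (del_arc G e a c) P b (S - {e})"
 shows "part_ext G P b S"
proof -
 obtain t1 where t1: "orientation (del_arc G e a c) t1" "\<forall>p\<in>P. net (del_arc G e a c) t1 p = bd (del_arc G e a c) p"
  "outset (del_arc G e a c) t1 b = S - {e}" using x unfolding part_ext_def by blast
 define t where "t = t1(e := a)"
 have "orientation G t" using t1(1) e unfolding orientation_def t_def by auto
 moreover have "net G t p = bd G p" if p: "p \<in> P" for p
  using net_del_arc[OF G e, of t t1 p] t1(2) p bdry_del_arc[of p G e a c] finite_subset[OF P[OF p] multigraphD(1)[OF G]]
  unfolding t_def by simp
 moreover have "outset G t b = S"
 proof -
  have "f \<in> outset G t b \<longleftrightarrow> f \<in> S" if "f \<noteq> e" for f
   using t1(3) that unfolding outset_def cut_del_arc t_def by auto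
  moreover have "e \<in> outset G t b \<longleftrightarrow> e \<in> S"
   unfolding outset_def t_def using in_cut_pair[OF e(2,3), of b] e(1) S by auto
  ultimately have "f \<in> outset G t b \<longleftrightarrow> f \<in> S" for f by (cases "f = e") auto
  thus ?thesis by blast
 qed
 ultimately show ?thesis unfolding part_ext_def by blast
qed

text \<open>An edge in the cut of \<open>b\<close> has its direction fixed by \<open>S\<close>, and
  an edge with both ends in one part can be redirected without effect. In both cases it may be taken
  to run from \<open>a\<close> to \<open>c\<close>.\<close>

lemma part_ext_del_arc2:
 assumes G: "multigraph G" and e: "e \<in> edges G" "ends G e = {a, c}" "a \<noteq> c"
  and P: "\<And>p. p \<in> P ==> p \<subseteq> verts G" and S: "e \<in> S \<longleftrightarrow> a \<in> b \<and> c \<notin> b"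
  and i: "e \<in> cut G b \<or> (\<forall>p\<in>P. a \<in> p \<longleftrightarrow> c \<in> p) \<and> (a \<in> b \<longleftrightarrow> c \<in> b)" and x: "part_ext G P b S"
 shows "part_ext (del_arc G e a c) P b (S - {e})"
proof -
 obtain t where t: "orientation G t" "\<forall>p\<in>P. net G t p = bd G p" "outset G t b = S"
  using x unfolding part_ext_def by blast
 define t' where "t' = t(e := a)"
 have o: "orientation G t'" using t(1) e unfolding orientation_def t'_def by auto
 have te: "t e = a \<or> t e = c" using orientationD[OF t(1) e(1)] e(2) by simp
 have eq: "t' = t" if c: "e \<in> cut G b"
 proof -
  have "t e \<in> b \<longleftrightarrow> a \<in> b \<and> c \<notin> b" using t(3) S c unfolding outset_def by blast
  moreover have "(a \<in> b) \<noteq> (c \<in> b)" using in_cut_pair[OF e(2,3), of b] c by simp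
  ultimately have "t e = a" using te by blast
  thus ?thesis unfolding t'_def by (metis fun_upd_triv)
 qed
 have cuteq: "outset G t' X = outset G t X" if "a \<in> X \<longleftrightarrow> c \<in> X" for X
 proof -
  have "e \<notin> cut G X" using in_cut_pair[OF e(2,3), of X] that by simp
  thus ?thesis unfolding outset_def t'_def by auto
 qed
 have out: "outset G t' b = S" using i eq cuteq[of b] t(3) by auto
 have net: "net G t' p = bd G p" if p: "p \<in> P" for p
  using i eq cuteq[of p] t(2) p net_eq_outset[OF G t(1) o, of p] by auto
 have "orientation (del_arc G e a c) t'" using o unfolding orientation_def by auto
 moreover have "net (del_arc G e a c) t' p = bd (del_arc G e a c) p" if p: "p \<in> P" for p
  using net_del_arc[OF G e, of t' t' p] net[OF p] bdry_del_arc[of p G e a c] finite_subset[OF P[OF p] multigraphD(1)[OF G]]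
  unfolding t'_def by simp
 moreover have "outset (del_arc G e a c) t' b = S - {e}"
  using out unfolding outset_def cut_del_arc by auto
 ultimately show ?thesis unfolding part_ext_def by blast
qed

lemma lft_add: "3 dvd lft (a + of_int i) - (lft a + i)"
 unfolding of_int_3_eq[symmetric] by simp

lemma tms_del_arc:
 assumes G: "multigraph G" and e: "e \<in> edges G" "ends G e = {a, c}" "a \<noteq> c" and A: "A \<noteq> {}" "A \<subseteq> verts G"
  and t: "tms G A" and s: "2 \<le> card A ==> sts G A"
  and a: "A = {a} ==> tm (int (deg G {a}) - 1) (lft (bdry G a) - 1)"
  and c: "A = {c} ==> tm (int (deg G {c}) - 1) (lft (bdry G c) + 1)"
 shows "tms (del_arc G e a c) A"
proof -
 have fA: "finite A" using finite_subset[OF A(2) multigraphD(1)[OF G]] .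
 note B = bdry_del_arc[OF fA, of G e a c]
 have cut: "e \<in> cut G A \<longleftrightarrow> (a \<in> A) \<noteq> (c \<in> A)" using in_cut_pair[OF e(2,3)] e(1) by simp
 have minus: "tms (del_arc G e a c) A" if m: "a \<in> A" "c \<notin> A" "tm (int (deg G A) - 1) (lft (bd G A) - 1)"
 proof -
  have "bd (del_arc G e a c) A = bd G A + of_int (- 1)" using B m by simp
  thus ?thesis unfolding tms_def deg_del_arc[OF G] using cut m tm_cong[OF lft_add[of "bd G A" "- 1"]] by simp
 qed
 have plus: "tms (del_arc G e a c) A" if m: "c \<in> A" "a \<notin> A" "tm (int (deg G A) - 1) (lft (bd G A) + 1)"
 proof -
  have "bd (del_arc G e a c) A = bd G A + of_int 1" using B m by simp
  thus ?thesis unfolding tms_def deg_del_arc[OF G] using cut m tm_cong[OF lft_add[of "bd G A" 1]] by simp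
 qed
 have one: "A = {v}" if "v \<in> A" "\<not> 2 \<le> card A" for v
 proof (rule ccontr)
  assume "A \<noteq> {v}"
  hence "card {v} < card A" using that(1) fA by (intro psubset_card_mono) auto
  thus False using that(2) by simp
 qed
 consider "(a \<in> A) = (c \<in> A)" | "a \<in> A" "c \<notin> A" | "c \<in> A" "a \<notin> A" by blast
 thus ?thesis
 proof cases
  case 1
  thus ?thesis using t cut B unfolding tms_def deg_del_arc[OF G] by auto
 next
  case 2
  thus ?thesis
   using minus[OF 2] st_tm1 s one[OF 2(1)] a unfolding sts_def by (cases "2 \<le> card A") auto
 next
  case 3
  thus ?thesis
   using plus[OF 3] st_tm1 s one[OF 3(1)] c unfolding sts_def by (cases "2 \<le> card A") auto
 qed
qed

lemma add_edge_iso: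
 assumes e: "e \<in> edges G" "ends G e = {a, c}" and H: "verts H = verts G" "edges H = edges G - {e}"
  "\<And>f. f \<in> edges H ==> ends H f = ends G f"
  "\<And>v. v \<in> verts G ==> bdry G v = bdry H v + (if v = a then 1 else 0) - (if v = c then 1 else 0)" and "a \<noteq> c"
 shows "canvas_iso G z (add_edge H a c) z"
proof -
 define g where "g f = (if f = e then None else Some f)" for f
 have "bij_betw g (edges G) (edges (add_edge H a c))"
  unfolding bij_betw_def
 proof
  show "inj_on g (edges G)" unfolding g_def inj_on_def by simp
  have "edges G = insert e (edges H)" using H(2) e(1) by blast
  moreover have "g ` edges H = Some ` edges H" unfolding g_def H(2) by (intro image_cong) auto
  moreover have "g e = None" by (simp add: g_def)
  ultimately show "g ` edges G = edges (add_edge H a c)" unfolding add_edge_def by simp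
 qed
 moreover have "ends (add_edge H a c) (g f) = id ` ends G f" if "f \<in> edges G" for f
  using H(2,3) that e(2) unfolding g_def add_edge_def by auto
 moreover have "bdry (add_edge H a c) (id v) = bdry G v" if "v \<in> verts G" for v
  using H(4)[OF that] assms(7) unfolding add_edge_def by auto
 moreover have "bij_betw id (verts G) (verts (add_edge H a c))" using H(1) unfolding add_edge_def by simp
 ultimately have "giso id g G (add_edge H a c)" unfolding giso_def by blast
 thus ?thesis unfolding canvas_iso_giso by (intro exI[of _ id] exI[of _ g]) simp
qed

section \<open>Friendliness as the ability to lose an edge\<close>

lemma in_friendly_iff: "in_friendly G v \<longleftrightarrow> (if even (deg G {v}) then bdry G v \<noteq> - 1 else bdry G v \<noteq> 1)"
 unfolding in_friendly_def tau_def Let_def using three_cases[of "bdry G v"] one_neq_3 by auto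

lemma out_friendly_iff: "out_friendly G v \<longleftrightarrow> (if even (deg G {v}) then bdry G v \<noteq> 1 else bdry G v \<noteq> - 1)"
 unfolding out_friendly_def tau_def Let_def using three_cases[of "bdry G v"] one_neq_3 by auto

lemma lft_dvd: "3 dvd lft b \<longleftrightarrow> b = 0" "3 dvd lft b - 1 \<longleftrightarrow> b = 1" "3 dvd lft b + 1 \<longleftrightarrow> b = - 1"
 using of_int_3_eq[of "lft b" 0] of_int_3_eq[of "lft b" 1] of_int_3_eq[of "lft b" "- 1"] by simp_all

text \<open>At degree 5 or 6 the loss of an edge fails for exactly one admissible boundary, and that
  is the one at which friendliness fails. From degree 7 on the loss is harmless.\<close>

lemma friendly_tm:
 assumes t: "tms G {v}" and d: "5 \<le> deg G {v}"
 shows "in_friendly G v ==> tm (int (deg G {v}) - 1) (lft (bdry G v) + 1)"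
  and "out_friendly G v ==> tm (int (deg G {v}) - 1) (lft (bdry G v) - 1)"
proof -
 define n where "n = int (deg G {v})"
 define b where "b = lft (bdry G v)"
 have e: "even (deg G {v}) \<longleftrightarrow> even n" by (simp add: n_def)
 have T: "tm n b" using t unfolding tms_def n_def b_def by simp
 have D: "5 \<le> n" using d by (simp add: n_def)
 show "tm (int (deg G {v}) - 1) (lft (bdry G v) + 1)" if "in_friendly G v"
 proof -
  have "if even n then \<not> 3 dvd b + 1 else \<not> 3 dvd b - 1"
   using that unfolding in_friendly_iff e b_def lft_dvd .
  thus ?thesis using T D unfolding n_def[symmetric] b_def[symmetric] tm_def by presburger
 qed
 show "tm (int (deg G {v}) - 1) (lft (bdry G v) - 1)" if "out_friendly G v"
 proof -
  have "if even n then \<not> 3 dvd b - 1 else \<not> 3 dvd b + 1"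
   using that unfolding out_friendly_iff e b_def lft_dvd .
  thus ?thesis using T D unfolding n_def[symmetric] b_def[symmetric] tm_def by presburger
 qed
qed

lemma in_or_out_friendly: "in_friendly G v \<or> out_friendly G v"
 unfolding in_friendly_iff out_friendly_iff using one_neq_3 by auto

context critical_tall
begin

lemma psi_ext: "tip_respecting G z P ==> nontrivial P ==> part_ext G P {z} S"
 using psi unfolding psicrit_def by blast

lemma collapse_tip_respecting:
 assumes "A \<subseteq> verts G - {z}" "2 \<le> card A"
 shows "tip_respecting G z (collapse (verts G) A)" "nontrivial (collapse (verts G) A)"
proof -
 have "A \<noteq> {}" using assms(2) by auto
 thus "tip_respecting G z (collapse (verts G) A)" "nontrivial (collapse (verts G) A)"
  using partition_collapse[of A "verts G"] assms z unfolding tip_respecting_def nontrivial_def collapse_def by auto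
qed

lemma tip_respectingD:
 assumes "tip_respecting G z P"
 shows "partition_on (verts G) P" "{z} \<in> P" "\<And>p. p \<in> P ==> p \<subseteq> verts G"
 using assms partition_onD1[of "verts G" P] unfolding tip_respecting_def by auto

lemma del_arc_reduction:
 assumes e: "e \<in> edges G" "ends G e = {a, c}" "a \<noteq> c"
  and Se: "e \<in> S \<longleftrightarrow> a = z"
  and ta: "a \<noteq> z ==> tm (int (deg G {a}) - 1) (lft (bdry G a) - 1)"
  and tc: "c \<noteq> z ==> tm (int (deg G {c}) - 1) (lft (bdry G c) + 1)"
 shows "multigraph (del_arc G e a c)" "bd (del_arc G e a c) (verts (del_arc G e a c)) = 0"
  "\<And>A. A \<noteq> {} ==> A \<subseteq> verts (del_arc G e a c) - {z} ==> tms (del_arc G e a c) A"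
  "tip_preflow (del_arc G e a c) z (S - {e})" "\<not> extends (del_arc G e a c) z (S - {e})"
proof -
 have ac: "a \<in> verts G" "c \<in> verts G" using multigraphD(3)[OF mG e(1)] e(2) by auto
 have Sz: "e \<in> S \<longleftrightarrow> a \<in> {z} \<and> c \<notin> {z}" using Se e(3) by auto
 show m1: "multigraph (del_arc G e a c)" by (rule multigraph_del_arc[OF mG])
 show "bd (del_arc G e a c) (verts (del_arc G e a c)) = 0"
  using bdry_del_arc[OF multigraphD(1)[OF mG], of G e a c] ac total by simp
 show "tms (del_arc G e a c) A" if A: "A \<noteq> {}" "A \<subseteq> verts (del_arc G e a c) - {z}" for A
 proof (rule tms_del_arc[OF mG e A(1)])
  show "A \<subseteq> verts G" using A(2) by auto
  show "tms G A" using tms[of A] A by simp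
  show "sts G A" if "2 \<le> card A" using sts[of A] that A by simp
  show "tm (int (deg G {a}) - 1) (lft (bdry G a) - 1)" if "A = {a}" using ta that A(2) by auto
  show "tm (int (deg G {c}) - 1) (lft (bdry G c) + 1)" if "A = {c}" using tc that A(2) by auto
 qed
 show "\<not> extends (del_arc G e a c) z (S - {e})"
 proof
  assume "extends (del_arc G e a c) z (S - {e})"
  hence x: "part_ext (del_arc G e a c) (singles (verts G)) {z} (S - {e})" unfolding extends_part_ext[OF m1] by simp
  have "part_ext G (singles (verts G)) {z} S" by (rule part_ext_del_arc1[OF mG e _ Sz x]) auto
  thus False using nex unfolding extends_part_ext[OF mG] by blast
 qed
 \<comment> \<open>To see that the rest of \<open>S\<close> is a preflow, a partition is needed to
   which \<open>S\<close> extends also after the deletion. If \<open>e\<close> meets the tip,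
   merging all other vertices works; otherwise both ends of \<open>e\<close> are put into one
   part.\<close>
 define A where "A = (if e \<in> cut G {z} then verts G - {z} else {a, c})"
 have A: "A \<subseteq> verts G - {z}" "2 \<le> card A"
 proof -
  have "z \<notin> ends G e" if "e \<notin> cut G {z}" using that in_cut_tip[OF mG e(1)] by simp
  thus "A \<subseteq> verts G - {z}" using ac e(2) unfolding A_def by auto
  have "2 \<le> card (verts G - {z})" using verts_ge_3 z multigraphD(1)[OF mG] by (simp add: card_Diff_singleton)
  thus "2 \<le> card A" unfolding A_def using e(3) by simp
 qed
 have i: "e \<in> cut G {z} \<or> (\<forall>p\<in>collapse (verts G) A. a \<in> p \<longleftrightarrow> c \<in> p) \<and> (a \<in> {z} \<longleftrightarrow> c \<in> {z})"
 proof (cases "e \<in> cut G {z}")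
  case False
  hence "A = {a, c}" "z \<notin> {a, c}" using in_cut_tip[OF mG e(1)] e(2) unfolding A_def by auto
  thus ?thesis unfolding collapse_def by auto
 qed simp
 note tr = collapse_tip_respecting[OF A]
 have "part_ext (del_arc G e a c) (collapse (verts G) A) {z} (S - {e})"
  by (rule part_ext_del_arc2[OF mG e _ Sz i psi_ext[OF tr]]) (rule tip_respectingD(3)[OF tr(1)])
 from part_ext_preflow[OF m1 this tip_respectingD(2)[OF tr(1)]]
 show "tip_preflow (del_arc G e a c) z (S - {e})" unfolding tip_preflow_balance by simp
qed

end

context large_tall
begin

text \<open>A mixed edge is deleted as an arc from its out-friendly to its in-friendly end. Putting
  it back raises the degree of a part by at most one, within the margin of two.\<close>

lemma EXPB_of_mixed:
 assumes five: "\<And>v. v \<in> verts G ==> v \<noteq> z ==> 5 \<le> deg G {v}"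
  and e: "e \<in> edges G" "mixed G z e"
 shows "EXPB k G z"
proof -
 obtain a c where ac: "ends G e = {a, c}" "a \<noteq> z" "c \<noteq> z" "a \<noteq> c" "in_friendly G c" "out_friendly G a"
  using e(2) unfolding mixed_def by (metis insert_commute)
 have acV: "a \<in> verts G" "c \<in> verts G" using multigraphD(3)[OF mG e(1)] ac(1) by auto
 have ez: "e \<notin> cut G {z}" using in_cut_tip[OF mG e(1)] ac(1-3) by auto
 have eS: "e \<notin> S" using ez S_sub by blast
 have T: "tms G {v}" if "v \<in> verts G" "v \<noteq> z" for v using tms[of "{v}"] that by simp
 define G1 where "G1 = del_arc G e a c"
 note R = del_arc_reduction[OF e(1) ac(1,4) _ friendly_tm(2)[OF T[OF acV(1) ac(2)] five[OF acV(1) ac(2)] ac(6)]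
   friendly_tm(1)[OF T[OF acV(2) ac(3)] five[OF acV(2) ac(3)] ac(5)], folded G1_def]
 have Se: "e \<in> S \<longleftrightarrow> a = z" and S1: "S - {e} = S" using eS ac(2) by auto
 note R = R[OF Se, unfolded S1]
 have V1: "verts G1 = verts G" "edges G1 = edges G - {e}" "ends G1 = ends G" by (simp_all add: G1_def)
 have z1: "z \<in> verts G1" using z V1 by simp
 obtain P where P: "tip_respecting G1 z P" "\<not> part_ext G1 P {z} S" "card P \<le> card (verts G1)"
  "\<forall>p\<in>P - {{z}}. deg G1 p + 2 \<le> deg G1 {z}"
  "\<forall>k. deg G1 {z} \<le> k + 1 \<and> (deg G1 {z} = k + 1 \<longrightarrow> S \<noteq> {} \<and> S \<noteq> cut G1 {z}) \<longrightarrow> (contract G1 P, {z}) \<in> tall_class k"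
  by (rule coarse_partition[OF R(1) z1 R(2-5)]) (assumption | rule that)+
 have cz: "cut G1 {z} = cut G {z}" using ez cut_del_arc[of G e a c "{z}"] unfolding G1_def by blast
 hence dz: "deg G1 {z} = deg G {z}" by (simp add: deg_def)
 have trG: "tip_respecting G z P" using P(1) unfolding tip_respecting_def V1 .
 note PD = tip_respectingD[OF trG]
 obtain pa pc where p: "pa \<in> P" "a \<in> pa" "pc \<in> P" "c \<in> pc"
  using partition_onD1[OF PD(1)] acV by blast
 have ma: "a \<in> q \<longleftrightarrow> q = pa" and mc: "c \<in> q \<longleftrightarrow> q = pc" if "q \<in> P" for q
  using part_mem[OF PD(1) p(1,2) that] part_mem[OF PD(1) p(3,4) that] by auto
 \<comment> \<open>If both ends of \<open>e\<close> lay in one part, the deletion would not affect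
   the quotient, and \<open>S\<close> extends to that quotient in \<open>G\<close>.\<close>
 have ne: "pa \<noteq> pc"
 proof
  assume eq: "pa = pc"
  hence "{a, c} \<subseteq> pa" using p by simp
  hence "card {a, c} \<le> card pa" by (rule card_mono[OF fin[OF PD(3)[OF p(1)]]])
  hence "2 \<le> card pa" using ac(4) by simp
  hence "nontrivial P" unfolding nontrivial_def using p(1) by blast
  moreover have i: "e \<in> cut G {z} \<or> (\<forall>p\<in>P. a \<in> p \<longleftrightarrow> c \<in> p) \<and> (a \<in> {z} \<longleftrightarrow> c \<in> {z})"
   using ma mc eq ac(2,3) by auto
  ultimately have "part_ext G1 P {z} (S - {e})"
   unfolding G1_def using part_ext_del_arc2[OF mG e(1) ac(1,4) PD(3) _ i psi_ext[OF trG]] eS ac(2) by simp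
  thus False using P(2) S1 by simp
 qed
 have zP: "pa \<noteq> {z}" "pc \<noteq> {z}" using p ac(2,3) by auto
 have "(contract G1 P, {z}) \<in> tall_class k" by (rule P(5)[rule_format]) (use deg_z nonuniform dz cz in auto)
 moreover have "prec (contract G1 P) {z} G z"
 proof -
  have "card P \<le> card (verts G)" using P(3) V1 by simp
  moreover have "e \<in> {e \<in> edges G. z \<notin> ends G e}" using e(1) ac(1-3) by auto
  hence "{e \<in> edges G1. z \<notin> ends G1 e} \<subset> {e \<in> edges G. z \<notin> ends G e}" unfolding V1 by auto
  hence "card {e \<in> edges G1. z \<notin> ends G1 e} < card {e \<in> edges G. z \<notin> ends G e}"
   using multigraphD(2)[OF mG] by (intro psubset_card_mono) auto
  ultimately show ?thesis using contract_size[OF R(1) P(1)] unfolding prec_def canvas_size_def[of G z] by linarith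
 qed
 moreover have "class_partition (tall_class k) G z P"
 proof (rule class_partition_intro[OF trG])
  fix q assume q: "q \<in> P" "2 \<le> card q"
  hence qz: "q \<noteq> {z}" by auto
  have "int (deg G1 q) \<ge> int (deg G q) - 1" using deg_del_arc[OF mG, of e a c q] unfolding G1_def by simp
  thus "restriction G q \<in> tall_class k"
   using restriction_in_class[OF part_sub[OF trG q(1) qz] q(2)] bspec[OF P(4), of q] q(1) qz deg_z dz by simp
 qed
 moreover have "one_alteration_at (contract G1 P) {z} pa pc"
  unfolding one_alteration_at_def using p ne zP by simp
 moreover have "canvas_iso (contract G P) {z} (add_edge (contract G1 P) pa pc) {z}"
 proof (rule add_edge_iso[of e])
  have E: "ends (contract G P) e = {pa, pc} \<and> (e \<in> edges (contract G P) \<longleftrightarrow> pa \<noteq> pc)"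
   by (rule ends_contract[OF mG PD(1) e(1) ac(1) p])
  thus "e \<in> edges (contract G P)" "ends (contract G P) e = {pa, pc}" using ne by auto
  show "verts (contract G1 P) = verts (contract G P)" by simp
  show "edges (contract G1 P) = edges (contract G P) - {e}" unfolding contract_def V1 by auto
  show "ends (contract G1 P) f = ends (contract G P) f" for f unfolding contract_def V1 by simp
  show "bdry (contract G P) q = bdry (contract G1 P) q + (if q = pa then 1 else 0) - (if q = pc then 1 else 0)"
   if "q \<in> verts (contract G P)" for q
   using bdry_del_arc[OF fin[OF PD(3)], of q G e a c] that ma mc unfolding G1_def by simp
  show "pa \<noteq> pc" by (rule ne)
 qed
 ultimately show ?thesis by (rule EXPB_intro)
qed

text \<open>At the tip the direction of \<open>e\<close> is known, so every non-trivial quotient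
  still admits an extension and no contraction is called for. The size stays the same; the order
  decreases because \<open>G1\<close> is not homogeneous or, if it is, because its tip degree is
  smaller.\<close>

lemma ADD_of_arc:
 assumes h: "homogeneous G z" and e: "e \<in> edges G" "ends G e = {a, c}" "a \<noteq> c"
  and Se: "e \<in> S \<longleftrightarrow> a = z" and zac: "a = z \<or> c = z"
  and ta: "a \<noteq> z ==> tm (int (deg G {a}) - 1) (lft (bdry G a) - 1)"
  and tc: "c \<noteq> z ==> tm (int (deg G {c}) - 1) (lft (bdry G c) + 1)"
 shows "ADD k G z"
proof -
 define G1 where "G1 = del_arc G e a c"
 note R = del_arc_reduction[OF e Se ta tc, folded G1_def]
 have acV: "a \<in> verts G" "c \<in> verts G" using multigraphD(3)[OF mG e(1)] e(2) by auto
 have V1: "verts G1 = verts G" "edges G1 = edges G - {e}" "ends G1 = ends G" by (simp_all add: G1_def)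
 have z1: "z \<in> verts G1" using z V1 by simp
 have ez: "e \<in> cut G {z}" using in_cut_tip[OF mG e(1)] e(2) zac by auto
 have dz: "int (deg G1 {z}) = int (deg G {z}) - 1" using deg_del_arc[OF mG, of e a c "{z}"] ez unfolding G1_def by simp
 have psi1: "psicrit G1 z (S - {e})"
  unfolding psicrit_def
 proof (intro conjI allI impI R(4,5))
  fix P assume P: "tip_respecting G1 z P \<and> nontrivial P"
  hence tr: "tip_respecting G z P" unfolding tip_respecting_def V1 by blast
  have "e \<in> S \<longleftrightarrow> a \<in> {z} \<and> c \<notin> {z}" using Se e(3) by auto
  note Sz = this
  have "nontrivial P" using P by simp
  from psi_ext[OF tr this] show "part_ext G1 P {z} (S - {e})" unfolding G1_def
   using part_ext_del_arc2[OF mG e tip_respectingD(3)[OF tr] Sz disjI1[OF ez]] by blast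
 qed
 have "is_canvas G1 z" unfolding is_canvas_def using bordered_total[OF R(1) z1 R(3)] R(2) z1 by blast
 moreover have "tame G1 z" unfolding tame_tms using R(3) by auto
 ultimately have "(G1, z) \<in> tall_class k" by (rule psicrit_tall_class[OF _ _ psi1]) (use dz deg_z in linarith)+
 moreover have "prec G1 z G z"
 proof -
  have "{e \<in> edges G1. z \<notin> ends G1 e} = {e \<in> edges G. z \<notin> ends G e}" unfolding V1 using e(2) zac by auto
  hence "canvas_size G1 z = canvas_size G z" unfolding canvas_size_def V1(1) by simp
  moreover have "deg G1 {z} < deg G {z}" using dz by linarith
  ultimately show ?thesis using h unfolding prec_def by blast
 qed
 moreover have "tip_alteration_at G1 z a c" unfolding tip_alteration_at_def V1(1) using acV e(3) zac by blast
 moreover have "canvas_iso G z (add_edge G1 a c) z"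
  by (rule add_edge_iso[OF e(1,2)]) (use e(3) in \<open>auto simp: G1_def del_arc_def\<close>)
 ultimately show ?thesis by (rule ADD_intro)
qed

end

section \<open>Doubling an edge at the tip\<close>

definition dbl :: "('v, 'e) bgraph => 'v => 'v => ('v, 'e option) bgraph" where
 "dbl G w z = \<lparr>verts = verts G, edges = insert None (Some ` edges G), ends = case_option {w, z} (ends G), bdry = bdry G\<rparr>"

lemma dbl_simps [simp]:
 "verts (dbl G w z) = verts G" "edges (dbl G w z) = insert None (Some ` edges G)"
 "ends (dbl G w z) (Some e) = ends G e" "ends (dbl G w z) None = {w, z}" "bdry (dbl G w z) = bdry G"
 by (simp_all add: dbl_def)

lemma multigraph_dbl: "multigraph G ==> w \<in> verts G ==> z \<in> verts G ==> w \<noteq> z ==> multigraph (dbl G w z)"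
 unfolding multigraph_def by auto

lemma cut_dbl:
 assumes "w \<noteq> z"
 shows "cut (dbl G w z) A = Some ` cut G A \<union> (if (w \<in> A) \<noteq> (z \<in> A) then {None} else {})"
 unfolding cut_def using card_pair_Int[OF assms, of A] by auto

lemma deg_dbl:
 assumes "multigraph G" "w \<noteq> z"
 shows "deg (dbl G w z) A = deg G A + (if (w \<in> A) \<noteq> (z \<in> A) then 1 else 0)"
 unfolding deg_def cut_dbl[OF assms(2)] using finite_cut[OF assms(1), of A] by (auto simp: card_image)

lemma net_dbl:
 assumes G: "multigraph G" and e: "e \<in> edges G" "ends G e = {p, q}" "p \<noteq> q" "{p, q} = {w, z}"
  and t: "t e = p" "t1 None = q" "t1 (Some e) = q" "\<And>f. f \<in> edges G - {e} ==> t1 (Some f) = t f"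
 shows "net (dbl G w z) t1 X = net G t X"
proof -
 define R where "R = (\<Sum>f\<in>edges G - {e}. cn (ends G f) (t f) X)"
 have fE: "finite (edges G)" using multigraphD(2)[OF G] .
 have "net G t X = cn (ends G e) (t e) X + R"
  unfolding net_def R_def by (rule sum.remove[OF fE e(1)])
 hence "net G t X = cn {p, q} p X + R" unfolding e(2) t(1) .
 moreover have "net (dbl G w z) t1 X = cn {w, z} q X + (\<Sum>f\<in>edges G. cn (ends G f) (t1 (Some f)) X)"
  unfolding net_def using fE t(2) by (simp add: sum.reindex)
 moreover have "(\<Sum>f\<in>edges G. cn (ends G f) (t1 (Some f)) X) = cn {p, q} q X + R"
 proof -
  have "(\<Sum>f\<in>edges G. cn (ends G f) (t1 (Some f)) X) = cn (ends G e) (t1 (Some e)) X + (\<Sum>f\<in>edges G - {e}. cn (ends G f) (t1 (Some f)) X)"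
   by (rule sum.remove[OF fE e(1)])
  also have "(\<Sum>f\<in>edges G - {e}. cn (ends G f) (t1 (Some f)) X) = R" unfolding R_def by (rule sum.cong) (use t(4) in auto)
  finally show ?thesis using e(2) t(3) by simp
 qed
 moreover have "cn {p, q} q X + cn {p, q} q X = cn {p, q} p X"
  unfolding three_double cn_pair[OF e(3)] cn_pair'[OF e(3)[symmetric]] by simp
 ultimately show ?thesis unfolding e(4)[symmetric] by (simp add: add.assoc[symmetric])
qed

text \<open>Both copies of \<open>e\<close> run against the direction that \<open>S\<close> gives to
  \<open>e\<close>.\<close>

definition dblS :: "'e => 'e set => 'e option set" where
 "dblS e S = (if e \<in> S then Some ` (S - {e}) else insert None (Some ` insert e S))"

lemma part_ext_dbl:
 assumes G: "multigraph G" and wz: "w \<in> verts G" "z \<in> verts G" "w \<noteq> z" and e: "e \<in> edges G" "ends G e = {w, z}" and S: "S \<subseteq> cut G {z}"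
 shows "part_ext (dbl G w z) P {z} (dblS e S) \<longleftrightarrow> part_ext G P {z} S"
proof -
 define p q where "p = (if e \<in> S then z else w)" and "q = (if e \<in> S then w else z)"
 have pq: "ends G e = {p, q}" "p \<noteq> q" "{p, q} = {w, z}" using e(2) wz(3) unfolding p_def q_def by auto
 have ez: "e \<in> cut G {z}" using in_cut_tip[OF G e(1)] e(2) by simp
 have cz: "cut (dbl G w z) {z} = insert None (Some ` cut G {z})" using cut_dbl[OF wz(3), of G "{z}"] wz(3) by auto
 show ?thesis
 proof
  assume "part_ext (dbl G w z) P {z} (dblS e S)"
  then obtain t1 where t1: "orientation (dbl G w z) t1" "\<forall>p\<in>P. net (dbl G w z) t1 p = bd G p"
   "outset (dbl G w z) t1 {z} = dblS e S" unfolding part_ext_def by auto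
  have out: "t1 f = z \<longleftrightarrow> f \<in> dblS e S" if "f \<in> cut (dbl G w z) {z}" for f
   using t1(3) that unfolding outset_singleton by blast
  have "t1 None \<in> {w, z}" "t1 (Some e) \<in> {w, z}" using t1(1) e unfolding orientation_def by auto
  moreover have "t1 None = z \<longleftrightarrow> e \<notin> S" "t1 (Some e) = z \<longleftrightarrow> e \<notin> S"
   using out[of None] out[of "Some e"] ez cz unfolding dblS_def by auto
  ultimately have q: "t1 None = q" "t1 (Some e) = q" unfolding q_def by auto
  define t where "t f = (if f = e then p else t1 (Some f))" for f
  have "orientation G t" using t1(1) pq(1) unfolding orientation_def t_def by auto
  moreover have "net G t r = net (dbl G w z) t1 r" for r
   by (rule net_dbl[OF G e(1) pq, symmetric]) (use q in \<open>auto simp: t_def\<close>)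
  moreover have "outset G t {z} = S"
  proof -
   have "t f = z \<longleftrightarrow> f \<in> S" if f: "f \<in> cut G {z}" for f
   proof (cases "f = e")
    case True
    thus ?thesis unfolding t_def p_def using wz(3) by simp
   next
    case False
    thus ?thesis unfolding t_def using out[of "Some f"] f cz unfolding dblS_def by auto
   qed
   thus ?thesis unfolding outset_singleton using S by blast
  qed
  ultimately show "part_ext G P {z} S" unfolding part_ext_def using t1(2) by auto
 next
  assume "part_ext G P {z} S"
  then obtain t where t: "orientation G t" "\<forall>p\<in>P. net G t p = bd G p" "outset G t {z} = S" unfolding part_ext_def by blast
  have out: "t f = z \<longleftrightarrow> f \<in> S" if "f \<in> cut G {z}" for f using t(3) that unfolding outset_singleton by blast
  have te: "t e = p" using out[OF ez] orientationD[OF t(1) e(1)] e(2) unfolding p_def by auto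
  define t1 where "t1 = case_option q (\<lambda>f. if f = e then q else t f)"
  have "orientation (dbl G w z) t1" using t(1) pq unfolding orientation_def t1_def by auto
  moreover have "net (dbl G w z) t1 r = net G t r" for r
   by (rule net_dbl[OF G e(1) pq]) (use te in \<open>auto simp: t1_def\<close>)
  moreover have "outset (dbl G w z) t1 {z} = dblS e S"
  proof -
   have "t1 f = z \<longleftrightarrow> f \<in> dblS e S" if f: "f \<in> cut (dbl G w z) {z}" for f
   proof (cases f)
    case None
    thus ?thesis unfolding t1_def q_def dblS_def using wz(3) by auto
   next
    case (Some g)
    thus ?thesis using out[of g] f cz wz(3) unfolding t1_def q_def dblS_def by auto
   qed
   moreover have "dblS e S \<subseteq> cut (dbl G w z) {z}" unfolding cz dblS_def using S ez by auto
   ultimately show ?thesis unfolding outset_singleton by blast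
  qed
  ultimately show "part_ext (dbl G w z) P {z} (dblS e S)" unfolding part_ext_def using t(2) by auto
 qed
qed

context large_tall
begin

lemma off_tip_neighbour:
 assumes "w \<in> verts G" "w \<noteq> z"
 obtains f x where "f \<in> edges G" "ends G f = {w, x}" "x \<noteq> z" "x \<noteq> w" "x \<in> verts G"
proof -
 have "2 \<le> card (verts G - {z})" using verts_ge_3 z multigraphD(1)[OF mG] by (simp add: card_Diff_singleton)
 hence "\<not> verts G - {z} \<subseteq> {w}" using card_mono[of "{w}" "verts G - {z}"] by fastforce
 then obtain y where y: "y \<in> verts G" "y \<noteq> z" "y \<noteq> w" by blast
 obtain f where f: "f \<in> cut G {w}" "z \<notin> ends G f" using other_neighbour[OF assms y] by blast
 have fE: "f \<in> edges G" by (rule cut_edge[OF f(1)])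
 have wf: "w \<in> ends G f" using in_cut_tip[OF mG fE] f(1) by simp
 obtain x where x: "ends G f = {w, x}" "w \<noteq> x" "x \<in> verts G" using edge_obtain_tail[OF mG fE wf] .
 have "x \<noteq> z" using x(1) f(2) by blast
 thus ?thesis using that[OF fE x(1) _ x(2)[symmetric] x(3)] by blast
qed

text \<open>Uniform preflows are excluded at tip degree \<open>k + 1\<close>, so one more edge at
  the tip is permitted. Doubling makes the preflow nonuniform, as at least five other edges keep
  their direction. It also changes the parity of \<open>w\<close> and thereby its friendly
  direction, so an edge at \<open>w\<close> becomes mixed and the larger canvas comes earlier in the
  order.\<close>

lemma REM_of_uniform:
 assumes h: "homogeneous G z" and five: "\<And>v. v \<in> verts G ==> v \<noteq> z ==> 5 \<le> deg G {v}"
  and u: "S = {} \<or> S = cut G {z}"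
  and k: "(\<forall>v\<in>verts G - {z}. \<not> out_friendly G v) \<or> (\<forall>v\<in>verts G - {z}. \<not> in_friendly G v)"
 shows "REM k G z"
proof -
 have "deg G {z} \<noteq> k + 1" using nonuniform u by blast
 hence dk: "deg G {z} \<le> k" using deg_z by linarith
 have "cut G {z} \<noteq> {}" using deg_z_ge_6 unfolding deg_def by auto
 then obtain e where e: "e \<in> cut G {z}" by blast
 have eE: "e \<in> edges G" by (rule cut_edge[OF e])
 obtain w where w: "ends G e = {w, z}" "w \<noteq> z" "w \<in> verts G"
  using edge_obtain_tail[OF mG eE] in_cut_tip[OF mG eE] e by (metis insert_commute)
 define G1 where "G1 = dbl G w z"
 have m1: "multigraph G1" unfolding G1_def by (rule multigraph_dbl[OF mG w(3) z w(2)])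
 have V1: "verts G1 = verts G" "bdry G1 = bdry G" by (simp_all add: G1_def)
 have z1: "z \<in> verts G1" using z V1 by simp
 note pe = part_ext_dbl[OF mG w(3) z w(2) eE w(1) S_sub, folded G1_def]
 have d1: "deg G1 A = deg G A + (if (w \<in> A) \<noteq> (z \<in> A) then 1 else 0)" for A
  unfolding G1_def by (rule deg_dbl[OF mG w(2)])
 have tms1: "tms G1 A" if A: "A \<noteq> {}" "A \<subseteq> verts G1 - {z}" for A
 proof -
  have A': "A \<subseteq> verts G - {z}" using A(2) V1 by simp
  have t: "tms G A" by (rule tms[OF A(1) A'])
  have "5 \<le> deg G A"
  proof (cases "2 \<le> card A")
   case True
   thus ?thesis using sts_deg[OF sts[OF A']] by linarith
  next
   case False
   have "0 < card A" using A fin[of A] V1 by (simp add: card_gt_0_iff subset_Diff_insert)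
   hence "card A = 1" using False by linarith
   then obtain v where "A = {v}" by (meson card_1_singletonE)
   thus ?thesis using five A' by auto
  qed
  hence "tm (int (deg G A) + 1) (lft (bd G A))" unfolding tm_def by linarith
  thus ?thesis using t unfolding tms_def d1 V1(2) by simp
 qed
 have canvas1: "is_canvas G1 z" unfolding is_canvas_def using bordered_total[OF m1 z1 tms1] total z1 V1 by simp
 have tame1: "tame G1 z" unfolding tame_tms using tms1 by auto
 have psi1: "psicrit G1 z (dblS e S)"
  unfolding psicrit_def
 proof (intro conjI allI impI)
  \<comment> \<open>The new orientation is a preflow because it extends to the quotient that merges
    all vertices off the tip.\<close>
  have "2 \<le> card (verts G - {z})" using verts_ge_3 z multigraphD(1)[OF mG] by (simp add: card_Diff_singleton)
  note tr = collapse_tip_respecting[OF order.refl this]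
  from part_ext_preflow[OF m1 _ tip_respectingD(2)[OF tr(1)]] psi_ext[OF tr] pe
  show "tip_preflow G1 z (dblS e S)" unfolding tip_preflow_balance by simp
  show "\<not> extends G1 z (dblS e S)" using nex pe unfolding extends_part_ext[OF m1] extends_part_ext[OF mG] V1(1) by blast
  show "part_ext G1 P {z} (dblS e S)" if "tip_respecting G1 z P \<and> nontrivial P" for P
   using psi_ext[of P] that pe unfolding tip_respecting_def V1 by blast
 qed
 have c1: "cut G1 {z} = insert None (Some ` cut G {z})" unfolding G1_def using cut_dbl[OF w(2), of G "{z}"] w(2) by auto
 have nu1: "dblS e S \<noteq> {} \<and> dblS e S \<noteq> cut G1 {z}"
 proof (cases "e \<in> S")
  case True
  hence Sc: "S = cut G {z}" using u by blast
  have "S - {e} \<noteq> {}"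
  proof
   assume "S - {e} = {}"
   hence "card (cut G {z}) \<le> card {e}" using Sc by (intro card_mono) auto
   thus False using deg_z_ge_6 unfolding deg_def by simp
  qed
  moreover have "None \<notin> dblS e S" unfolding dblS_def using True by auto
  ultimately show ?thesis using True c1 unfolding dblS_def by auto
 next
  case False
  hence "S = {}" using u e by blast
  hence "dblS e S = {None, Some e}" unfolding dblS_def by simp
  moreover have "cut G1 {z} \<noteq> {None, Some e}"
  proof
   assume "cut G1 {z} = {None, Some e}"
   hence "deg G1 {z} = 2" unfolding deg_def by simp
   thus False using d1[of "{z}"] deg_z_ge_6 by simp
  qed
  ultimately show ?thesis by auto
 qed
 have "(G1, z) \<in> tall_class k"
  by (rule psicrit_tall_class[OF canvas1 tame1 psi1]) (use d1[of "{z}"] dk w(2) nu1 in auto)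
 moreover have "prec G1 z G z"
 proof -
  have "{f \<in> edges G1. z \<notin> ends G1 f} = Some ` {f \<in> edges G. z \<notin> ends G f}" unfolding G1_def by auto
  hence "canvas_size G1 z = canvas_size G z" unfolding canvas_size_def V1(1) by (simp add: card_image)
  moreover have "\<not> homogeneous G1 z"
  proof -
   obtain f x where f: "f \<in> edges G" "ends G f = {w, x}" "x \<noteq> z" "x \<noteq> w" "x \<in> verts G" using off_tip_neighbour[OF w(3,2)] .
   have dw: "even (deg G1 {w}) \<longleftrightarrow> odd (deg G {w})" using d1[of "{w}"] w(2) by simp
   have dx: "deg G1 {x} = deg G {x}" using d1[of "{x}"] f(3,4) by auto
   have fl: "\<not> out_friendly G w ==> out_friendly G1 w" "\<not> in_friendly G w ==> in_friendly G1 w"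
    unfolding out_friendly_iff in_friendly_iff dw V1(2) using one_neq_3 by auto
   have fx: "in_friendly G1 x \<longleftrightarrow> in_friendly G x" "out_friendly G1 x \<longleftrightarrow> out_friendly G x"
    unfolding out_friendly_iff in_friendly_iff dx V1(2) by auto
   have "mixed G1 z (Some f)"
   proof (cases "\<forall>v\<in>verts G - {z}. \<not> out_friendly G v")
    case True
    hence "in_friendly G1 x" "out_friendly G1 w" using fl fx in_or_out_friendly[of G x] w f by auto
    moreover have "ends G1 (Some f) = {x, w}" using f(2) unfolding G1_def by auto
    ultimately show ?thesis unfolding mixed_def using f(3,4) w(2) by blast
   next
    case False
    hence "out_friendly G1 x" "in_friendly G1 w" using k fl fx in_or_out_friendly[of G x] w f by auto
    moreover have "ends G1 (Some f) = {w, x}" using f(2) unfolding G1_def by auto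
    ultimately show ?thesis unfolding mixed_def using f(3,4) w(2) by blast
   qed
   thus ?thesis unfolding homogeneous_def G1_def using f(1) by auto
  qed
  ultimately show ?thesis using h unfolding prec_def by blast
 qed
 moreover have "tip_reduction_at G1 z w None"
 proof -
  have "{None, Some e} \<subseteq> {f \<in> edges G1. ends G1 f = {w, z}}" unfolding G1_def using eE w(1) by auto
  hence "card {None, Some e} \<le> card {f \<in> edges G1. ends G1 f = {w, z}}"
   using multigraphD(2)[OF m1] by (intro card_mono) auto
  thus ?thesis unfolding tip_reduction_at_def using w(2,3) by (simp add: G1_def)
 qed
 moreover have "canvas_iso G z (delete_edge G1 None) z"
 proof -
  have "giso id Some G (delete_edge G1 None)"
   unfolding giso_def G1_def delete_edge_def by (auto simp: bij_betw_def dbl_def)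
  thus ?thesis unfolding canvas_iso_giso by (intro exI[of _ id] exI[of _ Some]) simp
 qed
 ultimately show ?thesis by (rule REM_intro)
qed

text \<open>Every vertex off the tip is friendly in one direction only, and by
  \<open>connected\<close> it is the same direction for all. An edge at the tip that runs in this
  direction can be deleted; if there is none, the preflow is uniform.\<close>

lemma homogeneous_outcome:
 assumes h: "homogeneous G z" and five: "\<And>v. v \<in> verts G ==> v \<noteq> z ==> 5 \<le> deg G {v}"
 shows "ADD k G z \<or> REM k G z"
proof -
 define U where "U = {v \<in> verts G - {z}. \<not> out_friendly G v}"
 have nomix: "\<not> (in_friendly G u \<and> out_friendly G v)" if "f \<in> edges G" "ends G f = {u, v}" "u \<noteq> z" "v \<noteq> z" "u \<noteq> v" for f u v
  using h that unfolding homogeneous_def mixed_def by blast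
 have notboth: "\<not> (in_friendly G v \<and> out_friendly G v)" if v: "v \<in> verts G" "v \<noteq> z" for v
 proof
  assume b: "in_friendly G v \<and> out_friendly G v"
  obtain f x where f: "f \<in> edges G" "ends G f = {v, x}" "x \<noteq> z" "x \<noteq> v" "x \<in> verts G" using off_tip_neighbour[OF v] .
  have f': "ends G f = {x, v}" using f(2) by auto
  show False using nomix[OF f(1,2) v(2) f(3)] nomix[OF f(1) f' f(3) v(2)] f(4) b in_or_out_friendly[of G x] by auto
 qed
 have "U = {} \<or> U = verts G - {z}"
 proof (rule ccontr)
  assume "\<not> (U = {} \<or> U = verts G - {z})"
  hence "U \<noteq> {}" "U \<subset> verts G - {z}" unfolding U_def by auto
  then obtain f where f: "f \<in> cut G U" "z \<notin> ends G f" using connected by blast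
  obtain u v where uv: "ends G f = {u, v}" "u \<noteq> v" "u \<in> U" "v \<notin> U" "u \<in> verts G" "v \<in> verts G" using cut_obtain[OF mG f(1)] .
  have "in_friendly G u" "out_friendly G v" using uv f(2) in_or_out_friendly[of G u] unfolding U_def by auto
  moreover have "f \<in> edges G" by (rule cut_edge[OF f(1)])
  ultimately show False using nomix[of f u v] uv(1,2) f(2) by auto
 qed
 have T: "tms G {v}" if "v \<in> verts G" "v \<noteq> z" for v using tms[of "{v}"] that by simp
 have ends: "\<exists>v. ends G e = {z, v} \<and> z \<noteq> v \<and> v \<in> verts G \<and> e \<in> edges G" if "e \<in> cut G {z}" for e
 proof -
  have "e \<in> edges G" by (rule cut_edge[OF that])
  thus ?thesis using edge_obtain_tail[OF mG \<open>e \<in> edges G\<close>] in_cut_tip[OF mG \<open>e \<in> edges G\<close>] that by metis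
 qed
 from \<open>U = {} \<or> U = verts G - {z}\<close> show ?thesis
 proof
  assume U: "U = verts G - {z}"
  show ?thesis
  proof (cases "S = {}")
   case False
   then obtain e where e: "e \<in> S" by blast
   obtain c where c: "ends G e = {z, c}" "z \<noteq> c" "c \<in> verts G" "e \<in> edges G" using ends[of e] e S_sub by blast
   have "in_friendly G c" using U c(2,3) in_or_out_friendly[of G c] unfolding U_def by auto
   hence "tm (int (deg G {c}) - 1) (lft (bdry G c) + 1)"
    using friendly_tm(1)[OF T five] c(2,3) by metis
   hence "ADD k G z" by (intro ADD_of_arc[OF h c(4,1,2)]) (use e in auto)
   thus ?thesis ..
  next
   case True
   have "\<forall>v\<in>verts G - {z}. \<not> out_friendly G v" using U unfolding U_def by blast
   thus ?thesis using REM_of_uniform[OF h five] True by blast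
  qed
 next
  assume U: "U = {}"
  hence nin: "\<forall>v\<in>verts G - {z}. \<not> in_friendly G v" using notboth unfolding U_def by blast
  show ?thesis
  proof (cases "S = cut G {z}")
   case False
   then obtain e where e: "e \<in> cut G {z}" "e \<notin> S" using S_sub by blast
   obtain c where c: "ends G e = {z, c}" "z \<noteq> c" "c \<in> verts G" "e \<in> edges G" using ends[OF e(1)] by blast
   have "out_friendly G c" using nin c(2,3) in_or_out_friendly[of G c] by auto
   hence t: "tm (int (deg G {c}) - 1) (lft (bdry G c) - 1)"
    using friendly_tm(2)[OF T five] c(2,3) by metis
   have c': "ends G e = {c, z}" "c \<noteq> z" using c(1,2) by auto
   have "ADD k G z" by (rule ADD_of_arc[OF h c(4) c']) (use e(2) c'(2) t in auto)
   thus ?thesis ..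
  next
   case True
   thus ?thesis using REM_of_uniform[OF h five] nin by blast
  qed
 qed
qed

end

section \<open>Restrictions of the largest permitted degree\<close>

context critical_tall
begin

text \<open>The task is a flow of the contraction \<open>H\<close> that is not uniform around
  \<open>p\<close>. Let \<open>\<A>\<close> be a set around \<open>p\<close> of least degree and,
  among these, of least size. If its degree is at least \<open>k + 1\<close>, nonuniform extension
  applies to all of \<open>W\<close>. Otherwise \<open>\<A>\<close> is collapsed and then filled in:
  by minimality its proper subsets around \<open>p\<close> exceed its degree, which is the slack
  needed by \<open>local_nonuniform_small\<close>.\<close>

lemma restriction_in_class_top:
 assumes p: "p \<subseteq> verts G - {z}" "2 \<le> card p" and d: "deg G p = k + 1" "deg G {z} = k + 1"
 shows "restriction G p \<in> tall_class k"
proof (rule restriction_tall_class[OF canvas crit tame p])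
 show "deg G p \<le> k + 1" using d by simp
 define Q where "Q = collapse (verts G) p"
 define H where "H = contract G Q"
 define W where "W = Q - {{z}}"
 note Qtr = collapse_tip_respecting[OF p, folded Q_def]
 note QD = tip_respectingD[OF Qtr(1)]
 note C = contract_canvas[OF mG QD(1,2) tms total]
 have mH: "multigraph H" and cz: "cut H {{z}} = cut G {z}" and totH: "bd H (verts H) = 0"
  unfolding H_def using C(1,2,4) by simp_all
 have VH: "verts H = Q" by (simp add: H_def)
 have fQ: "finite Q" using multigraphD(1)[OF mH] VH by simp
 have pQ: "p \<in> Q" unfolding Q_def collapse_def by simp
 have zp: "z \<notin> p" using p(1) by blast
 hence pz: "p \<noteq> {z}" by blast
 have pW: "p \<in> W" using pQ pz W_def by blast
 have WQ: "W \<subseteq> Q" "W \<subseteq> verts H" unfolding W_def VH by auto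
 have degH: "deg H \<A> = deg G (\<Union>\<A>)" if "\<A> \<subseteq> Q" for \<A> unfolding H_def by (rule deg_contract[OF mG QD(1) that])
 have Weq: "W = verts H - {{z}}" by (simp add: W_def VH)
 have tmsH: "tms H \<A>" if "\<A> \<noteq> {}" "\<A> \<subseteq> W" for \<A>
  unfolding H_def by (rule C(5)) (use that W_def in auto)
 have dz: "deg H {{z}} = k + 1" using cz d(2) by (simp add: deg_def)
 have dp: "deg H {p} = k + 1" using degH[of "{p}"] pQ d(1) by simp
 have preH: "tip_preflow H {z} S" using pre cz unfolding tip_preflow_balance balance_def by (simp add: H_def)
 have zH: "{z} \<in> verts H" using QD(2) VH by simp
 have nuS: "S \<noteq> {}" "S \<noteq> cut G {z}" using nonuniform d(2) by auto
 obtain \<A> where A: "\<A> \<subseteq> W" "p \<in> \<A>" "\<And>\<B>. \<B> \<subseteq> W ==> p \<in> \<B> ==> deg H \<A> \<le> deg H \<B>"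
  "\<And>\<B>. \<B> \<subseteq> W ==> p \<in> \<B> ==> deg H \<B> = deg H \<A> ==> card \<A> \<le> card \<B>"
 proof -
  have "W \<subseteq> W \<and> p \<in> W" using pW by simp
  from ex_has_least_nat[of "\<lambda>\<B>. \<B> \<subseteq> W \<and> p \<in> \<B>", OF this, of "deg H"]
  obtain \<C> where C: "\<C> \<subseteq> W \<and> p \<in> \<C>" "\<And>\<B>. \<B> \<subseteq> W \<and> p \<in> \<B> ==> deg H \<C> \<le> deg H \<B>" by blast
  have "\<C> \<subseteq> W \<and> p \<in> \<C> \<and> deg H \<C> = deg H \<C>" using C(1) by simp
  from ex_has_least_nat[of "\<lambda>\<B>. \<B> \<subseteq> W \<and> p \<in> \<B> \<and> deg H \<B> = deg H \<C>", OF this, of card]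
  obtain \<D> where D: "\<D> \<subseteq> W \<and> p \<in> \<D> \<and> deg H \<D> = deg H \<C>"
   "\<And>\<B>. \<B> \<subseteq> W \<and> p \<in> \<B> \<and> deg H \<B> = deg H \<C> ==> card \<D> \<le> card \<B>" by blast
  show ?thesis by (rule that[of \<D>]) (use C D in auto)
 qed
 have AQ: "\<A> \<subseteq> Q" using A(1) WQ(1) by blast
 have "\<exists>t. loc H W t \<and> outset H t {{z}} = S \<and> outset H t {p} \<noteq> {} \<and> outset H t {p} \<noteq> cut H {p}"
 proof (cases "k + 1 \<le> deg H \<A>")
  case True
  note T = tip_local[OF mH zH totH preH, folded Weq]
  have dW: "deg H W = k + 1" unfolding Weq deg_compl[OF mH] by (rule dz)
  have cW: "cut H W = cut H {{z}}" unfolding Weq by (rule cut_compl[OF mH])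
  have "\<exists>t. loc H W t \<and> outset H t W = cut H {{z}} - S \<and> outset H t {p} \<noteq> {} \<and> outset H t {p} \<noteq> cut H {p}"
  proof (rule local_nonuniform[OF mH WQ(2) T(1,2) pW])
   show "tms H \<B>" if "\<B> \<noteq> {}" "\<B> \<subset> W" for \<B> using tmsH that by blast
   show "deg H W \<le> deg H \<B>" if "\<B> \<subset> W" "p \<in> \<B>" for \<B> using A(3)[of \<B>] that True dW by fastforce
   show "6 \<le> deg H W" using deg_z_ge_6 d(2) dW by simp
   show "deg H W \<le> deg H {p}" using dW dp by simp
   show "cut H {{z}} - S \<noteq> {}" using nuS(2) S_sub cz by blast
   show "cut H {{z}} - S \<noteq> cut H W" unfolding cW using nuS(1) S_sub cz by blast
  qed
  then obtain t where t: "loc H W t" "outset H t W = cut H {{z}} - S" "outset H t {p} \<noteq> {}" "outset H t {p} \<noteq> cut H {p}" by blast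
  have o: "orientation H t" using t(1) by (simp add: loc_def)
  have "outset H t {{z}} = S"
   using outset_compl[OF mH o, of "{{z}}"] outset_subset[of H t "{{z}}"] t(2) S_sub cz Weq by blast
  thus ?thesis using t by blast
 next
  case False
  define A' where "A' = \<Union>\<A>"
  have A': "A' \<subseteq> verts G - {z}" unfolding A'_def using part_sub[OF Qtr(1)] A(1) W_def by blast
  have pA: "p \<subseteq> A'" using A(2) unfolding A'_def by blast
  have c2: "2 \<le> card A'" using card_mono[OF fin[of A'] pA] A' p(2) by fastforce
  have dA: "deg H \<A> = deg G A'" unfolding A'_def by (rule degH[OF AQ])
  have d6: "6 \<le> deg H \<A>" using sts_deg[OF sts[OF A' c2]] dA by simp
  obtain t0 where t0: "orientation G t0" "loc G (verts G - A') t0" "net G t0 A' = bd G A'" "outset G t0 {z} = S"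
   using collapse_ext[OF A' c2] by metis
  obtain t1 where t1: "orientation H t1" "\<And>\<B>. \<B> \<subseteq> Q ==> outset H t1 \<B> = outset G t0 (\<Union>\<B>)"
   using contract_lift[OF mG QD(1) t0(1)] unfolding H_def by blast
  have net1: "net H t1 \<B> = net G t0 (\<Union>\<B>)" if "\<B> \<subseteq> Q" for \<B>
   unfolding net_balance[OF mH t1(1)] net_balance[OF mG t0(1)] t1(2)[OF that]
   unfolding H_def by (rule balance_contract[OF mG QD(1) that])
  have b1: "bd H \<B> = bd G (\<Union>\<B>)" if "\<B> \<subseteq> Q" for \<B>
   unfolding H_def by (rule bdry_contract_Union[OF mG QD(1) that])
  have l1: "loc H (verts H - \<A>) t1"
   unfolding loc_def
  proof (intro conjI t1(1) ballI)
   fix q assume q: "q \<in> verts H - \<A>"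
   hence "q \<in> Q" "q \<notin> \<A>" using VH by auto
   then obtain v where v: "q = {v}" "v \<in> verts G" using A(2) unfolding Q_def collapse_def by blast
   have "v \<notin> A'" unfolding A'_def using part_mem_Union[OF QD(1) \<open>q \<in> Q\<close> _ AQ, of v] v(1) \<open>q \<notin> \<A>\<close> by simp
   hence "net G t0 {v} = bdry G v" using t0(2) v(2) unfolding loc_def by blast
   thus "net H t1 {q} = bdry H q" using net1[of "{q}"] b1[of "{q}"] \<open>q \<in> Q\<close> v(1) by simp
  qed
  have AV: "\<A> \<subseteq> verts H" using AQ VH by simp
  have bal: "balance H (outset H t1 \<A>) \<A> = bd H \<A>"
   using net_balance[OF mH t1(1), of \<A>] net1[OF AQ] b1[OF AQ] t0(3) unfolding A'_def by simp
  have "\<exists>t2. loc H \<A> t2 \<and> outset H t2 \<A> = outset H t1 \<A> \<and> outset H t2 {p} \<noteq> {} \<and> outset H t2 {p} \<noteq> cut H {p}"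
  proof (rule local_nonuniform_small[OF mH AV outset_subset bal A(2), of "deg H \<A> + 1"])
   show "tms H \<B>" if "\<B> \<noteq> {}" "\<B> \<subset> \<A>" for \<B> using tmsH[OF that(1)] that(2) A(1) by blast
   show "deg H \<A> + 1 \<le> deg H \<B>" if B: "\<B> \<subset> \<A>" "p \<in> \<B>" for \<B>
   proof -
    have BW: "\<B> \<subseteq> W" using B(1) A(1) by blast
    have "card \<B> < card \<A>" using psubset_card_mono[OF finite_subset[OF AQ fQ] B(1)] .
    hence "deg H \<B> \<noteq> deg H \<A>" using A(4)[OF BW B(2)] by linarith
    thus ?thesis using A(3)[OF BW B(2)] by linarith
   qed
   show "deg H \<A> + 1 \<le> deg H {p}" using False dp by simp
  qed (use d6 in auto)
  then obtain t2 where t2: "loc H \<A> t2" "outset H t2 \<A> = outset H t1 \<A>" "outset H t2 {p} \<noteq> {}" "outset H t2 {p} \<noteq> cut H {p}" by blast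
  have "{{z}} \<inter> \<A> = {}" using A(1) W_def by blast
  from expand[OF mH AV this l1 t2(1,2)] obtain t3 where t3: "loc H (verts H) t3" "outset H t3 {{z}} = outset H t1 {{z}}"
   "\<forall>v\<in>\<A>. outset H t3 {v} = outset H t2 {v}" by blast
  have "outset H t1 {{z}} = S" using t1(2)[of "{{z}}"] QD(2) t0(4) by simp
  moreover have "loc H W t3" using t3(1) WQ(2) unfolding loc_def by blast
  ultimately show ?thesis using t3(2,3) A(2) t2(3,4) by (intro exI[of _ t3]) simp
 qed
 then obtain t where t: "loc H W t" "outset H t {{z}} = S" "outset H t {p} \<noteq> {}" "outset H t {p} \<noteq> cut H {p}" by blast
 have o: "orientation H t" using t(1) by (simp add: loc_def)
 obtain t' where t': "orientation G t'" "\<And>\<B>. \<B> \<subseteq> Q ==> outset H t \<B> = outset G t' (\<Union>\<B>)"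
  using contract_unlift[OF mG QD(1) o[unfolded H_def]] unfolding H_def by blast
 have net': "net G t' q = bd G q" if q: "q \<in> Q" for q
 proof (cases "q = {z}")
  case True
  have "outset G t' {z} = S" using t'(2)[of "{{z}}"] t(2) QD(2) by simp
  thus ?thesis unfolding True net_balance[OF mG t'(1)] using pre unfolding tip_preflow_balance by simp
 next
  case False
  hence "q \<in> W" using q W_def by blast
  hence "net H t {q} = bdry H q" using t(1) unfolding loc_def by blast
  moreover have "net H t {q} = net G t' q"
   using net_balance[OF mH o, of "{q}"] net_balance[OF mG t'(1), of q] t'(2)[of "{q}"] q
    balance_contract[OF mG QD(1), of "{q}"] unfolding H_def by simp
  ultimately show ?thesis by (simp add: H_def)
 qed
 have l': "loc G (verts G - p) t'"
  unfolding loc_def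
 proof (intro conjI t'(1) ballI)
  fix v assume "v \<in> verts G - p"
  hence "{v} \<in> Q" unfolding Q_def collapse_def by blast
  thus "net G t' {v} = bdry G v" using net' by fastforce
 qed
 have z': "outset G t' {z} = S" using t'(2)[of "{{z}}"] t(2) QD(2) by simp
 have op: "outset G t' p = outset H t {p}" using t'(2)[of "{p}"] pQ by simp
 have cp: "cut H {p} = cut G p" unfolding H_def using cut_contract[OF mG QD(1), of "{p}"] pQ by simp
 have pV: "p \<subseteq> verts G" using p(1) by blast
 show "\<exists>t. loc G (verts G - p) t \<and> net G t p = bd G p \<and> outset G t p \<noteq> {} \<and>
   outset G t p \<noteq> cut G p \<and> \<not> (\<exists>t2. loc G p t2 \<and> outset G t2 p = outset G t p)"
  using l' net'[OF pQ] t(3,4) op cp no_local[OF pV zp l' z'] by (intro exI[of _ t']) auto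
qed

end

section \<open>Splitting off a vertex of degree four\<close>

text \<open>\<open>a2\<close> and \<open>a4\<close> avoid the tip, so a lifted edge at the tip
  inherits the name of the original one and \<open>S\<close> remains the same set. Distinct ends in
  each pair keep the lifted edges from being loops.\<close>

locale split_tall = large_tall +
 fixes w :: 'v and e1 e2 e3 e4 :: 'e and a1 a2 a3 a4 :: 'v
 assumes w: "w \<in> verts G" "w \<noteq> z" "bdry G w = 0" and cut_w: "cut G {w} = {e1, e2, e3, e4}" and dist: "distinct [e1, e2, e3, e4]"
  and ends_e: "ends G e1 = {w, a1}" "ends G e2 = {w, a2}" "ends G e3 = {w, a3}" "ends G e4 = {w, a4}"
  and av: "a1 \<noteq> w" "a2 \<noteq> w" "a3 \<noteq> w" "a4 \<noteq> w" "a1 \<in> verts G" "a2 \<in> verts G" "a3 \<in> verts G" "a4 \<in> verts G"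
  and aa: "a1 \<noteq> a2" "a3 \<noteq> a4" "a2 \<noteq> z" "a4 \<noteq> z"
begin

definition G1 :: "('v, 'e) bgraph" where
 "G1 = \<lparr>verts = verts G - {w}, edges = edges G - {e2, e4}, ends = (ends G)(e1 := {a1, a2}, e3 := {a3, a4}), bdry = bdry G\<rparr>"

definition R where "R = edges G - {e1, e2, e3, e4}"

lemma eE: "e1 \<in> edges G" "e2 \<in> edges G" "e3 \<in> edges G" "e4 \<in> edges G"
 using cut_subset[of G "{w}"] unfolding cut_w by auto

lemma G1_simps [simp]: "verts G1 = verts G - {w}" "bdry G1 = bdry G" "ends G1 e1 = {a1, a2}" "ends G1 e3 = {a3, a4}"
 "edges G1 = edges G - {e2, e4}"
 using dist by (simp_all add: G1_def)

lemma ends_R: "e \<in> R ==> ends G1 e = ends G e" "e \<in> R ==> w \<notin> ends G e" "e \<in> R ==> e \<in> edges G" "finite R"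
 using in_cut_tip[OF mG, of e w] multigraphD(2)[OF mG] unfolding cut_w R_def G1_def by auto

lemma edges_G: "edges G = insert e1 (insert e2 (insert e3 (insert e4 R)))" "edges G1 = insert e1 (insert e3 R)"
 using eE dist unfolding R_def by auto

lemma not_R: "e1 \<notin> R" "e2 \<notin> R" "e3 \<notin> R" "e4 \<notin> R" by (simp_all add: R_def)

lemma sum_G: "sum f (edges G) = f e1 + (f e2 + (f e3 + (f e4 + sum f R)))" for f :: "'e => 'b :: comm_monoid_add"
 unfolding edges_G(1) using dist not_R ends_R(4) by simp

lemma sum_G1: "sum f (edges G1) = f e1 + (f e3 + sum f R)" for f :: "'e => 'b :: comm_monoid_add"
 unfolding edges_G(2) using dist not_R ends_R(4) by simp

lemma m1: "multigraph G1"
proof -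
 have "ends G1 e \<subseteq> verts G1 \<and> card (ends G1 e) = 2" if "e \<in> edges G1" for e
 proof -
  have "e \<in> {e1, e3} \<or> e \<in> R" using that unfolding edges_G(2) by blast
  thus ?thesis
  proof
   assume "e \<in> {e1, e3}"
   thus ?thesis using av aa by auto
  next
   assume e: "e \<in> R"
   thus ?thesis using ends_R(1-3)[OF e] multigraphD(3,4)[OF mG, of e] by auto
  qed
 qed
 moreover have "finite (verts G1)" "finite (edges G1)" using multigraphD(1,2)[OF mG] by auto
 ultimately show ?thesis unfolding multigraph_def by blast
qed

lemma deg_sum: "int (deg H A) = (\<Sum>e\<in>edges H. if card (ends H e \<inter> A) = 1 then 1 else 0)" if "multigraph H" for H :: "('v, 'e) bgraph"
 unfolding deg_def cut_def using multigraphD(2)[OF that] by (simp add: sum.If_cases Int_def)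

lemma deg_split:
 assumes A: "w \<notin> A"
 shows "int (deg G A) = int (deg G1 A) + (if a1 \<in> A \<and> a2 \<in> A then 2 else 0) + (if a3 \<in> A \<and> a4 \<in> A then 2 else 0)"
  and "int (deg G (insert w A)) = int (deg G A) + (if a1 \<in> A then - 1 else 1) + (if a2 \<in> A then - 1 else 1)
   + (if a3 \<in> A then - 1 else 1) + (if a4 \<in> A then - 1 else 1)"
proof -
 let ?c = "\<lambda>H A e. (if card (ends H e \<inter> A) = 1 then 1 else 0 :: int)"
 have R1: "sum (?c G1 A) R = sum (?c G A) R" by (rule sum.cong) (simp_all add: ends_R(1))
 have R2: "sum (?c G (insert w A)) R = sum (?c G A) R"
  by (rule sum.cong) (simp_all add: ends_R(2))
 have pr: "card ({u, v} \<inter> B) = 1 \<longleftrightarrow> (u \<in> B) \<noteq> (v \<in> B)" if "u \<noteq> v" for u v B by (rule card_pair_Int[OF that])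
 have wa: "w \<noteq> a1" "w \<noteq> a2" "w \<noteq> a3" "w \<noteq> a4" using av(1-4) by auto
 note P = pr[OF wa(1)] pr[OF wa(2)] pr[OF wa(3)] pr[OF wa(4)] pr[OF aa(1)] pr[OF aa(2)]
 show "int (deg G A) = int (deg G1 A) + (if a1 \<in> A \<and> a2 \<in> A then 2 else 0) + (if a3 \<in> A \<and> a4 \<in> A then 2 else 0)"
  unfolding deg_sum[OF mG] deg_sum[OF m1] sum_G sum_G1 R1 ends_e G1_simps(3,4) P using A
  by (cases "a1 \<in> A"; cases "a2 \<in> A"; cases "a3 \<in> A"; cases "a4 \<in> A") simp_all
 show "int (deg G (insert w A)) = int (deg G A) + (if a1 \<in> A then - 1 else 1) + (if a2 \<in> A then - 1 else 1)
   + (if a3 \<in> A then - 1 else 1) + (if a4 \<in> A then - 1 else 1)"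
  unfolding deg_sum[OF mG] sum_G R2 ends_e P using A wa
  by (cases "a1 \<in> A"; cases "a2 \<in> A"; cases "a3 \<in> A"; cases "a4 \<in> A") simp_all
qed

lemma tms_split:
 assumes A: "A \<noteq> {}" "A \<subseteq> verts G1 - {z}"
 shows "tms G1 A"
proof -
 have wA: "w \<notin> A" and A': "A \<subseteq> verts G - {z}" using A(2) by auto
 note D = deg_split[OF wA]
 have t: "tms G A" by (rule tms[OF A(1) A'])
 have two: "sts G A" if "{u, v} \<subseteq> A" "u \<noteq> v" for u v
 proof -
  have "card {u, v} \<le> card A" using card_mono[OF fin that(1)] A' by blast
  thus ?thesis using sts[OF A'] that(2) by simp
 qed
 consider "a1 \<in> A" "a2 \<in> A" "a3 \<in> A" "a4 \<in> A" | "a1 \<in> A" "a2 \<in> A" "\<not> (a3 \<in> A \<and> a4 \<in> A)"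
  | "\<not> (a1 \<in> A \<and> a2 \<in> A)" "a3 \<in> A" "a4 \<in> A" | "\<not> (a1 \<in> A \<and> a2 \<in> A)" "\<not> (a3 \<in> A \<and> a4 \<in> A)" by blast
 thus ?thesis
 proof cases
  case 1
  \<comment> \<open>Both lifted edges lie inside \<open>A\<close>, whose degree becomes that of
    \<open>insert w A\<close>; the boundary is the same because that of \<open>w\<close> is
    zero.\<close>
  have "tms G (insert w A)" using tms[of "insert w A"] A' w by auto
  moreover have "bd G (insert w A) = bd G A"
  proof -
   have "finite A" using fin[of A] A' by blast
   thus ?thesis using w(3) wA by simp
  qed
  ultimately show ?thesis using D 1 unfolding tms_def by simp
 next
  case 2
  hence "sts G A" using two[of a1 a2] aa by auto
  moreover have "int (deg G1 A) = int (deg G A) - 2" using D(1) 2 by auto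
  ultimately show ?thesis using st_tm2 unfolding sts_def tms_def by simp
 next
  case 3
  hence "sts G A" using two[of a3 a4] aa by auto
  moreover have "int (deg G1 A) = int (deg G A) - 2" using D(1) 3 by auto
  ultimately show ?thesis using st_tm2 unfolding sts_def tms_def by simp
 next
  case 4
  hence "int (deg G1 A) = int (deg G A)" using D(1) by auto
  thus ?thesis using t unfolding tms_def by simp
 qed
qed

lemma cut_z: "cut G1 {z} = cut G {z}"
proof -
 have "e \<in> cut G1 {z} \<longleftrightarrow> e \<in> cut G {z}" if e: "e \<in> edges G" for e
 proof -
  consider "e \<in> {e1, e3}" | "e \<in> {e2, e4}" | "e \<in> R" using e edges_G(1) by blast
  thus ?thesis
  proof cases
   case 1
   hence "e \<in> edges G1" unfolding edges_G(2) by blast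
   thus ?thesis unfolding in_cut_tip[OF m1 \<open>e \<in> edges G1\<close>] in_cut_tip[OF mG e] using 1 ends_e aa w(2) by auto
  next
   case 2
   hence "e \<notin> edges G1" by simp
   hence "e \<notin> cut G1 {z}" using cut_subset[of G1 "{z}"] by blast
   moreover have "e \<notin> cut G {z}" unfolding in_cut_tip[OF mG e] using 2 ends_e aa w(2) by auto
   ultimately show ?thesis by simp
  next
   case 3
   hence "e \<in> edges G1" unfolding edges_G(2) by blast
   thus ?thesis unfolding in_cut_tip[OF m1 \<open>e \<in> edges G1\<close>] in_cut_tip[OF mG e] ends_R(1)[OF 3] by simp
  qed
 qed
 thus ?thesis using cut_subset[of G "{z}"] cut_subset[of G1 "{z}"] by auto
qed

lemma total1: "bd G1 (verts G1) = 0"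
 using sum.remove[OF multigraphD(1)[OF mG] w(1), of "bdry G"] total w(3) by simp

lemma pre1: "tip_preflow G1 z S"
 using pre unfolding tip_preflow_balance balance_def cut_z by simp

text \<open>Each lifted edge is turned back into a path through \<open>w\<close> in the same
  direction, so \<open>w\<close> receives one arc in and one arc out per pair.\<close>

lemma part_ext_split:
 assumes P: "\<And>p. p \<in> P ==> p \<subseteq> verts G - {w}" and x: "part_ext G1 P {z} S"
 shows "part_ext G (insert {w} P) {z} S"
proof -
 obtain t1 where t1: "orientation G1 t1" "\<forall>p\<in>P. net G1 t1 p = bd G p" "outset G1 t1 {z} = S"
  using x unfolding part_ext_def by auto
 have te: "t1 e1 = a1 \<or> t1 e1 = a2" "t1 e3 = a3 \<or> t1 e3 = a4"
  using orientationD[OF t1(1), of e1] orientationD[OF t1(1), of e3] edges_G(2) by auto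
 define t where "t e = (if e = e1 then (if t1 e1 = a1 then a1 else w) else if e = e2 then (if t1 e1 = a1 then w else a2)
  else if e = e3 then (if t1 e3 = a3 then a3 else w) else if e = e4 then (if t1 e3 = a3 then w else a4) else t1 e)" for e
 have tv: "t e1 = (if t1 e1 = a1 then a1 else w)" "t e2 = (if t1 e1 = a1 then w else a2)"
  "t e3 = (if t1 e3 = a3 then a3 else w)" "t e4 = (if t1 e3 = a3 then w else a4)" "\<And>e. e \<in> R ==> t e = t1 e"
  using dist not_R unfolding t_def by auto
 have o: "orientation G t"
  unfolding orientation_def edges_G(1)
 proof
  fix e assume "e \<in> insert e1 (insert e2 (insert e3 (insert e4 R)))"
  then consider "e \<in> {e1, e2, e3, e4}" | "e \<in> R" by blast
  thus "t e \<in> ends G e"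
  proof cases
   case 1
   thus ?thesis using tv(1-4) ends_e by auto
  next
   case 2
   thus ?thesis using tv(5)[OF 2] ends_R(1)[OF 2] orientationD[OF t1(1), of e] edges_G(2) by auto
  qed
 qed
 have net: "net G t X = net G1 t1 X" for X
 proof -
  have Req: "(\<Sum>e\<in>R. cn (ends G e) (t e) X) = (\<Sum>e\<in>R. cn (ends G1 e) (t1 e) X)"
   by (rule sum.cong) (simp_all add: tv(5) ends_R(1))
  have wa: "w \<noteq> a1" "w \<noteq> a2" "w \<noteq> a3" "w \<noteq> a4" using av(1-4) by auto
  have p12: "cn {w, a1} (t e1) X + cn {w, a2} (t e2) X = cn {a1, a2} (t1 e1) X"
   using te(1) aa(1) unfolding tv(1,2) by (auto simp: cn_pair cn_pair' wa wa[symmetric])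
  have p34: "cn {w, a3} (t e3) X + cn {w, a4} (t e4) X = cn {a3, a4} (t1 e3) X"
   using te(2) aa(2) unfolding tv(3,4) by (auto simp: cn_pair cn_pair' wa wa[symmetric])
  show ?thesis unfolding net_def sum_G sum_G1 Req ends_e G1_simps(3,4) p12[symmetric] p34[symmetric] by (simp add: add.assoc)
 qed
 have out: "outset G t {z} = S"
 proof -
  have "t e = z \<longleftrightarrow> t1 e = z" if e: "e \<in> cut G {z}" for e
  proof -
   have eG: "e \<in> edges G" by (rule cut_edge[OF e])
   have "z \<in> ends G e" using in_cut_tip[OF mG eG] e by simp
   hence "e \<noteq> e2" "e \<noteq> e4" using ends_e aa w(2) by auto
   then consider "e = e1" | "e = e3" | "e \<in> R" using eG edges_G(1) by blast
   thus ?thesis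
   proof cases
    case 1
    hence "a1 = z" using \<open>z \<in> ends G e\<close> ends_e w(2) by auto
    thus ?thesis using 1 tv(1) w(2) by simp
   next
    case 2
    hence "a3 = z" using \<open>z \<in> ends G e\<close> ends_e w(2) by auto
    thus ?thesis using 2 tv(3) w(2) by simp
   qed (simp add: tv(5))
  qed
  thus ?thesis using t1(3) unfolding outset_singleton cut_z by auto
 qed
 have "net G1 t1 {w} = 0"
 proof -
  have "cut G1 {w} = {}"
  proof (rule ccontr)
   assume "cut G1 {w} \<noteq> {}"
   then obtain e where e: "e \<in> cut G1 {w}" by blast
   have "e \<in> edges G1" by (rule cut_edge[OF e])
   hence "w \<in> verts G1" using in_cut_tip[OF m1] e multigraphD(3)[OF m1] by blast
   thus False by simp
  qed
  thus ?thesis unfolding net_balance[OF m1 t1(1)] balance_def outset_def by simp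
 qed
 hence "net G t p = bd G p" if "p \<in> insert {w} P" for p
  using that net t1(2) w(3) by auto
 thus ?thesis unfolding part_ext_def using o out by blast
qed

lemma not_extends1: "\<not> extends G1 z S"
proof
 assume "extends G1 z S"
 hence "part_ext G1 (singles (verts G - {w})) {z} S" unfolding extends_part_ext[OF m1] by simp
 hence "part_ext G (insert {w} (singles (verts G - {w}))) {z} S" by (rule part_ext_split[rotated]) auto
 moreover have "insert {w} (singles (verts G - {w})) = singles (verts G)" using w(1) by auto
 ultimately show False using nex unfolding extends_part_ext[OF mG] by simp
qed

text \<open>If all four neighbours lie in one part, \<open>w\<close> can join that part. Then
  neither the four edges nor the lifted ones cross parts, and the extension known for
  \<open>G\<close> carries over. So a quotient to which \<open>S\<close> does not extend has no such
  part.\<close>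

lemma part_ext_unsplit:
 assumes P: "partition_on (verts G - {w}) P" "{z} \<in> P" "q \<in> P" "a1 \<in> q" "a2 \<in> q" "a3 \<in> q" "a4 \<in> q"
 shows "part_ext G1 P {z} S"
proof -
 have wP: "w \<notin> p" if "p \<in> P" for p using partition_onD1[OF P(1)] that by blast
 have qz: "q \<noteq> {z}" using P(5) aa(3) by auto
 define P' where "P' = insert (insert w q) (P - {q})"
 have dis: "disjnt x y" if "x \<in> P" "y \<in> P" "x \<noteq> y" for x y
  using disjointD[OF partition_onD2[OF P(1)] that] by (simp add: disjnt_def)
 have "partition_on (verts G) P'"
 proof (rule partition_onI)
  show "\<Union>P' = verts G" using partition_onD1[OF P(1)] P(3) w(1) unfolding P'_def by blast
  show "{} \<notin> P'" using partition_onD3[OF P(1)] unfolding P'_def by auto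
  fix x y assume xy: "x \<in> P'" "y \<in> P'" "x \<noteq> y"
  show "disjnt x y"
  proof (cases "x = insert w q")
   case True
   hence y: "y \<in> P" "y \<noteq> q" using xy unfolding P'_def by auto
   show ?thesis unfolding True using dis[OF P(3) y(1)] y(2) wP[OF y(1)] by auto
  next
   case False
   hence x: "x \<in> P" "x \<noteq> q" using xy unfolding P'_def by auto
   show ?thesis
   proof (cases "y = insert w q")
    case True
    show ?thesis unfolding True using dis[OF x(1) P(3)] x(2) wP[OF x(1)] by (auto simp: disjnt_def)
   next
    case False
    hence "y \<in> P" using xy(2) unfolding P'_def by auto
    thus ?thesis by (rule dis[OF x(1) _ xy(3)])
   qed
  qed
 qed
 moreover have "{z} \<in> P'" using P(2) qz unfolding P'_def by blast
 moreover have "nontrivial P'"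
 proof -
  have "q \<subseteq> verts G" using partition_onD1[OF P(1)] P(3) by blast
  hence "card {w, a1} \<le> card (insert w q)" using P(4) fin[of q] by (intro card_mono) auto
  hence "2 \<le> card (insert w q)" using av(1) by simp
  thus ?thesis unfolding nontrivial_def P'_def by blast
 qed
 ultimately have "part_ext G P' {z} S" using psi_ext unfolding tip_respecting_def by blast
 then obtain t where t: "orientation G t" "\<forall>p\<in>P'. net G t p = bd G p" "outset G t {z} = S"
  unfolding part_ext_def by blast
 \<comment> \<open>Both lifted edges lie inside \<open>q\<close>, so their directions may be chosen
   at will.\<close>
 define t1 where "t1 = t(e1 := a1, e3 := a3)"
 have o: "orientation G1 t1"
  unfolding orientation_def
 proof
  fix e assume "e \<in> edges G1"
  then consider "e = e1" | "e = e3" | "e \<in> R" unfolding edges_G(2) by blast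
  thus "t1 e \<in> ends G1 e"
  proof cases
   case 3
   hence "t1 e = t e" using not_R unfolding t1_def by auto
   thus ?thesis using ends_R(1,3)[OF 3] orientationD[OF t(1)] by simp
  qed (use dist in \<open>auto simp: t1_def\<close>)
 qed
 have pr: "net G1 t1 p = bd G p \<and> outset G1 t1 p = outset G t X"
  if p: "p \<in> P" and X: "X = (if p = q then insert w q else p)" for p X
 proof -
  have a: "a1 \<in> p \<longleftrightarrow> p = q" "a2 \<in> p \<longleftrightarrow> p = q" "a3 \<in> p \<longleftrightarrow> p = q" "a4 \<in> p \<longleftrightarrow> p = q"
   using part_mem[OF P(1,3) _ p] P(4-7) by auto
  have wX: "w \<in> X \<longleftrightarrow> p = q" using X wP[OF p] by auto
  have vX: "v \<in> X \<longleftrightarrow> v \<in> p" if "v \<noteq> w" for v using X that by auto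
  have Rcut: "e \<in> cut G1 p \<longleftrightarrow> e \<in> cut G X" if e: "e \<in> R" for e
  proof -
   have "x \<in> ends G e \<inter> X \<longleftrightarrow> x \<in> ends G e \<inter> p" for x
    using ends_R(2)[OF e] vX[of x] by (cases "x = w") auto
   hence "ends G e \<inter> X = ends G e \<inter> p" by blast
   thus ?thesis unfolding cut_def using ends_R(1,3)[OF e] e edges_G by auto
  qed
  have nin: "e \<notin> cut G X" if "e \<in> {e1, e2, e3, e4}" for e
  proof -
   have "w \<noteq> a1" "w \<noteq> a2" "w \<noteq> a3" "w \<noteq> a4" using av by auto
   thus ?thesis
    using that in_cut_pair[OF ends_e(1), of X] in_cut_pair[OF ends_e(2), of X] in_cut_pair[OF ends_e(3), of X]
     in_cut_pair[OF ends_e(4), of X] wX a vX[OF av(1)] vX[OF av(2)] vX[OF av(3)] vX[OF av(4)] by auto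
  qed
  have nin1: "e \<notin> cut G1 p" if "e \<in> {e1, e3}" for e
   using that in_cut_pair[OF G1_simps(3) aa(1), of p] in_cut_pair[OF G1_simps(4) aa(2), of p] a by auto
  have cR: "cut G X \<subseteq> R" "cut G1 p \<subseteq> R"
   using cut_subset[of G X] cut_subset[of G1 p] nin nin1 unfolding edges_G by auto
  have ceq: "cut G1 p = cut G X" using Rcut cR by auto
  have oeq: "outset G1 t1 p = outset G t X"
  proof -
   have "t1 e \<in> p \<longleftrightarrow> t e \<in> X" if e: "e \<in> R" for e
   proof -
    have "t1 e = t e" using e not_R unfolding t1_def by auto
    moreover have "t e \<noteq> w" using orientationD[OF t(1) ends_R(3)[OF e]] ends_R(2)[OF e] by auto
    ultimately show ?thesis using vX by simp
   qed
   thus ?thesis unfolding outset_def ceq using cR(1) by blast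
  qed
  have "X \<in> P'" using p X unfolding P'_def by auto
  hence "net G t X = bd G X" using t(2) by blast
  moreover have "bd G X = bd G p"
  proof (cases "p = q")
   case True
   have "finite q" using fin partition_onD1[OF P(1)] P(3) by blast
   thus ?thesis unfolding X using True wP[OF P(3)] w(3) by simp
  qed (simp add: X)
  moreover have "net G1 t1 p = net G t X"
   unfolding net_balance[OF mG t(1)] net_balance[OF m1 o] balance_def oeq ceq ..
  ultimately show ?thesis using oeq by simp
 qed
 have "outset G1 t1 {z} = S" using pr[OF P(2) refl] qz t(3) by simp
 moreover have "net G1 t1 p = bd G1 p" if "p \<in> P" for p using pr[OF that refl] by simp
 ultimately show ?thesis unfolding part_ext_def using o by blast
qed

end

context split_tall
begin

lemma split_partition:
 assumes P: "partition_on (verts G - {w}) P" "{z} \<in> P"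
 shows "tip_respecting G z (insert {w} P)"
proof -
 have wP: "w \<notin> p" if "p \<in> P" for p using partition_onD1[OF P(1)] that by blast
 have "partition_on (verts G) (insert {w} P)"
 proof (rule partition_onI)
  show "\<Union>(insert {w} P) = verts G" using partition_onD1[OF P(1)] w(1) by auto
  show "{} \<notin> insert {w} P" using partition_onD3[OF P(1)] by auto
  fix x y assume xy: "x \<in> insert {w} P" "y \<in> insert {w} P" "x \<noteq> y"
  then consider "x = {w}" "y \<in> P" | "y = {w}" "x \<in> P" | "x \<in> P" "y \<in> P" by blast
  thus "disjnt x y"
  proof cases
   case 3
   thus ?thesis using disjointD[OF partition_onD2[OF P(1)] 3 xy(3)] by (simp add: disjnt_def)
  qed (use wP in \<open>auto simp: disjnt_def\<close>)
 qed
 thus ?thesis using P(2) unfolding tip_respecting_def by blast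
qed

text \<open>A lifted edge inside a part vanishes in the quotient, and \<open>w\<close> is then
  joined to that part by two parallel edges; any other lifted edge is subdivided by
  \<open>w\<close>.\<close>

definition alt_set :: "'v set => 'v set => 'v set => 'v set => ('v set + 'e) set" where
 "alt_set p1 p2 p3 p4 = {if p1 = p2 then Inl p1 else Inr e1, if p3 = p4 then Inl p3 else Inr e3}"

text \<open>\<open>nf\<close> keeps the two elements of the alteration apart: if both were the same
  vertex, the new vertex would receive two edges instead of four.\<close>

lemma split_iso:
 assumes P: "partition_on (verts G - {w}) P" "{z} \<in> P"
  and p: "p1 \<in> P" "a1 \<in> p1" "p2 \<in> P" "a2 \<in> p2" "p3 \<in> P" "a3 \<in> p3" "p4 \<in> P" "a4 \<in> p4"
  and nf: "\<not> (p1 = p2 \<and> p3 = p4 \<and> p1 = p3)"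
 shows "two_alteration_on (contract G1 P) (alt_set p1 p2 p3 p4)"
  and "canvas_iso (contract G (insert {w} P)) {z} (two_alteration (contract G1 P) (alt_set p1 p2 p3 p4)) (Some {z})"
proof -
 define H where "H = contract G1 P"
 define K where "K = contract G (insert {w} P)"
 define X where "X = alt_set p1 p2 p3 p4"
 define T where "T = two_alteration H X"
 have P1: "partition_on (verts G1) P" using P(1) by simp
 have tr: "tip_respecting G z (insert {w} P)" by (rule split_partition[OF P])
 hence PV: "partition_on (verts G) (insert {w} P)" unfolding tip_respecting_def by blast
 have wP: "q \<noteq> {w}" "w \<notin> q" if "q \<in> P" for q using partition_onD1[OF P(1)] that by blast+
 have E1: "e1 \<in> edges G1" "e3 \<in> edges G1" using edges_G(2) by auto
 have H1: "ends H e1 = {p1, p2} \<and> (e1 \<in> edges H \<longleftrightarrow> p1 \<noteq> p2)"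
  unfolding H_def by (rule ends_contract[OF m1 P1 E1(1) G1_simps(3) p(1-4)])
 have H3: "ends H e3 = {p3, p4} \<and> (e3 \<in> edges H \<longleftrightarrow> p3 \<noteq> p4)"
  unfolding H_def by (rule ends_contract[OF m1 P1 E1(2) G1_simps(4) p(5-8)])
 have wI: "{w} \<in> insert {w} P" "w \<in> {w}" by auto
 have K: "ends K e = {{w}, q} \<and> e \<in> edges K"
  if e: "e \<in> edges G" "ends G e = {w, a}" "q \<in> P" "a \<in> q" for e a q
  using ends_contract[OF mG PV e(1,2) wI insertI2[OF e(3)] e(4)] wP(1)[OF e(3)] unfolding K_def by auto
 note K1 = K[OF eE(1) ends_e(1) p(1,2)] and K2 = K[OF eE(2) ends_e(2) p(3,4)]
  and K3 = K[OF eE(3) ends_e(3) p(5,6)] and K4 = K[OF eE(4) ends_e(4) p(7,8)]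
 define R' where "R' = {e \<in> R. \<not> (\<exists>p\<in>P. ends G e \<subseteq> p)}"
 have KR: "e \<in> edges K \<longleftrightarrow> e \<in> R'" if e: "e \<in> R" for e
 proof -
  obtain u v where "ends G e = {u, v}" using edge_obtain[OF mG ends_R(3)[OF e]] by metis
  hence "\<not> ends G e \<subseteq> {w}" using ends_R(2)[OF e] by auto
  thus ?thesis unfolding K_def contract_def R'_def using e ends_R(3)[OF e] by auto
 qed
 have "edges K \<subseteq> edges G" unfolding K_def contract_def by auto
 hence EK: "edges K = insert e1 (insert e2 (insert e3 (insert e4 R')))"
  using K1 K2 K3 K4 KR edges_G(1) unfolding R'_def by auto
 have HR: "e \<in> edges H \<longleftrightarrow> e \<in> R'" if e: "e \<in> R" for e
  unfolding H_def contract_def R'_def using e edges_G(2) ends_R(1)[OF e] by auto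
 have "edges H \<subseteq> edges G1" unfolding H_def contract_def by auto
 hence EH: "e \<in> edges H \<longleftrightarrow> e \<in> R' \<or> e = e1 \<and> p1 \<noteq> p2 \<or> e = e3 \<and> p3 \<noteq> p4" for e
  using H1 H3 HR[of e] edges_G(2) unfolding R'_def by auto
 have nR: "e1 \<notin> R'" "e2 \<notin> R'" "e3 \<notin> R'" "e4 \<notin> R'" using not_R unfolding R'_def by auto
 have XR: "Inr e \<in> X \<longleftrightarrow> e = e1 \<and> p1 \<noteq> p2 \<or> e = e3 \<and> p3 \<noteq> p4" for e unfolding X_def alt_set_def by auto
 have XL: "Inl q \<in> X \<longleftrightarrow> q = p1 \<and> p1 = p2 \<or> q = p3 \<and> p3 = p4" for q unfolding X_def alt_set_def by auto
 have "two_alteration_on H X"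
  unfolding two_alteration_on_def
 proof (intro conjI)
  show "X \<subseteq> verts H <+> edges H" unfolding X_def alt_set_def using EH p by (auto simp: H_def)
  show "X \<noteq> {}" unfolding X_def alt_set_def by simp
  show "card X \<le> 2" unfolding X_def alt_set_def by (rule order.trans[OF card_insert_le_m1]) auto
 qed
 thus "two_alteration_on (contract G1 P) (alt_set p1 p2 p3 p4)" unfolding H_def X_def .
 define g where "g e = (if e = e1 then (if p1 = p2 then Double p1 False else Half e1 p1)
  else if e = e2 then (if p1 = p2 then Double p1 True else Half e1 p2)
  else if e = e3 then (if p3 = p4 then Double p3 False else Half e3 p3)
  else if e = e4 then (if p3 = p4 then Double p3 True else Half e3 p4) else Old e)" for e
 have gv: "g e1 = (if p1 = p2 then Double p1 False else Half e1 p1)" "g e2 = (if p1 = p2 then Double p1 True else Half e1 p2)"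
  "g e3 = (if p3 = p4 then Double p3 False else Half e3 p3)" "g e4 = (if p3 = p4 then Double p3 True else Half e3 p4)"
  using dist unfolding g_def by auto
 have gR: "g e = Old e" if "e \<in> R'" for e using that nR unfolding g_def by auto
 have gimg: "g ` R' = Old ` R'" by (rule image_cong[OF refl gR])
 have ET: "a \<in> edges T \<longleftrightarrow> (case a of Old e => e \<in> R' | Half e u => e = e1 \<and> p1 \<noteq> p2 \<and> (u = p1 \<or> u = p2) \<or> e = e3 \<and> p3 \<noteq> p4 \<and> (u = p3 \<or> u = p4)
   | Double q b => q = p1 \<and> p1 = p2 \<or> q = p3 \<and> p3 = p4)" for a
 proof (cases a)
  case (Old e)
  thus ?thesis unfolding T_def two_alteration_def using EH[of e] XR[of e] nR by auto
 next
  case (Half e u)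
  have "a \<in> edges T \<longleftrightarrow> Inr e \<in> X \<and> u \<in> ends H e" unfolding Half T_def two_alteration_def by auto
  thus ?thesis unfolding Half XR using H1 H3 dist by (cases "e = e1"; cases "e = e3") auto
 next
  case (Double q b)
  thus ?thesis unfolding T_def two_alteration_def using XL[of q] by auto
 qed
 have img: "g ` edges K = edges T"
 proof (rule set_eqI)
  fix a
  have "a \<in> g ` edges K \<longleftrightarrow> a = g e1 \<or> a = g e2 \<or> a = g e3 \<or> a = g e4 \<or> a \<in> Old ` R'"
   unfolding EK image_insert gimg by simp
  also have "\<dots> \<longleftrightarrow> a \<in> edges T"
  proof (cases a)
   case (Old e)
   thus ?thesis unfolding ET gv by (cases "p1 = p2"; cases "p3 = p4") auto
  next
   case (Half e u)
   thus ?thesis unfolding ET gv by (cases "p1 = p2"; cases "p3 = p4") auto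
  next
   case (Double q b)
   thus ?thesis unfolding ET gv by (cases "p1 = p2"; cases "p3 = p4"; cases b) auto
  qed
  finally show "a \<in> g ` edges K \<longleftrightarrow> a \<in> edges T" .
 qed
 have inj: "inj_on g (edges K)"
 proof -
  have "inj_on g R'" using gR by (intro inj_onI) simp
  moreover have "g e1 \<notin> Old ` R'" "g e2 \<notin> Old ` R'" "g e3 \<notin> Old ` R'" "g e4 \<notin> Old ` R'" unfolding gv by auto
  moreover have "g e1 \<noteq> g e2" "g e3 \<noteq> g e4" unfolding gv by auto
  moreover have "g e1 \<noteq> g e3" "g e1 \<noteq> g e4" "g e2 \<noteq> g e3" "g e2 \<noteq> g e4" unfolding gv using nf dist by auto
  ultimately show ?thesis unfolding EK using nR dist by (simp add: gimg)
 qed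
 define f where "f q = (if q = {w} then None else Some q)" for q
 have fP: "f q = Some q" if "q \<in> P" for q using wP(1)[OF that] by (simp add: f_def)
 have fw: "f {w} = None" by (simp add: f_def)
 have bf: "bij_betw f (verts K) (verts T)"
  unfolding bij_betw_def
 proof
  show "inj_on f (verts K)" unfolding f_def inj_on_def by auto
  have "f ` P = Some ` P" by (rule image_cong[OF refl fP])
  thus "f ` verts K = verts T" unfolding K_def T_def H_def two_alteration_def by (simp add: fw)
 qed
 have ends: "ends T (g e) = f ` ends K e" if e: "e \<in> edges K" for e
 proof -
  consider "e = e1" | "e = e2" | "e = e3" | "e = e4" | "e \<in> R'" using e unfolding EK by blast
  thus ?thesis
  proof cases
   case 5
   hence R: "e \<in> R" unfolding R'_def by blast
   have "ends K e = {q \<in> P. q \<inter> ends G e \<noteq> {}}" unfolding K_def contract_def using ends_R(2)[OF R] by auto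
   moreover have "ends H e = {q \<in> P. q \<inter> ends G e \<noteq> {}}" unfolding H_def contract_def using ends_R(1)[OF R] by simp
   ultimately have eq: "ends K e = ends H e" "ends H e \<subseteq> P" by auto
   have "f ` ends H e = Some ` ends H e" by (rule image_cong[OF refl fP]) (use eq(2) in blast)
   thus ?thesis unfolding gR[OF 5] eq(1) T_def two_alteration_def by simp
  qed (use K1 K2 K3 K4 p fw fP in \<open>auto simp: gv T_def two_alteration_def\<close>)
 qed
 have bd: "bdry T (f q) = bdry K q" if "q \<in> verts K" for q
 proof (cases "q = {w}")
  case True
  thus ?thesis unfolding T_def two_alteration_def K_def using fw w(3) by simp
 next
  case False
  hence "q \<in> P" using that unfolding K_def by simp
  thus ?thesis unfolding T_def two_alteration_def K_def H_def using fP by simp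
 qed
 have "giso f g K T" unfolding giso_def bij_betw_def[of g] using bf inj img ends bd by blast
 moreover have "f {z} = Some {z}" by (rule fP[OF P(2)])
 ultimately show "canvas_iso (contract G (insert {w} P)) {z} (two_alteration (contract G1 P) (alt_set p1 p2 p3 p4)) (Some {z})"
  unfolding canvas_iso_giso K_def T_def H_def X_def by blast
qed

lemma EXPA_of_split: "EXPA k G z"
proof -
 have z1: "z \<in> verts G1" using z w(2) by simp
 obtain P where P: "tip_respecting G1 z P" "\<not> part_ext G1 P {z} S" "card P \<le> card (verts G1)"
  "\<forall>p\<in>P - {{z}}. deg G1 p + 2 \<le> deg G1 {z}"
  "\<forall>k. deg G1 {z} \<le> k + 1 \<and> (deg G1 {z} = k + 1 \<longrightarrow> S \<noteq> {} \<and> S \<noteq> cut G1 {z}) \<longrightarrow> (contract G1 P, {z}) \<in> tall_class k"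
  by (rule coarse_partition[OF m1 z1 total1 tms_split pre1 not_extends1]) (assumption | rule that)+
 have dz: "deg G1 {z} = deg G {z}" by (simp add: deg_def cut_z)
 have PD: "partition_on (verts G - {w}) P" "{z} \<in> P" using P(1) unfolding tip_respecting_def by auto
 have tr: "tip_respecting G z (insert {w} P)" by (rule split_partition[OF PD])
 have nf: "\<not> (a1 \<in> q \<and> a2 \<in> q \<and> a3 \<in> q \<and> a4 \<in> q)" if "q \<in> P" for q
  using part_ext_unsplit[OF PD that] P(2) by blast
 have "\<exists>q. q \<in> P \<and> a \<in> q" if "a \<in> verts G" "a \<noteq> w" for a using partition_onD1[OF PD(1)] that by blast
 then obtain p1 p2 p3 p4 where p: "p1 \<in> P" "a1 \<in> p1" "p2 \<in> P" "a2 \<in> p2" "p3 \<in> P" "a3 \<in> p3" "p4 \<in> P" "a4 \<in> p4"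
  using av by metis
 have np: "\<not> (p1 = p2 \<and> p3 = p4 \<and> p1 = p3)" using nf[OF p(1)] p by blast
 have "(contract G1 P, {z}) \<in> tall_class k" by (rule P(5)[rule_format]) (use deg_z nonuniform dz cut_z in auto)
 moreover have "prec (contract G1 P) {z} G z"
 proof -
  have "card P \<le> card (verts G1)" by (rule P(3))
  also have "\<dots> < card (verts G)" using card_Diff1_less[OF multigraphD(1)[OF mG] w(1)] by simp
  finally have "card P < card (verts G)" .
  moreover have "{e \<in> edges G1. z \<notin> ends G1 e} \<subseteq> {e \<in> edges G. z \<notin> ends G e}"
  proof
   fix e assume e: "e \<in> {e \<in> edges G1. z \<notin> ends G1 e}"
   hence "e \<notin> cut G1 {z}" "e \<in> edges G" using in_cut_tip[OF m1] by auto
   thus "e \<in> {e \<in> edges G. z \<notin> ends G e}" using in_cut_tip[OF mG] cut_z by auto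
  qed
  hence "card {e \<in> edges G1. z \<notin> ends G1 e} \<le> card {e \<in> edges G. z \<notin> ends G e}"
   using multigraphD(2)[OF mG] by (intro card_mono) auto
  ultimately show ?thesis using contract_size[OF m1 P(1)] unfolding prec_def canvas_size_def[of G z] by linarith
 qed
 moreover have "class_partition (tall_class k) G z (insert {w} P)"
 proof (rule class_partition_intro[OF tr])
  fix q assume q: "q \<in> insert {w} P" "2 \<le> card q"
  hence qP: "q \<in> P" and qz: "q \<noteq> {z}" by auto
  have wq: "w \<notin> q" using partition_onD1[OF PD(1)] qP by blast
  have sub: "q \<subseteq> verts G - {z}" by (rule part_sub[OF tr q(1) qz])
  \<comment> \<open>No part contains all four neighbours, so at most one lifted edge lies inside
    \<open>q\<close> and at most two degrees were lost. The margin of two compensates for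
    this.\<close>
  have "int (deg G q) \<le> int (deg G1 q) + 2" using deg_split(1)[OF wq] nf[OF qP] by auto
  hence dq: "deg G q \<le> deg G {z}" using bspec[OF P(4), of q] qP qz dz by simp
  show "restriction G q \<in> tall_class k"
  proof (cases "deg G q \<le> k")
   case True
   thus ?thesis by (rule restriction_in_class[OF sub q(2)])
  next
   case False
   hence "deg G q = k + 1" "deg G {z} = k + 1" using dq deg_z by auto
   thus ?thesis by (rule restriction_in_class_top[OF sub q(2)])
  qed
 qed
 ultimately show ?thesis by (rule EXPA_intro2[OF _ _ _ split_iso[OF PD p np]])
qed

end

context large_tall
begin

lemma EXPA_of_small_degree:
 assumes w: "w \<in> verts G" "w \<noteq> z" and d: "deg G {w} \<le> 4"
 shows "EXPA k G z"
proof -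
 have t: "tms G {w}" by (rule tms) (use w in auto)
 hence d4: "deg G {w} = 4" using tms_deg d by fastforce
 have bw: "bdry G w = 0" using t unfolding tms_def tm_def d4 by (simp add: lft_dvd)
 have cE: "e \<in> edges G" "w \<in> ends G e" if "e \<in> cut G {w}" for e
  using that cut_subset[of G "{w}"] in_cut_tip[OF mG, of e w] by auto
 \<comment> \<open>Two edges at \<open>w\<close> that avoid the tip and have different other ends go
   into different pairs. The remaining two edges are distributed arbitrarily: edges parallel to
   these do not exist, so the ends in each pair differ.\<close>
 obtain f x where f: "f \<in> edges G" "ends G f = {w, x}" "x \<noteq> z" "x \<noteq> w" "x \<in> verts G" using off_tip_neighbour[OF w] .
 have fc: "f \<in> cut G {w}" unfolding in_cut_tip[OF mG f(1)] using f(2) by simp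
 obtain h where h: "h \<in> cut G {w}" "z \<notin> ends G h" "x \<notin> ends G h" using other_neighbour[OF w f(5,3,4)] by blast
 obtain y where y: "ends G h = {w, y}" "w \<noteq> y" "y \<in> verts G" using edge_obtain_tail[OF mG cE[OF h(1)]] .
 have fh: "f \<noteq> h" using h(3) f(2) by auto
 have "card (cut G {w} - {f, h}) = 2"
  using d4 fc h(1) fh finite_cut[OF mG, of "{w}"] unfolding deg_def by (subst card_Diff_subset) auto
 then obtain e1 e3 where e13: "cut G {w} - {f, h} = {e1, e3}" "e1 \<noteq> e3" by (meson card_2_iff)
 hence c13: "e1 \<in> cut G {w}" "e3 \<in> cut G {w}" "e1 \<noteq> f" "e1 \<noteq> h" "e3 \<noteq> f" "e3 \<noteq> h" by auto
 obtain a1 where a1: "ends G e1 = {w, a1}" "w \<noteq> a1" "a1 \<in> verts G" using edge_obtain_tail[OF mG cE[OF c13(1)]] .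
 obtain a3 where a3: "ends G e3 = {w, a3}" "w \<noteq> a3" "a3 \<in> verts G" using edge_obtain_tail[OF mG cE[OF c13(2)]] .
 have "z \<notin> ends G f" "z \<notin> ends G h" using f(2,3) w(2) h(2) by auto
 hence "a1 \<noteq> x" "a3 \<noteq> y"
  using no_parallel[OF f(1) cE(1)[OF c13(1)]] no_parallel[OF cE(1)[OF h(1)] cE(1)[OF c13(2)]] a1(1) a3(1) f(2) y(1) c13 by auto
 moreover have "y \<noteq> z" using y(1) h(2) by auto
 moreover have "cut G {w} = {e1, f, e3, h}" using e13(1) fc h(1) by auto
 ultimately interpret split_tall k G z S w e1 f e3 h a1 x a3 y
  by unfold_locales (use w bw fh e13(2) c13 a1 a3 f y in auto)
 show ?thesis by (rule EXPA_of_split)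
qed

lemma outcome:
 "(EXPA k G z \<or> EXPB k G z \<or> ADD k G z \<or> REM k G z) \<and> (min_degree G \<le> 4 \<longrightarrow> EXPA k G z)"
proof (cases "\<exists>w\<in>verts G - {z}. deg G {w} \<le> 4")
 case True
 thus ?thesis using EXPA_of_small_degree by blast
next
 case False
 hence five: "5 \<le> deg G {v}" if "v \<in> verts G" "v \<noteq> z" for v using that by force
 \<comment> \<open>The tip has degree at least six, so a small minimum would have to be attained at
   another vertex.\<close>
 have "\<not> min_degree G \<le> 4"
 proof
  assume "min_degree G \<le> 4"
  moreover have "finite ((\<lambda>v. deg G {v}) ` verts G)" "(\<lambda>v. deg G {v}) ` verts G \<noteq> {}"
   using multigraphD(1)[OF mG] z by auto
  ultimately obtain v where v: "v \<in> verts G" "deg G {v} \<le> 4" unfolding min_degree_def by (auto simp: Min_le_iff)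
  thus False using five[of v] deg_z_ge_6 by (cases "v = z") auto
 qed
 moreover have "EXPB k G z \<or> ADD k G z \<or> REM k G z"
 proof (cases "homogeneous G z")
  case True
  thus ?thesis using homogeneous_outcome[OF True five] by blast
 next
  case False
  then obtain e where "e \<in> edges G" "mixed G z e" unfolding homogeneous_def by blast
  thus ?thesis using EXPB_of_mixed[OF five] by blast
 qed
 ultimately show ?thesis by blast
qed

end

theorem mainTheorem8:
  fixes k :: nat and G :: "('v, 'e) bgraph" and z :: 'v
  assumes "k \<ge> 1" and "(G, z) \<in> tall_class k"
  shows "(SMALL G \<or> EXPA k G z \<or> EXPB k G z \<or> ADD k G z \<or> REM k G z) \<and>
         (min_degree G \<le> 4 \<longrightarrow> SMALL G \<or> EXPA k G z)"
proof -
 obtain S where "tallness_witnessing k G z S" using assms(2) unfolding tall_class_def by blast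
 then interpret tall k G z S
  using assms(2) unfolding tall_class_def tallness_witnessing_def by unfold_locales auto
 show ?thesis
 proof (cases "psicrit G z S")
  case False
  thus ?thesis using EXPA_of_not_psicrit by blast
 next
  case True
  then interpret critical_tall k G z S by unfold_locales
  show ?thesis
  proof (cases "card (verts G) = 3")
   case True
   thus ?thesis unfolding SMALL_def by blast
  next
   case False
   then interpret large_tall k G z S using verts_ge_3 by unfold_locales simp
   show ?thesis using outcome by blast
  qed
 qed
qed

end
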